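(* Let $(P,\sigma)$ be a simple labelled polytope in $\mathfrak t^*\simeq\mathbb R^n$. There exists an infinite-dimensional family of formal extremal solutions, i.e. of maps $H:\overline P\to\mathrm{Sym}^2(\mathfrak t^* )$ which satisfy the smoothness condition (i) and the boundary condition (ii) associated to $\sigma$ (both given in the context) and the equation $$S(H)=-\sum_{i,j=1}^n\frac{\partial^2H_{ij}}{\partial x_i\partial x_j}\in\mathrm{Aff}(\mathfrak t^* ).$$ Whenever one of these solutions $H$ is positive definite on the interior of $P$, $(P,\sigma)$ is uniformly $K$-stable.
   Context: Let $\mathfrak t\simeq\mathbb R^n$ with dual $\mathfrak t^*$, with fixed linear coordinates $x=(x_1,\dots,x_n)$ on $\mathfrak t^*$ and $dx=dx_1\wedge\dots\wedge dx_n$. $\mathrm{Aff}(\mathfrak t^* )$ is the space of real affine-linear functions on $\mathfrak t^*$. Polytopes and labellings. A polytope $P\subset\mathfrak t^*$ is an open, convex, polyhedral, relatively compact, simple subset (simple: each vertex is the intersection of exactly $n$ facets), with facets $F_1,\dots,F_d\subset\overline P$. A labelling is $\vec n=(\vec n_1,\dots,\vec n_d)\in\mathfrak t^d$ with $\vec n_s\ne0$ normal to $F_s$ and inward to $P$. $\mathbf M(P)$ is the set of measures $\sigma$ on $\partial P$ such that for some labelling $\vec n$, $\vec n_s\wedge\sigma=-dx$ on $F_s$ for every $s$; this gives a bijection between labellings and $\mathbf M(P)\simeq\mathbb R^d_{>0}$, and $\vec n_\sigma$ is the labelling of $\sigma$. A labelled polytope is a pair $(P,\sigma)$ with $\sigma\in\mathbf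 M(P)$. Smoothness and boundary conditions. Here $\mathrm{Sym}^2(\mathfrak t^* )$ is the space of symmetric bilinear forms on $\mathfrak t$ and $H=(H_{ij})$ in coordinates. With $\vec n=\vec n_\sigma$: (i) $H$ is the restriction to $\overline P$ of a smooth $\mathrm{Sym}^2(\mathfrak t^* )$-valued function on an open neighborhood of $\overline P$; (ii) for every $y$ in the relative interior of a facet $F_s$, $H_y(\vec n_s,\cdot)=0$ and $dH_y(\vec n_s,\vec n_s)=2\vec n_s$ (the differential at $y$ of $x\mapsto H_x(\vec n_s,\vec n_s)$, an element of $\mathfrak t$). No positivity of $H$ is required of a formal solution. Uniform $K$-stability. The extremal affine function $A_\sigma\in\mathrm{Aff}(\mathfrak t^* )$ is the unique affine-linear function with $\int_P A_\sigma f\,dx=2\int_{\partial P}f\,\sigma$ for all $f\in\mathrm{Aff}(\mathfrak t^* )$. Put $\mathcal L_{(P,\sigma)}(f)=\int_{\partial P}f\,\sigma-\frac12\int_P fA_\sigma\,dx$. Fix $p_o\in P$ and let $\widetilde{\mathcal C}$ be the set of continuous convex functions $f$ on $\overline P$, smooth in the interior, with $f(p)\ge f(p_o)=0$ for all $p\in P$. $(P,\sigma)$ is uniformly $K$-stable if there is $\lambda>0$ such that $\mathcal L_{(P,\sigma)}(f)\ge\lambda\int_{\partial P}f\,\sigma$ for all $f\in\widetilde{\mathcal C}$.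
   Formalization: The family of formal extremal solutions is shown infinite-dimensional only for n ≥ 2; for n = 1 it is a single cubic determined by (ii), so the claim fails there, and only existence is stated. The K-stability clause is proved for all n ≥ 1. *)

theory Defs
  imports "HOL-Analysis.Analysis"
begin

text \<open>
  Both the space \<open>t\<close> and its dual are rendered as \<open>real ^ 'n\<close>, in the fixed linear coordinates on
  the dual and the corresponding dual coordinates on \<open>t\<close>; the pairing between them is then the
  inner product, and \<open>dx\<close> is \<^const>\<open>lborel\<close>. An element of \<open>Sym\<^sup>2\<close> of the dual, i.e. a symmetric
  bilinear form on \<open>t\<close>, is its symmetric matrix \<open>A\<close>, with \<open>u \<bullet> (A *v w)\<close> as its value at \<open>(u, w)\<close>.
\<close>

definition affine_functions :: "(real ^ 'n \<Rightarrow> real) set" where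
  "affine_functions = {f. \<exists>u c. f = (\<lambda>x. u \<bullet> x + c)}"

primrec C_k_on :: "nat \<Rightarrow> 'a::real_normed_vector set \<Rightarrow> ('a \<Rightarrow> 'b::real_normed_vector) \<Rightarrow> bool" where
  "C_k_on 0 U f \<longleftrightarrow> continuous_on U f"
| "C_k_on (Suc k) U f \<longleftrightarrow>
     (\<forall>x\<in>U. f differentiable (at x)) \<and> (\<forall>v. C_k_on k U (\<lambda>x. frechet_derivative f (at x) v))"

text \<open>Only meaningful for open \<open>U\<close>, since derivatives are taken at points, not within \<open>U\<close>.\<close>

definition smooth_on :: "'a::real_normed_vector set \<Rightarrow> ('a \<Rightarrow> 'b::real_normed_vector) \<Rightarrow> bool" where
  "smooth_on U f \<longleftrightarrow> (\<forall>k. C_k_on k U f)"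


section \<open>Labelled polytopes\<close>

abbreviation facets :: "(real ^ 'n) set \<Rightarrow> (real ^ 'n) set set" where
  "facets P \<equiv> {F. F facet_of closure P}"

text \<open>The polytope itself is open; its faces are those of its closure.\<close>

definition simple_polytope :: "(real ^ 'n) set \<Rightarrow> bool" where
  "simple_polytope P \<longleftrightarrow>
     P \<noteq> {} \<and> open P \<and> convex P \<and> bounded P \<and> polyhedron (closure P) \<and>
     (\<forall>v. v extreme_point_of closure P \<longrightarrow> card {F \<in> facets P. v \<in> F} = CARD('n))"

text \<open>Labellings are indexed by the facets themselves; values elsewhere are irrelevant.\<close>

definition labelling :: "(real ^ 'n) set \<Rightarrow> ((real ^ 'n) set \<Rightarrow> real ^ 'n) \<Rightarrow> bool" where
  "labelling P \<nu> \<longleftrightarrow>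
     (\<forall>F\<in>facets P. \<nu> F \<noteq> 0 \<and>
        (\<forall>y\<in>F. \<forall>z\<in>F. \<nu> F \<bullet> (y - z) = 0) \<and>
        (\<forall>y\<in>F. \<forall>x\<in>P. 0 < \<nu> F \<bullet> (x - y)))"

text \<open>
  The condition \<open>\<nu> \<and> \<sigma> = - dx\<close> on a facet \<open>F\<close>, where the covector \<open>\<nu>\<close> is seen as a constant
  1-form. Contracting it with a vector \<open>v\<close> such that \<open>\<nu> \<bullet> v = 1\<close> and restricting to \<open>F\<close> says that
  \<open>\<sigma>\<close> is, up to the sign, \<open>dx\<close> contracted with \<open>v\<close>; the sign means that this form is positive for
  the orientation of \<open>F\<close> as a part of the boundary, so that it is a (positive) measure. As \<open>dx\<close> is
  translation invariant, the measure of \<open>E \<subseteq> F\<close> given by \<open>dx\<close> contracted with \<open>v\<close> is the volume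
  of the cylinder swept out by \<open>E\<close> along \<open>v\<close> in unit time.
\<close>

definition wedge_condition ::
  "real ^ 'n \<Rightarrow> (real ^ 'n) measure \<Rightarrow> (real ^ 'n) set \<Rightarrow> bool" where
  "wedge_condition \<nu> \<sigma> F \<longleftrightarrow>
     (\<forall>v. \<nu> \<bullet> v = 1 \<longrightarrow>
       (\<forall>E\<in>sets borel. E \<subseteq> F \<longrightarrow>
          emeasure \<sigma> E = emeasure lborel {y + \<tau> *\<^sub>R v | y \<tau>. y \<in> E \<and> \<tau> \<in> {0..1}}))"

definition labels ::
  "(real ^ 'n) set \<Rightarrow> (real ^ 'n) measure \<Rightarrow> ((real ^ 'n) set \<Rightarrow> real ^ 'n) \<Rightarrow> bool" where
  "labels P \<sigma> \<nu> \<longleftrightarrow> labelling P \<nu> \<and> (\<forall>F\<in>facets P. wedge_condition (\<nu> F) \<sigma> F)"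

definition boundary_measures :: "(real ^ 'n) set \<Rightarrow> (real ^ 'n) measure set" where
  "boundary_measures P =
     {\<sigma>. sets \<sigma> = sets (restrict_space borel (frontier P)) \<and> (\<exists>\<nu>. labels P \<sigma> \<nu>)}"

text \<open>The labelling of \<open>\<sigma>\<close>; it is unique on the facets of \<open>P\<close>.\<close>

definition label_of ::
  "(real ^ 'n) set \<Rightarrow> (real ^ 'n) measure \<Rightarrow> (real ^ 'n) set \<Rightarrow> real ^ 'n" where
  "label_of P \<sigma> = (SOME \<nu>. labels P \<sigma> \<nu>)"

definition labelled_polytope :: "(real ^ 'n) set \<Rightarrow> (real ^ 'n) measure \<Rightarrow> bool" where
  "labelled_polytope P \<sigma> \<longleftrightarrow> simple_polytope P \<and> \<sigma> \<in> boundary_measures P"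


section \<open>Uniform K-stability\<close>

definition extremal_affine_function ::
  "(real ^ 'n) set \<Rightarrow> (real ^ 'n) measure \<Rightarrow> real ^ 'n \<Rightarrow> real" where
  "extremal_affine_function P \<sigma> =
     (THE A. A \<in> affine_functions \<and>
        (\<forall>f\<in>affine_functions. (LINT x:P|lborel. A x * f x) = 2 * (LINT x|\<sigma>. f x)))"

definition L_functional ::
  "(real ^ 'n) set \<Rightarrow> (real ^ 'n) measure \<Rightarrow> (real ^ 'n \<Rightarrow> real) \<Rightarrow> real" where
  "L_functional P \<sigma> f =
     (LINT x|\<sigma>. f x) - 1 / 2 * (LINT x:P|lborel. f x * extremal_affine_function P \<sigma> x)"

definition normalized_convex_functions ::
  "(real ^ 'n) set \<Rightarrow> real ^ 'n \<Rightarrow> (real ^ 'n \<Rightarrow> real) set" where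
  "normalized_convex_functions P p\<^sub>o =
     {f. continuous_on (closure P) f \<and> convex_on (closure P) f \<and> smooth_on P f \<and>
         f p\<^sub>o = 0 \<and> (\<forall>p\<in>P. f p \<ge> f p\<^sub>o)}"

definition uniformly_K_stable ::
  "(real ^ 'n) set \<Rightarrow> (real ^ 'n) measure \<Rightarrow> real ^ 'n \<Rightarrow> bool" where
  "uniformly_K_stable P \<sigma> p\<^sub>o \<longleftrightarrow>
     (\<exists>c>0. \<forall>f\<in>normalized_convex_functions P p\<^sub>o. L_functional P \<sigma> f \<ge> c * (LINT x|\<sigma>. f x))"


section \<open>Formal extremal solutions\<close>

text \<open>
  A map on the closure of \<open>P\<close> is a function on \<open>real ^ 'n\<close> whose values outside the closure are
  ignored.
\<close>

definition smooth_Sym2 :: "(real ^ 'n) set \<Rightarrow> (real ^ 'n \<Rightarrow> real ^ 'n ^ 'n) \<Rightarrow> bool" where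
  "smooth_Sym2 P H \<longleftrightarrow>
     (\<exists>U G. open U \<and> closure P \<subseteq> U \<and> smooth_on U G \<and> (\<forall>x\<in>U. transpose (G x) = G x) \<and>
            (\<forall>x\<in>closure P. H x = G x))"

text \<open>
  At \<open>y\<close> in the closure of \<open>P\<close> a derivative within this closure is unique, because \<open>P\<close> is open,
  convex and nonempty, and it agrees with the derivative of any smooth extension.
\<close>

definition boundary_conditions ::
  "(real ^ 'n) set \<Rightarrow> (real ^ 'n) measure \<Rightarrow> (real ^ 'n \<Rightarrow> real ^ 'n ^ 'n) \<Rightarrow> bool" where
  "boundary_conditions P \<sigma> H \<longleftrightarrow>
     (\<forall>F\<in>facets P. \<forall>y\<in>rel_interior F. let \<nu> = label_of P \<sigma> F in
        (\<forall>w. \<nu> \<bullet> (H y *v w) = 0) \<and>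
        ((\<lambda>x. \<nu> \<bullet> (H x *v \<nu>)) has_derivative (\<lambda>w. (2 *\<^sub>R \<nu>) \<bullet> w)) (at y within closure P))"

definition partial_deriv :: "'n \<Rightarrow> (real ^ 'n \<Rightarrow> real) \<Rightarrow> real ^ 'n \<Rightarrow> real" where
  "partial_deriv i f x = frechet_derivative f (at x) (axis i 1)"

definition S_op :: "(real ^ 'n \<Rightarrow> real ^ 'n ^ 'n) \<Rightarrow> real ^ 'n \<Rightarrow> real" where
  "S_op H x = - (\<Sum>i\<in>UNIV. \<Sum>j\<in>UNIV. partial_deriv i (partial_deriv j (\<lambda>y. H y $ i $ j)) x)"

text \<open>
  The equation is imposed on the open set \<open>P\<close>, where \<^const>\<open>S_op\<close> depends only on the values of
  \<open>H\<close> on \<open>P\<close>; for smooth \<open>H\<close> it extends to the closure by continuity.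
\<close>

definition formal_extremal_solutions ::
  "(real ^ 'n) set \<Rightarrow> (real ^ 'n) measure \<Rightarrow> (real ^ 'n \<Rightarrow> real ^ 'n ^ 'n) set" where
  "formal_extremal_solutions P \<sigma> =
     {H. smooth_Sym2 P H \<and> boundary_conditions P \<sigma> H \<and>
         (\<exists>a\<in>affine_functions. \<forall>x\<in>P. S_op H x = a x)}"

definition positive_definite :: "real ^ 'n ^ 'n \<Rightarrow> bool" where
  "positive_definite A \<longleftrightarrow> transpose A = A \<and> (\<forall>v. v \<noteq> 0 \<longrightarrow> v \<bullet> (A *v v) > 0)"

text \<open>
  The maps in \<open>\<F>\<close>, restricted to \<open>D\<close>, form an infinite-dimensional affine space: \<open>\<F>\<close> is closed
  under affine combinations and contains an infinite sequence of maps that are affinely independent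
  as functions on \<open>D\<close>.
\<close>

definition infinite_dimensional_affine_family ::
  "'a set \<Rightarrow> ('a \<Rightarrow> 'b::real_vector) set \<Rightarrow> bool" where
  "infinite_dimensional_affine_family D \<F> \<longleftrightarrow>
     (\<forall>G\<in>\<F>. \<forall>H\<in>\<F>. \<forall>c. (\<lambda>x. (1 - c) *\<^sub>R G x + c *\<^sub>R H x) \<in> \<F>) \<and>
     (\<exists>h :: nat \<Rightarrow> 'a \<Rightarrow> 'b. (\<forall>k. h k \<in> \<F>) \<and>
        (\<forall>N c. (\<Sum>k\<le>N. c k) = (0::real) \<and> (\<forall>x\<in>D. (\<Sum>k\<le>N. c k *\<^sub>R h k x) = 0)
           \<longrightarrow> (\<forall>k\<le>N. c k = 0)))"

end

theory Submission
  imports Defs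
begin

text \<open>
  Write \<open>h\<^sub>F\<close> for the affine function that vanishes on the facet \<open>F\<close> and has the label of \<open>F\<close> as its
  gradient. The proof is about the double divergence \<open>\<Sum>\<^sub>i\<^sub>j \<partial>\<^sub>i\<partial>\<^sub>j H\<^sub>i\<^sub>j = - S(H)\<close>.

  Existence. Since \<open>P\<close> is simple, the labels at a vertex \<open>v\<close> have a dual basis \<open>e\<^sub>F\<close>, and
  \<open>\<Sum>\<^sub>F 2 h\<^sub>F e\<^sub>F \<otimes> e\<^sub>F\<close> satisfies the boundary conditions on the facets through \<open>v\<close>; a partition of unity
  indexed by the vertices glues these fields (\<open>boundary_conditions_solvable\<close>). It remains to prescribe
  the double divergence up to affine functions by a field with homogeneous boundary conditions.
  Near a facet \<open>F\<close> at \<open>v\<close> one integrates twice along \<open>e\<^sub>F\<close>: the resulting multiple of \<open>e\<^sub>F \<otimes> e\<^sub>F\<close>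
  vanishes to second order on \<open>F\<close>, and \<open>e\<^sub>F\<close> is tangent to the other facets at \<open>v\<close> (\<open>clear_facet\<close>). When
  all facets have been treated a compactly supported function is left, which is orthogonal to the
  affine functions by Green's formula, and such a function is the double divergence of a compactly
  supported field (\<open>double_divergence_solvable\<close>). In dimension at least two there are compactly
  supported fields with vanishing double divergence, and they may be added to any solution; this makes
  the family infinite-dimensional.

  Green's formula. For a field \<open>G\<close> with the boundary conditions and smooth \<open>f\<close>,
  \<open>\<integral>\<^sub>P f \<Sum>\<partial>\<^sub>i\<partial>\<^sub>j G\<^sub>i\<^sub>j = \<integral>\<^sub>P \<Sum>G\<^sub>i\<^sub>j \<partial>\<^sub>i\<partial>\<^sub>j f - 2 \<integral> f d\<sigma>\<close> (\<open>green_boundary_conditions\<close>). It follows from the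
  divergence theorem on \<open>P\<close>, which is proved with cutoff functions of the heights \<open>h\<^sub>F\<close>. For a solution
  \<open>G\<close> and affine \<open>f\<close> it shows that \<open>S(G)\<close> is the extremal affine function; for general \<open>f\<close> it turns the
  functional into \<open>\<L>(f) = 1/2 \<integral>\<^sub>P \<Sum>G\<^sub>i\<^sub>j \<partial>\<^sub>i\<partial>\<^sub>j f\<close>, which is nonnegative for convex \<open>f\<close> and positive \<open>G\<close>.

  Uniform stability. Let \<open>f\<close> be convex with minimum \<open>f(p) = 0\<close>. In the interior, \<open>\<integral> f \<eta>\<close> for a cutoff
  \<open>\<eta>\<close> is bounded by the integral of \<open>f\<close> against a weight that is orthogonal to the affine functions, hence a
  double divergence of some compactly supported \<open>K\<close>; as \<open>G\<close> dominates \<open>K\<close>, this is at most a multiple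
  of \<open>\<L>(f)\<close> (\<open>interior_estimate\<close>). In collars of the facets, the divergence theorem for a radial field
  shows that \<open>\<integral> f\<close> is a small multiple of the boundary integral (\<open>tail_estimate\<close>). So \<open>\<integral> f\<close> is at most a
  small multiple of the boundary integral plus a multiple of \<open>\<L>(f)\<close>; as the boundary integral is
  \<open>\<L>(f)\<close> plus \<open>1/2 \<integral> f A\<close> with \<open>A\<close> bounded, it is at most a multiple of \<open>\<L>(f)\<close>. Functions that are
  smooth only inside \<open>P\<close> are limits of their contractions towards \<open>p\<close>.
\<close>

section \<open>Calculus of smooth functions\<close>

definition dderiv :: "'a::real_normed_vector \<Rightarrow> ('a \<Rightarrow> 'b::real_normed_vector) \<Rightarrow> 'a \<Rightarrow> 'b" where
  "dderiv v f x = frechet_derivative f (at x) v"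

lemma dderivI: "(f has_derivative f') (at x) \<Longrightarrow> dderiv v f x = f' v"
  unfolding dderiv_def using frechet_derivative_at by metis

lemma has_derivative_dderiv:
  "f differentiable (at x) \<Longrightarrow> (f has_derivative (\<lambda>v. dderiv v f x)) (at x)"
  unfolding dderiv_def using frechet_derivative_works by blast

lemma C_k_on_Suc:
  "C_k_on (Suc k) U f \<longleftrightarrow> (\<forall>x\<in>U. f differentiable (at x)) \<and> (\<forall>v. C_k_on k U (dderiv v f))"
  by (simp add: dderiv_def[abs_def])

declare C_k_on.simps(2) [simp del]

lemma C_k_on_cong_imp:
  "\<lbrakk>open U; \<And>x. x \<in> U \<Longrightarrow> f x = g x; C_k_on k U f\<rbrakk> \<Longrightarrow> C_k_on k U g"
proof (induction k arbitrary: f g)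
  case 0
  then show ?case by (simp cong: continuous_on_cong)
next
  case (Suc k)
  have hd: "(g has_derivative (\<lambda>v. dderiv v f x)) (at x)" if x: "x \<in> U" for x
  proof -
    have "(f has_derivative (\<lambda>v. dderiv v f x)) (at x)"
      using Suc.prems(3) x by (intro has_derivative_dderiv) (auto simp: C_k_on_Suc)
    then show ?thesis
      by (rule has_derivative_transform_within_open[OF _ Suc.prems(1) x]) (use Suc.prems in auto)
  qed
  have "C_k_on k U (dderiv v g)" for v
    by (rule Suc.IH[of "dderiv v f"]) (use Suc.prems in \<open>auto simp: C_k_on_Suc dderivI[OF hd]\<close>)
  moreover have "g differentiable (at x)" if "x \<in> U" for x
    using hd[OF that] differentiableI by blast
  ultimately show ?case by (simp add: C_k_on_Suc)
qed

lemma C_k_on_SucI: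
  assumes "open U" "\<And>x. x \<in> U \<Longrightarrow> (f has_derivative f' x) (at x)" "\<And>v. C_k_on k U (\<lambda>x. f' x v)"
  shows "C_k_on (Suc k) U f"
proof -
  have "C_k_on k U (dderiv v f)" for v
    by (rule C_k_on_cong_imp[OF assms(1) _ assms(3)[of v]]) (use assms(2) dderivI in metis)
  moreover have "f differentiable (at x)" if "x \<in> U" for x
    using assms(2)[OF that] differentiableI by blast
  ultimately show ?thesis by (simp add: C_k_on_Suc)
qed

lemma C_k_on_Suc_has_derivative:
  "C_k_on (Suc k) U f \<Longrightarrow> x \<in> U \<Longrightarrow> (f has_derivative (\<lambda>v. dderiv v f x)) (at x)"
  by (intro has_derivative_dderiv) (auto simp: C_k_on_Suc)

lemma C_k_on_imp_continuous: "C_k_on k U f \<Longrightarrow> continuous_on U f"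
proof (cases k)
  case (Suc m)
  assume "C_k_on k U f"
  then show ?thesis using Suc
    by (auto simp: C_k_on_Suc intro!: continuous_at_imp_continuous_on differentiable_imp_continuous_within)
qed auto

lemma C_k_on_SucD: "C_k_on (Suc k) U f \<Longrightarrow> C_k_on k U f"
proof (induction k arbitrary: f)
  case 0
  then show ?case using C_k_on_imp_continuous[OF 0] by simp
next
  case (Suc k)
  then show ?case using C_k_on_Suc by blast
qed

lemma C_k_on_subset: "C_k_on k U f \<Longrightarrow> V \<subseteq> U \<Longrightarrow> C_k_on k V f"
  by (induction k arbitrary: f) (auto intro: continuous_on_subset simp: C_k_on_Suc)

lemma C_k_on_bounded_linear:
  "bounded_linear L \<Longrightarrow> open U \<Longrightarrow> C_k_on k U f \<Longrightarrow> C_k_on k U (\<lambda>x. L (f x))"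
proof (induction k arbitrary: f)
  case 0
  then show ?case by (auto intro: bounded_linear.continuous_on)
next
  case (Suc k)
  show ?case
  proof (rule C_k_on_SucI[where f' = "\<lambda>x v. L (dderiv v f x)"])
    fix x assume "x \<in> U"
    then show "((\<lambda>x. L (f x)) has_derivative (\<lambda>v. L (dderiv v f x))) (at x)"
      by (intro bounded_linear.has_derivative[OF Suc.prems(1)] C_k_on_Suc_has_derivative[OF Suc.prems(3)])
  next
    fix v
    show "C_k_on k U (\<lambda>x. L (dderiv v f x))"
      by (rule Suc.IH) (use Suc.prems in \<open>auto simp: C_k_on_Suc\<close>)
  qed fact
qed

lemma C_k_on_const: "C_k_on k U (\<lambda>x. c)"
  by (induction k arbitrary: c) (auto simp: C_k_on_Suc dderiv_def[abs_def])

lemma C_k_on_add: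
  "open U \<Longrightarrow> C_k_on k U f \<Longrightarrow> C_k_on k U g \<Longrightarrow> C_k_on k U (\<lambda>x. f x + g x)"
proof (induction k arbitrary: f g)
  case 0
  then show ?case by (auto intro: continuous_intros)
next
  case (Suc k)
  show ?case
  proof (rule C_k_on_SucI[where f' = "\<lambda>x v. dderiv v f x + dderiv v g x"])
    fix x assume "x \<in> U"
    then show "((\<lambda>x. f x + g x) has_derivative (\<lambda>v. dderiv v f x + dderiv v g x)) (at x)"
      by (intro has_derivative_add C_k_on_Suc_has_derivative[OF Suc.prems(2)]
          C_k_on_Suc_has_derivative[OF Suc.prems(3)])
  next
    fix v
    show "C_k_on k U (\<lambda>x. dderiv v f x + dderiv v g x)"
      by (rule Suc.IH) (use Suc.prems in \<open>auto simp: C_k_on_Suc\<close>)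
  qed fact
qed

lemma C_k_on_mult:
  fixes f g :: "'a::real_normed_vector \<Rightarrow> real"
  shows "open U \<Longrightarrow> C_k_on k U f \<Longrightarrow> C_k_on k U g \<Longrightarrow> C_k_on k U (\<lambda>x. f x * g x)"
proof (induction k arbitrary: f g)
  case 0
  then show ?case by (auto intro: continuous_intros)
next
  case (Suc k)
  show ?case
  proof (rule C_k_on_SucI[where f' = "\<lambda>x v. f x * dderiv v g x + dderiv v f x * g x"])
    fix x assume "x \<in> U"
    then show "((\<lambda>x. f x * g x) has_derivative (\<lambda>v. f x * dderiv v g x + dderiv v f x * g x)) (at x)"
      by (intro has_derivative_mult C_k_on_Suc_has_derivative[OF Suc.prems(2)]
          C_k_on_Suc_has_derivative[OF Suc.prems(3)])
  next
    fix v
    show "C_k_on k U (\<lambda>x. f x * dderiv v g x + dderiv v f x * g x)"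
      using Suc.prems(2,3)
      by (intro C_k_on_add[OF Suc.prems(1)] Suc.IH[OF Suc.prems(1)] C_k_on_SucD[OF Suc.prems(2)]
          C_k_on_SucD[OF Suc.prems(3)]) (auto simp: C_k_on_Suc)
  qed fact
qed

lemma C_k_on_compose_real:
  fixes f :: "'a::real_normed_vector \<Rightarrow> real" and g :: "real \<Rightarrow> real"
  shows "open U \<Longrightarrow> open V \<Longrightarrow> f ` U \<subseteq> V \<Longrightarrow> C_k_on k U f \<Longrightarrow> C_k_on k V g \<Longrightarrow> C_k_on k U (\<lambda>x. g (f x))"
proof (induction k arbitrary: g)
  case 0
  then show ?case by (auto intro: continuous_on_compose2)
next
  case (Suc k)
  show ?case
  proof (rule C_k_on_SucI[where f' = "\<lambda>x v. dderiv 1 g (f x) * dderiv v f x"])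
    fix x assume x: "x \<in> U"
    have gd: "(g has_derivative (\<lambda>v. dderiv v g (f x))) (at (f x))"
      by (rule C_k_on_Suc_has_derivative[OF Suc.prems(5)]) (use Suc.prems x in auto)
    then have lin: "linear (\<lambda>v. dderiv v g (f x))" using has_derivative_linear by blast
    have eq: "dderiv v g (f x) = dderiv 1 g (f x) * v" for v
      using linear_scale[OF lin, of v 1] by (simp add: mult.commute)
    have fd: "(f has_derivative (\<lambda>v. dderiv v f x)) (at x)"
      by (rule C_k_on_Suc_has_derivative[OF Suc.prems(4) x])
    have "((\<lambda>x. g (f x)) has_derivative (\<lambda>v. dderiv (dderiv v f x) g (f x))) (at x)"
      by (rule has_derivative_compose[OF fd gd])
    also have "(\<lambda>v. dderiv (dderiv v f x) g (f x)) = (\<lambda>v. dderiv 1 g (f x) * dderiv v f x)"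
      by (intro ext) (rule eq)
    finally show "((\<lambda>x. g (f x)) has_derivative (\<lambda>v. dderiv 1 g (f x) * dderiv v f x)) (at x)"
      .
  next
    fix v
    have "C_k_on k U (\<lambda>x. dderiv 1 g (f x))"
      by (rule Suc.IH[OF Suc.prems(1-3) C_k_on_SucD[OF Suc.prems(4)]])
        (use Suc.prems in \<open>auto simp: C_k_on_Suc\<close>)
    then show "C_k_on k U (\<lambda>x. dderiv 1 g (f x) * dderiv v f x)"
      by (rule C_k_on_mult[OF Suc.prems(1)]) (use Suc.prems in \<open>auto simp: C_k_on_Suc\<close>)
  qed fact
qed

lemma C_k_on_compose_affine:
  fixes f :: "'a::real_normed_vector \<Rightarrow> 'b::real_normed_vector" and L :: "'c::real_normed_vector \<Rightarrow> 'a"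
  assumes L: "bounded_linear L" and U: "open U"
  shows "C_k_on k U f \<Longrightarrow> C_k_on k {x. L x + c \<in> U} (\<lambda>x. f (L x + c))"
proof (induction k arbitrary: f)
  case 0
  then show ?case
    by (auto intro!: continuous_on_compose2[of U f] continuous_intros bounded_linear.continuous_on[OF L])
next
  case (Suc k)
  have op: "open {x. L x + c \<in> U}"
    using open_vimage[OF U, of "\<lambda>x. L x + c"] bounded_linear.continuous_on[OF L continuous_on_id]
    by (simp add: vimage_def continuous_on_add)
  show ?case
  proof (rule C_k_on_SucI[OF op, where f' = "\<lambda>x v. dderiv (L v) f (L x + c)"])
    fix x assume x: "x \<in> {x. L x + c \<in> U}"
    have "((\<lambda>x. L x + c) has_derivative L) (at x)"
      using bounded_linear_imp_has_derivative[OF L] by (auto intro!: derivative_eq_intros)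
    then show "((\<lambda>x. f (L x + c)) has_derivative (\<lambda>v. dderiv (L v) f (L x + c))) (at x)"
      by (rule has_derivative_compose) (use C_k_on_Suc_has_derivative[OF Suc.prems] x in auto)
  next
    fix v
    show "C_k_on k {x. L x + c \<in> U} (\<lambda>x. dderiv (L v) f (L x + c))"
      by (rule Suc.IH) (use Suc.prems in \<open>auto simp: C_k_on_Suc\<close>)
  qed
qed

lemma C_k_on_inverse:
  fixes f :: "'a::real_normed_vector \<Rightarrow> real"
  shows "open U \<Longrightarrow> (\<And>x. x \<in> U \<Longrightarrow> f x \<noteq> 0) \<Longrightarrow> C_k_on k U f \<Longrightarrow> C_k_on k U (\<lambda>x. inverse (f x))"
proof (induction k)
  case 0
  then show ?case by (auto intro: continuous_intros)
next
  case (Suc k)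
  have IH: "C_k_on k U (\<lambda>x. inverse (f x))" using Suc C_k_on_SucD by blast
  show ?case
  proof (rule C_k_on_SucI[where f' = "\<lambda>x v. - 1 * ((inverse (f x) * dderiv v f x) * inverse (f x))"])
    fix x assume x: "x \<in> U"
    show "((\<lambda>x. inverse (f x)) has_derivative (\<lambda>v. - 1 * ((inverse (f x) * dderiv v f x) * inverse (f x)))) (at x)"
      using Deriv.has_derivative_inverse[OF Suc.prems(2)[OF x] C_k_on_Suc_has_derivative[OF Suc.prems(3) x]]
      by simp
  next
    fix v
    show "C_k_on k U (\<lambda>x. - 1 * ((inverse (f x) * dderiv v f x) * inverse (f x)))"
      using Suc.prems by (intro C_k_on_mult C_k_on_const IH) (auto simp: C_k_on_Suc)
  qed fact
qed

subsection \<open>Smooth functions\<close>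

lemma smooth_on_C_k: "smooth_on U f \<Longrightarrow> C_k_on k U f"
  by (simp add: smooth_on_def)

lemma smooth_on_cong_imp:
  "open U \<Longrightarrow> (\<And>x. x \<in> U \<Longrightarrow> f x = g x) \<Longrightarrow> smooth_on U f \<Longrightarrow> smooth_on U g"
  using C_k_on_cong_imp unfolding smooth_on_def by blast

lemma smooth_on_subset: "smooth_on U f \<Longrightarrow> V \<subseteq> U \<Longrightarrow> smooth_on V f"
  unfolding smooth_on_def using C_k_on_subset by blast

lemma smooth_on_dderiv: "smooth_on U f \<Longrightarrow> smooth_on U (dderiv v f)"
  unfolding smooth_on_def using C_k_on_Suc by blast

lemma smooth_on_has_derivative:
  "smooth_on U f \<Longrightarrow> x \<in> U \<Longrightarrow> (f has_derivative (\<lambda>v. dderiv v f x)) (at x)"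
  using C_k_on_Suc_has_derivative smooth_on_C_k by blast

lemma smooth_on_continuous: "smooth_on U f \<Longrightarrow> continuous_on U f"
  using C_k_on_imp_continuous smooth_on_C_k by blast

named_theorems smooth_intros

lemma smooth_on_const [smooth_intros]: "smooth_on U (\<lambda>x. c)"
  by (simp add: smooth_on_def C_k_on_const)

lemma smooth_on_bounded_linear:
  "bounded_linear L \<Longrightarrow> open U \<Longrightarrow> smooth_on U f \<Longrightarrow> smooth_on U (\<lambda>x. L (f x))"
  by (simp add: smooth_on_def C_k_on_bounded_linear)

lemma smooth_on_id [smooth_intros]: "open U \<Longrightarrow> smooth_on U (\<lambda>x. x)"
  unfolding smooth_on_def
proof
  fix k assume "open U"
  then show "C_k_on k U (\<lambda>x. x)"
  proof (cases k)
    case (Suc m)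
    show ?thesis unfolding Suc
      by (rule C_k_on_SucI[OF \<open>open U\<close>, where f' = "\<lambda>x v. v"]) (auto intro: C_k_on_const)
  qed auto
qed

lemma smooth_on_inner_left [smooth_intros]: "open U \<Longrightarrow> smooth_on U (\<lambda>x. u \<bullet> x)"
  by (rule smooth_on_bounded_linear[OF bounded_linear_inner_right _ smooth_on_id])

lemma smooth_on_add [smooth_intros]:
  "open U \<Longrightarrow> smooth_on U f \<Longrightarrow> smooth_on U g \<Longrightarrow> smooth_on U (\<lambda>x. f x + g x)"
  by (simp add: smooth_on_def C_k_on_add)

lemma smooth_on_mult [smooth_intros]:
  fixes f g :: "'a::real_normed_vector \<Rightarrow> real"
  shows "open U \<Longrightarrow> smooth_on U f \<Longrightarrow> smooth_on U g \<Longrightarrow> smooth_on U (\<lambda>x. f x * g x)"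
  by (simp add: smooth_on_def C_k_on_mult)

lemma smooth_on_uminus [smooth_intros]:
  "open U \<Longrightarrow> smooth_on U f \<Longrightarrow> smooth_on U (\<lambda>x. - f x)"
  by (rule smooth_on_bounded_linear[OF bounded_linear_minus[OF bounded_linear_ident]])

lemma smooth_on_diff [smooth_intros]:
  "open U \<Longrightarrow> smooth_on U f \<Longrightarrow> smooth_on U g \<Longrightarrow> smooth_on U (\<lambda>x. f x - g x)"
  using smooth_on_add[OF _ _ smooth_on_uminus] by fastforce

lemma smooth_on_scaleR_const [smooth_intros]:
  fixes f :: "'a::real_normed_vector \<Rightarrow> real"
  shows "open U \<Longrightarrow> smooth_on U f \<Longrightarrow> smooth_on U (\<lambda>x. f x *\<^sub>R M)"
  by (rule smooth_on_bounded_linear[OF bounded_linear_scaleR_left])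

lemma smooth_on_sum [smooth_intros]:
  "open U \<Longrightarrow> (\<And>i. i \<in> I \<Longrightarrow> smooth_on U (f i)) \<Longrightarrow> smooth_on U (\<lambda>x. \<Sum>i\<in>I. f i x)"
  by (induction I rule: infinite_finite_induct) (auto intro: smooth_on_const smooth_on_add smooth_on_mult)

lemma smooth_on_prod [smooth_intros]:
  fixes f :: "'i \<Rightarrow> 'a::real_normed_vector \<Rightarrow> real"
  shows "open U \<Longrightarrow> (\<And>i. i \<in> I \<Longrightarrow> smooth_on U (f i)) \<Longrightarrow> smooth_on U (\<lambda>x. \<Prod>i\<in>I. f i x)"
  by (induction I rule: infinite_finite_induct) (auto intro: smooth_on_const smooth_on_add smooth_on_mult)

lemma smooth_on_inverse [smooth_intros]:
  fixes f :: "'a::real_normed_vector \<Rightarrow> real"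
  shows "open U \<Longrightarrow> (\<And>x. x \<in> U \<Longrightarrow> f x \<noteq> 0) \<Longrightarrow> smooth_on U f \<Longrightarrow> smooth_on U (\<lambda>x. inverse (f x))"
  by (simp add: smooth_on_def C_k_on_inverse)

lemma smooth_on_compose_real:
  fixes f :: "'a::real_normed_vector \<Rightarrow> real" and g :: "real \<Rightarrow> real"
  shows "open U \<Longrightarrow> smooth_on UNIV g \<Longrightarrow> smooth_on U f \<Longrightarrow> smooth_on U (\<lambda>x. g (f x))"
  unfolding smooth_on_def by (simp add: C_k_on_compose_real[of U UNIV])

lemma smooth_on_compose_affine:
  assumes "bounded_linear L" "open U" "smooth_on U f"
  shows "smooth_on {x. L x + c \<in> U} (\<lambda>x. f (L x + c))"
  using assms C_k_on_compose_affine[OF assms(1,2)] unfolding smooth_on_def by blast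

lemma dderiv_compose_affine:
  assumes "bounded_linear L" "smooth_on U f" "L x + c \<in> U"
  shows "dderiv v (\<lambda>x. f (L x + c)) x = dderiv (L v) f (L x + c)"
proof (rule dderivI)
  have "((\<lambda>x. L x + c) has_derivative L) (at x)"
    using bounded_linear_imp_has_derivative[OF assms(1)] by (auto intro!: derivative_eq_intros)
  then show "((\<lambda>x. f (L x + c)) has_derivative (\<lambda>v. dderiv (L v) f (L x + c))) (at x)"
    by (rule has_derivative_compose) (rule smooth_on_has_derivative[OF assms(2,3)])
qed

lemma dderiv_add:
  "smooth_on U f \<Longrightarrow> smooth_on U g \<Longrightarrow> x \<in> U \<Longrightarrow>
   dderiv v (\<lambda>x. f x + g x) x = dderiv v f x + dderiv v g x"
  by (rule dderivI[OF has_derivative_add]) (rule smooth_on_has_derivative; assumption)+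

lemma dderiv_diff:
  "smooth_on U f \<Longrightarrow> smooth_on U g \<Longrightarrow> x \<in> U \<Longrightarrow>
   dderiv v (\<lambda>x. f x - g x) x = dderiv v f x - dderiv v g x"
  by (rule dderivI[OF has_derivative_diff]) (rule smooth_on_has_derivative; assumption)+

lemma dderiv_mult:
  fixes f g :: "'a::real_normed_vector \<Rightarrow> real"
  shows "smooth_on U f \<Longrightarrow> smooth_on U g \<Longrightarrow> x \<in> U \<Longrightarrow>
   dderiv v (\<lambda>x. f x * g x) x = f x * dderiv v g x + dderiv v f x * g x"
  by (rule dderivI[OF has_derivative_mult]) (rule smooth_on_has_derivative; assumption)+

lemma dderiv_sum:
  "(\<And>i. i \<in> I \<Longrightarrow> smooth_on U (f i)) \<Longrightarrow> x \<in> U \<Longrightarrow>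
   dderiv v (\<lambda>x. \<Sum>i\<in>I. f i x) x = (\<Sum>i\<in>I. dderiv v (f i) x)"
  by (rule dderivI[OF has_derivative_sum]) (rule smooth_on_has_derivative; simp)

lemma dderiv_const [simp]: "dderiv v (\<lambda>x. c) x = 0"
  by (simp add: dderiv_def)

lemma dderiv_bounded_linear:
  assumes "bounded_linear L" "smooth_on U f" "x \<in> U"
  shows "dderiv v (\<lambda>x. L (f x)) x = L (dderiv v f x)"
  by (rule dderivI[OF bounded_linear.has_derivative[OF assms(1) smooth_on_has_derivative[OF assms(2,3)]]])

lemma dderiv_linear:
  assumes "smooth_on U f" "x \<in> U"
  shows "linear (\<lambda>v. dderiv v f x)"
  using smooth_on_has_derivative[OF assms] has_derivative_linear by blast

lemma dderiv_cong_open: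
  assumes "open U" "x \<in> U" "\<And>y. y \<in> U \<Longrightarrow> f y = g y"
  shows "dderiv v f x = dderiv v g x"
proof -
  have "(f has_derivative D) (at x) \<longleftrightarrow> (g has_derivative D) (at x)" for D
    using has_derivative_transform_within_open[OF _ assms(1,2)] assms(3) by metis
  then show ?thesis by (simp add: dderiv_def frechet_derivative_def)
qed

lemma partial_deriv_dderiv: "partial_deriv i f = dderiv (axis i 1) f"
  by (auto simp: partial_deriv_def dderiv_def)

subsection \<open>Mixed derivatives commute\<close>

lemma dderiv_line:
  fixes f :: "'a::real_normed_vector \<Rightarrow> 'b::real_normed_vector"
  assumes "smooth_on U f" "x + t *\<^sub>R v \<in> U"
  shows "((\<lambda>t. f (x + t *\<^sub>R v)) has_vector_derivative dderiv v f (x + t *\<^sub>R v)) (at t within S)"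
proof -
  have "((\<lambda>t. x + t *\<^sub>R v) has_derivative (\<lambda>h. h *\<^sub>R v)) (at t)"
    by (auto intro!: derivative_eq_intros)
  from has_derivative_compose[OF this smooth_on_has_derivative[OF assms]]
  have "((\<lambda>t. f (x + t *\<^sub>R v)) has_derivative (\<lambda>h. dderiv (h *\<^sub>R v) f (x + t *\<^sub>R v))) (at t)" .
  then show ?thesis
    using linear_scale[OF dderiv_linear[OF assms]]
    by (auto simp: has_vector_derivative_def intro: has_derivative_at_withinI)
qed

lemma dderiv_line_real:
  fixes f :: "'a::real_normed_vector \<Rightarrow> real"
  assumes "smooth_on U f" "x + t *\<^sub>R v \<in> U"
  shows "((\<lambda>t. f (x + t *\<^sub>R v)) has_real_derivative dderiv v f (x + t *\<^sub>R v)) (at t within S)"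
  using dderiv_line[OF assms] has_real_derivative_iff_has_vector_derivative by blast

lemma dderiv_commute:
  fixes f :: "'a::real_normed_vector \<Rightarrow> real"
  assumes sm: "smooth_on U f" and U: "open U" and x: "x \<in> U"
  shows "dderiv v (dderiv w f) x = dderiv w (dderiv v f) x"
proof -
  \<comment> \<open>the second difference of \<open>f\<close> over a small parallelogram is \<open>h\<^sup>2\<close> times a mixed second
    derivative, in either order, at a nearby point\<close>
  have key: "\<exists>y. norm (y - x) \<le> h * (norm v + norm w) \<and>
      f (x + h *\<^sub>R v + h *\<^sub>R w) - f (x + h *\<^sub>R v) - f (x + h *\<^sub>R w) + f x = h\<^sup>2 * dderiv w (dderiv v f) y"
    if h: "h > 0" and ball: "cball x (h * (norm v + norm w)) \<subseteq> U" for h v w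
  proof -
    have inU: "x + s *\<^sub>R v + t *\<^sub>R w \<in> U" if "0 \<le> s" "s \<le> h" "0 \<le> t" "t \<le> h" for s t
    proof -
      have "norm (s *\<^sub>R v + t *\<^sub>R w) \<le> s * norm v + t * norm w"
        using that norm_triangle_ineq[of "s *\<^sub>R v" "t *\<^sub>R w"] by simp
      also have "\<dots> \<le> h * (norm v + norm w)"
        using that by (auto simp: algebra_simps intro!: add_mono mult_right_mono)
      finally have "x + (s *\<^sub>R v + t *\<^sub>R w) \<in> cball x (h * (norm v + norm w))"
        unfolding mem_cball dist_norm by (subst norm_minus_commute) simp
      then show ?thesis using ball by (auto simp: add.assoc)
    qed
    define \<phi> where "\<phi> s = f ((x + h *\<^sub>R w) + s *\<^sub>R v) - f (x + s *\<^sub>R v)" for s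
    have d: "(\<phi> has_real_derivative (dderiv v f ((x + h *\<^sub>R w) + s *\<^sub>R v) - dderiv v f (x + s *\<^sub>R v))) (at s)"
      if "0 \<le> s" "s \<le> h" for s
      unfolding \<phi>_def
      using inU[of s h] inU[of s 0] that h
      by (intro DERIV_diff dderiv_line_real[OF sm]) (auto simp: algebra_simps)
    obtain s where s: "0 < s" "s < h"
        "\<phi> h - \<phi> 0 = (h - 0) * (dderiv v f ((x + h *\<^sub>R w) + s *\<^sub>R v) - dderiv v f (x + s *\<^sub>R v))"
      using MVT2[OF h d] by auto
    define \<psi> where "\<psi> t = dderiv v f ((x + s *\<^sub>R v) + t *\<^sub>R w)" for t
    have d2: "(\<psi> has_real_derivative dderiv w (dderiv v f) ((x + s *\<^sub>R v) + t *\<^sub>R w)) (at t)"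
      if "0 \<le> t" "t \<le> h" for t
      unfolding \<psi>_def
      using inU[of s t] that s by (intro dderiv_line_real[OF smooth_on_dderiv[OF sm]]) auto
    obtain t where t: "0 < t" "t < h"
        "\<psi> h - \<psi> 0 = (h - 0) * dderiv w (dderiv v f) ((x + s *\<^sub>R v) + t *\<^sub>R w)"
      using MVT2[OF h d2] by auto
    have "\<phi> h - \<phi> 0 = h\<^sup>2 * dderiv w (dderiv v f) ((x + s *\<^sub>R v) + t *\<^sub>R w)"
      using s(3) t(3) by (simp add: \<psi>_def power2_eq_square algebra_simps)
    moreover have "norm ((x + s *\<^sub>R v + t *\<^sub>R w) - x) \<le> h * (norm v + norm w)"
    proof -
      have "norm (s *\<^sub>R v + t *\<^sub>R w) \<le> s * norm v + t * norm w"
        using s t norm_triangle_ineq[of "s *\<^sub>R v" "t *\<^sub>R w"] by simp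
      also have "\<dots> \<le> h * (norm v + norm w)"
        using s t by (auto simp: algebra_simps intro!: add_mono mult_right_mono)
      finally show ?thesis by (simp add: add.assoc)
    qed
    ultimately show ?thesis by (intro exI[of _ "x + s *\<^sub>R v + t *\<^sub>R w"]) (simp add: \<phi>_def algebra_simps)
  qed
  obtain r where r: "r > 0" "cball x r \<subseteq> U" using U x open_contains_cball by blast
  define N where "N = norm v + norm w + 1"
  have N: "N > 0" by (simp add: N_def add_nonneg_pos)
  define h where "h n = r / N / real (Suc n)" for n
  have h: "h n > 0" "h n * (norm v + norm w) \<le> r" for n
  proof -
    show "h n > 0" using r N by (simp add: h_def)
    have "h n * (norm v + norm w) \<le> h n * N" using \<open>h n > 0\<close> by (simp add: N_def)
    also have "\<dots> = r / real (Suc n)" using N by (simp add: h_def)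
    also have "\<dots> \<le> r / 1" using r by (intro divide_left_mono) auto
    finally show "h n * (norm v + norm w) \<le> r" by simp
  qed
  have h0: "(\<lambda>n. h n * (norm v + norm w)) \<longlonglongrightarrow> 0"
    unfolding h_def using LIMSEQ_Suc[OF lim_const_over_n[of "r / N"]] tendsto_mult_left_zero by fastforce
  have ballU: "cball x (h n * (norm v + norm w)) \<subseteq> U" "cball x (h n * (norm w + norm v)) \<subseteq> U" for n
    using subset_cball[OF h(2)[of n]] r(2) by (auto simp: add.commute)
  have "\<forall>n. \<exists>y. norm (y - x) \<le> h n * (norm v + norm w) \<and>
     f (x + h n *\<^sub>R v + h n *\<^sub>R w) - f (x + h n *\<^sub>R v) - f (x + h n *\<^sub>R w) + f x = (h n)\<^sup>2 * dderiv w (dderiv v f) y"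
    by (intro allI key h ballU)
  from choice[OF this] obtain Y where Y: "\<And>n. norm (Y n - x) \<le> h n * (norm v + norm w)"
     "\<And>n. f (x + h n *\<^sub>R v + h n *\<^sub>R w) - f (x + h n *\<^sub>R v) - f (x + h n *\<^sub>R w) + f x = (h n)\<^sup>2 * dderiv w (dderiv v f) (Y n)"
    by auto
  have "\<forall>n. \<exists>y. norm (y - x) \<le> h n * (norm w + norm v) \<and>
     f (x + h n *\<^sub>R w + h n *\<^sub>R v) - f (x + h n *\<^sub>R w) - f (x + h n *\<^sub>R v) + f x = (h n)\<^sup>2 * dderiv v (dderiv w f) y"
    by (intro allI key h ballU)
  from choice[OF this] obtain Z where Z: "\<And>n. norm (Z n - x) \<le> h n * (norm w + norm v)"
     "\<And>n. f (x + h n *\<^sub>R w + h n *\<^sub>R v) - f (x + h n *\<^sub>R w) - f (x + h n *\<^sub>R v) + f x = (h n)\<^sup>2 * dderiv v (dderiv w f) (Z n)"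
    by auto
  have YZ: "dderiv w (dderiv v f) (Y n) = dderiv v (dderiv w f) (Z n)" for n
  proof -
    have "(h n)\<^sup>2 * dderiv w (dderiv v f) (Y n) = (h n)\<^sup>2 * dderiv v (dderiv w f) (Z n)"
    proof -
      have "f (x + h n *\<^sub>R v + h n *\<^sub>R w) = f (x + h n *\<^sub>R w + h n *\<^sub>R v)"
        by (simp add: add_ac)
      then show ?thesis using Y(2)[of n] Z(2)[of n] by linarith
    qed
    then show ?thesis using h(1)[of n] by simp
  qed
  have lim: "X \<longlonglongrightarrow> x" if "\<And>n. norm (X n - x) \<le> h n * (norm v + norm w)" for X
    using LIM_zero_cancel[OF Lim_null_comparison[OF _ h0]] that by (auto intro!: always_eventually)
  have cont: "(\<lambda>n. g (X n)) \<longlonglongrightarrow> g x" if "X \<longlonglongrightarrow> x" "smooth_on U g" for X and g :: "'a \<Rightarrow> real"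
  proof -
    have "isCont g x" using smooth_on_continuous[OF that(2)] continuous_on_eq_continuous_at[OF U] x by blast
    then show ?thesis using that(1) by (rule isCont_tendsto_compose)
  qed
  have "(\<lambda>n. dderiv w (dderiv v f) (Y n)) \<longlonglongrightarrow> dderiv w (dderiv v f) x"
    by (intro cont lim Y smooth_on_dderiv sm)
  moreover have "(\<lambda>n. dderiv v (dderiv w f) (Z n)) \<longlonglongrightarrow> dderiv v (dderiv w f) x"
    using Z(1) by (intro cont lim smooth_on_dderiv sm) (simp add: add.commute)
  ultimately show ?thesis unfolding YZ by (rule LIMSEQ_unique[rotated])
qed

subsection \<open>Smooth functions given by integrals\<close>

text \<open>
  Derivatives of such an integral are sums of integrals of the same form, because the factor \<open>t\<close> that
  the chain rule produces can be absorbed into the weight \<open>c\<close>; this gives smoothness by induction.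
\<close>

lemma parametric_integral:
  fixes F :: "'a::euclidean_space \<Rightarrow> real" and L :: "'a \<Rightarrow> 'a" and c :: "real \<Rightarrow> real"
  assumes F: "smooth_on UNIV F" and L: "bounded_linear L" and c: "continuous_on {a..b} c"
  shows "((\<lambda>x. integral {a..b} (\<lambda>t. c t * F (x + t *\<^sub>R (L x + d)))) has_derivative
     (\<lambda>v. integral {a..b} (\<lambda>t. c t * dderiv v F (x + t *\<^sub>R (L x + d))) +
          integral {a..b} (\<lambda>t. (t * c t) * dderiv (L v) F (x + t *\<^sub>R (L x + d))))) (at x)"
proof -
  define A where "A x t = x + t *\<^sub>R (L x + d)" for x t
  define fx where "fx x t = c t *\<^sub>R (Blinfun (\<lambda>v. dderiv v F (A x t)) o\<^sub>L
       (id_blinfun + t *\<^sub>R Blinfun L))" for x t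
  have bl: "bounded_linear (\<lambda>v. dderiv v F y)" for y
    using smooth_on_has_derivative[OF F, of y] has_derivative_bounded_linear by blast
  have fx_apply: "blinfun_apply (fx x t) v = c t * dderiv (v + t *\<^sub>R L v) F (A x t)" for x t v
    by (simp add: fx_def bounded_linear_Blinfun_apply[OF bl] bounded_linear_Blinfun_apply[OF L]
        blinfun.bilinear_simps)
  have contA: "continuous_on S (\<lambda>p. A (fst p) (snd p))" for S
    unfolding A_def by (intro continuous_intros bounded_linear.continuous_on[OF L])
  have contdF: "continuous_on S (\<lambda>p. dderiv v F (A (fst p) (snd p)))" for S v
    by (rule continuous_on_compose2[OF smooth_on_continuous[OF smooth_on_dderiv[OF F]] contA]) auto
  have contFA: "continuous_on S (\<lambda>t. dderiv v F (A x t))" for S v x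
    by (rule continuous_on_compose2[OF smooth_on_continuous[OF smooth_on_dderiv[OF F]]])
      (auto simp: A_def intro!: continuous_intros)
  have contB: "continuous_on S (\<lambda>p. Blinfun (\<lambda>v. dderiv v F (A (fst p) (snd p))))" for S
    by (rule continuous_on_blinfun_componentwise)
      (simp add: bounded_linear_Blinfun_apply[OF bl] contdF)
  have "((\<lambda>x. integral (cbox a b) (\<lambda>t. c t * F (A x t))) has_derivative
      blinfun_apply (integral (cbox a b) (fx x))) (at x within UNIV)"
  proof (rule leibniz_rule)
    fix x t assume "t \<in> cbox a b"
    have "((\<lambda>x. A x t) has_derivative (\<lambda>v. v + t *\<^sub>R L v)) (at x)"
      unfolding A_def by (auto intro!: derivative_eq_intros bounded_linear_imp_has_derivative[OF L])
    from has_derivative_compose[OF this smooth_on_has_derivative[OF F]]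
    have "((\<lambda>x. c t * F (A x t)) has_derivative (\<lambda>v. c t * dderiv (v + t *\<^sub>R L v) F (A x t))) (at x)"
      by (intro has_derivative_mult_right) auto
    then show "((\<lambda>x. c t * F (A x t)) has_derivative blinfun_apply (fx x t)) (at x within UNIV)"
      by (simp add: fx_apply[abs_def])
  next
    fix x
    show "(\<lambda>t. c t * F (A x t)) integrable_on cbox a b"
      unfolding A_def
      by (intro integrable_continuous continuous_intros continuous_on_compose2[OF smooth_on_continuous[OF F]])
        (use c in auto)
  next
    have "continuous_on (UNIV \<times> cbox a b) (\<lambda>p. c (snd p))"
      by (rule continuous_on_compose2[OF c]) (auto intro: continuous_intros)
    then show "continuous_on (UNIV \<times> cbox a b) (\<lambda>(x, t). fx x t)"
      unfolding fx_def split_beta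
      by (intro continuous_intros contB) auto
  qed auto
  moreover have "blinfun_apply (integral (cbox a b) (fx x)) =
     (\<lambda>v. integral {a..b} (\<lambda>t. c t * dderiv v F (A x t)) +
          integral {a..b} (\<lambda>t. (t * c t) * dderiv (L v) F (A x t)))"
  proof
    fix v
    have cfx: "continuous_on {a..b} (\<lambda>t. fx x t)"
    proof -
      have "continuous_on {a..b} (\<lambda>t. Blinfun (\<lambda>v. dderiv v F (A x t)))"
        by (rule continuous_on_blinfun_componentwise)
          (simp add: bounded_linear_Blinfun_apply[OF bl] contFA)
      then show ?thesis unfolding fx_def by (intro continuous_intros c) auto
    qed
    have lin: "dderiv (v + t *\<^sub>R L v) F y = dderiv v F y + t * dderiv (L v) F y" for t y
      using linear_add[OF dderiv_linear[OF F, of y]] linear_scale[OF dderiv_linear[OF F, of y]] by simp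
    have "blinfun_apply (integral (cbox a b) (fx x)) v = integral {a..b} (\<lambda>t. blinfun_apply (fx x t) v)"
      using integral_linear[OF integrable_continuous_interval[OF cfx] blinfun.bounded_linear_left[of v]]
      by (simp add: o_def)
    also have "\<dots> = integral {a..b} (\<lambda>t. c t * dderiv v F (A x t) + (t * c t) * dderiv (L v) F (A x t))"
      by (simp add: fx_apply lin algebra_simps)
    also have "\<dots> = integral {a..b} (\<lambda>t. c t * dderiv v F (A x t)) +
          integral {a..b} (\<lambda>t. (t * c t) * dderiv (L v) F (A x t))"
      by (intro integral_add integrable_continuous_interval continuous_intros c contFA)
    finally show "blinfun_apply (integral (cbox a b) (fx x)) v = \<dots>" .
  qed
  ultimately show ?thesis by (simp add: A_def)
qed

lemma smooth_parametric_integral: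
  fixes F :: "'a::euclidean_space \<Rightarrow> real" and L :: "'a \<Rightarrow> 'a" and c :: "real \<Rightarrow> real"
  assumes F: "smooth_on UNIV F" and L: "bounded_linear L" and c: "continuous_on {a..b} c"
  shows "smooth_on UNIV (\<lambda>x. integral {a..b} (\<lambda>t. c t * F (x + t *\<^sub>R (L x + d))))"
proof -
  have "C_k_on k UNIV (\<lambda>x. integral {a..b} (\<lambda>t. c t * F (x + t *\<^sub>R (L x + d))))" for k
    using F c
  proof (induction k arbitrary: F c)
    case 0
    have "continuous (at x) (\<lambda>x. integral {a..b} (\<lambda>t. c t * F (x + t *\<^sub>R (L x + d))))" for x
      using parametric_integral[OF 0(1) L 0(2)] has_derivative_continuous by blast
    then show ?case by (simp add: continuous_at_imp_continuous_on)
  next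
    case (Suc k)
    show ?case
    proof (rule C_k_on_SucI[OF _ parametric_integral[OF Suc.prems(1) L Suc.prems(2)]])
      fix v
      have "continuous_on {a..b} (\<lambda>t. t * c t)"
        by (intro continuous_intros Suc.prems)
      then show "C_k_on k UNIV (\<lambda>x. integral {a..b} (\<lambda>t. c t * dderiv v F (x + t *\<^sub>R (L x + d))) +
          integral {a..b} (\<lambda>t. (t * c t) * dderiv (L v) F (x + t *\<^sub>R (L x + d))))"
        using Suc.IH[OF smooth_on_dderiv[OF Suc.prems(1)] Suc.prems(2)]
          Suc.IH[OF smooth_on_dderiv[OF Suc.prems(1)]] by (intro C_k_on_add) auto
    qed auto
  qed
  then show ?thesis by (simp add: smooth_on_def)
qed

subsection \<open>Smooth cutoff functions on the line\<close>

text \<open>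
  The function \<open>exp (- 1 / t)\<close> for \<open>t > 0\<close>, extended by 0, together with its multiples by negative powers
  of \<open>t\<close>: the span of this family is closed under differentiation.
\<close>

definition bump_exp :: "nat \<Rightarrow> real \<Rightarrow> real" where
  "bump_exp k t = (if t \<le> 0 then 0 else inverse t ^ k * exp (- inverse t))"

lemma bump_exp_has_derivative:
  "(bump_exp k has_real_derivative (bump_exp (k + 2) t - real k * bump_exp (k + 1) t)) (at t)"
proof -
  consider "t < 0" | "t > 0" | "t = 0" by linarith
  then show ?thesis
  proof cases
    case 1
    have "((\<lambda>t. 0) has_real_derivative 0) (at t)" by simp
    then have "(bump_exp k has_real_derivative 0) (at t)"
      by (rule has_field_derivative_transform_within_open[of _ _ _ "{..<0}"])
        (use 1 in \<open>auto simp: bump_exp_def\<close>)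
    then show ?thesis using 1 by (simp add: bump_exp_def)
  next
    case 2
    have "((\<lambda>t. inverse t ^ k * exp (- inverse t)) has_real_derivative
       (inverse t ^ (k + 2) * exp (- inverse t) - real k * (inverse t ^ (k + 1) * exp (- inverse t)))) (at t)"
    proof (rule DERIV_cong)
      have d: "((\<lambda>t. inverse t) has_real_derivative - (inverse t ^ Suc (Suc 0))) (at t)"
        by (rule DERIV_inverse) (use 2 in simp)
      show "((\<lambda>t. inverse t ^ k * exp (- inverse t)) has_real_derivative
          (real k * ((- (inverse t ^ Suc (Suc 0))) * inverse t ^ (k - Suc 0)) * exp (- inverse t) +
           exp (- inverse t) * (- (- (inverse t ^ Suc (Suc 0)))) * inverse t ^ k)) (at t)"
        by (rule DERIV_mult[OF DERIV_power[OF d, of k] DERIV_chain2[OF DERIV_exp DERIV_minus[OF d]]])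
    qed (cases k; simp add: power_add algebra_simps)
    then have "(bump_exp k has_real_derivative
       (inverse t ^ (k + 2) * exp (- inverse t) - real k * (inverse t ^ (k + 1) * exp (- inverse t)))) (at t)"
      by (rule has_field_derivative_transform_within_open[of _ _ _ "{0<..}"])
        (use 2 in \<open>auto simp: bump_exp_def\<close>)
    then show ?thesis using 2 by (simp add: bump_exp_def)
  next
    case 3
    have "((\<lambda>h. bump_exp (Suc k) h) \<longlongrightarrow> 0) (at 0)"
    proof -
      have "((\<lambda>x. x ^ Suc k / exp x) \<longlongrightarrow> (0::real)) at_top"
        by (rule tendsto_power_div_exp_0)
      then have "((\<lambda>h. inverse h ^ Suc k / exp (inverse h)) \<longlongrightarrow> (0::real)) (at_right 0)"
        using filterlim_compose filterlim_inverse_at_top_right by blast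
      then have "((\<lambda>h. bump_exp (Suc k) h) \<longlongrightarrow> 0) (at_right 0)"
        by (rule Lim_transform_eventually)
          (auto simp: eventually_at_right_field bump_exp_def exp_minus field_simps intro!: exI[of _ 1])
      moreover have "((\<lambda>h. bump_exp (Suc k) h) \<longlongrightarrow> 0) (at_left 0)"
        by (rule Lim_transform_eventually[OF tendsto_const])
          (auto simp: eventually_at_left_field bump_exp_def intro!: exI[of _ "-1"])
      ultimately show ?thesis by (simp add: filterlim_split_at)
    qed
    then have "((\<lambda>h. (bump_exp k (0 + h) - bump_exp k 0) / h) \<longlongrightarrow> 0) (at 0)"
      by (rule Lim_transform_eventually)
        (auto simp: eventually_at_filter bump_exp_def field_simps)
    then show ?thesis using 3 by (simp add: DERIV_def bump_exp_def)
  qed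
qed

lemma smooth_bump_exp: "smooth_on UNIV (bump_exp k)"
proof -
  have "C_k_on m UNIV (bump_exp k)" for m
  proof (induction m arbitrary: k)
    case 0
    have "continuous_on UNIV (bump_exp k)"
      by (rule DERIV_continuous_on) (rule has_field_derivative_at_within[OF bump_exp_has_derivative])
    then show ?case by simp
  next
    case (Suc m)
    show ?case
    proof (rule C_k_on_SucI[where f' = "\<lambda>t v. (bump_exp (k + 2) t + - real k * bump_exp (k + 1) t) * v"])
      fix v
      show "C_k_on m UNIV (\<lambda>t. (bump_exp (k + 2) t + - real k * bump_exp (k + 1) t) * v)"
        using Suc.IH by (intro C_k_on_mult C_k_on_add C_k_on_const) auto
    qed (use bump_exp_has_derivative[of k] in \<open>auto simp: has_field_derivative_def\<close>)
  qed
  then show ?thesis by (simp add: smooth_on_def)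
qed

definition half_bump :: "real \<Rightarrow> real" where
  "half_bump = bump_exp 0"

lemma half_bump: "smooth_on UNIV half_bump" "t \<le> 0 \<Longrightarrow> half_bump t = 0" "t > 0 \<Longrightarrow> half_bump t > 0"
    "half_bump t \<ge> 0"
  by (auto simp: half_bump_def smooth_bump_exp bump_exp_def)

text \<open>A smooth step: it vanishes up to 1 and equals 1 from 2 on.\<close>

definition smooth_step :: "real \<Rightarrow> real" where
  "smooth_step t = half_bump (t - 1) * inverse (half_bump (t - 1) + half_bump (2 - t))"

lemma smooth_on_half_bump_affine: "smooth_on UNIV (\<lambda>t. half_bump (r * t + s))"
  by (rule smooth_on_compose_real[OF open_UNIV half_bump(1)])
    (auto intro!: smooth_on_add smooth_on_mult smooth_on_const smooth_on_id)

lemma smooth_step: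
  "smooth_on UNIV smooth_step" "t \<le> 1 \<Longrightarrow> smooth_step t = 0" "t \<ge> 2 \<Longrightarrow> smooth_step t = 1"
  "0 \<le> smooth_step t" "smooth_step t \<le> 1" "t > 1 \<Longrightarrow> smooth_step t > 0"
proof -
  have pos: "half_bump (t - 1) + half_bump (2 - t) > 0" for t
    using half_bump(3)[of "t - 1"] half_bump(3)[of "2 - t"] half_bump(4)[of "t - 1"] half_bump(4)[of "2 - t"]
    by (cases "t > 1") auto
  have "smooth_on UNIV (\<lambda>t. half_bump (t - 1))" "smooth_on UNIV (\<lambda>t. half_bump (2 - t))"
    using smooth_on_half_bump_affine[of 1 "-1"] smooth_on_half_bump_affine[of "-1" 2] by simp_all
  then show "smooth_on UNIV smooth_step"
    unfolding smooth_step_def[abs_def] using pos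
    by (intro smooth_on_mult smooth_on_inverse smooth_on_add) (auto simp: less_le)
  show "t \<le> 1 \<Longrightarrow> smooth_step t = 0" "t \<ge> 2 \<Longrightarrow> smooth_step t = 1"
    using pos[of t] by (simp_all add: smooth_step_def half_bump(2) less_le)
  show "0 \<le> smooth_step t"
    unfolding smooth_step_def using pos[of t] half_bump(4) by (intro mult_nonneg_nonneg) auto
  show "smooth_step t > 0" if "t > 1"
    unfolding smooth_step_def using pos[of t] half_bump(3) that by (intro mult_pos_pos) auto
  show "smooth_step t \<le> 1"
    using pos[of t] half_bump(4)[of "2 - t"] unfolding smooth_step_def divide_inverse[symmetric]
    by (subst divide_le_eq_1_pos) auto
qed

section \<open>Integrals of compactly supported functions\<close>

lemma integrable_compact_support:
  fixes u :: "'a::euclidean_space \<Rightarrow> real"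
  assumes "continuous_on UNIV u" "compact S" "\<And>x. x \<notin> S \<Longrightarrow> u x = 0"
  shows "integrable lborel u"
proof -
  have "integrable lborel (\<lambda>x. indicator S x *\<^sub>R u x)"
    by (rule borel_integrable_compact) (use assms in \<open>auto intro: continuous_on_subset\<close>)
  moreover have "(\<lambda>x. indicator S x *\<^sub>R u x) = u"
    by (rule ext) (use assms(3) in \<open>auto simp: indicator_def\<close>)
  ultimately show ?thesis by simp
qed

lemma integral_translate:
  fixes u :: "'a::euclidean_space \<Rightarrow> real"
  assumes "u \<in> borel_measurable borel"
  shows "(\<integral>x. u (x + a) \<partial>lborel) = (\<integral>x. u x \<partial>lborel)"
proof -
  have "(\<integral>x. u x \<partial>lborel) = (\<integral>x. u x \<partial>distr lborel borel ((+) a))"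
    by (simp add: lborel_distr_plus)
  also have "\<dots> = (\<integral>x. u (a + x) \<partial>lborel)"
    by (rule integral_distr) (use assms in auto)
  finally show ?thesis by (simp add: add.commute)
qed

text \<open>The integrals of the difference quotients vanish by translation invariance.\<close>

lemma integral_directional_derivative:
  fixes Y g :: "'a::euclidean_space \<Rightarrow> real"
  assumes d: "\<And>x. ((\<lambda>t. Y (x + t *\<^sub>R w)) has_real_derivative g x) (at 0)"
    and Y: "continuous_on UNIV Y" and g: "continuous_on UNIV g"
    and S: "compact S" "\<And>x. x \<notin> S \<Longrightarrow> Y x = 0"
  shows "(\<integral>x. g x \<partial>lborel) = 0"
proof -
  have d': "((\<lambda>t. Y (x + t *\<^sub>R w)) has_real_derivative g (x + s *\<^sub>R w)) (at s)" for x s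
  proof -
    have "((\<lambda>t. Y ((x + s *\<^sub>R w) + t *\<^sub>R w)) has_real_derivative g (x + s *\<^sub>R w)) (at 0)"
      by (rule d)
    then have "((\<lambda>t. Y (x + (s + t) *\<^sub>R w)) has_real_derivative g (x + s *\<^sub>R w)) (at 0)"
      by (simp add: algebra_simps)
    then show ?thesis using DERIV_at_within_shift[of "\<lambda>t. Y (x + t *\<^sub>R w)" _ s 0 UNIV] by simp
  qed
  have g0: "g x = 0" if x: "x \<notin> S" for x
  proof -
    have "continuous_on UNIV (\<lambda>t. x + t *\<^sub>R w)" by (intro continuous_intros)
    then have op: "open {t. x + t *\<^sub>R w \<in> - S}"
      using open_vimage[OF open_Compl[OF compact_imp_closed[OF S(1)]]] by (simp add: vimage_def)
    have "((\<lambda>t. Y (x + t *\<^sub>R w)) has_real_derivative 0) (at 0)"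
      by (rule has_field_derivative_transform_within_open[OF DERIV_const[of 0] op])
        (use x S in auto)
    then show ?thesis using d[of x] DERIV_unique by blast
  qed
  obtain B where B: "\<And>x. \<bar>g x\<bar> \<le> B"
  proof -
    have "bounded (g ` S)"
      by (intro compact_imp_bounded compact_continuous_image continuous_on_subset[OF g] S) auto
    then obtain b where "\<And>x. x \<in> S \<Longrightarrow> \<bar>g x\<bar> \<le> b" by (auto simp: bounded_iff)
    then have "\<bar>g x\<bar> \<le> max b 0" for x using g0[of x] by (cases "x \<in> S") (auto intro: max.coboundedI1)
    then show ?thesis using that by blast
  qed
  define T where "T = (\<lambda>(x, t). x - t *\<^sub>R w) ` (S \<times> {0..1::real})"
  have T: "compact T" unfolding T_def
    by (intro compact_continuous_image compact_Times S compact_Icc) (auto simp: split_beta intro!: continuous_intros)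
  have Y0: "Y (x + t *\<^sub>R w) = 0" if "x \<notin> T" "0 \<le> t" "t \<le> 1" for x t
  proof (rule S(2), rule notI)
    assume "x + t *\<^sub>R w \<in> S"
    then have "(\<lambda>(x, t). x - t *\<^sub>R w) (x + t *\<^sub>R w, t) \<in> T" unfolding T_def
      by (intro imageI) (use that in auto)
    then show False using that by simp
  qed
  define h where "h n = 1 / real (Suc n)" for n
  have h: "0 < h n" "h n \<le> 1" for n by (auto simp: h_def)
  define q where "q n x = (Y (x + h n *\<^sub>R w) - Y x) / h n" for n x
  have Yint: "integrable lborel Y" by (rule integrable_compact_support[OF Y S])
  have Ym: "Y \<in> borel_measurable borel" by (rule borel_measurable_continuous_onI[OF Y])
  have Ytm: "(\<lambda>x. Y (x + a)) \<in> borel_measurable borel" for a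
    by (rule borel_measurable_continuous_onI)
      (auto intro!: continuous_on_compose2[OF Y] continuous_intros)
  have Ytint: "integrable lborel (\<lambda>x. Y (x + a))" for a
  proof (rule integrable_compact_support)
    show "continuous_on UNIV (\<lambda>x. Y (x + a))"
      by (auto intro!: continuous_on_compose2[OF Y] continuous_intros)
    show "compact ((\<lambda>x. x - a) ` S)" by (intro compact_continuous_image S continuous_intros)
    fix x assume "x \<notin> (\<lambda>x. x - a) ` S"
    then have "x + a \<notin> S" by (metis add_diff_cancel_right' imageI)
    then show "Y (x + a) = 0" by (rule S)
  qed
  have "(\<integral>x. q n x \<partial>lborel) = 0" for n
    unfolding q_def using integral_translate[OF Ym, of "h n *\<^sub>R w"] Ytint Yint by simp
  moreover have "(\<lambda>n. \<integral>x. q n x \<partial>lborel) \<longlonglongrightarrow> (\<integral>x. g x \<partial>lborel)"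
  proof (rule integral_dominated_convergence)
    show "g \<in> borel_measurable lborel" using borel_measurable_continuous_onI[OF g] by simp
    show "q n \<in> borel_measurable lborel" for n
      unfolding q_def using Ytm Ym by simp
    show "integrable lborel (\<lambda>x. indicator T x *\<^sub>R B)"
      using emeasure_bounded_finite[OF compact_imp_bounded[OF T]] borel_compact[OF T] by simp
    show "AE x in lborel. (\<lambda>n. q n x) \<longlonglongrightarrow> g x"
    proof (intro AE_I2)
      fix x
      have "((\<lambda>h. (Y (x + h *\<^sub>R w) - Y x) / h) \<longlongrightarrow> g x) (at 0)"
        using d[of x] by (simp add: DERIV_def)
      moreover have "filterlim h (at 0) sequentially"
        unfolding filterlim_at h_def
        using LIMSEQ_Suc[OF lim_const_over_n[of "1::real"]] by auto
      ultimately show "(\<lambda>n. q n x) \<longlonglongrightarrow> g x"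
        unfolding q_def by (rule filterlim_compose)
    qed
    show "AE x in lborel. norm (q n x) \<le> indicator T x *\<^sub>R B" for n
    proof (intro AE_I2)
      fix x
      show "norm (q n x) \<le> indicator T x *\<^sub>R B"
      proof (cases "x \<in> T")
        case True
        obtain z where "Y (x + h n *\<^sub>R w) - Y (x + 0 *\<^sub>R w) = (h n - 0) * g (x + z *\<^sub>R w)"
          using MVT2[OF h(1)[of n] d'[of x]] by auto
        then have "q n x = g (x + z *\<^sub>R w)" using h(1)[of n] by (simp add: q_def)
        then show ?thesis using B True by simp
      next
        case False
        then show ?thesis using Y0[of x "h n"] Y0[of x 0] h[of n] by (simp add: q_def)
      qed
    qed
  qed
  ultimately show ?thesis by (simp add: LIMSEQ_const_iff)
qed

lemma integral_dderiv_eq_0: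
  fixes Y :: "'a::euclidean_space \<Rightarrow> real"
  assumes "smooth_on UNIV Y" "compact S" "\<And>x. x \<notin> S \<Longrightarrow> Y x = 0"
  shows "(\<integral>x. dderiv w Y x \<partial>lborel) = 0"
proof (rule integral_directional_derivative[OF _ _ _ assms(2,3)])
  show "((\<lambda>t. Y (x + t *\<^sub>R w)) has_real_derivative dderiv w Y x) (at 0)" for x
    using dderiv_line_real[OF assms(1), of x 0 w UNIV] by simp
qed (fact smooth_on_continuous[OF assms(1)] smooth_on_continuous[OF smooth_on_dderiv[OF assms(1)]])+

lemma dderiv_outside_support:
  fixes u :: "'a::real_normed_vector \<Rightarrow> real"
  assumes "closed S" "\<And>x. x \<notin> S \<Longrightarrow> u x = 0" "x \<notin> S"
  shows "dderiv v u x = 0"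
proof -
  have "dderiv v u x = dderiv v (\<lambda>_. 0) x"
    by (rule dderiv_cong_open[of "- S"]) (use assms(1,3) in \<open>auto intro: assms(2)\<close>)
  then show ?thesis by simp
qed

lemma integral_continuous_eq_0:
  fixes f :: "'a::euclidean_space \<Rightarrow> real"
  assumes P: "open P" and f: "continuous_on P f" "\<And>x. x \<in> P \<Longrightarrow> f x \<ge> 0"
    and int: "set_integrable lborel P f" "(LINT x:P|lborel. f x) = 0" and x: "x \<in> P"
  shows "f x = 0"
proof (rule ccontr)
  assume "f x \<noteq> 0"
  define N where "N = P \<inter> f -` {0<..}"
  have op: "open N" unfolding N_def by (rule continuous_open_preimage[OF f(1) P open_greaterThan])
  have "AE y in lborel. indicator P y *\<^sub>R f y = 0"
    using integral_nonneg_eq_0_iff_AE[of lborel "\<lambda>y. indicator P y *\<^sub>R f y"] int f(2)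
    by (auto simp: set_integrable_def set_lebesgue_integral_def indicator_def)
  then have "AE y in lborel. y \<notin> N" by eventually_elim (auto simp: N_def indicator_def)
  then have "N \<in> null_sets lborel"
    using op AE_iff_null_sets[of N lborel] by auto
  then have "negligible N" by (simp add: negligible_iff_null_sets null_sets_completionI)
  then have "N = {}" using op open_not_negligible by blast
  moreover have "x \<in> N" using x f(2)[OF x] \<open>f x \<noteq> 0\<close> by (auto simp: N_def)
  ultimately show False by simp
qed

section \<open>Primitives along a direction\<close>

text \<open>
  When \<open>\<nu> \<bullet> e = 1\<close>, this is the primitive of \<open>F\<close> along \<open>e\<close> that vanishes on the hyperplane
  \<open>\<nu> \<bullet> x = b\<close>, i.e. the integral of \<open>F (x - s e)\<close> over \<open>s\<close> from 0 to \<open>\<nu> \<bullet> x - b\<close>; the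
  substitution \<open>s = t (\<nu> \<bullet> x - b)\<close> makes the range of integration constant.
\<close>

definition primitive :: "'a::euclidean_space \<Rightarrow> real \<Rightarrow> 'a \<Rightarrow> ('a \<Rightarrow> real) \<Rightarrow> 'a \<Rightarrow> real" where
  "primitive \<nu> b e F x = (\<nu> \<bullet> x - b) *
     integral {0..1} (\<lambda>t. 1 * F (x + t *\<^sub>R (- (\<nu> \<bullet> x) *\<^sub>R e + b *\<^sub>R e)))"

lemma bounded_linear_primitive: "bounded_linear (\<lambda>x. - (\<nu> \<bullet> x) *\<^sub>R (e::'a::euclidean_space))"
  by (rule bounded_linear_compose[OF bounded_linear_scaleR_left
        bounded_linear_minus[OF bounded_linear_inner_right]])

lemma smooth_primitive:
  assumes F: "smooth_on UNIV F"
  shows "smooth_on UNIV (primitive \<nu> b e F)"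
  unfolding primitive_def[abs_def]
  by (intro smooth_intros smooth_parametric_integral[OF F bounded_linear_primitive] open_UNIV
        continuous_on_const)

lemma primitive_eq_0:
  assumes "\<And>t. 0 \<le> t \<Longrightarrow> t \<le> 1 \<Longrightarrow> F (x - (t * (\<nu> \<bullet> x - b)) *\<^sub>R e) = 0"
  shows "primitive \<nu> b e F x = 0"
proof -
  have "integral {0..1} (\<lambda>t. 1 * F (x + t *\<^sub>R (- (\<nu> \<bullet> x) *\<^sub>R e + b *\<^sub>R e))) = integral {0..1} (\<lambda>t::real. 0::real)"
    by (rule Henstock_Kurzweil_Integration.integral_cong) (use assms in \<open>auto simp: algebra_simps\<close>)
  then show ?thesis by (simp add: primitive_def)
qed

lemma dderiv_primitive:
  assumes F: "smooth_on UNIV F" and e: "\<nu> \<bullet> e = 1"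
  shows "dderiv e (primitive \<nu> b e F) x = F x"
proof -
  define l where "l = \<nu> \<bullet> x - b"
  define A where "A t = x + t *\<^sub>R (- (\<nu> \<bullet> x) *\<^sub>R e + b *\<^sub>R e)" for t
  have A: "A t = x + t *\<^sub>R (- l *\<^sub>R e)" for t by (simp add: A_def l_def algebra_simps)
  let ?M = "\<lambda>x. integral {0..1} (\<lambda>t. 1 * F (x + t *\<^sub>R (- (\<nu> \<bullet> x) *\<^sub>R e + b *\<^sub>R e)))"
  note M' = parametric_integral[OF F bounded_linear_primitive[of \<nu> e], where c = "\<lambda>_. 1" and a = 0 and b = 1
      and d = "b *\<^sub>R e" and x = x, OF continuous_on_const]
  have cont: "continuous_on {0..1} (\<lambda>t. G (A t))" if "continuous_on UNIV G" for G :: "'a \<Rightarrow> real"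
    unfolding A_def by (auto intro!: continuous_on_compose2[OF that] continuous_intros)
  have cF: "continuous_on {0..1} (\<lambda>t. F (A t))" "continuous_on {0..1} (\<lambda>t. dderiv v F (A t))" for v
    using smooth_on_continuous[OF F] smooth_on_continuous[OF smooth_on_dderiv[OF F, of v]] by (auto intro: cont)
  have "((\<lambda>x. (\<nu> \<bullet> x - b)) has_derivative (\<lambda>v. \<nu> \<bullet> v)) (at x)"
    by (auto intro!: derivative_eq_intros)
  from dderivI[OF has_derivative_mult[OF this M'], of e]
  have "dderiv e (primitive \<nu> b e F) x =
     l * (integral {0..1} (\<lambda>t. dderiv e F (A t)) + integral {0..1} (\<lambda>t. t * dderiv (- e) F (A t)))
      + integral {0..1} (\<lambda>t. F (A t))"
    by (simp add: primitive_def[abs_def] l_def A_def e)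
  also have "\<dots> = integral {0..1} (\<lambda>t. l * (dderiv e F (A t) + t * dderiv (- e) F (A t)) + F (A t))"
  proof -
    have i: "(\<lambda>t. dderiv e F (A t)) integrable_on {0..1}" "(\<lambda>t. t * dderiv (- e) F (A t)) integrable_on {0..1}"
      "(\<lambda>t. F (A t)) integrable_on {0..1}"
      by (intro integrable_continuous_interval continuous_intros cF)+
    have "((\<lambda>t. l * (dderiv e F (A t) + t * dderiv (- e) F (A t)) + F (A t)) has_integral
       l * (integral {0..1} (\<lambda>t. dderiv e F (A t)) + integral {0..1} (\<lambda>t. t * dderiv (- e) F (A t)))
        + integral {0..1} (\<lambda>t. F (A t))) {0..1}"
      by (intro has_integral_add has_integral_mult_right integrable_integral i)
    then show ?thesis by (simp add: integral_unique)
  qed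
  also have "\<dots> = F x"
  proof -
    have neg: "dderiv (- e) F y = - dderiv e F y" "dderiv (- l *\<^sub>R e) F y = - l * dderiv e F y" for y
      using linear_neg[OF dderiv_linear[OF F, of y]] linear_scale[OF dderiv_linear[OF F, of y]] by auto
    have "((\<lambda>t. (t - 1) * F (A t)) has_vector_derivative
        l * (dderiv e F (A t) + t * dderiv (- e) F (A t)) + F (A t)) (at t within {0..1})" for t
    proof -
      have "((\<lambda>t. F (A t)) has_real_derivative dderiv (- l *\<^sub>R e) F (A t)) (at t within {0..1})"
        unfolding A by (rule dderiv_line_real[OF F]) auto
      then have "((\<lambda>t. (t - 1) * F (A t)) has_real_derivative
         (1 * F (A t) + dderiv (- l *\<^sub>R e) F (A t) * (t - 1))) (at t within {0..1})"
        by (intro DERIV_mult) (auto intro!: derivative_eq_intros)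
      then show ?thesis
        unfolding has_real_derivative_iff_has_vector_derivative neg
        by (simp add: algebra_simps)
    qed
    then have "((\<lambda>t. l * (dderiv e F (A t) + t * dderiv (- e) F (A t)) + F (A t)) has_integral
        (1 - 1) * F (A 1) - (0 - 1) * F (A 0)) {0..1}"
      by (intro fundamental_theorem_of_calculus) auto
    then have "((\<lambda>t. l * (dderiv e F (A t) + t * dderiv (- e) F (A t)) + F (A t)) has_integral F (A 0)) {0..1}"
      by simp
    then show ?thesis by (simp add: integral_unique A)
  qed
  finally show ?thesis .
qed

section \<open>The divergence and the double divergence\<close>

definition divergence :: "('n \<Rightarrow> real ^ 'n \<Rightarrow> real) \<Rightarrow> real ^ 'n \<Rightarrow> real" where
  "divergence X x = (\<Sum>i\<in>UNIV. dderiv (axis i 1) (X i) x)"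

definition double_divergence :: "(real ^ 'n \<Rightarrow> real ^ 'n ^ 'n) \<Rightarrow> real ^ 'n \<Rightarrow> real" where
  "double_divergence H x =
     (\<Sum>i\<in>UNIV. \<Sum>j\<in>UNIV. dderiv (axis i 1) (dderiv (axis j 1) (\<lambda>y. H y $ i $ j)) x)"

lemma S_op_eq: "S_op H x = - double_divergence H x"
  by (simp add: S_op_def double_divergence_def partial_deriv_dderiv)

lemma smooth_divergence:
  "(\<And>i. smooth_on UNIV (X i)) \<Longrightarrow> smooth_on UNIV (divergence X)"
  unfolding divergence_def[abs_def] by (intro smooth_intros smooth_on_dderiv open_UNIV)

lemma integral_divergence_eq_0:
  fixes X :: "'n \<Rightarrow> real ^ 'n \<Rightarrow> real"
  assumes "\<And>i. smooth_on UNIV (X i)" "compact S" "\<And>i x. x \<notin> S \<Longrightarrow> X i x = 0"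
  shows "(\<integral>x. divergence X x \<partial>lborel) = 0"
proof -
  have "integrable lborel (dderiv (axis i 1) (X i))" for i
    using assms
    by (intro integrable_compact_support[of _ S] smooth_on_continuous smooth_on_dderiv
        dderiv_outside_support[of S]) (auto intro: compact_imp_closed)
  then have "(\<integral>x. divergence X x \<partial>lborel) = (\<Sum>i\<in>UNIV. \<integral>x. dderiv (axis i 1) (X i) x \<partial>lborel)"
    unfolding divergence_def by (intro Bochner_Integration.integral_sum) auto
  also have "\<dots> = 0" using integral_dderiv_eq_0[OF assms(1,2)] assms(3) by (intro sum.neutral) auto
  finally show ?thesis .
qed

lemma smooth_on_component:
  "open U \<Longrightarrow> smooth_on U H \<Longrightarrow> smooth_on U (\<lambda>x. H x $ i)"
  by (rule smooth_on_bounded_linear[OF bounded_linear_vec_nth])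

lemma smooth_on_matrix_entry:
  "open U \<Longrightarrow> smooth_on U H \<Longrightarrow> smooth_on U (\<lambda>x. H x $ i $ j)"
  by (rule smooth_on_component[OF _ smooth_on_component])

lemma smooth_on_matrixI:
  fixes H :: "'a::real_normed_vector \<Rightarrow> real ^ 'n ^ 'm"
  assumes U: "open U" and H: "\<And>i j. smooth_on U (\<lambda>x. H x $ i $ j)"
  shows "smooth_on U H"
proof -
  have "smooth_on U (\<lambda>x. \<Sum>i\<in>UNIV. \<Sum>j\<in>UNIV. (H x $ i $ j) *\<^sub>R (\<chi> a b. if a = i \<and> b = j then 1 else 0 :: real ^ 'n ^ 'm))"
    by (intro smooth_on_sum smooth_on_scaleR_const U H)
  moreover have "(\<Sum>i\<in>UNIV. \<Sum>j\<in>UNIV. (H x $ i $ j) *\<^sub>R (\<chi> a b. if a = i \<and> b = j then 1 else 0 :: real ^ 'n ^ 'm)) = H x" for x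
  proof -
    have *: "(H x $ i $ j) * (if a = i \<and> b = j then 1 else 0) =
        (if j = b then (if i = a then H x $ i $ j else 0) else 0)" for i j a b by simp
    show ?thesis by (simp add: vec_eq_iff * sum.delta cong: if_cong)
  qed
  ultimately show ?thesis by simp
qed

lemma double_divergence_cong:
  assumes "open U" "x \<in> U" "\<And>y. y \<in> U \<Longrightarrow> G y = H y"
  shows "double_divergence G x = double_divergence H x"
proof -
  have "dderiv (axis i 1) (dderiv (axis j 1) (\<lambda>y. G y $ i $ j)) x =
      dderiv (axis i 1) (dderiv (axis j 1) (\<lambda>y. H y $ i $ j)) x" for i j
    by (intro dderiv_cong_open[OF assms(1)] assms(2)) (auto simp: assms(3))
  then show ?thesis by (simp add: double_divergence_def)
qed

lemma double_divergence_add: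
  assumes U: "open U" "smooth_on U G" "smooth_on U H" "x \<in> U"
  shows "double_divergence (\<lambda>x. G x + H x) x = double_divergence G x + double_divergence H x"
proof -
  note e = smooth_on_matrix_entry[OF U(1)]
  have "dderiv v (dderiv w (\<lambda>y. (G y + H y) $ i $ j)) x =
      dderiv v (dderiv w (\<lambda>y. G y $ i $ j)) x + dderiv v (dderiv w (\<lambda>y. H y $ i $ j)) x" for v w i j
  proof -
    have "dderiv v (dderiv w (\<lambda>y. (G y + H y) $ i $ j)) x =
      dderiv v (\<lambda>y. dderiv w (\<lambda>y. G y $ i $ j) y + dderiv w (\<lambda>y. H y $ i $ j) y) x"
      by (rule dderiv_cong_open[OF U(1,4)]) (simp add: dderiv_add[OF e[OF U(2)] e[OF U(3)]])
    then show ?thesis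
      by (simp add: dderiv_add[OF smooth_on_dderiv[OF e[OF U(2)]] smooth_on_dderiv[OF e[OF U(3)]] U(4)])
  qed
  then show ?thesis by (simp add: double_divergence_def sum.distrib)
qed

lemma dderiv_cmult:
  fixes f :: "'a::real_normed_vector \<Rightarrow> real"
  assumes "smooth_on U f" "x \<in> U"
  shows "dderiv v (\<lambda>x. c * f x) x = c * dderiv v f x"
  using dderiv_bounded_linear[OF bounded_linear_mult_right assms] .

lemma double_divergence_scaleR:
  assumes U: "open U" "smooth_on U H" "x \<in> U"
  shows "double_divergence (\<lambda>x. c *\<^sub>R H x) x = c * double_divergence H x"
proof -
  note e = smooth_on_matrix_entry[OF U(1,2)]
  have "dderiv v (dderiv w (\<lambda>y. (c *\<^sub>R H y) $ i $ j)) x = c * dderiv v (dderiv w (\<lambda>y. H y $ i $ j)) x" for v w i j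
  proof -
    have "dderiv v (dderiv w (\<lambda>y. (c *\<^sub>R H y) $ i $ j)) x =
      dderiv v (\<lambda>y. c * dderiv w (\<lambda>y. H y $ i $ j) y) x"
      by (rule dderiv_cong_open[OF U(1,3)]) (simp add: dderiv_cmult[OF e])
    then show ?thesis by (simp add: dderiv_cmult[OF smooth_on_dderiv[OF e] U(3)])
  qed
  then show ?thesis by (simp add: double_divergence_def sum_distrib_left)
qed

text \<open>For a rank one field \<open>\<psi> e \<otimes> e\<close> the double divergence is the second derivative along \<open>e\<close>.\<close>

definition rank_one :: "real ^ 'n \<Rightarrow> real ^ 'n ^ 'n" where
  "rank_one e = (\<chi> i j. e $ i * e $ j)"

lemma rank_one_mult: "rank_one e *v w = (e \<bullet> w) *\<^sub>R e"
  by (simp add: rank_one_def matrix_vector_mult_def vec_eq_iff inner_vec_def sum_distrib_left mult_ac)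

lemma dderiv_axis_sum:
  fixes f :: "real ^ 'n \<Rightarrow> real"
  assumes "smooth_on U f" "x \<in> U"
  shows "(\<Sum>i\<in>UNIV. v $ i * dderiv (axis i 1) f x) = dderiv v f x"
proof -
  have "dderiv v f x = dderiv (\<Sum>i\<in>UNIV. v $ i *\<^sub>R axis i 1) f x"
    using basis_expansion[of v] by (simp add: scalar_mult_eq_scaleR)
  also have "\<dots> = (\<Sum>i\<in>UNIV. v $ i * dderiv (axis i 1) f x)"
    by (simp add: linear_sum[OF dderiv_linear[OF assms]] linear_scale[OF dderiv_linear[OF assms]])
  finally show ?thesis by simp
qed

lemma double_divergence_rank_one:
  assumes U: "open U" "smooth_on U \<psi>" "x \<in> U"
  shows "double_divergence (\<lambda>x. \<psi> x *\<^sub>R rank_one e) x = dderiv e (dderiv e \<psi>) x"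
proof -
  have "dderiv (axis i 1) (dderiv (axis j 1) (\<lambda>y. (\<psi> y *\<^sub>R rank_one e) $ i $ j)) x =
      (e $ i * e $ j) * dderiv (axis i 1) (dderiv (axis j 1) \<psi>) x" for i j
  proof -
    have "dderiv (axis i 1) (dderiv (axis j 1) (\<lambda>y. (\<psi> y *\<^sub>R rank_one e) $ i $ j)) x =
       dderiv (axis i 1) (\<lambda>y. (e $ i * e $ j) * dderiv (axis j 1) \<psi> y) x"
    proof (rule dderiv_cong_open[OF U(1,3)])
      fix y assume y: "y \<in> U"
      have "(\<lambda>y. (\<psi> y *\<^sub>R rank_one e) $ i $ j) = (\<lambda>y. (e $ i * e $ j) * \<psi> y)"
        by (simp add: rank_one_def fun_eq_iff)
      then show "dderiv (axis j 1) (\<lambda>y. (\<psi> y *\<^sub>R rank_one e) $ i $ j) y = (e $ i * e $ j) * dderiv (axis j 1) \<psi> y"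
        by (simp only: dderiv_cmult[OF U(2) y])
    qed
    then show ?thesis by (simp add: dderiv_cmult[OF smooth_on_dderiv[OF U(2)] U(3)])
  qed
  then have "double_divergence (\<lambda>x. \<psi> x *\<^sub>R rank_one e) x =
     (\<Sum>j\<in>UNIV. \<Sum>i\<in>UNIV. e $ j * (e $ i * dderiv (axis i 1) (dderiv (axis j 1) \<psi>) x))"
    unfolding double_divergence_def by (subst sum.swap) (simp add: mult_ac)
  also have "\<dots> = (\<Sum>j\<in>UNIV. e $ j * dderiv e (dderiv (axis j 1) \<psi>) x)"
    by (simp add: sum_distrib_left[symmetric] dderiv_axis_sum[OF smooth_on_dderiv[OF U(2)] U(3)])
  also have "\<dots> = dderiv e (\<lambda>y. \<Sum>j\<in>UNIV. e $ j * dderiv (axis j 1) \<psi> y) x"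
    by (subst dderiv_sum[of _ U]) (auto intro!: smooth_intros smooth_on_dderiv U
        simp: dderiv_cmult[OF smooth_on_dderiv[OF U(2)] U(3)])
  also have "\<dots> = dderiv e (dderiv e \<psi>) x"
    by (rule dderiv_cong_open[OF U(1,3)]) (rule dderiv_axis_sum[OF U(2)])
  finally show ?thesis .
qed

section \<open>Compactly supported solutions of the double divergence equation\<close>

lemma smooth_step_mono: "s \<le> t \<Longrightarrow> smooth_step s \<le> smooth_step t"
proof -
  have hm: "half_bump s \<le> half_bump t" if "s \<le> t" for s t
  proof (cases "s \<le> 0")
    case True
    then show ?thesis using half_bump(2,4) by simp
  next
    case False
    then show ?thesis using that by (simp add: half_bump_def bump_exp_def le_imp_inverse_le)
  qed
  assume st: "s \<le> t"
  define a b c d where "a = half_bump (s - 1)" and "b = half_bump (2 - s)"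
    and "c = half_bump (t - 1)" and "d = half_bump (2 - t)"
  have pos: "a + b > 0" "c + d > 0"
    using half_bump(3)[of "s - 1"] half_bump(3)[of "2 - s"] half_bump(4)[of "s - 1"] half_bump(4)[of "2 - s"]
      half_bump(3)[of "t - 1"] half_bump(3)[of "2 - t"] half_bump(4)[of "t - 1"] half_bump(4)[of "2 - t"]
    by (cases "s > 1"; cases "t > 1"; simp add: a_def b_def c_def d_def)+
  have "0 \<le> a" "a \<le> c" "0 \<le> d" "d \<le> b"
    using st half_bump(4) by (auto simp: a_def b_def c_def d_def intro: hm)
  then have "a * d \<le> c * b" by (intro mult_mono) auto
  then have "a / (a + b) \<le> c / (c + d)"
    using pos by (simp add: divide_simps algebra_simps)
  then show ?thesis
    by (simp add: smooth_step_def a_def b_def c_def d_def divide_inverse)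
qed

text \<open>A step \<open>\<Theta>\<close> across the interval \<open>(- r, r)\<close>; its derivative is a bump in this interval.\<close>

lemma step_across:
  fixes r :: real assumes r: "r > 0"
  obtains \<Theta> :: "real \<Rightarrow> real" where "smooth_on UNIV \<Theta>" "\<And>t. t \<le> - r / 2 \<Longrightarrow> \<Theta> t = 0" "\<And>t. t \<ge> r / 2 \<Longrightarrow> \<Theta> t = 1"
    "\<And>t. dderiv 1 \<Theta> t \<ge> 0" "\<exists>t. dderiv 1 \<Theta> t > 0" "\<And>t. \<bar>t\<bar> \<ge> r \<Longrightarrow> dderiv 1 \<Theta> t = 0"
proof
  define \<Theta> where "\<Theta> t = smooth_step ((1 / r) * t + 3 / 2)" for t
  show sm: "smooth_on UNIV \<Theta>"
    unfolding \<Theta>_def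
    by (rule smooth_on_compose_real[OF open_UNIV smooth_step(1)])
      (intro smooth_on_add smooth_on_mult smooth_on_const smooth_on_id open_UNIV)
  show 0: "\<Theta> t = 0" if "t \<le> - r / 2" for t
    unfolding \<Theta>_def by (rule smooth_step(2)) (use that r in \<open>simp add: field_simps\<close>)
  show 1: "\<Theta> t = 1" if "t \<ge> r / 2" for t
    unfolding \<Theta>_def by (rule smooth_step(3)) (use that r in \<open>simp add: field_simps\<close>)
  have D: "(\<Theta> has_real_derivative dderiv 1 \<Theta> t) (at t)" for t
    using dderiv_line_real[OF sm, of 0 t 1 UNIV] by simp
  have mono: "\<Theta> s \<le> \<Theta> t" if "s \<le> t" for s t
    unfolding \<Theta>_def by (rule smooth_step_mono) (use that r in \<open>simp add: divide_right_mono\<close>)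
  show nn: "dderiv 1 \<Theta> t \<ge> 0" for t
  proof (rule ccontr)
    assume "\<not> dderiv 1 \<Theta> t \<ge> 0"
    then obtain d where "d > 0" "\<And>h. 0 < h \<Longrightarrow> h < d \<Longrightarrow> \<Theta> (t + h) < \<Theta> t"
      using DERIV_neg_dec_right[OF D, of t] by auto
    then have "\<Theta> (t + d / 2) < \<Theta> t" by simp
    then show False using mono[of t "t + d / 2"] \<open>d > 0\<close> by simp
  qed
  show "\<exists>t. dderiv 1 \<Theta> t > 0"
  proof -
    have "\<exists>z>- r. z < r \<and> \<Theta> r - \<Theta> (- r) = (r - (- r)) * dderiv 1 \<Theta> z"
      using MVT2[of "- r" r, OF _ D] r by simp
    then obtain z where "\<Theta> r - \<Theta> (- r) = (2 * r) * dderiv 1 \<Theta> z" by auto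
    then have "(2 * r) * dderiv 1 \<Theta> z = 1" using 0[of "- r"] 1[of r] r by simp
    then have "dderiv 1 \<Theta> z \<noteq> 0" by auto
    then show ?thesis using nn[of z] by (auto simp: less_le)
  qed
  show "dderiv 1 \<Theta> t = 0" if "\<bar>t\<bar> \<ge> r" for t
  proof (cases "t \<ge> r")
    case True
    have "dderiv 1 \<Theta> t = dderiv 1 (\<lambda>_. 1) t"
      by (rule dderiv_cong_open[of "{r / 2<..}"]) (use True r in \<open>auto intro!: 1\<close>)
    then show ?thesis by simp
  next
    case False
    have "dderiv 1 \<Theta> t = dderiv 1 (\<lambda>_. 0) t"
      by (rule dderiv_cong_open[of "{..<- r / 2}"]) (use False that r in \<open>auto intro!: 0\<close>)
    then show ?thesis by simp
  qed
qed

text \<open>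
  Inside a cube, the coordinates are treated one at a time: \<open>u\<close> is replaced by the product of a
  fixed bump in \<open>x\<^sub>i\<close> with the integral of \<open>u\<close> over \<open>x\<^sub>i\<close>. The difference has integral zero along
  each line parallel to the axis, so its primitive along the axis has support in the cube. Once all
  the coordinates have been treated, only a multiple of a product of bumps is left.
\<close>

lemma cube_divergence_step:
  fixes v :: "real ^ 'n \<Rightarrow> real" and p :: "real ^ 'n" and i :: "'n"
  assumes r: "r > 0" and \<Theta>: "smooth_on UNIV \<Theta>" "\<And>t. t \<le> - r / 2 \<Longrightarrow> \<Theta> t = 0" "\<And>t. t \<ge> r / 2 \<Longrightarrow> \<Theta> t = 1"
    and v: "smooth_on UNIV v" "\<And>x j. v x \<noteq> 0 \<Longrightarrow> \<bar>x $ j - p $ j\<bar> < r"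
  defines "I \<equiv> primitive (axis i 1) (p $ i - r) (axis i 1)"
    and "A \<equiv> \<lambda>x. x + (p $ i + r - x $ i) *\<^sub>R axis i 1"
  shows "\<exists>X. smooth_on UNIV X \<and> (\<forall>x j. X x \<noteq> 0 \<longrightarrow> \<bar>x $ j - p $ j\<bar> < r) \<and>
     (\<forall>x. v x - dderiv (axis i 1) X x = dderiv 1 \<Theta> (x $ i - p $ i) * I v (A x))"
proof -
  let ?e = "axis i 1 :: real ^ 'n"
  have ee: "?e \<bullet> ?e = 1" and ex: "?e \<bullet> x = x $ i" for x
    by (simp_all add: inner_axis_axis inner_axis')
  have smI: "smooth_on UNIV (I v)" unfolding I_def by (rule smooth_primitive[OF v(1)])
  have dI: "dderiv ?e (I v) x = v x" for x
    unfolding I_def by (rule dderiv_primitive[OF v(1) ee])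
  define L where "L x = x + - (x $ i) *\<^sub>R ?e" for x
  have L: "bounded_linear L" unfolding L_def
    by (intro bounded_linear_add bounded_linear_ident
        bounded_linear_compose[OF bounded_linear_scaleR_left bounded_linear_minus[OF bounded_linear_vec_nth]])
  have A: "A x = L x + (p $ i + r) *\<^sub>R ?e" for x by (simp add: A_def L_def algebra_simps)
  have Le: "L ?e = 0" by (simp add: L_def)
  define J where "J x = I v (A x)" for x
  have smJ: "smooth_on UNIV J"
    using smooth_on_compose_affine[OF L open_UNIV smI] by (simp add: J_def[abs_def] A)
  have dJ: "dderiv ?e J x = 0" for x
  proof -
    have "dderiv ?e J x = dderiv (L ?e) (I v) (L x + (p $ i + r) *\<^sub>R ?e)"
      unfolding J_def[abs_def] A by (rule dderiv_compose_affine[OF L smI]) simp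
    then show ?thesis using linear_0[OF dderiv_linear[OF smI]] by (simp add: Le)
  qed
  define T where "T x = \<Theta> (?e \<bullet> x + - p $ i)" for x
  have smT: "smooth_on UNIV T" unfolding T_def
    by (rule smooth_on_compose_real[OF open_UNIV \<Theta>(1)]) (auto intro!: smooth_intros)
  have dT: "dderiv ?e T x = dderiv 1 \<Theta> (x $ i - p $ i)" for x
  proof -
    have "dderiv ?e T x = dderiv (?e \<bullet> ?e) \<Theta> (?e \<bullet> x + - p $ i)"
      unfolding T_def[abs_def] by (rule dderiv_compose_affine[OF bounded_linear_inner_right \<Theta>(1)]) simp
    then show ?thesis by (simp add: ee ex)
  qed
  define X where "X x = I v x - T x * J x" for x
  have smX: "smooth_on UNIV X" unfolding X_def by (intro smooth_intros smI smT smJ open_UNIV)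
  have dX: "dderiv ?e X x = v x - dderiv 1 \<Theta> (x $ i - p $ i) * J x" for x
  proof -
    have "dderiv ?e X x = dderiv ?e (I v) x - dderiv ?e (\<lambda>x. T x * J x) x"
      unfolding X_def[abs_def]
      by (rule dderiv_diff[OF smI]) (auto intro!: smooth_intros smT smJ)
    then show ?thesis by (simp add: dI dderiv_mult[OF smT smJ] dJ dT)
  qed
  have I0: "I v x = 0" if "\<not> \<bar>x $ j - p $ j\<bar> < r" "j \<noteq> i" for x j
    unfolding I_def
  proof (rule primitive_eq_0)
    fix t :: real
    have "(x - (t * (?e \<bullet> x - (p $ i - r))) *\<^sub>R ?e) $ j = x $ j" using that(2) by (simp add: axis_def)
    then show "v (x - (t * (?e \<bullet> x - (p $ i - r))) *\<^sub>R ?e) = 0" using v(2) that(1) by metis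
  qed
  have I0': "I v x = 0" if "x $ i \<le> p $ i - r" for x
    unfolding I_def
  proof (rule primitive_eq_0)
    fix t :: real assume t: "0 \<le> t" "t \<le> 1"
    have "(x - (t * (?e \<bullet> x - (p $ i - r))) *\<^sub>R ?e) $ i - p $ i = (1 - t) * (x $ i - (p $ i - r)) - r"
      by (simp add: ex algebra_simps)
    also have "\<dots> \<le> - r" using t that by (simp add: mult_nonneg_nonpos)
    finally have "\<not> \<bar>(x - (t * (?e \<bullet> x - (p $ i - r))) *\<^sub>R ?e) $ i - p $ i\<bar> < r" by simp
    then show "v (x - (t * (?e \<bullet> x - (p $ i - r))) *\<^sub>R ?e) = 0" using v(2) by metis
  qed
  have supp: "\<bar>x $ j - p $ j\<bar> < r" if "X x \<noteq> 0" for x j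
  proof (rule ccontr)
    assume nr: "\<not> \<bar>x $ j - p $ j\<bar> < r"
    show False
    proof (cases "j = i")
      case False
      then have "(A x) $ j = x $ j" by (simp add: A_def axis_def)
      then have "J x = 0" using I0[of "A x" j] nr False by (simp add: J_def)
      then show False using that I0[OF nr False] by (simp add: X_def)
    next
      case True
      show False
      proof (cases "x $ i \<le> p $ i - r")
        case True
        then show False using that I0'[OF True] r \<Theta>(2)[of "x $ i - p $ i"] by (simp add: X_def T_def ex)
      next
        case False
        then have xi: "x $ i \<ge> p $ i + r" using nr True by auto
        define \<phi> where "\<phi> t = I v (A x + t *\<^sub>R ?e)" for t
        have "(\<phi> has_real_derivative 0) (at t within {0..x $ i - p $ i - r})" if "t \<in> {0..x $ i - p $ i - r}" for t
        proof -
          have "\<not> \<bar>(A x + t *\<^sub>R ?e) $ i - p $ i\<bar> < r" using that r by (auto simp: A_def abs_if)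
          then have "v (A x + t *\<^sub>R ?e) = 0" using v(2) by metis
          then show ?thesis unfolding \<phi>_def using dderiv_line_real[OF smI, of "A x" t ?e] by (simp add: dI)
        qed
        then obtain c where "\<And>t. t \<in> {0..x $ i - p $ i - r} \<Longrightarrow> \<phi> t = c"
          using has_field_derivative_zero_constant[of "{0..x $ i - p $ i - r}" \<phi>] by auto
        then have "\<phi> 0 = \<phi> (x $ i - p $ i - r)" using xi by simp
        moreover have "A x + (x $ i - p $ i - r) *\<^sub>R ?e = x" by (simp add: A_def algebra_simps)
        ultimately have "J x = I v x" by (simp add: \<phi>_def J_def)
        then show False using that xi r \<Theta>(3)[of "x $ i - p $ i"] by (simp add: X_def T_def ex)
      qed
    qed
  qed
  show ?thesis
    using smX supp dX by (intro exI[of _ X]) (auto simp: J_def)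
qed

lemma invariant_under_axes:
  fixes w :: "real ^ 'n \<Rightarrow> real"
  assumes "\<And>i x t. w (x + t *\<^sub>R axis i 1) = w x"
  shows "w x = w 0"
proof -
  have "w (\<Sum>i\<in>J. x $ i *\<^sub>R axis i 1) = w 0" if "finite J" for J
    using that
  proof (induction J)
    case (insert i J)
    then show ?case using assms[of "\<Sum>i\<in>J. x $ i *\<^sub>R axis i 1" "x $ i" i] by (simp add: add.commute)
  qed simp
  from this[of UNIV] show ?thesis using basis_expansion[of x] by (simp add: scalar_mult_eq_scaleR)
qed

text \<open>
  What is left when all the coordinates have been treated is a product of bumps, with positive
  integral, times a constant; this constant is zero because \<open>u\<close> and all divergences have integral zero.
\<close>

lemma cube_divergence:
  fixes u :: "real ^ 'n \<Rightarrow> real" and p :: "real ^ 'n"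
  assumes r: "r > 0"
    and u: "smooth_on UNIV u" "\<And>x j. u x \<noteq> 0 \<Longrightarrow> \<bar>x $ j - p $ j\<bar> < r" "(\<integral>x. u x \<partial>lborel) = 0"
  shows "\<exists>X. (\<forall>i. smooth_on UNIV (X i)) \<and> (\<forall>i x j. X i x \<noteq> 0 \<longrightarrow> \<bar>x $ j - p $ j\<bar> < r) \<and>
     (\<forall>x. u x = divergence X x)"
proof -
  obtain \<Theta> :: "real \<Rightarrow> real" where \<Theta>: "smooth_on UNIV \<Theta>" "\<And>t. t \<le> - r / 2 \<Longrightarrow> \<Theta> t = 0" "\<And>t. t \<ge> r / 2 \<Longrightarrow> \<Theta> t = 1"
    "\<And>t. dderiv 1 \<Theta> t \<ge> 0" "\<exists>t. dderiv 1 \<Theta> t > 0" "\<And>t. \<bar>t\<bar> \<ge> r \<Longrightarrow> dderiv 1 \<Theta> t = 0"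
    using step_across[OF r] by metis
  define \<rho> where "\<rho> i x = dderiv 1 \<Theta> (x $ i - p $ i)" for i and x :: "real ^ 'n"
  have sm\<rho>: "smooth_on UNIV (\<rho> i)" for i
  proof -
    show ?thesis unfolding \<rho>_def
      by (rule smooth_on_compose_real[OF open_UNIV smooth_on_dderiv[OF \<Theta>(1)]])
        (intro smooth_on_diff smooth_on_const open_UNIV smooth_on_component[OF open_UNIV smooth_on_id])
  qed
  have "\<exists>X w. (\<forall>i. smooth_on UNIV (X i)) \<and> (\<forall>i x j. X i x \<noteq> 0 \<longrightarrow> \<bar>x $ j - p $ j\<bar> < r) \<and> smooth_on UNIV w \<and>
      (\<forall>i\<in>J. \<forall>x t. w (x + t *\<^sub>R axis i 1) = w x) \<and>
      (\<forall>x. u x - divergence X x = (\<Prod>i\<in>J. \<rho> i x) * w x)" if "finite J" for J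
    using that
  proof (induction J)
    case empty
    show ?case
      by (rule exI[of _ "\<lambda>i x. 0"], rule exI[of _ u])
        (auto simp: u smooth_on_const divergence_def)
  next
    case (insert i J)
    let ?e = "axis i 1 :: real ^ 'n"
    obtain X w where X: "\<And>i. smooth_on UNIV (X i)" "\<And>i x j. X i x \<noteq> 0 \<Longrightarrow> \<bar>x $ j - p $ j\<bar> < r"
        and w: "smooth_on UNIV w" "\<And>i x t. i \<in> J \<Longrightarrow> w (x + t *\<^sub>R axis i 1) = w x"
        and eq: "\<And>x. u x - divergence X x = (\<Prod>i\<in>J. \<rho> i x) * w x"
      using insert.IH by blast
    define v where "v x = u x - divergence X x" for x
    have v1: "smooth_on UNIV v" unfolding v_def
      by (intro smooth_on_diff open_UNIV u smooth_divergence X)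
    have v2: "\<bar>x $ j - p $ j\<bar> < r" if "v x \<noteq> 0" for x j
    proof (rule ccontr)
      assume n: "\<not> \<bar>x $ j - p $ j\<bar> < r"
      have c: "closed {x. \<bar>x $ j - p $ j\<bar> \<le> r'}" for r'
        by (intro closed_Collect_le continuous_intros)
      have "dderiv y (X i) x = 0" for i y
      proof -
        \<comment> \<open>the derivatives vanish off the closed cube, hence by continuity off the open one\<close>
        have "continuous_on UNIV (dderiv y (X i))"
          by (rule smooth_on_continuous[OF smooth_on_dderiv[OF X(1)]])
        then have cl: "closed {x. dderiv y (X i) x = 0}"
          by (intro closed_Collect_eq continuous_intros) auto
        have "{x. \<bar>x $ j - p $ j\<bar> > r} \<subseteq> {x. dderiv y (X i) x = 0}"
        proof
          fix z assume z: "z \<in> {x. \<bar>x $ j - p $ j\<bar> > r}"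
          have "X i x = 0" if "x \<notin> {x. \<bar>x $ j - p $ j\<bar> \<le> r}" for x
            using X(2)[of i x j] that by (cases "X i x = 0") auto
          from dderiv_outside_support[OF c[of r] this, where x = z] z
          show "z \<in> {x. dderiv y (X i) x = 0}" by simp
        qed
        then have "closure {x. \<bar>x $ j - p $ j\<bar> > r} \<subseteq> {x. dderiv y (X i) x = 0}"
          using cl by (rule closure_minimal)
        moreover have "x \<in> closure {x. \<bar>x $ j - p $ j\<bar> > r}"
          unfolding closure_approachable
        proof (intro allI impI)
          fix d :: real assume d: "d > 0"
          define s where "s = (if x $ j - p $ j > 0 then d / 2 else - (d / 2))"
          have "\<bar>(x + s *\<^sub>R axis j 1) $ j - p $ j\<bar> > r" using n d r by (auto simp: s_def)
          moreover have "dist (x + s *\<^sub>R axis j 1) x < d" using d by (simp add: dist_norm s_def)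
          ultimately show "\<exists>y\<in>{x. \<bar>x $ j - p $ j\<bar> > r}. dist y x < d" by blast
        qed
        ultimately show ?thesis by auto
      qed
      then have "divergence X x = 0" by (simp add: divergence_def)
      moreover have "u x = 0" using u(2) n by blast
      ultimately show False using that by (simp add: v_def)
    qed
    define I where "I = primitive ?e (p $ i - r) ?e"
    define A where "A x = x + (p $ i + r - x $ i) *\<^sub>R ?e" for x
    obtain Z where Z: "smooth_on UNIV Z" "\<And>x j. Z x \<noteq> 0 \<Longrightarrow> \<bar>x $ j - p $ j\<bar> < r"
        "\<And>x. v x - dderiv ?e Z x = \<rho> i x * I v (A x)"
      using cube_divergence_step[OF r \<Theta>(1-3) v1 v2, of i] unfolding I_def A_def \<rho>_def by auto
    define X' where "X' j = (if j = i then (\<lambda>x. X i x + Z x) else X j)" for j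
    have divX': "divergence X' x = divergence X x + dderiv ?e Z x" for x
    proof -
      have "dderiv (axis j 1) (X' j) x = dderiv (axis j 1) (X j) x + (if j = i then dderiv ?e Z x else 0)" for j
        using dderiv_add[OF X(1) Z(1)] by (simp add: X'_def)
      then show ?thesis by (simp add: divergence_def sum.distrib)
    qed
    have \<rho>inv: "\<rho> j (y + s *\<^sub>R ?e) = \<rho> j y" if "j \<in> J" for j y s
      using that insert.hyps by (auto simp: \<rho>_def axis_def)
    have Iv: "I v y = (\<Prod>j\<in>J. \<rho> j y) * I w y" for y
    proof -
      have "v (y + t *\<^sub>R (- (?e \<bullet> y) *\<^sub>R ?e + (p $ i - r) *\<^sub>R ?e)) =
         (\<Prod>j\<in>J. \<rho> j y) * w (y + t *\<^sub>R (- (?e \<bullet> y) *\<^sub>R ?e + (p $ i - r) *\<^sub>R ?e))" for t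
      proof -
        have "y + t *\<^sub>R (- (?e \<bullet> y) *\<^sub>R ?e + (p $ i - r) *\<^sub>R ?e) = y + (t * (- (?e \<bullet> y) + (p $ i - r))) *\<^sub>R ?e"
          by (simp add: algebra_simps)
        then show ?thesis using \<rho>inv by (simp add: v_def eq)
      qed
      then show ?thesis unfolding I_def primitive_def by (simp add: integral_mult_right)
    qed
    define w' where "w' x = I w (A x)" for x
    define L where "L x = x + - (x $ i) *\<^sub>R ?e" for x
    have L: "bounded_linear L" unfolding L_def
      by (intro bounded_linear_add bounded_linear_ident
          bounded_linear_compose[OF bounded_linear_scaleR_left bounded_linear_minus[OF bounded_linear_vec_nth]])
    have A: "A x = L x + (p $ i + r) *\<^sub>R ?e" for x by (simp add: A_def L_def algebra_simps)
    have "smooth_on UNIV w'"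
      using smooth_on_compose_affine[OF L open_UNIV smooth_primitive[OF w(1)]]
      by (simp add: w'_def[abs_def] A I_def)
    moreover have "w' (x + t *\<^sub>R axis k 1) = w' x" if k: "k \<in> insert i J" for k x t
    proof (cases "k = i")
      case True
      then have "A (x + t *\<^sub>R axis k 1) = A x" by (simp add: A_def algebra_simps)
      then show ?thesis by (simp add: w'_def)
    next
      case False
      then have kJ: "k \<in> J" using k by simp
      have xk: "(axis k 1 :: real ^ 'n) $ i = 0" using False by (simp add: axis_def)
      have "A (x + t *\<^sub>R axis k 1) = A x + t *\<^sub>R axis k 1" by (simp add: A_def xk)
      moreover have "I w (y + t *\<^sub>R axis k 1) = I w y" for y
      proof -
        have "?e \<bullet> (y + t *\<^sub>R axis k 1) = ?e \<bullet> y" by (simp add: inner_axis' xk)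
        moreover have "w (y + t *\<^sub>R axis k 1 + z) = w (y + z)" for z
          using w(2)[OF kJ, of "y + z" t] by (simp add: algebra_simps)
        ultimately show ?thesis by (simp add: I_def primitive_def)
      qed
      ultimately show ?thesis by (simp add: w'_def)
    qed
    moreover have "u x - divergence X' x = (\<Prod>j\<in>insert i J. \<rho> j x) * w' x" for x
    proof -
      have "u x - divergence X' x = v x - dderiv ?e Z x" by (simp add: v_def divX')
      also have "\<dots> = \<rho> i x * ((\<Prod>j\<in>J. \<rho> j (A x)) * I w (A x))" by (simp add: Z(3) Iv)
      also have "(\<Prod>j\<in>J. \<rho> j (A x)) = (\<Prod>j\<in>J. \<rho> j x)" by (simp add: A_def \<rho>inv)
      finally show ?thesis using insert.hyps by (simp add: w'_def)
    qed
    moreover have "smooth_on UNIV (X' j)" for j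
      using X Z by (auto simp: X'_def intro!: smooth_intros)
    moreover have "\<bar>x $ j - p $ j\<bar> < r" if "X' k x \<noteq> 0" for k x j
      using that X(2) Z(2) by (cases "k = i"; cases "Z x = 0") (auto simp: X'_def)
    ultimately show ?case by (intro exI[of _ X'] exI[of _ w']) blast
  qed
  note this[of UNIV, OF finite]
  then obtain X w where XW: "(\<forall>i. smooth_on UNIV (X i)) \<and> (\<forall>i x j. X i x \<noteq> 0 \<longrightarrow> \<bar>x $ j - p $ j\<bar> < r) \<and> smooth_on UNIV w \<and>
      (\<forall>i\<in>UNIV. \<forall>x t. w (x + t *\<^sub>R axis i 1) = w x) \<and>
      (\<forall>x. u x - divergence X x = (\<Prod>i\<in>UNIV. \<rho> i x) * w x)"
    by (elim exE) (rule that)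
  have X: "\<And>i. smooth_on UNIV (X i)" "\<And>i x j. X i x \<noteq> 0 \<Longrightarrow> \<bar>x $ j - p $ j\<bar> < r"
    and w: "\<And>i x t. w (x + t *\<^sub>R axis i 1) = w x"
    and eq: "\<And>x. u x - divergence X x = (\<Prod>i\<in>UNIV. \<rho> i x) * w x"
    using XW by simp_all
  define S where "S = cbox (p - (\<chi> i. r)) (p + (\<chi> i. r))"
  have S: "compact S" unfolding S_def by (rule compact_cbox)
  have inS: "x \<in> S" if "\<And>j. \<bar>x $ j - p $ j\<bar> < r" for x
    unfolding S_def mem_box_cart using that by (auto simp: abs_less_iff less_imp_le algebra_simps)
  have bump0: "(\<Prod>i\<in>UNIV. \<rho> i x) = 0" if "x \<notin> S" for x
  proof -
    obtain j where "\<not> \<bar>x $ j - p $ j\<bar> < r" using inS \<open>x \<notin> S\<close> by blast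
    then have "\<rho> j x = 0" using \<Theta>(6) by (simp add: \<rho>_def)
    then show ?thesis by (intro prod_zero) auto
  qed
  have smb: "continuous_on UNIV (\<lambda>x. \<Prod>i\<in>UNIV. \<rho> i x)"
    by (intro smooth_on_continuous smooth_on_prod sm\<rho> open_UNIV)
  have "(\<integral>x. u x - divergence X x \<partial>lborel) = 0"
  proof -
    have X0: "X i x = 0" if "x \<notin> S" for i x using X(2)[of i x] inS that by blast
    have d0: "divergence X x = 0" if "x \<notin> S" for x
      using dderiv_outside_support[OF compact_imp_closed[OF S] X0 that] by (simp add: divergence_def)
    have "integrable lborel (divergence X)"
      by (rule integrable_compact_support[OF smooth_on_continuous[OF smooth_divergence[of X, OF X(1)]] S d0])
    moreover have "integrable lborel u"
      by (rule integrable_compact_support[OF smooth_on_continuous[OF u(1)] S]) (use u(2) inS in blast)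
    ultimately show ?thesis
      using u(3) integral_divergence_eq_0[of X, OF X(1) S X0] by simp
  qed
  moreover define c where "c = w 0"
  have wc: "w x = c" for x unfolding c_def by (rule invariant_under_axes[OF w])
  ultimately have "(\<integral>x. (\<Prod>i\<in>UNIV. \<rho> i x) \<partial>lborel) * c = 0"
    unfolding eq wc by simp
  moreover have "(\<integral>x. (\<Prod>i\<in>UNIV. \<rho> i x) \<partial>lborel) \<noteq> 0"
  proof
    assume "(\<integral>x. (\<Prod>i\<in>UNIV. \<rho> i x) \<partial>lborel) = 0"
    then have "(\<Prod>i\<in>UNIV. \<rho> i x) = 0" for x
      using integral_continuous_eq_0[of UNIV "\<lambda>x. \<Prod>i\<in>UNIV. \<rho> i x" x] smb
        integrable_compact_support[OF smb S bump0]
      by (auto simp: set_integrable_def set_lebesgue_integral_def \<rho>_def intro!: prod_nonneg \<Theta>(4))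
    moreover obtain t where "dderiv 1 \<Theta> t > 0" using \<Theta>(5) by blast
    then have "\<rho> i (p + (\<chi> i. t)) > 0" for i by (simp add: \<rho>_def)
    then have "(\<Prod>i\<in>UNIV. \<rho> i (p + (\<chi> i. t))) > 0" by (intro prod_pos) auto
    ultimately show False by (metis less_irrefl)
  qed
  ultimately have "c = 0" by simp
  then have "u x = divergence X x" for x
    using eq[of x] wc[of x] by simp
  then show ?thesis using X by blast
qed


text \<open>
  Contracting \<open>u\<close> towards a point of the convex set \<open>P\<close> changes it by the divergence of a radial
  field that is supported in the region swept out. This moves the support into a small cube.
\<close>

lemma divergence_solvable:
  fixes u :: "real ^ 'n \<Rightarrow> real"
  assumes P: "open P" "convex P" "p \<in> P" and S: "compact S" "S \<subseteq> P"
    and u: "smooth_on UNIV u" "\<And>x. x \<notin> S \<Longrightarrow> u x = 0" "(\<integral>x. u x \<partial>lborel) = 0"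
  shows "\<exists>X T. compact T \<and> T \<subseteq> P \<and> (\<forall>i. smooth_on UNIV (X i)) \<and> (\<forall>i x. x \<notin> T \<longrightarrow> X i x = 0) \<and>
     (\<forall>x. u x = divergence X x)"
proof -
  define N where "N = CARD('n) - 1"
  have N: "CARD('n) = Suc N" by (simp add: N_def)
  obtain d where d: "d > 0" "ball p d \<subseteq> P" using P open_contains_ball by blast
  define r where "r = d / (2 * CARD('n))"
  have r: "r > 0" using d by (simp add: r_def)
  define Q where "Q = cbox (p - (\<chi> i. r)) (p + (\<chi> i. r))"
  have inQ: "x \<in> Q \<longleftrightarrow> (\<forall>j. \<bar>x $ j - p $ j\<bar> \<le> r)" for x
    unfolding Q_def mem_box_cart by (auto simp: abs_le_iff algebra_simps)
  have QP: "Q \<subseteq> P"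
  proof
    fix x assume x: "x \<in> Q"
    have "norm (x - p) \<le> (\<Sum>j\<in>UNIV. \<bar>(x - p) $ j\<bar>)" by (rule norm_le_l1_cart)
    also have "\<dots> \<le> (\<Sum>j\<in>(UNIV::'n set). r)" using x by (intro sum_mono) (simp add: inQ)
    also have "\<dots> < d" using d by (simp add: r_def)
    finally show "x \<in> P" using d(2) by (auto simp: dist_norm norm_minus_commute)
  qed
  obtain M where M: "M > 0" "\<And>y. y \<in> S \<Longrightarrow> norm (y - p) \<le> M"
  proof -
    have "bounded ((\<lambda>y. y - p) ` S)" using compact_imp_bounded[OF S(1)] by (simp add: bounded_translation_minus)
    then show ?thesis using that by (auto simp: bounded_pos)
  qed
  define R where "R = 1 + M / r"
  have R: "R > 1" using M r by (simp add: R_def)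
  define X0 where "X0 x = integral {0..R - 1} (\<lambda>t. (1 + t) ^ N * u (x + t *\<^sub>R (x + - p)))" for x
  have cN: "continuous_on A (\<lambda>t. (1 + t) ^ k)" for A :: "real set" and k
    by (intro continuous_intros)
  have smX0: "smooth_on UNIV X0"
    unfolding X0_def by (rule smooth_parametric_integral[OF u(1) bounded_linear_ident cN])
  have X0_0: "X0 x = 0" if x: "x \<notin> convex hull (insert p S)" for x
  proof -
    have "u (x + t *\<^sub>R (x + - p)) = 0" if t: "t \<ge> 0" for t
    proof (rule u(2), rule notI)
      assume y: "x + t *\<^sub>R (x + - p) \<in> S"
      have "x = (1 - 1 / (1 + t)) *\<^sub>R p + (1 / (1 + t)) *\<^sub>R (x + t *\<^sub>R (x + - p))"
      proof -
        have "(1 + t) *\<^sub>R ((1 - 1 / (1 + t)) *\<^sub>R p + (1 / (1 + t)) *\<^sub>R (x + t *\<^sub>R (x + - p))) = (1 + t) *\<^sub>R x"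
          using t by (simp add: scaleR_right_distrib right_diff_distrib) (simp add: algebra_simps)
        then show ?thesis using t by (metis add_nonneg_eq_0_iff scaleR_cancel_left zero_le_one zero_neq_one)
      qed
      also have "\<dots> \<in> convex hull (insert p S)"
        using y t by (intro convexD_alt[OF convex_convex_hull]) (auto intro: hull_inc simp: field_simps)
      finally show False using x by simp
    qed
    then have "X0 x = integral {0..R - 1} (\<lambda>t::real. 0::real)"
      unfolding X0_def by (intro Henstock_Kurzweil_Integration.integral_cong) simp
    then show ?thesis by simp
  qed
  define T where "T = convex hull (insert p S)"
  have T: "compact T" "T \<subseteq> P" unfolding T_def
    using S P hull_minimal[of "insert p S" P convex] by (auto intro!: compact_convex_hull)
  define u1 where "u1 x = R ^ Suc N * u (R *\<^sub>R x + (p - R *\<^sub>R p))" for x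
  have smu1: "smooth_on UNIV u1"
    unfolding u1_def
    by (intro smooth_on_mult smooth_on_const open_UNIV)
      (use smooth_on_compose_affine[OF bounded_linear_scaleR_right open_UNIV u(1)] in simp)
  have main: "real CARD('n) * X0 x + dderiv (x - p) X0 x = u1 x - u x" for x
  proof -
    define \<gamma> where "\<gamma> t = x + t *\<^sub>R (x + - p)" for t
    have c\<gamma>: "continuous_on {0..R - 1} (\<lambda>t. G (\<gamma> t))" if "smooth_on UNIV G" for G :: "real ^ 'n \<Rightarrow> real"
      unfolding \<gamma>_def by (auto intro!: continuous_on_compose2[OF smooth_on_continuous[OF that]] continuous_intros)
    let ?G = "dderiv (x - p) u"
    have smG: "smooth_on UNIV ?G" by (rule smooth_on_dderiv[OF u(1)])
    have i: "(\<lambda>t. (1 + t) ^ N * u (\<gamma> t)) integrable_on {0..R - 1}"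
        "(\<lambda>t. (1 + t) ^ N * ?G (\<gamma> t)) integrable_on {0..R - 1}"
        "(\<lambda>t. (t * (1 + t) ^ N) * ?G (\<gamma> t)) integrable_on {0..R - 1}"
      by (intro integrable_continuous_interval continuous_intros c\<gamma> u smG)+
    have dX0: "dderiv (x - p) X0 x = integral {0..R - 1} (\<lambda>t. (1 + t) ^ N * ?G (\<gamma> t)) +
        integral {0..R - 1} (\<lambda>t. (t * (1 + t) ^ N) * ?G (\<gamma> t))"
      unfolding X0_def[abs_def] \<gamma>_def
      by (rule dderivI[OF parametric_integral[OF u(1) bounded_linear_ident cN]])
    have i1: "((\<lambda>t. real CARD('n) * ((1 + t) ^ N * u (\<gamma> t)) + ((1 + t) ^ N * ?G (\<gamma> t) + (t * (1 + t) ^ N) * ?G (\<gamma> t)))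
      has_integral (real CARD('n) * X0 x + (integral {0..R - 1} (\<lambda>t. (1 + t) ^ N * ?G (\<gamma> t)) +
        integral {0..R - 1} (\<lambda>t. (t * (1 + t) ^ N) * ?G (\<gamma> t))))) {0..R - 1}"
      unfolding X0_def using i unfolding \<gamma>_def
      by (intro has_integral_add has_integral_mult_right integrable_integral)
    have i2: "((\<lambda>t. real CARD('n) * ((1 + t) ^ N * u (\<gamma> t)) + ((1 + t) ^ N * ?G (\<gamma> t) + (t * (1 + t) ^ N) * ?G (\<gamma> t)))
      has_integral ((1 + (R - 1)) ^ Suc N * u (\<gamma> (R - 1)) - (1 + 0) ^ Suc N * u (\<gamma> 0))) {0..R - 1}"
    proof (rule fundamental_theorem_of_calculus)
      fix t assume "t \<in> {0..R - 1}"
      have "((\<lambda>t. u (\<gamma> t)) has_real_derivative ?G (\<gamma> t)) (at t within {0..R - 1})"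
        unfolding \<gamma>_def using dderiv_line_real[OF u(1), of x t "x + - p"] by simp
      moreover have "((\<lambda>t. (1 + t) ^ Suc N) has_real_derivative (real CARD('n) * (1 + t) ^ N)) (at t within {0..R - 1})"
        unfolding N by (auto intro!: derivative_eq_intros simp del: power_Suc)
      ultimately have "((\<lambda>t. (1 + t) ^ Suc N * u (\<gamma> t)) has_real_derivative
          ((real CARD('n) * (1 + t) ^ N) * u (\<gamma> t) + ?G (\<gamma> t) * (1 + t) ^ Suc N)) (at t within {0..R - 1})"
        by (intro DERIV_mult)
      then show "((\<lambda>t. (1 + t) ^ Suc N * u (\<gamma> t)) has_vector_derivative
         real CARD('n) * ((1 + t) ^ N * u (\<gamma> t)) + ((1 + t) ^ N * ?G (\<gamma> t) + (t * (1 + t) ^ N) * ?G (\<gamma> t)))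
         (at t within {0..R - 1})"
        unfolding has_real_derivative_iff_has_vector_derivative by (simp add: algebra_simps)
    qed (use R in simp)
    have "real CARD('n) * X0 x + dderiv (x - p) X0 x =
        (1 + (R - 1)) ^ Suc N * u (\<gamma> (R - 1)) - (1 + 0) ^ Suc N * u (\<gamma> 0)"
      unfolding dX0 by (rule has_integral_unique[OF i1 i2])
    moreover have "\<gamma> (R - 1) = R *\<^sub>R x + (p - R *\<^sub>R p)" "\<gamma> 0 = x" by (simp_all add: \<gamma>_def algebra_simps)
    ultimately show ?thesis by (simp add: u1_def)
  qed
  define X where "X i x = (axis i 1 \<bullet> x - p $ i) * X0 x" for i x
  have sml: "smooth_on UNIV (\<lambda>x. axis i 1 \<bullet> x - p $ i)" for i by (intro smooth_intros open_UNIV)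
  have smX: "smooth_on UNIV (X i)" for i unfolding X_def by (intro smooth_on_mult sml smX0 open_UNIV)
  have X0': "X i x = 0" if "x \<notin> T" for i x using X0_0 that by (simp add: X_def T_def)
  have divX: "divergence X x = u1 x - u x" for x
  proof -
    have "dderiv (axis i 1) (X i) x = X0 x + (x - p) $ i * dderiv (axis i 1) X0 x" for i
    proof -
      have "((\<lambda>x. axis i 1 \<bullet> x - p $ i) has_derivative (\<lambda>v. axis i 1 \<bullet> v)) (at x)"
        by (auto intro!: derivative_eq_intros)
      then have "dderiv (axis i 1) (\<lambda>x. axis i 1 \<bullet> x - p $ i) x = 1"
        by (simp add: dderivI inner_axis_axis)
      then show ?thesis
        unfolding X_def[abs_def] dderiv_mult[OF sml smX0 UNIV_I] by (simp add: inner_axis' inner_real_def)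
    qed
    then have "divergence X x = real CARD('n) * X0 x + (\<Sum>i\<in>UNIV. (x - p) $ i * dderiv (axis i 1) X0 x)"
      by (simp add: divergence_def sum.distrib)
    also have "\<dots> = u1 x - u x"
      by (simp only: dderiv_axis_sum[OF smX0 UNIV_I] main)
    finally show ?thesis .
  qed
  have u1supp: "\<bar>x $ j - p $ j\<bar> < r" if "u1 x \<noteq> 0" for x j
  proof -
    have "R *\<^sub>R x + (p - R *\<^sub>R p) \<in> S" using that u(2) by (auto simp: u1_def)
    from M(2)[OF this] have "norm (R *\<^sub>R (x - p)) \<le> M" by (simp add: algebra_simps)
    then have "R * norm (x - p) \<le> M" using R by simp
    moreover have "R * r > M" using r by (simp add: R_def field_simps)
    ultimately have "norm (x - p) < r" using R by (smt (verit) mult_left_mono)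
    moreover have "\<bar>(x - p) $ j\<bar> \<le> norm (x - p)" by (rule component_le_norm_cart)
    ultimately show ?thesis by simp
  qed
  have "(\<integral>x. u1 x \<partial>lborel) = 0"
  proof -
    have "integrable lborel (divergence X)"
    proof (rule integrable_compact_support[OF smooth_on_continuous[OF smooth_divergence[of X, OF smX]] T(1)])
      show "divergence X x = 0" if "x \<notin> T" for x
        using dderiv_outside_support[OF compact_imp_closed[OF T(1)] X0' that] by (simp add: divergence_def)
    qed
    moreover have "integrable lborel u" by (rule integrable_compact_support[OF smooth_on_continuous[OF u(1)] S(1) u(2)])
    ultimately have "(\<integral>x. divergence X x + u x \<partial>lborel) = 0"
      using integral_divergence_eq_0[of X, OF smX T(1) X0'] u(3) by simp
    then show ?thesis by (simp add: divX)
  qed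
  from cube_divergence[OF r smu1 u1supp this]
  obtain Z where Z: "\<And>i. smooth_on UNIV (Z i)" "\<And>i x j. Z i x \<noteq> 0 \<Longrightarrow> \<bar>x $ j - p $ j\<bar> < r"
      "\<And>x. u1 x = divergence Z x" by blast
  have Z0: "Z i x = 0" if "x \<notin> Q" for i x using Z(2)[of i x] that inQ by (meson less_imp_le)
  have "u x = divergence (\<lambda>i x. Z i x - X i x) x" for x
    using divX[of x] Z(3)[of x]
    by (simp add: divergence_def dderiv_diff[OF Z(1) smX UNIV_I] sum_subtractf)
  moreover have "compact (T \<union> Q)" "T \<union> Q \<subseteq> P" using T QP by (auto simp: Q_def)
  ultimately show ?thesis
    using Z0 X0' smX Z(1) by (intro exI[of _ "\<lambda>i x. Z i x - X i x"] exI[of _ "T \<union> Q"])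
      (auto intro!: smooth_on_diff)
qed

text \<open>
  The first moments of \<open>u\<close> are, up to sign, the integrals of the components of a field with
  divergence \<open>u\<close>, so these components are divergences themselves.
\<close>

lemma double_divergence_solvable:
  fixes u :: "real ^ 'n \<Rightarrow> real"
  assumes P: "open P" "convex P" "p \<in> P" and S: "compact S" "S \<subseteq> P"
    and u: "smooth_on UNIV u" "\<And>x. x \<notin> S \<Longrightarrow> u x = 0" "(\<integral>x. u x \<partial>lborel) = 0"
      "\<And>i. (\<integral>x. x $ i * u x \<partial>lborel) = 0"
  shows "\<exists>K T. compact T \<and> T \<subseteq> P \<and> smooth_on UNIV K \<and> (\<forall>x. transpose (K x) = K x) \<and>
     (\<forall>x. x \<notin> T \<longrightarrow> K x = 0) \<and> (\<forall>x. u x = double_divergence K x)"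
proof -
  obtain X T where T: "compact T" "T \<subseteq> P" and X: "\<And>i. smooth_on UNIV (X i)" "\<And>i x. x \<notin> T \<Longrightarrow> X i x = 0"
      and uX: "\<And>x. u x = divergence X x"
    using divergence_solvable[OF P S u(1-3)] by blast
  have int0: "(\<integral>x. X i x \<partial>lborel) = 0" for i
  proof -
    have sml: "smooth_on UNIV (\<lambda>x::real ^ 'n. x $ i)"
      by (rule smooth_on_component[OF open_UNIV smooth_on_id[OF open_UNIV]])
    define W where "W j x = x $ i * X j x" for j x
    have smW: "smooth_on UNIV (W j)" for j
      unfolding W_def by (intro smooth_on_mult sml X open_UNIV)
    have "dderiv (axis j 1) (W j) x = x $ i * dderiv (axis j 1) (X j) x + (if j = i then X i x else 0)" for j x
    proof -
      have "((\<lambda>x. x $ i) has_derivative (\<lambda>v. v $ i)) (at x)"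
        by (rule bounded_linear_imp_has_derivative[OF bounded_linear_vec_nth])
      then show ?thesis
        unfolding W_def[abs_def] dderiv_mult[OF sml X(1) UNIV_I] by (simp add: dderivI axis_def)
    qed
    then have divW: "divergence W x = x $ i * u x + X i x" for x
      by (simp add: divergence_def sum.distrib uX sum_distrib_left)
    have "(\<integral>x. divergence W x \<partial>lborel) = 0"
      by (rule integral_divergence_eq_0[OF smW T(1)]) (simp add: W_def X)
    moreover have "integrable lborel (\<lambda>x. x $ i * u x)"
      by (rule integrable_compact_support[OF smooth_on_continuous S(1)])
        (auto intro!: smooth_on_mult sml u)
    moreover have "integrable lborel (X i)"
      by (rule integrable_compact_support[OF smooth_on_continuous[OF X(1)] T(1) X(2)])
    ultimately show ?thesis using u(4)[of i] by (simp add: divW)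
  qed
  have "\<forall>i. \<exists>Y T'. compact T' \<and> T' \<subseteq> P \<and> (\<forall>j. smooth_on UNIV (Y j)) \<and> (\<forall>j x. x \<notin> T' \<longrightarrow> Y j x = 0) \<and>
     (\<forall>x. X i x = divergence Y x)"
    by (intro allI divergence_solvable[OF P T X int0])
  from choice[OF this] obtain Y where "\<forall>i. \<exists>T'. compact T' \<and> T' \<subseteq> P \<and> (\<forall>j. smooth_on UNIV (Y i j)) \<and> (\<forall>j x. x \<notin> T' \<longrightarrow> Y i j x = 0) \<and>
     (\<forall>x. X i x = divergence (Y i) x)" by blast
  from choice[OF this] obtain T' where T': "\<And>i. compact (T' i)" "\<And>i. T' i \<subseteq> P"
     and Y: "\<And>i j. smooth_on UNIV (Y i j)" "\<And>i j x. x \<notin> T' i \<Longrightarrow> Y i j x = 0" and XY: "\<And>i x. X i x = divergence (Y i) x"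
    by blast
  define K where "K x = (\<chi> i j. 1 / 2 * (Y i j x + Y j i x))" for x
  define V where "V = (\<Union>i. T' i)"
  have "compact V" "V \<subseteq> P" using T' by (auto simp: V_def)
  moreover have smY: "smooth_on UNIV (\<lambda>x. Y i j x + Y j i x)" for i j
    by (intro smooth_on_add Y open_UNIV)
  then have "smooth_on UNIV (\<lambda>x. K x $ i $ j)" for i j
    unfolding K_def vec_lambda_beta by (intro smooth_on_mult smooth_on_const open_UNIV)
  then have "smooth_on UNIV K" by (rule smooth_on_matrixI[OF open_UNIV])
  moreover have "transpose (K x) = K x" for x by (simp add: K_def transpose_def add.commute)
  moreover have "K x = 0" if "x \<notin> V" for x
    using that Y(2) by (auto simp: K_def V_def vec_eq_iff)
  moreover have "u x = double_divergence K x" for x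
  proof -
    define D where "D i j k l = dderiv (axis i 1) (dderiv (axis j 1) (Y k l)) x" for i j k l
    have "dderiv (axis i 1) (dderiv (axis j 1) (\<lambda>y. K y $ i $ j)) x = 1 / 2 * (D i j i j + D i j j i)" for i j
    proof -
      have "dderiv (axis j 1) (\<lambda>y. K y $ i $ j) = (\<lambda>y. 1 / 2 * (dderiv (axis j 1) (Y i j) y + dderiv (axis j 1) (Y j i) y))"
        using dderiv_cmult[OF smY[of i j] UNIV_I, of "axis j 1" "1 / 2"] dderiv_add[OF Y(1)[of i j] Y(1)[of j i] UNIV_I]
        by (intro ext) (simp add: K_def)
      moreover have "smooth_on UNIV (\<lambda>y. dderiv (axis j 1) (Y i j) y + dderiv (axis j 1) (Y j i) y)"
        by (intro smooth_on_add smooth_on_dderiv Y open_UNIV)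
      ultimately show ?thesis
        using dderiv_add[OF smooth_on_dderiv[OF Y(1)[of i j]] smooth_on_dderiv[OF Y(1)[of j i]] UNIV_I]
          dderiv_cmult[of UNIV _ x "axis i 1" "1 / 2"]
        by (simp add: D_def)
    qed
    then have "double_divergence K x = 1 / 2 * ((\<Sum>i\<in>UNIV. \<Sum>j\<in>UNIV. D i j i j) + (\<Sum>i\<in>UNIV. \<Sum>j\<in>UNIV. D i j j i))"
      by (simp only: double_divergence_def sum_distrib_left[symmetric] sum.distrib)
    also have "(\<Sum>i\<in>UNIV. \<Sum>j\<in>UNIV. D i j j i) = (\<Sum>i\<in>UNIV. \<Sum>j\<in>UNIV. D i j i j)"
    proof -
      have "D i j j i = D j i j i" for i j unfolding D_def by (rule dderiv_commute[OF Y(1)]) auto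
      then show ?thesis by (subst sum.swap) simp
    qed
    also have "(\<Sum>i\<in>UNIV. \<Sum>j\<in>UNIV. D i j i j) = u x"
    proof -
      have "(\<Sum>j\<in>UNIV. D i j i j) = dderiv (axis i 1) (X i) x" for i
      proof -
        have "X i = (\<lambda>x. \<Sum>j\<in>UNIV. dderiv (axis j 1) (Y i j) x)"
          by (intro ext) (simp add: XY divergence_def)
        then show ?thesis
          using dderiv_sum[of UNIV UNIV "\<lambda>j. dderiv (axis j 1) (Y i j)" x "axis i 1"] smooth_on_dderiv[OF Y(1)]
          by (simp add: D_def)
      qed
      then show ?thesis by (simp add: uX divergence_def)
    qed
    finally show ?thesis by simp
  qed
  ultimately show ?thesis by blast
qed

section \<open>Geometry of labelled simple polytopes\<close>

locale labelled_simple_polytope =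
  fixes P :: "(real ^ 'n) set" and \<sigma> :: "(real ^ 'n) measure" and \<nu> :: "(real ^ 'n) set \<Rightarrow> real ^ 'n"
  assumes simple: "simple_polytope P"
    and sets_\<sigma>: "sets \<sigma> = sets (restrict_space borel (frontier P))"
    and labels: "labels P \<sigma> \<nu>"
begin

lemma P_ne: "P \<noteq> {}" and P_open: "open P" and P_convex: "convex P" and P_bounded: "bounded P"
  and P_polyhedron: "polyhedron (closure P)"
  using simple by (auto simp: simple_polytope_def)

lemma compact_closure_P: "compact (closure P)"
  using P_bounded by (simp add: compact_closure)

lemma convex_closure_P: "convex (closure P)"
  by (rule convex_closure[OF P_convex])

lemma interior_closure_P: "interior (closure P) = P"
  using convex_interior_closure[OF P_convex] P_open by (simp add: interior_open)

lemma rel_interior_closure_P: "rel_interior (closure P) = P"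
  using rel_interior_nonempty_interior[of "closure P"] interior_closure_P P_ne by simp

lemma finite_facets: "finite (facets P)"
  using finite_polyhedron_facets[OF P_polyhedron] by simp

lemma frontier_eq: "frontier P = \<Union>(facets P)"
  using rel_boundary_of_polyhedron[OF P_polyhedron] P_open
  by (simp add: rel_interior_closure_P frontier_def interior_open)

text \<open>The affine function that vanishes on \<open>F\<close> and has the label of \<open>F\<close> as its gradient.\<close>

definition height :: "(real ^ 'n) set \<Rightarrow> real ^ 'n \<Rightarrow> real" where
  "height F x = \<nu> F \<bullet> x - \<nu> F \<bullet> (SOME y. y \<in> F)"

lemma facet_subset: "F \<in> facets P \<Longrightarrow> F \<subseteq> closure P"
  by (simp add: facet_of_imp_subset)

lemma height_facet: "F \<in> facets P \<Longrightarrow> y \<in> F \<Longrightarrow> height F y = 0"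
proof -
  assume F: "F \<in> facets P" and y: "y \<in> F"
  have "(SOME y. y \<in> F) \<in> F" by (rule someI[of "\<lambda>y. y \<in> F", OF y])
  then have "\<nu> F \<bullet> (y - (SOME y. y \<in> F)) = 0"
    using labels F y unfolding labels_def labelling_def by blast
  then show "height F y = 0" by (simp add: height_def inner_diff_right)
qed

lemma facet_ne: "F \<in> facets P \<Longrightarrow> F \<noteq> {}"
  by (simp add: facet_of_def)

lemma height_pos: "F \<in> facets P \<Longrightarrow> x \<in> P \<Longrightarrow> height F x > 0"
proof -
  assume F: "F \<in> facets P" and x: "x \<in> P"
  obtain y where y: "y \<in> F" using facet_ne[OF F] by blast
  then have "0 < \<nu> F \<bullet> (x - y)" using labels F x unfolding labels_def labelling_def by blast
  then show ?thesis using height_facet[OF F y] by (simp add: height_def inner_diff_right)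
qed

lemma label_ne: "F \<in> facets P \<Longrightarrow> \<nu> F \<noteq> 0"
  using labels unfolding labels_def labelling_def by blast

lemma continuous_height: "continuous_on S (height F)"
  unfolding height_def[abs_def] by (intro continuous_intros)

lemma smooth_height: "open U \<Longrightarrow> smooth_on U (height F)"
  unfolding height_def[abs_def] by (intro smooth_intros)

lemma height_add: "height F (x + w) = height F x + \<nu> F \<bullet> w"
  by (simp add: height_def inner_add_right)

lemma dderiv_height: "dderiv w (height F) x = \<nu> F \<bullet> w"
proof -
  have "(height F has_derivative (\<lambda>w. \<nu> F \<bullet> w)) (at x)"
    unfolding height_def[abs_def] by (auto intro!: derivative_eq_intros)
  then show ?thesis by (rule dderivI)
qed

lemma height_nonneg: "F \<in> facets P \<Longrightarrow> x \<in> closure P \<Longrightarrow> height F x \<ge> 0"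
proof -
  assume F: "F \<in> facets P" and x: "x \<in> closure P"
  have "closed {x. height F x \<ge> 0}"
    by (intro closed_Collect_le continuous_on_const continuous_height)
  moreover have "P \<subseteq> {x. height F x \<ge> 0}" using height_pos[OF F] by (auto intro: less_imp_le)
  ultimately have "closure P \<subseteq> {x. height F x \<ge> 0}" by (rule closure_minimal[rotated])
  then show ?thesis using x by auto
qed

text \<open>
  The sum of the labels in \<open>I\<close> defines a supporting hyperplane, since all the heights are nonnegative.
\<close>

lemma face_height:
  assumes "I \<subseteq> facets P"
  shows "(closure P \<inter> {x. \<forall>F\<in>I. height F x = 0}) face_of closure P"
proof -
  let ?a = "\<Sum>F\<in>I. \<nu> F" and ?b = "\<Sum>F\<in>I. \<nu> F \<bullet> (SOME y. y \<in> F)"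
  have eq: "?a \<bullet> x - ?b = (\<Sum>F\<in>I. height F x)" for x
    by (simp add: height_def sum_subtractf inner_sum_left)
  have fin: "finite I" using assms finite_facets finite_subset by blast
  have "(closure P \<inter> {x. ?a \<bullet> x = ?b}) face_of closure P"
  proof (rule face_of_Int_supporting_hyperplane_ge[OF convex_closure_P])
    fix x assume "x \<in> closure P"
    then have "(\<Sum>F\<in>I. height F x) \<ge> 0" using height_nonneg assms by (intro sum_nonneg) auto
    then show "?b \<le> ?a \<bullet> x" using eq[of x] by simp
  qed
  moreover have "closure P \<inter> {x. ?a \<bullet> x = ?b} = closure P \<inter> {x. \<forall>F\<in>I. height F x = 0}"
  proof -
    have "?a \<bullet> x = ?b \<longleftrightarrow> (\<forall>F\<in>I. height F x = 0)" if "x \<in> closure P" for x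
    proof -
      have "?a \<bullet> x = ?b \<longleftrightarrow> (\<Sum>F\<in>I. height F x) = 0" using eq[of x] by auto
      also have "\<dots> \<longleftrightarrow> (\<forall>F\<in>I. height F x = 0)"
        using fin assms height_nonneg that by (intro sum_nonneg_eq_0_iff) auto
      finally show ?thesis .
    qed
    then show ?thesis by auto
  qed
  ultimately show ?thesis by simp
qed

lemma facet_maximal:
  assumes F: "F \<in> facets P" and G: "G face_of closure P" "F \<subseteq> G" "G \<noteq> closure P"
  shows "F = G"
proof (rule ccontr)
  assume ne: "F \<noteq> G"
  have Ff: "F face_of closure P" "aff_dim F = aff_dim (closure P) - 1"
    using F by (auto simp: facet_of_def)
  have "F face_of G" by (rule face_of_subset[OF Ff(1) G(2) face_of_imp_subset[OF G(1)]])
  then have "aff_dim F < aff_dim G"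
    using face_of_aff_dim_lt[of G F] face_of_imp_convex[OF G(1)] ne convex_closure_P by blast
  moreover have "aff_dim G < aff_dim (closure P)"
    using face_of_aff_dim_lt[OF convex_closure_P G(1,3)] .
  ultimately show False using Ff(2) by simp
qed

lemma facet_eq: "F \<in> facets P \<Longrightarrow> F = closure P \<inter> {x. height F x = 0}"
proof (rule facet_maximal)
  assume F: "F \<in> facets P"
  show "(closure P \<inter> {x. height F x = 0}) face_of closure P" using face_height[of "{F}"] F by simp
  show "F \<subseteq> closure P \<inter> {x. height F x = 0}" using F height_facet facet_subset by blast
  obtain x where "x \<in> P" using P_ne by blast
  then have "x \<in> closure P" "x \<notin> {x. height F x = 0}"
    using height_pos[OF F, of x] closure_subset[of P] by auto
  then show "closure P \<inter> {x. height F x = 0} \<noteq> closure P" by blast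
qed

lemma facet_not_subset: "F \<in> facets P \<Longrightarrow> G \<in> facets P \<Longrightarrow> F \<subseteq> G \<Longrightarrow> F = G"
proof -
  assume F: "F \<in> facets P" and G: "G \<in> facets P" and sub: "F \<subseteq> G"
  have Gf: "G face_of closure P" "aff_dim G = aff_dim (closure P) - 1" using G by (auto simp: facet_of_def)
  then have "G \<noteq> closure P" by (metis diff_add_cancel zless_add1_eq less_irrefl)
  then show "F = G" by (rule facet_maximal[OF F Gf(1) sub])
qed

text \<open>
  A segment from \<open>P\<close> to \<open>x\<close> leaves the closure through some facet, whose height changes sign there. Hence
  \<open>P\<close> is cut out by the half-spaces of its facets.
\<close>

lemma height_neg_outside:
  assumes x: "x \<notin> closure P"
  shows "\<exists>F\<in>facets P. height F x < 0"
proof -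
  obtain p where p: "p \<in> P" using P_ne by blast
  have "closed_segment p x \<inter> frontier P \<noteq> {}"
    by (rule connected_Int_frontier) (use p x closure_subset[of P] in auto)
  then obtain y where y: "y \<in> closed_segment p x" "y \<in> frontier P" by blast
  then obtain F where F: "F \<in> facets P" "y \<in> F" using frontier_eq by auto
  obtain u where u: "0 \<le> u" "u \<le> 1" "y = (1 - u) *\<^sub>R p + u *\<^sub>R x"
    using y(1) by (auto simp: in_segment)
  have "height F y = (1 - u) * height F p + u * height F x"
    by (simp add: u(3) height_def inner_add_right algebra_simps)
  then have eq: "(1 - u) * height F p + u * height F x = 0" using height_facet[OF F] by simp
  have pp: "height F p > 0" by (rule height_pos[OF F(1) p])
  have "u \<noteq> 1"
  proof
    assume "u = 1"
    then have "x \<in> F" using u(3) F(2) by simp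
    then show False using x facet_subset[OF F(1)] by blast
  qed
  then have "(1 - u) * height F p > 0" using u pp by simp
  then have "u * height F x < 0" using eq by linarith
  then have "height F x < 0" using u(1) by (simp add: mult_less_0_iff)
  then show ?thesis using F(1) by blast
qed

lemma mem_closure_iff: "x \<in> closure P \<longleftrightarrow> (\<forall>F\<in>facets P. height F x \<ge> 0)"
  using height_nonneg height_neg_outside[of x] by force

lemma mem_P_iff: "x \<in> P \<longleftrightarrow> (\<forall>F\<in>facets P. height F x > 0)"
proof
  assume r: "\<forall>F\<in>facets P. height F x > 0"
  then have c: "x \<in> closure P" unfolding mem_closure_iff by (auto intro: less_imp_le)
  have "x \<notin> frontier P"
  proof
    assume "x \<in> frontier P"
    then obtain F where "F \<in> facets P" "x \<in> F" using frontier_eq by auto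
    then show False using r height_facet[of F x] by auto
  qed
  then show "x \<in> P" using c P_open by (simp add: frontier_def interior_open)
qed (use height_pos in blast)

lemma rel_interior_facet:
  assumes F: "F \<in> facets P" and y: "y \<in> rel_interior F" and G: "G \<in> facets P" "G \<noteq> F"
  shows "height G y > 0"
proof (rule ccontr)
  assume n: "\<not> height G y > 0"
  have yF: "y \<in> F" using y rel_interior_subset by blast
  then have yc: "y \<in> closure P" using facet_subset[OF F] by blast
  then have "height G y = 0" using n height_nonneg[OF G(1) yc] by simp
  then have "y \<in> G" using facet_eq[OF G(1)] yc by auto
  then have "F \<subseteq> G"
    using subset_of_face_of[of G "closure P" F] G(1) facet_subset[OF F] y by (auto simp: facet_of_def)
  then show False using facet_not_subset[OF F G(1)] G(2) by simp
qed

text \<open>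
  Near such a point the closure of \<open>P\<close> coincides with the half-space of \<open>F\<close>.
\<close>

lemma rel_interior_facetI:
  assumes F: "F \<in> facets P" and y: "y \<in> F" and G: "\<And>G. G \<in> facets P \<Longrightarrow> G \<noteq> F \<Longrightarrow> height G y > 0"
  shows "y \<in> rel_interior F"
proof -
  define W where "W = (\<Inter>G\<in>facets P - {F}. {x. height G x > 0})"
  have "open W" unfolding W_def using finite_facets
    by (intro open_INT finite_imageI finite_Diff ballI open_Collect_less continuous_on_const continuous_height)
  have aff: "affine {x. height F x = 0}"
    using affine_hyperplane[of "\<nu> F" "\<nu> F \<bullet> (SOME y. y \<in> F)"] by (simp add: height_def)
  then have "affine hull F \<subseteq> {x. height F x = 0}"
    by (intro hull_minimal) (use facet_eq[OF F] in auto)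
  then have "W \<inter> affine hull F \<subseteq> F"
  proof (intro subsetI)
    fix x assume x: "x \<in> W \<inter> affine hull F" and sub: "affine hull F \<subseteq> {x. height F x = 0}"
    then have "height F x = 0" by auto
    moreover have "x \<in> closure P"
      unfolding mem_closure_iff
    proof
      fix G assume "G \<in> facets P"
      then show "height G x \<ge> 0" using x calculation by (cases "G = F") (auto simp: W_def less_imp_le)
    qed
    ultimately show "x \<in> F" using facet_eq[OF F] by auto
  qed
  moreover have "y \<in> W" using G by (auto simp: W_def)
  ultimately show ?thesis using \<open>open W\<close> y unfolding mem_rel_interior by blast
qed

subsection \<open>Vertices and dual bases\<close>

definition vertices :: "(real ^ 'n) set" where
  "vertices = {v. v extreme_point_of closure P}"

definition active :: "real ^ 'n \<Rightarrow> (real ^ 'n) set set" where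
  "active x = {F \<in> facets P. x \<in> F}"

lemma finite_vertices: "finite vertices"
  unfolding vertices_def by (rule finite_polyhedron_extreme_points[OF P_polyhedron])

lemma vertex_closure: "v \<in> vertices \<Longrightarrow> v \<in> closure P"
  by (simp add: vertices_def extreme_point_of_def)

lemma active_iff: "x \<in> closure P \<Longrightarrow> F \<in> active x \<longleftrightarrow> F \<in> facets P \<and> height F x = 0"
  unfolding active_def using facet_eq by auto

lemma inactive_pos: "x \<in> closure P \<Longrightarrow> F \<in> facets P \<Longrightarrow> F \<notin> active x \<Longrightarrow> height F x > 0"
  using active_iff height_nonneg[of F x] by force

text \<open>A vertex of the smallest face that contains \<open>x\<close>.\<close>

lemma vertex_of_smallest_face:
  assumes x: "x \<in> closure P"
  shows "\<exists>v\<in>vertices. active x \<subseteq> active v"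
proof -
  define C where "C = closure P \<inter> {z. \<forall>F\<in>active x. height F z = 0}"
  have C: "C face_of closure P" unfolding C_def by (rule face_height) (auto simp: active_def)
  have "x \<in> C" using x active_iff[OF x] by (auto simp: C_def)
  moreover have "compact C" using face_of_imp_compact[OF convex_closure_P compact_closure_P C] .
  moreover have "convex C" by (rule face_of_imp_convex[OF C])
  ultimately obtain v where v: "v extreme_point_of C"
    using extreme_point_exists_convex[of C] by blast
  then have "v extreme_point_of closure P" "v \<in> C" using extreme_point_of_face[OF C] by auto
  then show ?thesis
    using active_iff[OF vertex_closure, of v] by (intro bexI[of _ v]) (auto simp: vertices_def C_def active_def)
qed

text \<open>
  A vector orthogonal to all the labels at \<open>v\<close> could be followed in both directions within the closure,
  which is impossible at an extreme point.
\<close>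

lemma vertex_labels_span:
  assumes v: "v \<in> vertices"
  shows "span (\<nu> ` active v) = UNIV"
proof (rule ccontr)
  assume "span (\<nu> ` active v) \<noteq> UNIV"
  then obtain w where w: "w \<noteq> 0" "\<And>x. x \<in> span (\<nu> ` active v) \<Longrightarrow> w \<bullet> x = 0"
    using span_not_UNIV_orthogonal[of "\<nu> ` active v"] by blast
  have vc: "v \<in> closure P" by (rule vertex_closure[OF v])
  have "\<exists>t>0. \<forall>s. \<bar>s\<bar> \<le> t \<longrightarrow> v + s *\<^sub>R w \<in> closure P"
  proof -
    define W where "W = (\<Inter>G\<in>facets P - active v. {x. height G x > 0})"
    have "open W" unfolding W_def using finite_facets
      by (intro open_INT finite_imageI finite_Diff ballI open_Collect_less continuous_on_const continuous_height)
    moreover have "v \<in> W" using inactive_pos[OF vc] by (auto simp: W_def)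
    ultimately obtain d where d: "d > 0" "ball v d \<subseteq> W" using open_contains_ball by blast
    define t where "t = d / (2 * norm w)"
    have "v + s *\<^sub>R w \<in> closure P" if s: "\<bar>s\<bar> \<le> t" for s
      unfolding mem_closure_iff
    proof
      fix G assume G: "G \<in> facets P"
      show "height G (v + s *\<^sub>R w) \<ge> 0"
      proof (cases "G \<in> active v")
        case True
        then have "w \<bullet> \<nu> G = 0" by (intro w(2) span_base imageI)
        then show ?thesis using height_nonneg[OF G vc] by (simp add: height_add inner_commute)
      next
        case False
        have "\<bar>s\<bar> * norm w \<le> d / 2" using s w(1) by (simp add: t_def field_simps)
        then have "v + s *\<^sub>R w \<in> ball v d" using d(1) by (simp add: dist_norm)
        then show ?thesis using d(2) G False by (auto simp: W_def less_imp_le)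
      qed
    qed
    moreover have "t > 0" using d w by (simp add: t_def)
    ultimately show ?thesis by blast
  qed
  then obtain t where t: "t > 0" "\<And>s. \<bar>s\<bar> \<le> t \<Longrightarrow> v + s *\<^sub>R w \<in> closure P" by blast
  have "v \<in> open_segment (v + t *\<^sub>R w) (v + (- t) *\<^sub>R w)"
    unfolding in_segment
    using t(1) w(1) by (intro conjI exI[of _ "1 / 2"]) (auto simp: algebra_simps scaleR_add_left[symmetric])
  moreover have "v + t *\<^sub>R w \<in> closure P" "v + (- t) *\<^sub>R w \<in> closure P"
    using t(2)[of t] t(2)[of "- t"] t(1) by (simp_all only: abs_of_pos abs_minus_cancel order_refl)
  ultimately show False using v unfolding vertices_def extreme_point_of_def by blast
qed

lemma linear_functional_inner:
  fixes g :: "real ^ 'n \<Rightarrow> real"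
  assumes "linear g"
  shows "\<exists>e. \<forall>x. g x = x \<bullet> e"
proof -
  have "g x = x \<bullet> adjoint g 1" for x
    using adjoint_works[OF assms, of x 1] by simp
  then show ?thesis by blast
qed

text \<open>Simplicity enters here: the labels of the \<open>n\<close> facets through a vertex form a basis.\<close>

lemma dual_basis:
  assumes v: "v \<in> vertices" and F: "F \<in> active v"
  shows "\<exists>e. \<nu> F \<bullet> e = 1 \<and> (\<forall>G\<in>active v. G \<noteq> F \<longrightarrow> \<nu> G \<bullet> e = 0)"
proof -
  have fin: "finite (active v)" using finite_facets by (simp add: active_def)
  have card: "card (active v) = CARD('n)"
    using simple v by (simp add: simple_polytope_def vertices_def active_def)
  have "dim (span (\<nu> ` active v)) = CARD('n)" by (simp add: vertex_labels_span[OF v])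
  then have "CARD('n) \<le> card (\<nu> ` active v)" using dim_le_card'[of "\<nu> ` active v"] fin by simp
  then have ci: "card (\<nu> ` active v) = card (active v)" using card_image_le[OF fin, of \<nu>] card by simp
  then have inj: "inj_on \<nu> (active v)" by (rule eq_card_imp_inj_on[OF fin])
  have "independent (\<nu> ` active v)"
    by (rule card_le_dim_spanning[of _ UNIV]) (use fin ci card vertex_labels_span[OF v] in auto)
  from linear_independent_extend[OF this, of "\<lambda>x. if x = \<nu> F then 1 else 0"]
  obtain g :: "real ^ 'n \<Rightarrow> real" where g: "linear g" "\<And>x. x \<in> \<nu> ` active v \<Longrightarrow> g x = (if x = \<nu> F then 1 else 0)"
    by blast
  obtain e where e: "\<And>x. g x = x \<bullet> e" using linear_functional_inner[OF g(1)] by blast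
  have "\<nu> F \<bullet> e = 1" using g(2)[of "\<nu> F"] F e[of "\<nu> F"] by simp
  moreover have "\<nu> G \<bullet> e = 0" if "G \<in> active v" "G \<noteq> F" for G
    using g(2)[of "\<nu> G"] that F e[of "\<nu> G"] inj_onD[OF inj, of G F] by auto
  ultimately show ?thesis by blast
qed

definition dual_vector :: "real ^ 'n \<Rightarrow> (real ^ 'n) set \<Rightarrow> real ^ 'n" where
  "dual_vector v F = (SOME e. \<nu> F \<bullet> e = 1 \<and> (\<forall>G\<in>active v. G \<noteq> F \<longrightarrow> \<nu> G \<bullet> e = 0))"

lemma dual_vector:
  assumes "v \<in> vertices" "F \<in> active v"
  shows "\<nu> F \<bullet> dual_vector v F = 1" "G \<in> active v \<Longrightarrow> G \<noteq> F \<Longrightarrow> \<nu> G \<bullet> dual_vector v F = 0"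
  using someI_ex[OF dual_basis[OF assms]] unfolding dual_vector_def by auto

lemma vertices_ne: "vertices \<noteq> {}"
  using vertex_of_smallest_face P_ne closure_subset by blast

end

section \<open>Scaling along a coordinate\<close>

text \<open>
  An affine change of variables in one coordinate, with an offset that depends on the others: by
  Tonelli's theorem it reduces to a change of variables on the line.
\<close>

lemma nn_integral_scale_axis:
  fixes h :: "'a::euclidean_space \<Rightarrow> ennreal" and g :: "'a \<Rightarrow> real"
  assumes h: "h \<in> borel_measurable borel" and k: "k \<in> Basis" and e: "\<epsilon> > 0"
    and g: "g \<in> borel_measurable borel" "\<And>x t. g (x + t *\<^sub>R k) = g x"
  shows "(\<integral>\<^sup>+x. h x \<partial>lborel) = ennreal \<epsilon> * (\<integral>\<^sup>+x. h (x + ((\<epsilon> - 1) * (x \<bullet> k) + g x) *\<^sub>R k) \<partial>lborel)"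
proof -
  interpret product_sigma_finite "\<lambda>_::'a. lborel :: real measure"
    by standard
  define \<psi> where "\<psi> f = (\<Sum>b\<in>Basis. f b *\<^sub>R b)" for f :: "'a \<Rightarrow> real"
  define s where "s f = (\<Sum>b\<in>Basis - {k}. f b *\<^sub>R b)" for f :: "'a \<Rightarrow> real"
  have ins: "insert k (Basis - {k}) = Basis" using k by auto
  have \<psi>m [measurable]: "\<psi> \<in> borel_measurable (Pi\<^sub>M Basis (\<lambda>_. lborel))"
    unfolding \<psi>_def by measurable
  have split: "(\<integral>\<^sup>+x. H x \<partial>lborel) = (\<integral>\<^sup>+f. (\<integral>\<^sup>+t. H (s f + t *\<^sub>R k) \<partial>lborel) \<partial>(Pi\<^sub>M (Basis - {k}) (\<lambda>_. lborel)))"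
    if H [measurable]: "H \<in> borel_measurable borel" for H :: "'a \<Rightarrow> ennreal"
  proof -
    have "(\<integral>\<^sup>+x. H x \<partial>lborel) = (\<integral>\<^sup>+x. H x \<partial>distr (Pi\<^sub>M Basis (\<lambda>_. lborel)) borel \<psi>)"
      by (simp add: lborel_def[where 'a = 'a] lborel_eq_real[symmetric] \<psi>_def[abs_def])
    also have "\<dots> = (\<integral>\<^sup>+f. H (\<psi> f) \<partial>(Pi\<^sub>M Basis (\<lambda>_. lborel)))"
      by (rule nn_integral_distr) measurable
    also have "\<dots> = (\<integral>\<^sup>+f. (\<integral>\<^sup>+t. H (\<psi> (f(k := t))) \<partial>lborel) \<partial>(Pi\<^sub>M (Basis - {k}) (\<lambda>_. lborel)))"
    proof -
      have "(\<lambda>f. H (\<psi> f)) \<in> borel_measurable (Pi\<^sub>M (insert k (Basis - {k})) (\<lambda>_. lborel))"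
        unfolding ins by measurable
      from product_nn_integral_insert[OF _ _ this] show ?thesis unfolding ins by simp
    qed
    also have "\<dots> = (\<integral>\<^sup>+f. (\<integral>\<^sup>+t. H (s f + t *\<^sub>R k) \<partial>lborel) \<partial>(Pi\<^sub>M (Basis - {k}) (\<lambda>_. lborel)))"
    proof -
      have "\<psi> (f(k := t)) = s f + t *\<^sub>R k" for f t
      proof -
        have "\<psi> (f(k := t)) = (f(k := t)) k *\<^sub>R k + (\<Sum>b\<in>Basis - {k}. (f(k := t)) b *\<^sub>R b)"
          unfolding \<psi>_def by (rule sum.remove[OF finite_Basis k])
        also have "(\<Sum>b\<in>Basis - {k}. (f(k := t)) b *\<^sub>R b) = s f"
          unfolding s_def by (intro sum.cong) auto
        finally show ?thesis by (simp only: fun_upd_same add.commute)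
      qed
      then show ?thesis by simp
    qed
    finally show ?thesis .
  qed
  have sk: "s f \<bullet> k = 0" for f
    unfolding s_def inner_sum_left using k by (intro sum.neutral) (auto simp: inner_Basis)
  have kk: "k \<bullet> k = 1" using k by (simp add: inner_Basis)
  have m: "(\<lambda>x. h (x + ((\<epsilon> - 1) * (x \<bullet> k) + g x) *\<^sub>R k)) \<in> borel_measurable borel"
    using h g(1) by measurable
  have inner: "(\<integral>\<^sup>+t. h (s f + t *\<^sub>R k) \<partial>lborel) =
      ennreal \<epsilon> * (\<integral>\<^sup>+t. h ((s f + t *\<^sub>R k) + ((\<epsilon> - 1) * ((s f + t *\<^sub>R k) \<bullet> k) + g (s f + t *\<^sub>R k)) *\<^sub>R k) \<partial>lborel)" for f
  proof -
    have "(\<lambda>t. h (s f + t *\<^sub>R k)) \<in> borel_measurable borel" using h by measurable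
    from nn_integral_real_affine[OF this, of \<epsilon> "g (s f)"] e
    have "(\<integral>\<^sup>+t. h (s f + t *\<^sub>R k) \<partial>lborel) = ennreal \<epsilon> * (\<integral>\<^sup>+t. h (s f + (g (s f) + \<epsilon> * t) *\<^sub>R k) \<partial>lborel)"
      by simp
    also have "(\<lambda>t. h (s f + (g (s f) + \<epsilon> * t) *\<^sub>R k)) =
       (\<lambda>t. h ((s f + t *\<^sub>R k) + ((\<epsilon> - 1) * ((s f + t *\<^sub>R k) \<bullet> k) + g (s f + t *\<^sub>R k)) *\<^sub>R k))"
    proof
      fix t
      have "(s f + t *\<^sub>R k) \<bullet> k = t" by (simp add: inner_add_left sk kk)
      then have "(s f + t *\<^sub>R k) + ((\<epsilon> - 1) * ((s f + t *\<^sub>R k) \<bullet> k) + g (s f + t *\<^sub>R k)) *\<^sub>R k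
         = s f + (g (s f) + \<epsilon> * t) *\<^sub>R k"
        by (simp only: g(2)) (simp add: algebra_simps)
      then show "h (s f + (g (s f) + \<epsilon> * t) *\<^sub>R k) =
         h ((s f + t *\<^sub>R k) + ((\<epsilon> - 1) * ((s f + t *\<^sub>R k) \<bullet> k) + g (s f + t *\<^sub>R k)) *\<^sub>R k)"
        by (simp only:)
    qed
    finally show ?thesis .
  qed
  have ma: "(\<lambda>f. \<integral>\<^sup>+t. h ((s f + t *\<^sub>R k) + ((\<epsilon> - 1) * ((s f + t *\<^sub>R k) \<bullet> k) + g (s f + t *\<^sub>R k)) *\<^sub>R k) \<partial>lborel)
     \<in> borel_measurable (Pi\<^sub>M (Basis - {k}) (\<lambda>_. lborel))"
  proof -
    have [measurable]: "s \<in> borel_measurable (Pi\<^sub>M (Basis - {k}) (\<lambda>_. lborel))"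
      unfolding s_def by measurable
    show ?thesis using m by measurable
  qed
  show ?thesis
    unfolding split[OF h] split[OF m] inner by (rule nn_integral_cmult[OF ma])
qed

lemma integral_scale_axis:
  fixes h :: "'a::euclidean_space \<Rightarrow> real" and g :: "'a \<Rightarrow> real"
  assumes h: "h \<in> borel_measurable borel" and k: "k \<in> Basis" and e: "\<epsilon> > 0"
    and g: "g \<in> borel_measurable borel" "\<And>x t. g (x + t *\<^sub>R k) = g x"
  shows "(\<integral>x. h x \<partial>lborel) = \<epsilon> * (\<integral>x. h (x + ((\<epsilon> - 1) * (x \<bullet> k) + g x) *\<^sub>R k) \<partial>lborel)"
proof -
  define T where "T x = x + ((\<epsilon> - 1) * (x \<bullet> k) + g x) *\<^sub>R k" for x
  have T [measurable]: "T \<in> borel_measurable borel" unfolding T_def using g(1) by measurable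
  have "lborel = density (distr lborel borel T) (\<lambda>_. ennreal \<epsilon>)" (is "_ = ?D")
  proof (rule measure_eqI)
    fix A :: "'a set" assume "A \<in> sets lborel"
    then have A [measurable]: "A \<in> sets borel" by simp
    have "emeasure lborel A = (\<integral>\<^sup>+x. indicator A x \<partial>lborel)" by simp
    also have "\<dots> = ennreal \<epsilon> * (\<integral>\<^sup>+x. indicator A (T x) \<partial>lborel)"
      unfolding T_def by (rule nn_integral_scale_axis[OF _ k e g]) measurable
    also have "\<dots> = ennreal \<epsilon> * (\<integral>\<^sup>+x. indicator A x \<partial>distr lborel borel T)"
      by (subst nn_integral_distr) measurable
    also have "\<dots> = (\<integral>\<^sup>+x. ennreal \<epsilon> * indicator A x \<partial>distr lborel borel T)"
      by (subst nn_integral_cmult) measurable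
    also have "\<dots> = emeasure ?D A"
      by (subst emeasure_density) auto
    finally show "emeasure lborel A = emeasure ?D A" .
  qed simp
  then have "(\<integral>x. h x \<partial>lborel) = (\<integral>x. h x \<partial>?D)" by (rule arg_cong)
  also have "\<dots> = (\<integral>x. \<epsilon> *\<^sub>R h x \<partial>distr lborel borel T)"
    by (rule integral_density) (use h e in auto)
  also have "\<dots> = (\<integral>x. \<epsilon> *\<^sub>R h (T x) \<partial>lborel)"
    by (rule integral_distr) (use h in measurable)
  finally show ?thesis by (simp add: T_def)
qed

lemma AE_affine_neq_0:
  fixes a :: "'a::euclidean_space"
  assumes "a \<noteq> 0 \<or> c \<noteq> 0"
  shows "AE x in lborel. a \<bullet> x + c \<noteq> 0"
proof (cases "a = 0")
  case False
  define N where "N = {x. a \<bullet> x = - c}"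
  have "negligible N" unfolding N_def by (rule negligible_hyperplane) (use False in simp)
  moreover have "N \<in> sets borel" unfolding N_def by (intro borel_closed closed_hyperplane)
  ultimately have "N \<in> null_sets lborel"
    by (simp add: negligible_iff_null_sets null_sets_completion_iff)
  then have "AE x in lborel. x \<notin> N" by (rule AE_not_in)
  then show ?thesis by eventually_elim (auto simp: N_def)
qed (use assms in auto)

section \<open>Integration over the facets\<close>

context labelled_simple_polytope
begin

definition pivot :: "(real ^ 'n) set \<Rightarrow> 'n" where
  "pivot F = (SOME i. \<nu> F $ i \<noteq> 0)"

text \<open>
  Any vector paired to 1 with the label will do; as a multiple of a basis vector it allows integration
  along this coordinate.
\<close>

definition transversal :: "(real ^ 'n) set \<Rightarrow> real ^ 'n" where
  "transversal F = (1 / \<nu> F $ pivot F) *\<^sub>R axis (pivot F) 1"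

lemma pivot: "F \<in> facets P \<Longrightarrow> \<nu> F $ pivot F \<noteq> 0"
proof -
  assume "F \<in> facets P"
  then have "\<nu> F \<noteq> 0" by (rule label_ne)
  then have "\<exists>i. \<nu> F $ i \<noteq> 0" by (simp add: vec_eq_iff)
  then show ?thesis unfolding pivot_def by (rule someI_ex)
qed

lemma label_transversal: "F \<in> facets P \<Longrightarrow> \<nu> F \<bullet> transversal F = 1"
  using pivot[of F] by (simp add: transversal_def inner_axis)

text \<open>
  The projection along \<open>transversal F\<close> to the hyperplane of \<open>F\<close>.
\<close>

definition foot :: "(real ^ 'n) set \<Rightarrow> real ^ 'n \<Rightarrow> real ^ 'n" where
  "foot F x = x - height F x *\<^sub>R transversal F"

lemma height_foot: "F \<in> facets P \<Longrightarrow> height F (foot F x) = 0"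
  using height_add[of F x "- height F x *\<^sub>R transversal F"] by (simp add: foot_def label_transversal)

lemma foot_facet: "F \<in> facets P \<Longrightarrow> y \<in> F \<Longrightarrow> foot F y = y"
  by (simp add: foot_def height_facet)

lemma height_translate: "F \<in> facets P \<Longrightarrow> height F (x + t *\<^sub>R transversal F) = height F x + t"
  by (simp add: height_add label_transversal)

lemma foot_translate: "F \<in> facets P \<Longrightarrow> foot F (x + t *\<^sub>R transversal F) = foot F x"
  by (simp add: foot_def height_translate algebra_simps)

lemma continuous_foot: "continuous_on S (foot F)"
  unfolding foot_def[abs_def] by (intro continuous_intros continuous_height)

lemma measurable_height [measurable]: "height F \<in> borel_measurable borel"
  by (rule borel_measurable_continuous_onI[OF continuous_height])

lemma measurable_foot [measurable]: "foot F \<in> borel_measurable borel"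
  by (rule borel_measurable_continuous_onI[OF continuous_foot])

text \<open>
  The compression towards the hyperplane of \<open>F\<close> along \<open>transversal F\<close> changes a single coordinate.
\<close>

lemma integral_squeeze:
  assumes F: "F \<in> facets P" and h: "h \<in> borel_measurable borel" and e: "\<epsilon> > 0"
  shows "(\<integral>x. h x \<partial>lborel) = \<epsilon> * (\<integral>x. h (foot F x + (\<epsilon> * height F x) *\<^sub>R transversal F) \<partial>lborel)"
proof -
  let ?k = "axis (pivot F) 1 :: real ^ 'n"
  define g where "g x = (\<epsilon> - 1) * (height F x / \<nu> F $ pivot F - x \<bullet> ?k)" for x
  have gm: "g \<in> borel_measurable borel" unfolding g_def by measurable
  have gi: "g (x + t *\<^sub>R ?k) = g x" for x t
    using pivot[OF F] by (simp add: g_def height_add inner_axis inner_add_left inner_axis_axis field_simps)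
  have "x + ((\<epsilon> - 1) * (x \<bullet> ?k) + g x) *\<^sub>R ?k = foot F x + (\<epsilon> * height F x) *\<^sub>R transversal F" for x
  proof -
    have "(\<epsilon> - 1) * (x \<bullet> ?k) + g x = (\<epsilon> - 1) * height F x * (1 / \<nu> F $ pivot F)"
    proof -
      have "E * a + E * (q - a) = E * q" for E a q :: real by (simp add: right_diff_distrib)
      then show ?thesis unfolding g_def by simp
    qed
    moreover have "x + ((\<epsilon> - 1) * height F x * \<kappa>) *\<^sub>R ?k =
        (x - height F x *\<^sub>R (\<kappa> *\<^sub>R ?k)) + (\<epsilon> * height F x) *\<^sub>R (\<kappa> *\<^sub>R ?k)" for \<kappa>
      by (simp add: algebra_simps)
    ultimately show ?thesis by (simp only: foot_def transversal_def)
  qed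
  then show ?thesis
    using integral_scale_axis[OF h _ e gm gi] by (simp add: axis_in_Basis_iff)
qed

text \<open>
  The cylinder over \<open>F\<close> whose volume is prescribed by the condition that relates \<open>\<sigma>\<close> to the label of \<open>F\<close>.
\<close>

definition slab :: "(real ^ 'n) set \<Rightarrow> (real ^ 'n) set" where
  "slab F = {x. 0 \<le> height F x \<and> height F x \<le> 1 \<and> foot F x \<in> F}"

lemma mem_facet_iff: "F \<in> facets P \<Longrightarrow> y \<in> F \<longleftrightarrow> y \<in> closure P \<and> height F y = 0"
  using eqset_imp_iff[OF facet_eq, of F y] by simp

lemma facet_closed: "F \<in> facets P \<Longrightarrow> closed F"
  by (subst facet_eq, assumption)
    (intro closed_Int closed_closure closed_Collect_eq continuous_height continuous_on_const)

lemma slab_borel: "F \<in> facets P \<Longrightarrow> slab F \<in> sets borel"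
proof -
  assume F: "F \<in> facets P"
  have [measurable]: "F \<in> sets borel" using facet_closed[OF F] by simp
  have "{x \<in> space borel. 0 \<le> height F x \<and> height F x \<le> 1 \<and> foot F x \<in> F} \<in> sets borel"
    by measurable
  then show ?thesis by (simp add: slab_def)
qed

lemma slab_bounded: "F \<in> facets P \<Longrightarrow> bounded (slab F)"
proof -
  assume F: "F \<in> facets P"
  obtain B where B: "\<And>x. x \<in> closure P \<Longrightarrow> norm x \<le> B"
    using compact_imp_bounded[OF compact_closure_P] by (auto simp: bounded_iff)
  have "norm x \<le> B + norm (transversal F)" if x: "x \<in> slab F" for x
  proof -
    have "norm x = norm (foot F x + height F x *\<^sub>R transversal F)" by (simp add: foot_def)
    also have "\<dots> \<le> norm (foot F x) + \<bar>height F x\<bar> * norm (transversal F)"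
      using norm_triangle_ineq[of "foot F x" "height F x *\<^sub>R transversal F"] by simp
    also have "\<dots> \<le> B + 1 * norm (transversal F)"
      using x facet_subset[OF F] by (intro add_mono B mult_right_mono) (auto simp: slab_def)
    finally show ?thesis by simp
  qed
  then show ?thesis by (auto simp: bounded_iff)
qed

lemma AE_foot_height_neq_0:
  assumes F: "F \<in> facets P" and G: "G \<in> facets P" "G \<noteq> F"
  shows "AE x in lborel. height G (foot F x) \<noteq> 0"
proof -
  define a where "a = \<nu> G - (\<nu> G \<bullet> transversal F) *\<^sub>R \<nu> F"
  define c where "c = height G (foot F 0)"
  have aff: "height G (foot F x) = a \<bullet> x + c" for x
  proof -
    have h: "height F x = \<nu> F \<bullet> x + height F 0" for x by (simp add: height_def)
    have e: "height G (foot F x) = height G 0 + \<nu> G \<bullet> x - height F x * (\<nu> G \<bullet> transversal F)" for x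
      by (simp add: foot_def height_def inner_diff_right)
    show ?thesis unfolding c_def a_def e[of x] e[of 0] h[of x] by (simp add: inner_diff_left algebra_simps)
  qed
  have "a \<noteq> 0 \<or> c \<noteq> 0"
  proof (rule ccontr)
    assume "\<not> (a \<noteq> 0 \<or> c \<noteq> 0)"
    then have "height G (foot F y) = 0" for y using aff by simp
    then have "height G y = 0" if "y \<in> F" for y using foot_facet[OF F that] by metis
    then have "F \<subseteq> G" using mem_facet_iff[OF G(1)] facet_subset[OF F] by blast
    then show False using facet_not_subset[OF F G(1)] G(2) by simp
  qed
  from AE_affine_neq_0[OF this] show ?thesis by (simp add: aff)
qed

lemma emeasure_facet:
  assumes F: "F \<in> facets P" and E: "E \<in> sets borel" "E \<subseteq> F"
  shows "emeasure \<sigma> E = emeasure lborel {x. 0 \<le> height F x \<and> height F x \<le> 1 \<and> foot F x \<in> E}"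
proof -
  have "emeasure \<sigma> E = emeasure lborel {y + t *\<^sub>R transversal F | y t. y \<in> E \<and> t \<in> {0..1}}"
    using labels F E label_transversal[OF F] unfolding labels_def wedge_condition_def by blast
  also have "{y + t *\<^sub>R transversal F | y t. y \<in> E \<and> t \<in> {0..1}} =
     {x. 0 \<le> height F x \<and> height F x \<le> 1 \<and> foot F x \<in> E}" (is "?A = ?B")
  proof
    show "?A \<subseteq> ?B"
      using E(2) height_facet[OF F] foot_facet[OF F]
      by (auto simp: height_translate[OF F] foot_translate[OF F] subset_iff)
    show "?B \<subseteq> ?A"
    proof
      fix x assume "x \<in> ?B"
      moreover have "x = foot F x + height F x *\<^sub>R transversal F" by (simp add: foot_def)
      ultimately show "x \<in> ?A" by (intro CollectI exI[of _ "foot F x"] exI[of _ "height F x"]) auto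
    qed
  qed
  finally show ?thesis .
qed

lemma space_\<sigma>: "space \<sigma> = frontier P"
  using sets_eq_imp_space_eq[OF sets_\<sigma>] by (simp add: space_restrict_space)

lemma sets_\<sigma>_iff: "A \<in> sets \<sigma> \<longleftrightarrow> A \<in> sets borel \<and> A \<subseteq> frontier P"
  unfolding sets_\<sigma> by (subst sets_restrict_space_iff) auto

lemma measurable_ident_\<sigma>: "(\<lambda>x. x) \<in> measurable \<sigma> borel"
  using measurable_restrict_space1[OF measurable_ident, of borel "frontier P"] sets_\<sigma>
  by (simp add: id_def cong: measurable_cong_sets)

text \<open>
  On \<open>F\<close> the measure \<open>\<sigma>\<close> is the image of Lebesgue measure on the slab under \<open>foot\<close>: this is the labelling
  condition for the vector \<open>transversal F\<close>.
\<close>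

lemma facet_integral:
  fixes g :: "real ^ 'n \<Rightarrow> real"
  assumes F: "F \<in> facets P" and g: "g \<in> borel_measurable borel"
  shows "(\<integral>x. indicator F x * g x \<partial>\<sigma>) = (\<integral>x. indicator (slab F) x * g (foot F x) \<partial>lborel)"
    and "integrable \<sigma> (\<lambda>x. indicator F x * g x) \<longleftrightarrow> integrable lborel (\<lambda>x. indicator (slab F) x * g (foot F x))"
proof -
  note [measurable] = measurable_ident_\<sigma> g
  have Fb [measurable]: "F \<in> sets borel" using facet_closed[OF F] by simp
  have sb [measurable]: "slab F \<in> sets borel" by (rule slab_borel[OF F])
  have Fs [measurable]: "F \<in> sets \<sigma>" using Fb F frontier_eq by (auto simp: sets_\<sigma>_iff)
  let ?M = "distr (density \<sigma> (\<lambda>x. ennreal (indicator F x))) borel (\<lambda>x. x)"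
  let ?N = "distr (density lborel (\<lambda>x. ennreal (indicator (slab F) x))) borel (foot F)"
  have eq: "?M = ?N"
  proof (rule measure_eqI)
    fix A assume "A \<in> sets ?M"
    then have A [measurable]: "A \<in> sets borel" by simp
    have As: "A \<inter> space \<sigma> \<in> sets \<sigma>"
      using measurable_sets[OF measurable_ident_\<sigma> A] by (simp add: vimage_def Int_def)
    have "emeasure ?M A = emeasure (density \<sigma> (\<lambda>x. ennreal (indicator F x))) (A \<inter> space \<sigma>)"
      by (subst emeasure_distr) (auto simp: measurable_ident_\<sigma> vimage_def Int_def)
    also have "\<dots> = (\<integral>\<^sup>+x. ennreal (indicator F x) * indicator (A \<inter> space \<sigma>) x \<partial>\<sigma>)"
      by (rule emeasure_density) (use Fs As in auto)
    also have "\<dots> = (\<integral>\<^sup>+x. indicator (F \<inter> A) x \<partial>\<sigma>)"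
      by (intro nn_integral_cong) (auto simp: indicator_def)
    also have "\<dots> = emeasure \<sigma> (F \<inter> A)"
      by (rule nn_integral_indicator) (use Fb A F frontier_eq in \<open>auto simp: sets_\<sigma>_iff\<close>)
    also have "\<dots> = emeasure lborel {x. 0 \<le> height F x \<and> height F x \<le> 1 \<and> foot F x \<in> F \<inter> A}"
      by (rule emeasure_facet[OF F]) auto
    also have "{x. 0 \<le> height F x \<and> height F x \<le> 1 \<and> foot F x \<in> F \<inter> A} = slab F \<inter> foot F -` A"
      by (auto simp: slab_def)
    also have "emeasure lborel \<dots> = (\<integral>\<^sup>+x. ennreal (indicator (slab F) x) * indicator (foot F -` A) x \<partial>lborel)"
    proof -
      have "foot F -` A \<in> sets borel" using measurable_sets[OF measurable_foot A] by simp
      then show ?thesis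
        unfolding ennreal_indicator indicator_inter_arith[symmetric]
        by (intro nn_integral_indicator[symmetric]) (use sb in auto)
    qed
    also have "\<dots> = emeasure (density lborel (\<lambda>x. ennreal (indicator (slab F) x))) (foot F -` A)"
      by (rule emeasure_density[symmetric]) (use measurable_sets[OF measurable_foot A] sb in auto)
    also have "\<dots> = emeasure ?N A"
      by (subst emeasure_distr) auto
    finally show "emeasure ?M A = emeasure ?N A" .
  qed simp
  have iM1: "(\<integral>x. g x \<partial>?M) = (\<integral>x. g x \<partial>density \<sigma> (\<lambda>x. ennreal (indicator F x)))"
    by (rule integral_distr[where g = "\<lambda>x. x" and f = g]) (use measurable_ident_\<sigma> g in simp_all)
  have iM2: "integrable ?M g \<longleftrightarrow> integrable (density \<sigma> (\<lambda>x. ennreal (indicator F x))) g"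
    by (rule integrable_distr_eq[where g = "\<lambda>x. x" and f = g]) (use measurable_ident_\<sigma> g in simp_all)
  have iN1: "(\<integral>x. g x \<partial>?N) = (\<integral>x. g (foot F x) \<partial>density lborel (\<lambda>x. ennreal (indicator (slab F) x)))"
    by (rule integral_distr[where g = "foot F" and f = g]) (use g in simp_all)
  have iN2: "integrable ?N g \<longleftrightarrow> integrable (density lborel (\<lambda>x. ennreal (indicator (slab F) x))) (\<lambda>x. g (foot F x))"
    by (rule integrable_distr_eq[where g = "foot F" and f = g]) (use g in simp_all)
  have g\<sigma>: "g \<in> borel_measurable \<sigma>" using measurable_compose[OF measurable_ident_\<sigma> g] by simp
  have gf: "(\<lambda>x. g (foot F x)) \<in> borel_measurable lborel" using measurable_compose[OF measurable_foot g] by simp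
  have dM1: "(\<integral>x. g x \<partial>density \<sigma> (\<lambda>x. ennreal (indicator F x))) = (\<integral>x. indicator F x *\<^sub>R g x \<partial>\<sigma>)"
    by (rule integral_density) (use g\<sigma> Fs in simp_all)
  have dM2: "integrable (density \<sigma> (\<lambda>x. ennreal (indicator F x))) g \<longleftrightarrow> integrable \<sigma> (\<lambda>x. indicator F x *\<^sub>R g x)"
    by (rule integrable_density) (use g\<sigma> Fs in simp_all)
  have dN1: "(\<integral>x. g (foot F x) \<partial>density lborel (\<lambda>x. ennreal (indicator (slab F) x))) =
      (\<integral>x. indicator (slab F) x *\<^sub>R g (foot F x) \<partial>lborel)"
    by (rule integral_density) (use gf sb in simp_all)
  have dN2: "integrable (density lborel (\<lambda>x. ennreal (indicator (slab F) x))) (\<lambda>x. g (foot F x)) \<longleftrightarrow>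
       integrable lborel (\<lambda>x. indicator (slab F) x *\<^sub>R g (foot F x))"
    by (rule integrable_density) (use gf sb in simp_all)
  show "(\<integral>x. indicator F x * g x \<partial>\<sigma>) = (\<integral>x. indicator (slab F) x * g (foot F x) \<partial>lborel)"
    using iM1 iN1 dM1 dN1 unfolding eq by simp
  show "integrable \<sigma> (\<lambda>x. indicator F x * g x) \<longleftrightarrow> integrable lborel (\<lambda>x. indicator (slab F) x * g (foot F x))"
    using iM2 iN2 dM2 dN2 unfolding eq by simp
qed

definition facet_int :: "(real ^ 'n) set \<Rightarrow> (real ^ 'n \<Rightarrow> real) \<Rightarrow> real" where
  "facet_int F g = (\<integral>x. indicator F x * g x \<partial>\<sigma>)"

lemma continuous_bounded_on_closure:
  assumes "continuous_on (closure P) g"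
  obtains B where "B \<ge> 0" "\<And>x. x \<in> closure P \<Longrightarrow> \<bar>g x :: real\<bar> \<le> B"
proof -
  have "bounded (g ` closure P)"
    by (intro compact_imp_bounded compact_continuous_image assms compact_closure_P)
  then obtain b where "b > 0" "\<And>x. x \<in> closure P \<Longrightarrow> \<bar>g x\<bar> \<le> b" by (auto simp: bounded_pos)
  then show ?thesis using that by (meson less_imp_le)
qed

lemma restricted_measurable:
  assumes "continuous_on (closure P) (g :: real ^ 'n \<Rightarrow> real)"
  shows "(\<lambda>x. indicator (closure P) x * g x) \<in> borel_measurable borel"
  using borel_measurable_continuous_on_indicator[OF _ assms] by simp

lemma facet_int_slab:
  assumes F: "F \<in> facets P" and g: "continuous_on (closure P) g"
  shows "facet_int F g = (\<integral>x. indicator (slab F) x * g (foot F x) \<partial>lborel)"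
    and "integrable \<sigma> (\<lambda>x. indicator F x * g x)"
    and "integrable lborel (\<lambda>x. indicator (slab F) x * g (foot F x))"
proof -
  let ?g = "\<lambda>x. indicator (closure P) x * g x"
  note gm = restricted_measurable[OF g]
  have e1: "indicator F x * ?g x = indicator F x * g x" for x
    using facet_subset[OF F] by (auto simp: indicator_def)
  have e2: "indicator (slab F) x * ?g (foot F x) = indicator (slab F) x * g (foot F x)" for x
    using facet_subset[OF F] by (auto simp: indicator_def slab_def)
  show "facet_int F g = (\<integral>x. indicator (slab F) x * g (foot F x) \<partial>lborel)"
    using facet_integral(1)[OF F gm] by (simp only: e1 e2 facet_int_def)
  obtain B where B: "B \<ge> 0" "\<And>x. x \<in> closure P \<Longrightarrow> \<bar>g x\<bar> \<le> B"
    by (rule continuous_bounded_on_closure[OF g]) blast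
  have "integrable lborel (\<lambda>x. indicator (slab F) x * ?g (foot F x))"
  proof (rule Bochner_Integration.integrable_bound)
    show "integrable lborel (\<lambda>x. indicator (slab F) x *\<^sub>R B)"
      using slab_borel[OF F] emeasure_bounded_finite[OF slab_bounded[OF F]] by simp
    show "(\<lambda>x. indicator (slab F) x * ?g (foot F x)) \<in> borel_measurable lborel"
      using slab_borel[OF F] gm by measurable
    show "AE x in lborel. norm (indicator (slab F) x * ?g (foot F x)) \<le> norm (indicator (slab F) x *\<^sub>R B)"
      using B by (auto simp: indicator_def)
  qed
  then show "integrable lborel (\<lambda>x. indicator (slab F) x * g (foot F x))" by (simp only: e2)
  then show "integrable \<sigma> (\<lambda>x. indicator F x * g x)"
    using facet_integral(2)[OF F gm] by (simp only: e1 e2)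
qed

text \<open>
  The part of the slab of \<open>F\<close> above another facet lies in a hyperplane.
\<close>

lemma AE_unique_facet: "AE x in \<sigma>. \<forall>F\<in>facets P. \<forall>G\<in>facets P. x \<in> F \<longrightarrow> x \<in> G \<longrightarrow> F = G"
proof -
  have "AE x in \<sigma>. x \<in> F \<longrightarrow> x \<in> G \<longrightarrow> F = G" if F: "F \<in> facets P" and G: "G \<in> facets P" for F G
  proof (cases "F = G")
    case False
    have FG: "F \<inter> G \<in> sets borel" using facet_closed[OF F] facet_closed[OF G] by auto
    have "emeasure \<sigma> (F \<inter> G) = emeasure lborel {x. 0 \<le> height F x \<and> height F x \<le> 1 \<and> foot F x \<in> F \<inter> G}"
      by (rule emeasure_facet[OF F FG]) auto
    also have "\<dots> = 0"
    proof -
      have [measurable]: "F \<inter> G \<in> sets borel" by fact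
      define W where "W = {x. 0 \<le> height F x \<and> height F x \<le> 1 \<and> foot F x \<in> F \<inter> G}"
      have "{x \<in> space borel. 0 \<le> height F x \<and> height F x \<le> 1 \<and> foot F x \<in> F \<inter> G} \<in> sets borel"
        by measurable
      then have W: "W \<in> sets lborel" by (simp add: W_def)
      have "AE x in lborel. x \<notin> W"
        using AE_foot_height_neq_0[OF F G not_sym[OF False]]
        by eventually_elim (auto simp: height_facet[OF G] W_def)
      then have "W \<in> null_sets lborel" using AE_iff_null_sets[OF W] by simp
      then show ?thesis unfolding W_def by (rule null_setsD1)
    qed
    finally have "F \<inter> G \<in> null_sets \<sigma>"
      using FG F frontier_eq by (auto simp: null_sets_def sets_\<sigma>_iff)
    then show ?thesis by (rule AE_I') auto
  qed auto
  then show ?thesis by (intro eventually_ball_finite finite_facets ballI)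
qed

lemma boundary_integral:
  assumes g: "continuous_on (closure P) g"
  shows "(\<integral>x. g x \<partial>\<sigma>) = (\<Sum>F\<in>facets P. facet_int F g)" "integrable \<sigma> g"
proof -
  have ae: "AE x in \<sigma>. (\<Sum>F\<in>facets P. indicator F x * g x) = g x"
    using AE_unique_facet
  proof (rule AE_mp, intro AE_I2 impI)
    fix x assume x: "x \<in> space \<sigma>" and u: "\<forall>F\<in>facets P. \<forall>G\<in>facets P. x \<in> F \<longrightarrow> x \<in> G \<longrightarrow> F = G"
    obtain F where F: "F \<in> facets P" "x \<in> F" using x space_\<sigma> frontier_eq by auto
    have "(\<Sum>F\<in>facets P. indicator F x * g x) = (\<Sum>G\<in>facets P. if G = F then g x else 0)"
      by (rule sum.cong) (use F u in \<open>auto simp: indicator_def\<close>)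
    then show "(\<Sum>F\<in>facets P. indicator F x * g x) = g x" using F finite_facets by simp
  qed
  have gm: "g \<in> borel_measurable \<sigma>"
  proof -
    have "(\<lambda>x. indicator (closure P) x * g x) \<in> borel_measurable \<sigma>"
      using measurable_compose[OF measurable_ident_\<sigma> restricted_measurable[OF g]] .
    moreover have "indicator (closure P) x * g x = g x" if "x \<in> space \<sigma>" for x
      using that by (auto simp: space_\<sigma> frontier_def indicator_def)
    ultimately show ?thesis by (subst measurable_cong[of \<sigma> _ "\<lambda>x. indicator (closure P) x * g x"]) auto
  qed
  have int: "integrable \<sigma> (\<lambda>x. \<Sum>F\<in>facets P. indicator F x * g x)"
    by (intro Bochner_Integration.integrable_sum facet_int_slab(2)[OF _ g])
  then show "integrable \<sigma> g"
    using integrable_cong_AE[OF borel_measurable_integrable[OF int] gm ae] by simp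
  have "(\<integral>x. g x \<partial>\<sigma>) = (\<integral>x. (\<Sum>F\<in>facets P. indicator F x * g x) \<partial>\<sigma>)"
    using integral_cong_AE[OF borel_measurable_integrable[OF int] gm ae] by simp
  also have "\<dots> = (\<Sum>F\<in>facets P. facet_int F g)"
    unfolding facet_int_def by (intro Bochner_Integration.integral_sum facet_int_slab(2)[OF _ g])
  finally show "(\<integral>x. g x \<partial>\<sigma>) = (\<Sum>F\<in>facets P. facet_int F g)" .
qed

end

section \<open>The divergence theorem on a polytope\<close>

text \<open>
  A \<open>C\<^sup>1\<close> cutoff. Its derivative is the hat function on \<open>[0, 2]\<close>, whose translates by 1 add up
  to 1; this makes integrals of the derivative across a facet exact.
\<close>

definition cutoff :: "real \<Rightarrow> real" where
  "cutoff s = (max 0 s)\<^sup>2 / 2 - (max 0 (s - 1))\<^sup>2 + (max 0 (s - 2))\<^sup>2 / 2"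

definition hat :: "real \<Rightarrow> real" where
  "hat s = max 0 s - 2 * max 0 (s - 1) + max 0 (s - 2)"

lemma DERIV_pos_part_square: "((\<lambda>s. (max 0 (s - a))\<^sup>2) has_real_derivative 2 * max 0 (s - a)) (at s)"
proof -
  consider "s < a" | "s > a" | "s = a" by linarith
  then show ?thesis
  proof cases
    case 1
    have "((\<lambda>s. 0) has_real_derivative 0) (at s)" by simp
    then have "((\<lambda>s. (max 0 (s - a))\<^sup>2) has_real_derivative 0) (at s)"
      by (rule has_field_derivative_transform_within_open[of _ _ _ "{..<a}"]) (use 1 in auto)
    then show ?thesis using 1 by simp
  next
    case 2
    have "((\<lambda>s. (s - a)\<^sup>2) has_real_derivative 2 * (s - a)) (at s)"
      by (auto intro!: derivative_eq_intros)
    then have "((\<lambda>s. (max 0 (s - a))\<^sup>2) has_real_derivative 2 * (s - a)) (at s)"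
      by (rule has_field_derivative_transform_within_open[of _ _ _ "{a<..}"]) (use 2 in auto)
    then show ?thesis using 2 by simp
  next
    case 3
    have "((\<lambda>h. ((max 0 (s + h - a))\<^sup>2 - (max 0 (s - a))\<^sup>2) / h) \<longlongrightarrow> 0) (at 0)"
    proof (rule Lim_null_comparison)
      have "\<bar>((max 0 (s + h - a))\<^sup>2 - (max 0 (s - a))\<^sup>2) / h\<bar> \<le> \<bar>h\<bar>" for h
        using 3 by (cases "h > 0") (auto simp: power2_eq_square)
      then show "\<forall>\<^sub>F h in at 0. norm (((max 0 (s + h - a))\<^sup>2 - (max 0 (s - a))\<^sup>2) / h) \<le> \<bar>h\<bar>"
        by (auto intro: always_eventually)
      show "((\<lambda>h. \<bar>h\<bar>) \<longlongrightarrow> 0) (at (0::real))" by (intro tendsto_rabs_zero tendsto_ident_at)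
    qed
    then show ?thesis using 3 by (simp add: DERIV_def)
  qed
qed

lemma DERIV_cutoff: "(cutoff has_real_derivative hat s) (at s)"
proof -
  have "((\<lambda>s. (max 0 (s - 0))\<^sup>2 / 2 - (max 0 (s - 1))\<^sup>2 + (max 0 (s - 2))\<^sup>2 / 2) has_real_derivative
    (2 * max 0 (s - 0)) / 2 - 2 * max 0 (s - 1) + (2 * max 0 (s - 2)) / 2) (at s)"
    by (intro DERIV_add DERIV_diff DERIV_cdivide DERIV_pos_part_square)
  then show ?thesis by (simp add: cutoff_def[abs_def] hat_def)
qed

lemma cutoff_le_0: "s \<le> 0 \<Longrightarrow> cutoff s = 0" and cutoff_ge_2: "s \<ge> 2 \<Longrightarrow> cutoff s = 1"
  by (auto simp: cutoff_def max_def power2_eq_square field_simps)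

lemma hat_le_0: "s \<le> 0 \<Longrightarrow> hat s = 0" and hat_ge_2: "s \<ge> 2 \<Longrightarrow> hat s = 0"
  and hat_range: "0 \<le> hat s" "hat s \<le> 1" and hat_partition: "0 \<le> s \<Longrightarrow> s \<le> 1 \<Longrightarrow> hat s + hat (s + 1) = 1"
  by (auto simp: hat_def max_def)

lemma cutoff_range: "0 \<le> cutoff s" "cutoff s \<le> 1"
proof -
  have mono: "cutoff s \<le> cutoff t" if "s \<le> t" for s t
    by (rule DERIV_nonneg_imp_nondecreasing[OF that]) (use DERIV_cutoff hat_range in blast)
  show "0 \<le> cutoff s" using mono[of "min s 0" s] cutoff_le_0[of "min s 0"] by simp
  show "cutoff s \<le> 1" using mono[of s "max s 2"] cutoff_ge_2[of "max s 2"] by simp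
qed

lemma continuous_cutoff: "continuous_on UNIV cutoff" and continuous_hat: "continuous_on UNIV hat"
  unfolding cutoff_def[abs_def] hat_def[abs_def] by (intro continuous_intros; simp)+

lemma continuous_extend_by_0:
  fixes f :: "'a::t2_space \<Rightarrow> real"
  assumes U: "open U" and C: "closed C" "C \<subseteq> U" and f: "continuous_on U f" "\<And>x. x \<in> U - C \<Longrightarrow> f x = 0"
  shows "continuous_on UNIV (\<lambda>x. if x \<in> U then f x else 0)"
proof -
  let ?f = "\<lambda>x. if x \<in> U then f x else 0"
  have "continuous_on U ?f" using f(1) by (rule continuous_on_eq) simp
  moreover have "continuous_on (- C) ?f"
    by (rule continuous_on_eq[OF continuous_on_const[of _ 0]]) (use f(2) in auto)
  ultimately have "continuous_on (U \<union> - C) ?f"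
    using U C(1) by (intro continuous_on_open_Un) auto
  moreover have "U \<union> - C = UNIV" using C(2) by auto
  ultimately show ?thesis by simp
qed

lemma prod_eventually_1:
  assumes "finite I" "\<And>i. i \<in> I \<Longrightarrow> eventually (\<lambda>n. f i n = (1::real)) F"
  shows "eventually (\<lambda>n. (\<Prod>i\<in>I. f i n) = 1) F"
proof -
  have "eventually (\<lambda>n. \<forall>i\<in>I. f i n = 1) F" using assms by (intro eventually_ball_finite) auto
  then show ?thesis by eventually_elim simp
qed

context labelled_simple_polytope
begin

lemma measurable_cutoff: "cutoff \<in> borel_measurable borel" and measurable_hat: "hat \<in> borel_measurable borel"
  by (rule borel_measurable_continuous_onI[OF continuous_cutoff], rule borel_measurable_continuous_onI[OF continuous_hat])

definition strip_prod :: "real \<Rightarrow> (real ^ 'n) set set \<Rightarrow> real ^ 'n \<Rightarrow> real" where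
  "strip_prod \<epsilon> I x = (\<Prod>G\<in>I. cutoff (height G x / \<epsilon>))"

lemma measurable_strip_prod: "strip_prod \<epsilon> I \<in> borel_measurable borel"
  unfolding strip_prod_def using measurable_cutoff by measurable

lemma continuous_strip_prod: "continuous_on S (strip_prod \<epsilon> I)"
  unfolding strip_prod_def[abs_def] divide_inverse
  by (intro continuous_on_prod continuous_on_compose2[OF continuous_cutoff] continuous_on_mult
      continuous_height continuous_on_const) auto

lemma strip_prod_range: "0 \<le> strip_prod \<epsilon> I x" "strip_prod \<epsilon> I x \<le> 1"
  unfolding strip_prod_def by (auto intro!: prod_nonneg prod_le_1 simp: cutoff_range)

text \<open>
  The contribution of one facet to the gradient of the product of all cutoffs. After the change of
  variables that stretches the strip of width \<open>2 \<epsilon>\<close> along the facet to width 2, the integrand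
  converges almost everywhere.
\<close>

lemma strip_limit:
  assumes F: "F \<in> facets P" and \<phi>: "continuous_on (closure P) \<phi>"
  shows "(\<lambda>n. \<integral>x. indicator P x * (hat (height F x * real (Suc n)) * real (Suc n) *
      strip_prod (1 / real (Suc n)) (facets P - {F}) x * \<phi> x) \<partial>lborel) \<longlonglongrightarrow> facet_int F \<phi>"
proof -
  define \<psi> where "\<psi> x = indicator (closure P) x * \<phi> x" for x
  have \<psi>m [measurable]: "\<psi> \<in> borel_measurable borel"
    unfolding \<psi>_def by (rule restricted_measurable[OF \<phi>])
  note [measurable] = measurable_strip_prod measurable_hat
  have Pm [measurable]: "P \<in> sets borel" using P_open by simp
  have Fm [measurable]: "F \<in> sets borel" using facet_closed[OF F] by simp
  obtain B where B: "B \<ge> 0" "\<And>x. x \<in> closure P \<Longrightarrow> \<bar>\<phi> x\<bar> \<le> B"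
    by (rule continuous_bounded_on_closure[OF \<phi>]) blast
  define e where "e n = 1 / real (Suc n)" for n
  have e: "e n > 0" "e n \<le> 1" for n by (auto simp: e_def)
  have e0: "e \<longlonglongrightarrow> 0" unfolding e_def using LIMSEQ_Suc[OF lim_const_over_n[of "1::real"]] by simp
  define T where "T n x = foot F x + (e n * height F x) *\<^sub>R transversal F" for n x
  have Tm [measurable]: "T n \<in> borel_measurable borel" for n unfolding T_def by measurable
  have hT: "height F (T n x) = e n * height F x" for n x
    by (simp add: T_def height_translate[OF F] height_foot[OF F])
  have T0: "(\<lambda>n. T n x) \<longlonglongrightarrow> foot F x" for x
  proof -
    have "(\<lambda>n. foot F x + (e n * height F x) *\<^sub>R transversal F) \<longlonglongrightarrow> foot F x + (0 * height F x) *\<^sub>R transversal F"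
      by (intro tendsto_intros e0)
    then show ?thesis by (simp add: T_def)
  qed
  define I where "I = facets P - {F}"
  define u where "u n x = indicator P x * (strip_prod (e n) I x * \<psi> x)" for n x
  have um [measurable]: "u n \<in> borel_measurable borel" for n unfolding u_def by measurable
  have eq: "(\<integral>x. indicator P x * (hat (height F x * real (Suc n)) * real (Suc n) * strip_prod (1 / real (Suc n)) I x * \<phi> x) \<partial>lborel)
     = (\<integral>x. hat (height F x) * u n (T n x) \<partial>lborel)" for n
  proof -
    have "(\<integral>x. indicator P x * (hat (height F x * real (Suc n)) * real (Suc n) * strip_prod (1 / real (Suc n)) I x * \<phi> x) \<partial>lborel)
      = (\<integral>x. hat (height F x / e n) / e n * u n x \<partial>lborel)"
      using closure_subset[of P] by (intro Bochner_Integration.integral_cong) (auto simp: u_def e_def \<psi>_def indicator_def)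
    also have "\<dots> = e n * (\<integral>x. hat (height F (T n x) / e n) / e n * u n (T n x) \<partial>lborel)"
      unfolding T_def by (rule integral_squeeze[OF F _ e(1)]) measurable
    also have "\<dots> = (\<integral>x. e n * (hat (height F (T n x) / e n) / e n * u n (T n x)) \<partial>lborel)"
      by simp
    also have "\<dots> = (\<integral>x. hat (height F x) * u n (T n x) \<partial>lborel)"
      using e(1)[of n] by (simp add: hT)
    finally show ?thesis .
  qed
  define k where "k x = indicator F (foot F x) * \<psi> (foot F x)" for x
  have km [measurable]: "k \<in> borel_measurable borel" unfolding k_def by measurable
  have kB: "\<bar>k x\<bar> \<le> B" for x
    using B facet_subset[OF F] by (auto simp: k_def \<psi>_def indicator_def)
  have uB: "\<bar>u n x\<bar> \<le> B" for n x
  proof -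
    have "\<bar>u n x\<bar> \<le> 1 * (1 * B)"
      unfolding u_def abs_mult using B strip_prod_range
      by (intro mult_mono) (auto simp: indicator_def \<psi>_def)
    then show ?thesis by simp
  qed
  obtain R where R: "\<And>x. x \<in> closure P \<Longrightarrow> norm x \<le> R"
    using compact_imp_bounded[OF compact_closure_P] by (auto simp: bounded_iff)
  define D where "D = cball (0 :: real ^ 'n) (R + 2 * norm (transversal F))"
  have inD: "x \<in> D" if "\<bar>height F x\<bar> \<le> 2" "y \<in> closure P" "y = x - s *\<^sub>R transversal F" "\<bar>s\<bar> \<le> 2" for x y s
  proof -
    have "norm x \<le> norm y + \<bar>s\<bar> * norm (transversal F)"
      using norm_triangle_ineq[of y "s *\<^sub>R transversal F"] that by simp
    also have "\<dots> \<le> R + 2 * norm (transversal F)"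
      using that by (intro add_mono R mult_right_mono) auto
    finally show ?thesis by (simp add: D_def)
  qed
  have lim: "(\<lambda>n. \<integral>x. hat (height F x) * u n (T n x) \<partial>lborel) \<longlonglongrightarrow> (\<integral>x. hat (height F x) * k x \<partial>lborel)"
  proof (rule integral_dominated_convergence)
    show "integrable lborel (\<lambda>x. indicator D x *\<^sub>R B)"
      using emeasure_bounded_finite[of D] by (simp add: D_def)
    show "AE x in lborel. norm (hat (height F x) * u n (T n x)) \<le> indicator D x *\<^sub>R B" for n
    proof (intro AE_I2)
      fix x
      show "norm (hat (height F x) * u n (T n x)) \<le> indicator D x *\<^sub>R B"
      proof (cases "hat (height F x) * u n (T n x) = 0")
        case True
        show ?thesis using B(1) by (simp only: True norm_zero) (simp add: indicator_def)
      next
        case False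
        then have h: "0 < height F x" "height F x < 2"
          using hat_le_0[of "height F x"] hat_ge_2[of "height F x"] by (auto simp: not_less[symmetric])
        have TP: "T n x \<in> closure P" using False closure_subset[of P] by (auto simp: u_def indicator_def split: if_splits)
        have "T n x = x - (height F x - e n * height F x) *\<^sub>R transversal F"
          by (simp add: T_def foot_def algebra_simps)
        moreover have "\<bar>height F x - e n * height F x\<bar> \<le> 2"
        proof -
          have "0 \<le> e n * height F x" "e n * height F x \<le> 1 * height F x"
            using e[of n] h by (auto intro: mult_right_mono)
          then show ?thesis using h by simp
        qed
        ultimately have "x \<in> D" using h TP by (intro inD[of x "T n x"]) auto
        moreover have "\<bar>hat (height F x)\<bar> * \<bar>u n (T n x)\<bar> \<le> 1 * B"
          using uB hat_range B(1) by (intro mult_mono) auto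
        ultimately show ?thesis by (simp add: abs_mult)
      qed
    qed
    have "AE x in lborel. \<forall>G\<in>I. height G (foot F x) \<noteq> 0"
      unfolding I_def using AE_foot_height_neq_0[OF F] finite_facets
      by (intro eventually_ball_finite) auto
    then show "AE x in lborel. (\<lambda>n. hat (height F x) * u n (T n x)) \<longlonglongrightarrow> hat (height F x) * k x"
    proof (rule AE_mp, intro AE_I2 impI)
      fix x assume nz: "\<forall>G\<in>I. height G (foot F x) \<noteq> 0"
      have hlim: "(\<lambda>n. height G (T n x)) \<longlonglongrightarrow> height G (foot F x)" for G
        using continuous_on_tendsto_compose[OF continuous_height[of UNIV G] T0] by simp
      show "(\<lambda>n. hat (height F x) * u n (T n x)) \<longlonglongrightarrow> hat (height F x) * k x"
      proof (cases "height F x > 0")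
        case False
        then show ?thesis by (simp add: hat_le_0)
      next
        case hpos: True
        have "(\<lambda>n. u n (T n x)) \<longlonglongrightarrow> k x"
        proof (cases "\<forall>G\<in>I. height G (foot F x) > 0")
          case True
          have fc: "foot F x \<in> closure P"
            unfolding mem_closure_iff
          proof
            fix G assume "G \<in> facets P"
            then show "height G (foot F x) \<ge> 0"
              using True height_foot[OF F] by (cases "G = F") (auto simp: I_def less_imp_le)
          qed
          then have fF: "foot F x \<in> F" using mem_facet_iff[OF F] height_foot[OF F] by simp
          have ev1: "\<forall>\<^sub>F n in sequentially. \<forall>G\<in>I. height G (T n x) > 0"
            using True finite_facets order_tendstoD(1)[OF hlim]
            by (intro eventually_ball_finite) (auto simp: I_def)
          then have evP: "\<forall>\<^sub>F n in sequentially. T n x \<in> P"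
          proof eventually_elim
            case (elim n)
            have "height F (T n x) > 0" using hpos e[of n] by (simp add: hT)
            then show ?case unfolding mem_P_iff using elim by (auto simp: I_def)
          qed
          have ev2: "\<forall>\<^sub>F n in sequentially. strip_prod (e n) I (T n x) = 1"
            unfolding strip_prod_def
          proof (rule prod_eventually_1)
            show "finite I" using finite_facets by (simp add: I_def)
            fix G assume G: "G \<in> I"
            define c where "c = height G (foot F x)"
            have c: "c > 0" using True G by (simp add: c_def)
            have "\<forall>\<^sub>F n in sequentially. height G (T n x) > c / 2"
              using order_tendstoD(1)[OF hlim, of "c / 2" G] c by (simp add: c_def)
            moreover have "\<forall>\<^sub>F n in sequentially. e n < c / 4"
              using order_tendstoD(2)[OF e0, of "c / 4"] c by simp
            ultimately show "\<forall>\<^sub>F n in sequentially. cutoff (height G (T n x) / e n) = 1"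
            proof eventually_elim
              case (elim n)
              then have "height G (T n x) / e n \<ge> 2" using e(1)[of n] by (simp add: field_simps)
              then show ?case by (rule cutoff_ge_2)
            qed
          qed
          have "\<forall>\<^sub>F n in sequentially. \<phi> (T n x) = u n (T n x)"
            using ev2 evP by eventually_elim (use closure_subset[of P] in \<open>auto simp: u_def \<psi>_def indicator_def\<close>)
          moreover have "(\<lambda>n. \<phi> (T n x)) \<longlonglongrightarrow> \<phi> (foot F x)"
            using evP closure_subset[of P]
            by (intro continuous_on_tendsto_compose[OF \<phi> T0 fc]) (auto elim: eventually_mono)
          ultimately have "(\<lambda>n. u n (T n x)) \<longlonglongrightarrow> \<phi> (foot F x)"
            by (rule Lim_transform_eventually[rotated])
          then show ?thesis using fF fc by (simp add: k_def \<psi>_def)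
        next
          case False
          then obtain G where G: "G \<in> I" "height G (foot F x) < 0" using nz by (auto simp: not_less le_less)
          have "foot F x \<notin> F"
            using G height_nonneg[of G "foot F x"] facet_subset[OF F] by (auto simp: I_def)
          moreover have "\<forall>\<^sub>F n in sequentially. 0 = u n (T n x)"
            using order_tendstoD(2)[OF hlim G(2)]
          proof eventually_elim
            case (elim n)
            then have "cutoff (height G (T n x) / e n) = 0"
              using e(1)[of n] by (intro cutoff_le_0) (simp add: divide_nonpos_pos)
            then have "strip_prod (e n) I (T n x) = 0"
              unfolding strip_prod_def using G finite_facets by (intro prod_zero) (auto simp: I_def)
            then show ?case by (simp add: u_def)
          qed
          then have "(\<lambda>n. u n (T n x)) \<longlonglongrightarrow> 0" by (rule Lim_transform_eventually[OF tendsto_const])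
          ultimately show ?thesis by (simp add: k_def)
        qed
        then show ?thesis by (intro tendsto_intros)
      qed
    qed
  qed measurable
  have "(\<integral>x. hat (height F x) * k x \<partial>lborel) = facet_int F \<phi>"
  proof -
    have kt: "k (x + t *\<^sub>R transversal F) = k x" for x t by (simp add: k_def foot_translate[OF F])
    define A where "A x = indicator {x. 0 \<le> height F x \<and> height F x \<le> 1} x * (hat (height F x) * k x)" for x
    define C where "C x = indicator {x. 0 \<le> height F x \<and> height F x \<le> 1} x * (hat (height F x + 1) * k x)" for x
    have Am: "A \<in> borel_measurable borel" unfolding A_def by measurable
    have Cm: "C \<in> borel_measurable borel" unfolding C_def by measurable
    have bound: "\<bar>A x\<bar> \<le> indicator D x * B \<and> \<bar>C x\<bar> \<le> indicator D x * B" for x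
    proof (cases "0 \<le> height F x \<and> height F x \<le> 1 \<and> foot F x \<in> F")
      case False
      then show ?thesis using B(1) by (auto simp: A_def C_def k_def indicator_def)
    next
      case True
      then have "x \<in> D" using facet_subset[OF F] by (intro inD[of x "foot F x" "height F x"]) (auto simp: foot_def)
      moreover have "\<bar>hat t\<bar> * \<bar>k x\<bar> \<le> 1 * B" for t
        using kB hat_range B(1) by (intro mult_mono) auto
      ultimately show ?thesis using B(1) by (auto simp: A_def C_def indicator_def abs_mult)
    qed
    have Dint: "integrable lborel (\<lambda>x. indicator D x * B)"
      using emeasure_bounded_finite[of D] by (simp add: D_def)
    have Aint: "integrable lborel A"
      by (rule Bochner_Integration.integrable_bound[OF Dint]) (use Am bound in \<open>auto intro: order_trans[OF _ abs_ge_self]\<close>)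
    have Cint: "integrable lborel C"
      by (rule Bochner_Integration.integrable_bound[OF Dint]) (use Cm bound in \<open>auto intro: order_trans[OF _ abs_ge_self]\<close>)
    have Csh: "(\<integral>x. C (x + (- 1) *\<^sub>R transversal F) \<partial>lborel) = (\<integral>x. C x \<partial>lborel)"
      by (rule integral_translate[OF Cm])
    have Cshint: "integrable lborel (\<lambda>x. C (x + (- 1) *\<^sub>R transversal F))"
    proof -
      have "integrable (distr lborel borel ((+) ((- 1) *\<^sub>R transversal F))) C"
        using Cint by (simp add: lborel_distr_plus)
      then show ?thesis by (subst (asm) integrable_distr_eq) (use Cm in \<open>auto simp: add.commute\<close>)
    qed
    have ae: "AE x in lborel. hat (height F x) * k x = A x + C (x + (- 1) *\<^sub>R transversal F)"
    proof -
      have "AE x in lborel. \<nu> F \<bullet> x + (height F 0 - 1) \<noteq> 0"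
        using label_ne[OF F] by (intro AE_affine_neq_0) simp
      then show ?thesis
      proof (rule AE_mp, intro AE_I2 impI)
        fix x assume "\<nu> F \<bullet> x + (height F 0 - 1) \<noteq> 0"
        then have h1: "height F x \<noteq> 1" by (auto simp: height_def)
        have "C (x + (- 1) *\<^sub>R transversal F) = indicator {x. 1 \<le> height F x \<and> height F x \<le> 2} x * (hat (height F x) * k x)"
          unfolding C_def kt by (auto simp: indicator_def height_translate[OF F, of x "- 1", simplified])
        then show "hat (height F x) * k x = A x + C (x + (- 1) *\<^sub>R transversal F)"
          using h1 hat_le_0[of "height F x"] hat_ge_2[of "height F x"]
          by (cases "height F x \<le> 0"; cases "height F x \<ge> 2") (auto simp: A_def indicator_def)
      qed
    qed
    have "(\<integral>x. hat (height F x) * k x \<partial>lborel) = (\<integral>x. A x + C (x + (- 1) *\<^sub>R transversal F) \<partial>lborel)"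
      by (rule integral_cong_AE[OF _ _ ae]) (use Aint Cshint in \<open>auto intro: borel_measurable_integrable\<close>)
    also have "\<dots> = (\<integral>x. A x \<partial>lborel) + (\<integral>x. C x \<partial>lborel)"
      using Aint Cshint Csh by simp
    also have "\<dots> = (\<integral>x. A x + C x \<partial>lborel)" using Aint Cint by simp
    also have "\<dots> = (\<integral>x. indicator (slab F) x * \<phi> (foot F x) \<partial>lborel)"
    proof (rule Bochner_Integration.integral_cong[OF refl])
      fix x
      show "A x + C x = indicator (slab F) x * \<phi> (foot F x)"
      proof (cases "x \<in> slab F")
        case True
        then have "A x + C x = (hat (height F x) + hat (height F x + 1)) * k x"
          by (simp add: A_def C_def slab_def algebra_simps)
        then show ?thesis using True hat_partition[of "height F x"] facet_subset[OF F]
          by (auto simp: slab_def k_def \<psi>_def)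
      next
        case False
        then show ?thesis by (auto simp: A_def C_def slab_def k_def indicator_def)
      qed
    qed
    also have "\<dots> = facet_int F \<phi>" by (rule facet_int_slab(1)[OF F \<phi>, symmetric])
    finally show ?thesis .
  qed
  then show ?thesis using lim unfolding eq[symmetric] I_def by simp
qed

lemma closure_integrable:
  assumes "continuous_on (closure P) (g :: real ^ 'n \<Rightarrow> real)"
  shows "set_integrable lborel P g"
proof -
  have "set_integrable lborel (closure P) g"
    unfolding set_integrable_def by (rule borel_integrable_compact[OF compact_closure_P assms])
  then show ?thesis
    by (rule set_integrable_subset) (use P_open closure_subset in auto)
qed

lemma DERIV_strip_prod:
  assumes e: "\<epsilon> \<noteq> 0" and I: "finite I"
  shows "((\<lambda>t. strip_prod \<epsilon> I (x + t *\<^sub>R w)) has_real_derivative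
     (\<Sum>F\<in>I. (\<nu> F \<bullet> w) * (hat (height F x / \<epsilon>) / \<epsilon> * strip_prod \<epsilon> (I - {F}) x))) (at 0)"
proof -
  have "((\<lambda>t. cutoff (height F (x + t *\<^sub>R w) / \<epsilon>)) has_real_derivative
      hat (height F (x + 0 *\<^sub>R w) / \<epsilon>) * ((\<nu> F \<bullet> w) / \<epsilon>)) (at 0)" for F
  proof (rule DERIV_chain2[OF DERIV_cutoff])
    show "((\<lambda>t. height F (x + t *\<^sub>R w) / \<epsilon>) has_real_derivative (\<nu> F \<bullet> w) / \<epsilon>) (at 0)"
      unfolding height_add using e by (auto intro!: derivative_eq_intros)
  qed
  from has_field_derivative_prod[of I, OF this]
  have "((\<lambda>t. \<Prod>F\<in>I. cutoff (height F (x + t *\<^sub>R w) / \<epsilon>)) has_real_derivative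
     (\<Sum>F\<in>I. (hat (height F (x + 0 *\<^sub>R w) / \<epsilon>) * ((\<nu> F \<bullet> w) / \<epsilon>)) * (\<Prod>G\<in>I - {F}. cutoff (height G (x + 0 *\<^sub>R w) / \<epsilon>)))) (at 0)" .
  then show ?thesis by (simp add: strip_prod_def mult_ac)
qed

text \<open>
  Multiplied by the product of the cutoffs at distance \<open>\<epsilon>\<close> from the facets, \<open>\<phi>\<close> has compact support in \<open>P\<close>,
  so the integral of its derivative vanishes. By the product rule this is the integral of the
  derivative of \<open>\<phi>\<close> plus one strip integral for each facet, and \<open>\<epsilon>\<close> tends to 0.
\<close>

theorem divergence_theorem:
  assumes U: "open U" "closure P \<subseteq> U" and \<phi>: "C_k_on 1 U \<phi>"
  shows "(LINT x:P|lborel. dderiv w \<phi> x) = - (\<Sum>F\<in>facets P. (\<nu> F \<bullet> w) * facet_int F \<phi>)"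
proof -
  have \<phi>c: "continuous_on U \<phi>" "continuous_on U (dderiv w \<phi>)"
    using C_k_on_imp_continuous[OF \<phi>] \<phi> by (auto simp: C_k_on_Suc One_nat_def)
  have \<phi>cl: "continuous_on (closure P) \<phi>" "continuous_on (closure P) (dderiv w \<phi>)"
    using \<phi>c U(2) continuous_on_subset by blast+
  have \<phi>d: "((\<lambda>t. \<phi> (x + t *\<^sub>R w)) has_real_derivative dderiv w \<phi> x) (at 0)" if x: "x \<in> U" for x
  proof -
    have hd: "(\<phi> has_derivative (\<lambda>v. dderiv v \<phi> x)) (at x)"
      using C_k_on_Suc_has_derivative[of 0 U \<phi> x] \<phi> x by simp
    have "((\<lambda>t. x + t *\<^sub>R w) has_derivative (\<lambda>h. h *\<^sub>R w)) (at 0)"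
      by (auto intro!: derivative_eq_intros)
    moreover have "(\<phi> has_derivative (\<lambda>v. dderiv v \<phi> x)) (at (x + 0 *\<^sub>R w))" using hd by simp
    ultimately have "((\<lambda>t. \<phi> (x + t *\<^sub>R w)) has_derivative (\<lambda>h. dderiv (h *\<^sub>R w) \<phi> x)) (at 0)"
      by (rule has_derivative_compose)
    moreover have "(\<lambda>h. dderiv (h *\<^sub>R w) \<phi> x) = (*) (dderiv w \<phi> x)"
      by (rule ext) (simp add: linear_scale[OF has_derivative_linear[OF hd]])
    ultimately show ?thesis by (simp only: has_field_derivative_def)
  qed
  have Z: "strip_prod \<epsilon> (facets P) x = 0"
       "F \<in> facets P \<Longrightarrow> hat (height F x / \<epsilon>) * strip_prod \<epsilon> (facets P - {F}) x = 0"
    if "x \<notin> P" "\<epsilon> > 0" for \<epsilon> x F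
  proof -
    have "\<not> (\<forall>G\<in>facets P. height G x > 0)" using that(1) mem_P_iff[of x] by blast
    then obtain G where G: "G \<in> facets P" "height G x \<le> 0" by (auto simp: not_less)
    have c: "cutoff (height G x / \<epsilon>) = 0" "hat (height G x / \<epsilon>) = 0"
      using G that by (auto intro!: cutoff_le_0 hat_le_0 simp: divide_nonpos_pos)
    show "strip_prod \<epsilon> (facets P) x = 0"
      unfolding strip_prod_def using G c finite_facets by (intro prod_zero) auto
    show "hat (height F x / \<epsilon>) * strip_prod \<epsilon> (facets P - {F}) x = 0" if "F \<in> facets P"
    proof (cases "F = G")
      case False
      then have "strip_prod \<epsilon> (facets P - {F}) x = 0"
        unfolding strip_prod_def using G c finite_facets by (intro prod_zero) auto
      then show ?thesis by simp
    qed (simp add: c)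
  qed
  define q where "q \<epsilon> F x = hat (height F x / \<epsilon>) / \<epsilon> * strip_prod \<epsilon> (facets P - {F}) x" for \<epsilon> F x
  have q0: "q \<epsilon> F x = 0" if "x \<notin> P" "\<epsilon> > 0" "F \<in> facets P" for \<epsilon> F x
    using Z(2)[OF that] by (auto simp: q_def)
  have qc: "continuous_on S (q \<epsilon> F)" for S \<epsilon> F
    unfolding q_def[abs_def] divide_inverse
    by (intro continuous_on_mult continuous_strip_prod continuous_on_const
        continuous_on_compose2[OF continuous_hat] continuous_height) auto
  have ident: "(LINT x:P|lborel. strip_prod \<epsilon> (facets P) x * dderiv w \<phi> x) +
     (\<Sum>F\<in>facets P. (\<nu> F \<bullet> w) * (\<integral>x. indicator P x * (q \<epsilon> F x * \<phi> x) \<partial>lborel)) = 0" if e: "\<epsilon> > 0" for \<epsilon>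
  proof -
    let ?\<eta> = "strip_prod \<epsilon> (facets P)"
    define g0 where "g0 x = ?\<eta> x * dderiv w \<phi> x + (\<Sum>F\<in>facets P. (\<nu> F \<bullet> w) * q \<epsilon> F x) * \<phi> x" for x
    define Y where "Y x = (if x \<in> U then ?\<eta> x * \<phi> x else 0)" for x
    define g where "g x = (if x \<in> U then g0 x else 0)" for x
    have g00: "g0 x = 0" if "x \<notin> P" for x using that Z(1) q0 e by (simp add: g0_def)
    have gP: "g x = indicator P x * g0 x" for x
      using g00 U(2) closure_subset[of P] by (auto simp: g_def indicator_def)
    have "(\<integral>x. g x \<partial>lborel) = 0"
    proof (rule integral_directional_derivative[where Y = Y and w = w and S = "closure P"])
      show "continuous_on UNIV Y" unfolding Y_def
        by (rule continuous_extend_by_0[OF U(1) closed_closure U(2)])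
          (use \<phi>c Z(1) e closure_subset[of P] in \<open>auto intro!: continuous_on_mult continuous_strip_prod\<close>)
      show "continuous_on UNIV g" unfolding g_def
        by (rule continuous_extend_by_0[OF U(1) closed_closure U(2)])
          (use g00 closure_subset[of P] in \<open>auto simp: g0_def[abs_def] intro!: continuous_on_mult continuous_on_add continuous_on_sum
             continuous_on_const qc continuous_strip_prod \<phi>c\<close>)
      show "compact (closure P)" by (rule compact_closure_P)
      show "Y x = 0" if "x \<notin> closure P" for x
        using that Z(1) e closure_subset[of P] by (auto simp: Y_def)
      show "((\<lambda>t. Y (x + t *\<^sub>R w)) has_real_derivative g x) (at 0)" for x
      proof (cases "x \<in> U")
        case True
        have "((\<lambda>t. ?\<eta> (x + t *\<^sub>R w) * \<phi> (x + t *\<^sub>R w)) has_real_derivative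
           ((\<Sum>F\<in>facets P. (\<nu> F \<bullet> w) * q \<epsilon> F x) * \<phi> (x + 0 *\<^sub>R w) + dderiv w \<phi> x * ?\<eta> (x + 0 *\<^sub>R w))) (at 0)"
          unfolding q_def using e by (intro DERIV_mult DERIV_strip_prod finite_facets \<phi>d True) simp
        then have d: "((\<lambda>t. ?\<eta> (x + t *\<^sub>R w) * \<phi> (x + t *\<^sub>R w)) has_real_derivative g x) (at 0)"
          using True by (simp add: g_def g0_def algebra_simps)
        have "continuous_on UNIV (\<lambda>t. x + t *\<^sub>R w)" by (intro continuous_intros)
        then have "open {t. x + t *\<^sub>R w \<in> U}" using open_vimage[OF U(1)] by (simp add: vimage_def)
        then show ?thesis
          by (rule has_field_derivative_transform_within_open[OF d]) (use True in \<open>auto simp: Y_def\<close>)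
      next
        case False
        then have gx: "g x = 0" by (simp add: g_def)
        have "continuous_on UNIV (\<lambda>t. x + t *\<^sub>R w)" by (intro continuous_intros)
        then have "open {t. x + t *\<^sub>R w \<in> - closure P}"
          using open_vimage[OF open_Compl[OF closed_closure]] by (simp add: vimage_def)
        then show ?thesis unfolding gx
          by (rule has_field_derivative_transform_within_open[OF DERIV_const[of 0]])
            (use False U(2) Z(1) e closure_subset[of P] in \<open>auto simp: Y_def\<close>)
      qed
    qed
    moreover have "g x = indicator P x * (?\<eta> x * dderiv w \<phi> x) +
        (\<Sum>F\<in>facets P. (\<nu> F \<bullet> w) * (indicator P x * (q \<epsilon> F x * \<phi> x)))" for x
      by (simp add: gP g0_def sum_distrib_left sum_distrib_right algebra_simps)
    moreover have "integrable lborel (\<lambda>x. indicator P x * (?\<eta> x * dderiv w \<phi> x))"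
      using closure_integrable[OF continuous_on_mult[OF continuous_strip_prod \<phi>cl(2)]]
      by (simp add: set_integrable_def)
    moreover have "integrable lborel (\<lambda>x. indicator P x * (q \<epsilon> F x * \<phi> x))" for F
      using closure_integrable[OF continuous_on_mult[OF qc \<phi>cl(1)]]
      by (simp add: set_integrable_def)
    ultimately show ?thesis by (simp add: set_lebesgue_integral_def)
  qed
  define e where "e n = 1 / real (Suc n)" for n
  have e: "e n > 0" for n by (simp add: e_def)
  have e0: "e \<longlonglongrightarrow> 0" unfolding e_def using LIMSEQ_Suc[OF lim_const_over_n[of "1::real"]] by simp
  have "(\<lambda>n. LINT x:P|lborel. strip_prod (e n) (facets P) x * dderiv w \<phi> x) \<longlonglongrightarrow> (LINT x:P|lborel. dderiv w \<phi> x)"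
    unfolding set_lebesgue_integral_def
  proof (rule integral_dominated_convergence)
    have i: "integrable lborel (\<lambda>x. indicator P x *\<^sub>R dderiv w \<phi> x)"
      using closure_integrable[OF \<phi>cl(2)] by (simp add: set_integrable_def)
    then show "integrable lborel (\<lambda>x. norm (indicator P x *\<^sub>R dderiv w \<phi> x))" by (rule integrable_norm)
    show "(\<lambda>x. indicator P x *\<^sub>R dderiv w \<phi> x) \<in> borel_measurable lborel" using i by (rule borel_measurable_integrable)
    show "(\<lambda>x. indicator P x *\<^sub>R (strip_prod (e n) (facets P) x * dderiv w \<phi> x)) \<in> borel_measurable lborel" for n
      using closure_integrable[OF continuous_on_mult[OF continuous_strip_prod \<phi>cl(2)], of "e n" "facets P"]
      by (auto simp: set_integrable_def intro: borel_measurable_integrable)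
    show "AE x in lborel. norm (indicator P x *\<^sub>R (strip_prod (e n) (facets P) x * dderiv w \<phi> x))
        \<le> norm (indicator P x *\<^sub>R dderiv w \<phi> x)" for n
      using strip_prod_range by (intro AE_I2) (auto simp: indicator_def abs_mult intro!: mult_left_le_one_le)
    show "AE x in lborel. (\<lambda>n. indicator P x *\<^sub>R (strip_prod (e n) (facets P) x * dderiv w \<phi> x)) \<longlonglongrightarrow> indicator P x *\<^sub>R dderiv w \<phi> x"
    proof (intro AE_I2)
      fix x
      show "(\<lambda>n. indicator P x *\<^sub>R (strip_prod (e n) (facets P) x * dderiv w \<phi> x)) \<longlonglongrightarrow> indicator P x *\<^sub>R dderiv w \<phi> x"
      proof (cases "x \<in> P")
        case True
        have "\<forall>\<^sub>F n in sequentially. strip_prod (e n) (facets P) x = 1"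
          unfolding strip_prod_def
        proof (rule prod_eventually_1[OF finite_facets])
          fix G assume "G \<in> facets P"
          then have h: "height G x > 0" using True by (rule height_pos)
          then have "\<forall>\<^sub>F n in sequentially. e n < height G x / 2"
            using order_tendstoD(2)[OF e0, of "height G x / 2"] by simp
          then show "\<forall>\<^sub>F n in sequentially. cutoff (height G x / e n) = 1"
          proof eventually_elim
            case (elim n)
            then have "height G x / e n \<ge> 2" using e[of n] by (simp add: field_simps)
            then show ?case by (rule cutoff_ge_2)
          qed
        qed
        then have "\<forall>\<^sub>F n in sequentially. dderiv w \<phi> x = strip_prod (e n) (facets P) x * dderiv w \<phi> x"
          by eventually_elim simp
        then show ?thesis using True by (simp add: Lim_transform_eventually[OF tendsto_const])
      qed simp
    qed
  qed
  moreover have "(\<lambda>n. \<integral>x. indicator P x * (q (e n) F x * \<phi> x) \<partial>lborel) \<longlonglongrightarrow> facet_int F \<phi>" if "F \<in> facets P" for F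
    using strip_limit[OF that \<phi>cl(1)] by (simp add: q_def e_def mult_ac)
  ultimately have "(\<lambda>n. (LINT x:P|lborel. strip_prod (e n) (facets P) x * dderiv w \<phi> x) +
     (\<Sum>F\<in>facets P. (\<nu> F \<bullet> w) * (\<integral>x. indicator P x * (q (e n) F x * \<phi> x) \<partial>lborel)))
    \<longlonglongrightarrow> (LINT x:P|lborel. dderiv w \<phi> x) + (\<Sum>F\<in>facets P. (\<nu> F \<bullet> w) * facet_int F \<phi>)"
    by (intro tendsto_add tendsto_sum tendsto_mult tendsto_const) auto
  then have "(LINT x:P|lborel. dderiv w \<phi> x) + (\<Sum>F\<in>facets P. (\<nu> F \<bullet> w) * facet_int F \<phi>) = 0"
    unfolding ident[OF e] by (simp add: LIMSEQ_const_iff)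
  then show ?thesis by simp
qed

end

section \<open>Green's formula and the boundary conditions\<close>

definition hessian_trace :: "(real ^ 'n \<Rightarrow> real ^ 'n ^ 'n) \<Rightarrow> (real ^ 'n \<Rightarrow> real) \<Rightarrow> real ^ 'n \<Rightarrow> real" where
  "hessian_trace G f x =
     (\<Sum>i\<in>UNIV. \<Sum>j\<in>UNIV. G x $ i $ j * dderiv (axis j 1) (dderiv (axis i 1) f) x)"

definition row_divergence :: "(real ^ 'n \<Rightarrow> real ^ 'n ^ 'n) \<Rightarrow> 'n \<Rightarrow> real ^ 'n \<Rightarrow> real" where
  "row_divergence G i x = (\<Sum>j\<in>UNIV. dderiv (axis j 1) (\<lambda>y. G y $ i $ j) x)"

lemma smooth_row_divergence:
  "open U \<Longrightarrow> smooth_on U G \<Longrightarrow> smooth_on U (row_divergence G i)"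
  unfolding row_divergence_def[abs_def]
  by (intro smooth_on_sum smooth_on_dderiv smooth_on_matrix_entry)

lemma smooth_hessian_trace:
  "open U \<Longrightarrow> smooth_on U G \<Longrightarrow> smooth_on U f \<Longrightarrow> smooth_on U (hessian_trace G f)"
  unfolding hessian_trace_def[abs_def]
  by (intro smooth_on_sum smooth_on_mult smooth_on_dderiv smooth_on_matrix_entry)

lemma smooth_double_divergence:
  "open U \<Longrightarrow> smooth_on U G \<Longrightarrow> smooth_on U (double_divergence G)"
  unfolding double_divergence_def[abs_def]
  by (intro smooth_on_sum smooth_on_dderiv smooth_on_matrix_entry)

lemma double_divergence_row:
  assumes "open U" "smooth_on U G" "x \<in> U"
  shows "double_divergence G x = (\<Sum>i\<in>UNIV. dderiv (axis i 1) (row_divergence G i) x)"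
  unfolding double_divergence_def row_divergence_def[abs_def]
  by (intro sum.cong refl dderiv_sum[of UNIV U, symmetric] smooth_on_dderiv smooth_on_matrix_entry assms)

context labelled_simple_polytope
begin

lemma facet_int_sum:
  assumes "F \<in> facets P" "\<And>i. i \<in> I \<Longrightarrow> continuous_on (closure P) (g i)"
  shows "facet_int F (\<lambda>x. \<Sum>i\<in>I. g i x) = (\<Sum>i\<in>I. facet_int F (g i))"
  unfolding facet_int_def sum_distrib_left
  by (intro Bochner_Integration.integral_sum facet_int_slab(2) assms)

lemma facet_int_cmult: "facet_int F (\<lambda>x. c * g x) = c * facet_int F g"
proof -
  have "indicator F x * (c * g x) = c * (indicator F x * g x)" for x by simp
  then show ?thesis by (simp only: facet_int_def integral_mult_right_zero)
qed

lemma AE_rel_interior: "AE x in \<sigma>. \<forall>F\<in>facets P. x \<in> F \<longrightarrow> x \<in> rel_interior F"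
  using AE_unique_facet
proof (rule AE_mp, intro AE_I2 impI ballI)
  fix x F assume u: "\<forall>F\<in>facets P. \<forall>G\<in>facets P. x \<in> F \<longrightarrow> x \<in> G \<longrightarrow> F = G" and F: "F \<in> facets P" "x \<in> F"
  show "x \<in> rel_interior F"
  proof (rule rel_interior_facetI[OF F])
    fix G assume G: "G \<in> facets P" "G \<noteq> F"
    have xc: "x \<in> closure P" using facet_subset[OF F(1)] F(2) by blast
    have "x \<notin> G" using u F G by blast
    then show "height G x > 0"
      using mem_facet_iff[OF G(1)] height_nonneg[OF G(1) xc] xc by (auto simp: less_le)
  qed
qed

lemma facet_int_cong:
  assumes F: "F \<in> facets P" and g: "continuous_on (closure P) g" "continuous_on (closure P) h"
    and eq: "\<And>y. y \<in> rel_interior F \<Longrightarrow> g y = h y"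
  shows "facet_int F g = facet_int F h"
  unfolding facet_int_def
proof (rule integral_cong_AE)
  show "(\<lambda>x. indicator F x * g x) \<in> borel_measurable \<sigma>" "(\<lambda>x. indicator F x * h x) \<in> borel_measurable \<sigma>"
    using facet_int_slab(2)[OF F g(1)] facet_int_slab(2)[OF F g(2)] by (auto intro: borel_measurable_integrable)
  show "AE x in \<sigma>. indicator F x * g x = indicator F x * h x"
    using AE_rel_interior by eventually_elim (use F eq in \<open>auto simp: indicator_def\<close>)
qed

lemma smooth_continuous_closure:
  "closure P \<subseteq> U \<Longrightarrow> smooth_on U f \<Longrightarrow> continuous_on (closure P) f"
  by (rule continuous_on_subset[OF smooth_on_continuous])

lemma divergence_theorem_field:
  assumes U: "open U" "closure P \<subseteq> U" and X: "\<And>i. C_k_on 1 U (X i)"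
  shows "(LINT x:P|lborel. (\<Sum>i\<in>UNIV. dderiv (axis i 1) (X i) x)) =
     - (\<Sum>F\<in>facets P. facet_int F (\<lambda>x. \<Sum>i\<in>UNIV. \<nu> F $ i * X i x))"
proof -
  have c: "continuous_on (closure P) (X i)" for i
    using continuous_on_subset[OF C_k_on_imp_continuous[OF X] U(2)] .
  have cd: "continuous_on (closure P) (dderiv v (X i))" for v i
    using X[of i] U(2) by (auto simp: One_nat_def C_k_on_Suc intro: continuous_on_subset)
  have "(LINT x:P|lborel. (\<Sum>i\<in>UNIV. dderiv (axis i 1) (X i) x)) =
      (\<Sum>i\<in>UNIV. LINT x:P|lborel. dderiv (axis i 1) (X i) x)"
    unfolding set_lebesgue_integral_def scaleR_sum_right
    using closure_integrable[OF cd] unfolding set_integrable_def by (intro Bochner_Integration.integral_sum)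
  also have "\<dots> = - (\<Sum>i\<in>UNIV. \<Sum>F\<in>facets P. \<nu> F $ i * facet_int F (X i))"
    by (simp add: divergence_theorem[OF U X] inner_axis sum_negf)
  also have "(\<Sum>i\<in>UNIV. \<Sum>F\<in>facets P. \<nu> F $ i * facet_int F (X i)) =
      (\<Sum>F\<in>facets P. \<Sum>i\<in>UNIV. facet_int F (\<lambda>x. \<nu> F $ i * X i x))"
    by (subst sum.swap) (simp add: facet_int_cmult)
  also have "\<dots> = (\<Sum>F\<in>facets P. facet_int F (\<lambda>x. \<Sum>i\<in>UNIV. \<nu> F $ i * X i x))"
    by (intro sum.cong refl facet_int_sum[symmetric]) (auto intro!: continuous_on_mult continuous_on_const c)
  finally show ?thesis .
qed

lemma smooth_on_C_1: "smooth_on U f \<Longrightarrow> C_k_on 1 U f"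
  by (rule smooth_on_C_k)

text \<open>
  The divergence theorem, applied twice: to \<open>f\<close> times the row divergences of \<open>G\<close> and to the product of
  \<open>G\<close> with the gradient of \<open>f\<close>.
\<close>

lemma green_formula:
  assumes U: "open U" "closure P \<subseteq> U" and G: "smooth_on U G" and f: "smooth_on U f"
  shows "(LINT x:P|lborel. f x * double_divergence G x) = (LINT x:P|lborel. hessian_trace G f x)
     - (\<Sum>F\<in>facets P. facet_int F (\<lambda>x. f x * (\<Sum>i\<in>UNIV. \<nu> F $ i * row_divergence G i x)))
     + (\<Sum>F\<in>facets P. facet_int F (\<lambda>x. \<Sum>j\<in>UNIV. \<nu> F $ j * (\<Sum>i\<in>UNIV. G x $ i $ j * dderiv (axis i 1) f x)))"
proof -
  note entry = smooth_on_matrix_entry[OF U(1) G]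
  note row = smooth_row_divergence[OF U(1) G]
  define Y where "Y i x = f x * row_divergence G i x" for i x
  define Z where "Z j x = (\<Sum>i\<in>UNIV. G x $ i $ j * dderiv (axis i 1) f x)" for j x
  have smY: "smooth_on U (Y i)" for i unfolding Y_def by (intro smooth_on_mult U f row)
  have smZ: "smooth_on U (Z j)" for j unfolding Z_def
    by (intro smooth_on_sum smooth_on_mult smooth_on_dderiv U f entry)
  have pt: "f x * double_divergence G x = (\<Sum>i\<in>UNIV. dderiv (axis i 1) (Y i) x)
      - (\<Sum>j\<in>UNIV. dderiv (axis j 1) (Z j) x) + hessian_trace G f x" if x: "x \<in> U" for x
  proof -
    have Y: "(\<Sum>i\<in>UNIV. dderiv (axis i 1) (Y i) x) = f x * double_divergence G x +
       (\<Sum>i\<in>UNIV. dderiv (axis i 1) f x * row_divergence G i x)"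
      unfolding Y_def[abs_def] dderiv_mult[OF f row x] double_divergence_row[OF U(1) G x]
      by (simp add: sum.distrib sum_distrib_left)
    have "dderiv (axis j 1) (Z j) x = (\<Sum>i\<in>UNIV. G x $ i $ j * dderiv (axis j 1) (dderiv (axis i 1) f) x +
        dderiv (axis j 1) (\<lambda>y. G y $ i $ j) x * dderiv (axis i 1) f x)" for j
      unfolding Z_def[abs_def]
      by (subst dderiv_sum[of _ U]) (auto intro!: smooth_on_mult smooth_on_dderiv U f entry x sum.cong
          dderiv_mult[OF entry smooth_on_dderiv[OF f] x])
    then have "(\<Sum>j\<in>UNIV. dderiv (axis j 1) (Z j) x) =
       (\<Sum>j\<in>UNIV. \<Sum>i\<in>UNIV. G x $ i $ j * dderiv (axis j 1) (dderiv (axis i 1) f) x) +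
       (\<Sum>j\<in>UNIV. \<Sum>i\<in>UNIV. dderiv (axis j 1) (\<lambda>y. G y $ i $ j) x * dderiv (axis i 1) f x)"
      by (simp add: sum.distrib)
    also have "(\<Sum>j\<in>UNIV. \<Sum>i\<in>UNIV. G x $ i $ j * dderiv (axis j 1) (dderiv (axis i 1) f) x) = hessian_trace G f x"
      unfolding hessian_trace_def by (rule sum.swap)
    also have "(\<Sum>j\<in>UNIV. \<Sum>i\<in>UNIV. dderiv (axis j 1) (\<lambda>y. G y $ i $ j) x * dderiv (axis i 1) f x) =
        (\<Sum>i\<in>UNIV. dderiv (axis i 1) f x * row_divergence G i x)"
      by (subst sum.swap) (simp add: row_divergence_def sum_distrib_left mult.commute)
    finally show ?thesis using Y by simp
  qed
  have smdY: "smooth_on U (\<lambda>x. \<Sum>i\<in>UNIV. dderiv (axis i 1) (Y i) x)"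
    "smooth_on U (\<lambda>x. \<Sum>j\<in>UNIV. dderiv (axis j 1) (Z j) x)"
    by (intro smooth_on_sum smooth_on_dderiv U smY smZ)+
  note ci = closure_integrable[OF smooth_continuous_closure[OF U(2)]]
  note i = ci[OF smdY(1)] ci[OF smdY(2)] ci[OF smooth_hessian_trace[OF U(1) G f]]
  have "(LINT x:P|lborel. f x * double_divergence G x) = (LINT x:P|lborel. (\<Sum>i\<in>UNIV. dderiv (axis i 1) (Y i) x)
      - (\<Sum>j\<in>UNIV. dderiv (axis j 1) (Z j) x) + hessian_trace G f x)"
    by (rule set_lebesgue_integral_cong) (use P_open pt U(2) closure_subset[of P] in auto)
  also have "\<dots> = (LINT x:P|lborel. (\<Sum>i\<in>UNIV. dderiv (axis i 1) (Y i) x))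
      - (LINT x:P|lborel. (\<Sum>j\<in>UNIV. dderiv (axis j 1) (Z j) x)) + (LINT x:P|lborel. hessian_trace G f x)"
    using i by (simp add: set_integral_add set_integral_diff)
  also have "(LINT x:P|lborel. (\<Sum>i\<in>UNIV. dderiv (axis i 1) (Y i) x)) =
     - (\<Sum>F\<in>facets P. facet_int F (\<lambda>x. f x * (\<Sum>i\<in>UNIV. \<nu> F $ i * row_divergence G i x)))"
    by (subst divergence_theorem_field[OF U smooth_on_C_1[OF smY]])
      (simp add: Y_def sum_distrib_left mult.left_commute)
  also have "(LINT x:P|lborel. (\<Sum>j\<in>UNIV. dderiv (axis j 1) (Z j) x)) =
     - (\<Sum>F\<in>facets P. facet_int F (\<lambda>x. \<Sum>j\<in>UNIV. \<nu> F $ j * Z j x))"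
    by (rule divergence_theorem_field[OF U smooth_on_C_1[OF smZ]])
  finally show ?thesis by (simp add: Z_def)
qed

text \<open>
  The boundary conditions with \<open>c\<close> in place of the constant 2. The homogeneous conditions
  (\<open>c = 0\<close>) are those of the difference of two solutions.
\<close>

definition boundary_conditions_with :: "real \<Rightarrow> (real ^ 'n \<Rightarrow> real ^ 'n ^ 'n) \<Rightarrow> bool" where
  "boundary_conditions_with c H \<longleftrightarrow>
     (\<forall>F\<in>facets P. \<forall>y\<in>rel_interior F. (\<forall>w. \<nu> F \<bullet> (H y *v w) = 0) \<and>
        ((\<lambda>x. \<nu> F \<bullet> (H x *v \<nu> F)) has_derivative (\<lambda>w. c * (\<nu> F \<bullet> w))) (at y within closure P))"

lemma inner_matrix_axis:
  fixes A :: "real ^ 'n ^ 'n"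
  shows "u \<bullet> (A *v axis j 1) = (\<Sum>i\<in>UNIV. u $ i * A $ i $ j)"
  by (simp add: inner_vec_def matrix_vector_mult_basis column_def)

text \<open>
  On a facet the row \<open>\<nu> H\<close> vanishes, hence so do its derivatives along the facet; its divergence is
  therefore its transversal derivative paired with the label, which condition (ii) prescribes.
\<close>

lemma normal_row_divergence:
  assumes U: "open U" "closure P \<subseteq> U" and G: "smooth_on U G"
    and bc: "boundary_conditions_with c G" and F: "F \<in> facets P" and y: "y \<in> rel_interior F"
  shows "(\<Sum>i\<in>UNIV. \<nu> F $ i * row_divergence G i y) = c"
proof -
  note entry = smooth_on_matrix_entry[OF U(1) G]
  have yF: "y \<in> F" using y rel_interior_subset by blast
  have yc: "y \<in> closure P" using yF facet_subset[OF F] by blast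
  have yU: "y \<in> U" using yc U(2) by blast
  define N where "N j x = (\<Sum>i\<in>UNIV. \<nu> F $ i * G x $ i $ j)" for j x
  have smN: "smooth_on U (N j)" for j
    unfolding N_def by (intro smooth_on_sum smooth_on_mult smooth_on_const U entry)
  have N0: "N j z = 0" if "z \<in> rel_interior F" for j z
    using bc F that inner_matrix_axis[of "\<nu> F" "G z" j] unfolding boundary_conditions_with_def N_def by metis
  note lin = dderiv_linear[OF smN yU]
  have tangent: "dderiv w (N j) y = 0" if w: "\<nu> F \<bullet> w = 0" for w j
  proof -
    define W where "W = (\<Inter>A\<in>facets P - {F}. {z. height A z > 0})"
    have "open W" unfolding W_def using finite_facets
      by (intro open_INT finite_Diff ballI open_Collect_less continuous_on_const continuous_height)
    moreover have yW: "y \<in> W" using rel_interior_facet[OF F y] by (auto simp: W_def)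
    moreover have "continuous_on UNIV (\<lambda>t. y + t *\<^sub>R w)" by (intro continuous_intros)
    ultimately have op: "open {t. y + t *\<^sub>R w \<in> W}" using open_vimage by (force simp: vimage_def)
    have z: "N j (y + t *\<^sub>R w) = 0" if t: "y + t *\<^sub>R w \<in> W" for t
    proof (rule N0, rule rel_interior_facetI[OF F])
      show "height A (y + t *\<^sub>R w) > 0" if "A \<in> facets P" "A \<noteq> F" for A using that t by (auto simp: W_def)
      have h: "height F (y + t *\<^sub>R w) = 0" by (simp add: height_add w height_facet[OF F yF])
      have "y + t *\<^sub>R w \<in> closure P" unfolding mem_closure_iff
      proof
        fix A assume "A \<in> facets P"
        then show "0 \<le> height A (y + t *\<^sub>R w)" using t h by (cases "A = F") (auto simp: W_def less_imp_le)
      qed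
      then show "y + t *\<^sub>R w \<in> F" using mem_facet_iff[OF F] h by simp
    qed
    have "((\<lambda>t. N j (y + t *\<^sub>R w)) has_real_derivative 0) (at 0)"
      by (rule has_field_derivative_transform_within_open[OF DERIV_const[of 0] op]) (use yW z in auto)
    moreover have "((\<lambda>t. N j (y + t *\<^sub>R w)) has_real_derivative dderiv w (N j) y) (at 0)"
      using dderiv_line_real[OF smN[of j], of y 0 w UNIV] yU by simp
    ultimately show ?thesis using DERIV_unique by blast
  qed
  define \<alpha> where "\<alpha> j = dderiv (transversal F) (N j) y" for j
  have dN: "dderiv w (N j) y = \<alpha> j * (\<nu> F \<bullet> w)" for w j
  proof -
    have "dderiv (w - (\<nu> F \<bullet> w) *\<^sub>R transversal F) (N j) y = 0"
      by (rule tangent) (simp add: inner_diff_right label_transversal[OF F])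
    then show ?thesis
      using linear_diff[OF lin[of j], of w "(\<nu> F \<bullet> w) *\<^sub>R transversal F"] linear_scale[OF lin[of j], of "\<nu> F \<bullet> w" "transversal F"]
      by (simp add: \<alpha>_def)
  qed
  have "(\<Sum>i\<in>UNIV. \<nu> F $ i * row_divergence G i y) =
     (\<Sum>j\<in>UNIV. \<Sum>i\<in>UNIV. \<nu> F $ i * dderiv (axis j 1) (\<lambda>y. G y $ i $ j) y)"
    unfolding row_divergence_def sum_distrib_left by (rule sum.swap)
  also have "\<dots> = (\<Sum>j\<in>UNIV. dderiv (axis j 1) (N j) y)"
    unfolding N_def[abs_def]
    by (intro sum.cong refl, subst dderiv_sum[of _ U])
      (auto intro!: smooth_on_mult smooth_on_const U entry yU simp: dderiv_cmult[OF entry yU])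
  also have "\<dots> = (\<Sum>j\<in>UNIV. \<alpha> j * \<nu> F $ j)" by (simp add: dN inner_axis)
  also have "\<dots> = c"
  proof -
    obtain p where p: "p \<in> P" using P_ne by blast
    define w where "w = p - y"
    have w: "\<nu> F \<bullet> w > 0"
      using height_pos[OF F p] height_add[of F y w] height_facet[OF F yF] by (simp add: w_def)
    define \<phi> where "\<phi> x = (\<Sum>j\<in>UNIV. \<nu> F $ j * N j x)" for x
    have \<phi>: "(\<lambda>x. \<nu> F \<bullet> (G x *v \<nu> F)) = \<phi>"
    proof
      fix x
      have "\<nu> F \<bullet> (G x *v \<nu> F) = (\<Sum>i\<in>UNIV. \<Sum>j\<in>UNIV. \<nu> F $ i * (G x $ i $ j * \<nu> F $ j))"
        by (simp add: inner_vec_def matrix_vector_mult_def sum_distrib_left)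
      also have "\<dots> = (\<Sum>j\<in>UNIV. \<Sum>i\<in>UNIV. \<nu> F $ i * (G x $ i $ j * \<nu> F $ j))" by (rule sum.swap)
      also have "\<dots> = \<phi> x"
        unfolding \<phi>_def N_def sum_distrib_left by (intro sum.cong refl) (simp add: mult_ac)
      finally show "\<nu> F \<bullet> (G x *v \<nu> F) = \<phi> x" .
    qed
    have smp: "smooth_on U \<phi>" unfolding \<phi>_def by (intro smooth_on_sum smooth_on_mult smooth_on_const U smN)
    have "dderiv v \<phi> y = (\<Sum>j\<in>UNIV. \<alpha> j * \<nu> F $ j) * (\<nu> F \<bullet> v)" for v
    proof -
      have "dderiv v \<phi> y = (\<Sum>j\<in>UNIV. \<nu> F $ j * dderiv v (N j) y)"
        unfolding \<phi>_def[abs_def]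
        by (subst dderiv_sum[of _ U]) (auto intro!: smooth_on_mult smooth_on_const U smN yU simp: dderiv_cmult[OF smN yU])
      then show ?thesis unfolding dN sum_distrib_right by (simp only: mult_ac)
    qed
    then have d1: "(\<phi> has_derivative (\<lambda>v. (\<Sum>j\<in>UNIV. \<alpha> j * \<nu> F $ j) * (\<nu> F \<bullet> v))) (at y within closure P)"
      using has_derivative_at_withinI[OF smooth_on_has_derivative[OF smp yU]] by simp
    have d2: "(\<phi> has_derivative (\<lambda>v. c * (\<nu> F \<bullet> v))) (at y within closure P)"
      using bc F y unfolding boundary_conditions_with_def \<phi>[symmetric] by blast
    have line: "((\<lambda>t. y + t *\<^sub>R w) has_derivative (\<lambda>h. h *\<^sub>R w)) (at 0 within {0..1})"
      by (auto intro!: derivative_eq_intros)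
    have seg: "(\<lambda>t. y + t *\<^sub>R w) ` {0..1} \<subseteq> closure P"
    proof
      fix z assume "z \<in> (\<lambda>t. y + t *\<^sub>R w) ` {0..1}"
      then obtain t where "0 \<le> t" "t \<le> 1" "z = (1 - t) *\<^sub>R y + t *\<^sub>R p" by (auto simp: w_def algebra_simps)
      then show "z \<in> closure P"
        using convexD_alt[OF convex_closure_P yc, of p t] p closure_subset[of P] by auto
    qed
    have comp: "((\<lambda>t. \<phi> (y + t *\<^sub>R w)) has_derivative (\<lambda>h. a * (\<nu> F \<bullet> (h *\<^sub>R w)))) (at 0 within cbox 0 1)"
      if "(\<phi> has_derivative (\<lambda>v. a * (\<nu> F \<bullet> v))) (at y within closure P)" for a
      using has_derivative_in_compose[OF line, of \<phi> "\<lambda>v. a * (\<nu> F \<bullet> v)"] has_derivative_subset[OF that seg] by simp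
    have "(\<lambda>h. (\<Sum>j\<in>UNIV. \<alpha> j * \<nu> F $ j) * (\<nu> F \<bullet> (h *\<^sub>R w))) = (\<lambda>h. c * (\<nu> F \<bullet> (h *\<^sub>R w)))"
      by (rule frechet_derivative_unique_within_closed_interval[OF _ _ comp[OF d1] comp[OF d2]]) auto
    then have "(\<Sum>j\<in>UNIV. \<alpha> j * \<nu> F $ j) * (\<nu> F \<bullet> (1 *\<^sub>R w)) = c * (\<nu> F \<bullet> (1 *\<^sub>R w))" by (rule fun_cong)
    then show ?thesis using w by simp
  qed
  finally show ?thesis .
qed

text \<open>
  In Green's formula the boundary term with the gradient of \<open>f\<close> vanishes because the label is in the
  kernel of \<open>G\<close>, and in the other one the normal component of the row divergence is the constant \<open>c\<close>.
\<close>

lemma green_boundary_conditions: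
  assumes U: "open U" "closure P \<subseteq> U" and G: "smooth_on U G" "\<And>x. x \<in> U \<Longrightarrow> transpose (G x) = G x"
    and f: "smooth_on U f" and bc: "boundary_conditions_with c G"
  shows "(LINT x:P|lborel. f x * double_divergence G x) = (LINT x:P|lborel. hessian_trace G f x) - c * (\<integral>x. f x \<partial>\<sigma>)"
proof -
  note sc = smooth_continuous_closure[OF U(2)]
  note entry = smooth_on_matrix_entry[OF U(1) G(1)]
  note row = smooth_row_divergence[OF U(1) G(1)]
  have "facet_int F (\<lambda>x. f x * (\<Sum>i\<in>UNIV. \<nu> F $ i * row_divergence G i x)) = facet_int F (\<lambda>x. c * f x)"
    if F: "F \<in> facets P" for F
    by (rule facet_int_cong[OF F])
      (use normal_row_divergence[OF U G(1) bc F] in \<open>auto intro!: sc smooth_on_mult smooth_on_sum smooth_on_const U f row\<close>)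
  moreover have "facet_int F (\<lambda>x. \<Sum>j\<in>UNIV. \<nu> F $ j * (\<Sum>i\<in>UNIV. G x $ i $ j * dderiv (axis i 1) f x)) = 0"
    if F: "F \<in> facets P" for F
  proof -
    have "facet_int F (\<lambda>x. \<Sum>j\<in>UNIV. \<nu> F $ j * (\<Sum>i\<in>UNIV. G x $ i $ j * dderiv (axis i 1) f x)) = facet_int F (\<lambda>x. 0)"
    proof (rule facet_int_cong[OF F])
      fix y assume y: "y \<in> rel_interior F"
      have yU: "y \<in> U" using y rel_interior_subset[of F] facet_subset[OF F] U(2) by blast
      have sym: "G y $ i $ j = G y $ j $ i" for i j
        using G(2)[OF yU] by (metis transpose_def vec_lambda_beta)
      have N0: "(\<Sum>j\<in>UNIV. \<nu> F $ j * G y $ j $ i) = 0" for i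
        using bc F y inner_matrix_axis[of "\<nu> F" "G y" i] unfolding boundary_conditions_with_def by metis
      have "(\<Sum>j\<in>UNIV. \<nu> F $ j * (\<Sum>i\<in>UNIV. G y $ i $ j * dderiv (axis i 1) f y)) =
         (\<Sum>i\<in>UNIV. \<Sum>j\<in>UNIV. \<nu> F $ j * (G y $ i $ j * dderiv (axis i 1) f y))"
        unfolding sum_distrib_left by (rule sum.swap)
      also have "\<dots> = (\<Sum>i\<in>UNIV. (\<Sum>j\<in>UNIV. \<nu> F $ j * G y $ j $ i) * dderiv (axis i 1) f y)"
        unfolding sum_distrib_right by (intro sum.cong refl) (simp only: sym[of _ "_ :: 'n"] mult.assoc)
      finally show "(\<Sum>j\<in>UNIV. \<nu> F $ j * (\<Sum>i\<in>UNIV. G y $ i $ j * dderiv (axis i 1) f y)) = 0"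
        by (simp add: N0)
    qed (auto intro!: sc smooth_on_mult smooth_on_sum smooth_on_const smooth_on_dderiv U f entry)
    then show ?thesis by (simp add: facet_int_def)
  qed
  ultimately show ?thesis
    using green_formula[OF U G(1) f] boundary_integral(1)[OF sc[OF f]]
    by (simp add: facet_int_cmult sum_distrib_left)
qed

end

section \<open>Existence of formal solutions\<close>

lemma C_k_on_Un: "open U \<Longrightarrow> open V \<Longrightarrow> C_k_on k U f \<Longrightarrow> C_k_on k V f \<Longrightarrow> C_k_on k (U \<union> V) f"
  by (induction k arbitrary: f) (auto simp: C_k_on_Suc continuous_on_open_Un)

lemma smooth_on_Un: "open U \<Longrightarrow> open V \<Longrightarrow> smooth_on U f \<Longrightarrow> smooth_on V f \<Longrightarrow> smooth_on (U \<union> V) f"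
  by (simp add: smooth_on_def C_k_on_Un)

lemma double_divergence_0: "open U \<Longrightarrow> x \<in> U \<Longrightarrow> (\<And>y. y \<in> U \<Longrightarrow> K y = 0) \<Longrightarrow> double_divergence K x = 0"
proof -
  assume "open U" "x \<in> U" "\<And>y. y \<in> U \<Longrightarrow> K y = 0"
  then have "double_divergence K x = double_divergence (\<lambda>_. 0) x" by (intro double_divergence_cong[of U]) auto
  also have "\<dots> = 0"
  proof -
    have "dderiv v (\<lambda>y. 0 :: real) = (\<lambda>y. 0)" for v :: "real ^ 'a" by (intro ext) simp
    then show ?thesis by (simp add: double_divergence_def)
  qed
  finally show ?thesis .
qed

lemma double_divergence_sum:
  assumes "finite I" "\<And>i. i \<in> I \<Longrightarrow> smooth_on UNIV (K i)"
  shows "smooth_on UNIV (\<lambda>x. \<Sum>i\<in>I. K i x) \<and> double_divergence (\<lambda>x. \<Sum>i\<in>I. K i x) x = (\<Sum>i\<in>I. double_divergence (K i) x)"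
  using assms
proof (induction I)
  case empty
  then show ?case using double_divergence_0[of UNIV x "\<lambda>_. 0"] by (simp add: smooth_on_const)
next
  case (insert i I)
  then show ?case
    using double_divergence_add[of UNIV "K i" "\<lambda>x. \<Sum>i\<in>I. K i x" x] by (auto intro!: smooth_on_add)
qed

text \<open>Where \<open>F\<close> vanishes, the primitive vanishes to second order on its hyperplane.\<close>

lemma dderiv_primitive_hyperplane:
  assumes F: "smooth_on UNIV F" and y: "\<nu> \<bullet> y = b" "F y = 0"
  shows "dderiv v (primitive \<nu> b e F) y = 0"
proof -
  note M' = parametric_integral[OF F bounded_linear_primitive[of \<nu> e], where c = "\<lambda>_. 1" and a = 0 and b = 1
      and d = "b *\<^sub>R e" and x = y, OF continuous_on_const]
  have h: "((\<lambda>x. \<nu> \<bullet> x - b) has_derivative (\<lambda>v. \<nu> \<bullet> v)) (at y)"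
    by (auto intro!: derivative_eq_intros)
  have "integral {0..1} (\<lambda>t::real. 1 * F (y + t *\<^sub>R (- (\<nu> \<bullet> y) *\<^sub>R e + b *\<^sub>R e))) = 0"
    using y by simp
  then show ?thesis
    using dderivI[OF has_derivative_mult[OF h M'], of v] y by (simp add: primitive_def[abs_def])
qed

context labelled_simple_polytope
begin

text \<open>
  Every point of the closure is at positive height above the facets that miss some vertex \<open>v\<close>, namely a
  vertex of its smallest face; compactness makes this uniform.
\<close>

lemma uniform_vertex_distance:
  "\<exists>\<epsilon>>0. \<forall>x\<in>closure P. \<exists>v\<in>vertices. \<forall>F\<in>facets P - active v. height F x > \<epsilon>"
proof -
  define O' where "O' k = (\<Union>v\<in>vertices. \<Inter>F\<in>facets P - active v. {x. height F x > 1 / real (Suc k)})" for k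
  have op: "open (O' k)" for k unfolding O'_def using finite_facets
    by (intro open_UN ballI open_INT finite_Diff open_Collect_less continuous_on_const continuous_height)
  have mono: "O' k \<subseteq> O' m" if "k \<le> m" for k m
  proof -
    have "1 / real (Suc m) \<le> 1 / real (Suc k)" using that by (intro divide_left_mono) auto
    then have "height F x > 1 / real (Suc m)" if "height F x > 1 / real (Suc k)" for F x using that by linarith
    then show ?thesis unfolding O'_def by blast
  qed
  have "closure P \<subseteq> (\<Union>k\<in>UNIV. O' k)"
  proof
    fix x assume x: "x \<in> closure P"
    obtain v where v: "v \<in> vertices" "active x \<subseteq> active v" using vertex_of_smallest_face[OF x] by blast
    have "\<forall>\<^sub>F k in sequentially. \<forall>F\<in>facets P - active v. 1 / real (Suc k) < height F x"
    proof (intro eventually_ball_finite finite_Diff finite_facets ballI)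
      fix F assume "F \<in> facets P - active v"
      then have "height F x > 0" using inactive_pos[OF x] v(2) by blast
      then show "\<forall>\<^sub>F k in sequentially. 1 / real (Suc k) < height F x"
        using order_tendstoD(2)[OF LIMSEQ_Suc[OF lim_const_over_n[of "1::real"]]] by auto
    qed
    then obtain k where "\<forall>F\<in>facets P - active v. 1 / real (Suc k) < height F x"
      by (auto simp: eventually_sequentially)
    then show "x \<in> (\<Union>k\<in>UNIV. O' k)" using v(1) by (auto simp: O'_def)
  qed
  then obtain K where K: "finite K" "closure P \<subseteq> (\<Union>k\<in>K. O' k)"
    using compactE_image[OF compact_closure_P, of UNIV O'] op by metis
  define m where "m = Max (insert 0 K)"
  have "closure P \<subseteq> O' m"
  proof
    fix x assume "x \<in> closure P"
    then obtain k where "k \<in> K" "x \<in> O' k" using K(2) by blast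
    then show "x \<in> O' m" using mono[of k m] K(1) by (auto simp: m_def)
  qed
  then have "\<forall>x\<in>closure P. \<exists>v\<in>vertices. \<forall>F\<in>facets P - active v. height F x > 1 / real (Suc m)"
    unfolding O'_def by blast
  moreover have "1 / real (Suc m) > 0" by simp
  ultimately show ?thesis by blast
qed

text \<open>
  A partition of unity on the closure of \<open>P\<close> that is indexed by the vertices: near a facet only the
  vertices of this facet count. On the support of one of these functions \<open>P\<close> looks like an orthant.
\<close>

definition vertex_partition :: "real \<Rightarrow> (real ^ 'n \<Rightarrow> real ^ 'n \<Rightarrow> real) \<Rightarrow> bool" where
  "vertex_partition \<epsilon> \<omega> \<longleftrightarrow> (\<forall>v\<in>vertices. smooth_on UNIV (\<omega> v)) \<and>
     (\<forall>v\<in>vertices. \<forall>F\<in>facets P - active v. \<forall>x. height F x \<le> \<epsilon> \<longrightarrow> \<omega> v x = 0) \<and>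
     (\<forall>x\<in>closure P. (\<Sum>v\<in>vertices. \<omega> v x) = 1)"

text \<open>
  The functions are products of bumps in the heights of the facets away from the vertex. The
  normalizing denominator also contains terms that are positive only outside the closure, so that it
  vanishes nowhere.
\<close>

lemma vertex_partition_exists: "\<exists>\<epsilon>>0. \<exists>\<omega>. vertex_partition \<epsilon> \<omega>"
proof -
  obtain \<epsilon> where e: "\<epsilon> > 0" "\<And>x. x \<in> closure P \<Longrightarrow> \<exists>v\<in>vertices. \<forall>F\<in>facets P - active v. height F x > \<epsilon>"
    using uniform_vertex_distance by blast
  define w where "w v x = (\<Prod>F\<in>facets P - active v. half_bump (height F x + - \<epsilon>))" for v x
  define W where "W x = (\<Sum>v\<in>vertices. w v x) + (\<Sum>F\<in>facets P. half_bump (- 1 * height F x))" for x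
  have hb: "smooth_on UNIV (\<lambda>x. half_bump (height F x + c))" "smooth_on UNIV (\<lambda>x. half_bump (- 1 * height F x))" for F c
    by (rule smooth_on_compose_real[OF open_UNIV half_bump(1)];
        intro smooth_on_add smooth_on_mult smooth_on_const smooth_height open_UNIV)+
  have smw: "smooth_on UNIV (w v)" for v unfolding w_def by (intro smooth_on_prod hb open_UNIV)
  have smW: "smooth_on UNIV W" unfolding W_def
    by (intro smooth_on_add smooth_on_sum smw hb open_UNIV)
  have w0: "w v x \<ge> 0" for v x unfolding w_def by (intro prod_nonneg ballI half_bump(4))
  have pos: "W x > 0" for x
  proof (cases "x \<in> closure P")
    case True
    then obtain v where v: "v \<in> vertices" "\<forall>F\<in>facets P - active v. height F x > \<epsilon>" using e(2) by blast
    have "w v x > 0" unfolding w_def by (intro prod_pos ballI half_bump(3)) (use v in auto)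
    then have "(\<Sum>v\<in>vertices. w v x) > 0" using v(1) finite_vertices w0 by (intro sum_pos2[of _ v]) auto
    moreover have "(\<Sum>F\<in>facets P. half_bump (- 1 * height F x)) \<ge> 0" by (intro sum_nonneg half_bump(4))
    ultimately show ?thesis by (simp add: W_def)
  next
    case False
    then obtain F where F: "F \<in> facets P" "height F x < 0" using height_neg_outside by blast
    have "(\<Sum>F\<in>facets P. half_bump (- 1 * height F x)) > 0"
      using finite_facets F half_bump(4) by (intro sum_pos2[of _ F]) (auto intro: half_bump(3))
    moreover have "(\<Sum>v\<in>vertices. w v x) \<ge> 0" by (intro sum_nonneg w0)
    ultimately show ?thesis by (simp add: W_def)
  qed
  define \<omega> where "\<omega> v x = w v x * inverse (W x)" for v x
  have c1: "smooth_on UNIV (\<omega> v)" for v unfolding \<omega>_def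
    using pos by (intro smooth_on_mult smooth_on_inverse smw smW open_UNIV) (auto simp: less_le)
  have c2: "\<omega> v x = 0" if F: "F \<in> facets P - active v" and "height F x \<le> \<epsilon>" for v F x
  proof -
    have "half_bump (height F x + - \<epsilon>) = 0" using that by (intro half_bump(2)) auto
    then have "w v x = 0" unfolding w_def using F finite_facets by (intro prod_zero) auto
    then show ?thesis by (simp add: \<omega>_def)
  qed
  have c3: "(\<Sum>v\<in>vertices. \<omega> v x) = 1" if x: "x \<in> closure P" for x
  proof -
    have "(\<Sum>F\<in>facets P. half_bump (- 1 * height F x)) = 0"
      using height_nonneg[OF _ x] by (intro sum.neutral ballI half_bump(2)) auto
    then have "(\<Sum>v\<in>vertices. w v x) = W x" by (simp add: W_def)
    then show ?thesis using pos[of x] by (simp add: \<omega>_def sum_distrib_right[symmetric])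
  qed
  have "vertex_partition \<epsilon> \<omega>" unfolding vertex_partition_def
    by (intro conjI ballI allI impI) (rule c1, erule (1) c2, erule c3)
  then show ?thesis using e(1) by blast
qed

lemma inner_matrix_sum:
  fixes M :: "'i \<Rightarrow> real ^ 'n ^ 'n"
  shows "u \<bullet> ((\<Sum>i\<in>I. c i *\<^sub>R M i) *v w) = (\<Sum>i\<in>I. c i * (u \<bullet> (M i *v w)))"
  by (induction I rule: infinite_finite_induct)
    (auto simp: matrix_vector_mult_add_rdistrib inner_add_right scaleR_matrix_vector_assoc[symmetric])

lemma transpose_sum: "(\<And>i. i \<in> I \<Longrightarrow> transpose (M i) = M i) \<Longrightarrow> transpose (\<Sum>i\<in>I. M i) = (\<Sum>i\<in>I. M i :: real ^ 'n ^ 'n)"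
  by (simp add: transpose_def vec_eq_iff)

lemma transpose_scaleR_rank_one: "transpose (c *\<^sub>R rank_one e) = c *\<^sub>R rank_one e"
  by (simp add: transpose_def vec_eq_iff rank_one_def mult.commute)

text \<open>
  At a vertex the field \<open>\<Sum>\<^sub>F 2 h\<^sub>F e\<^sub>F \<otimes> e\<^sub>F\<close>, with \<open>e\<^sub>F\<close> the dual basis of the labels, satisfies the
  conditions on all the facets through the vertex; the partition of unity glues these fields.
\<close>

lemma boundary_conditions_solvable:
  "\<exists>H. smooth_on UNIV H \<and> (\<forall>x. transpose (H x) = H x) \<and> boundary_conditions_with 2 H"
proof -
  obtain \<epsilon> \<omega> where e: "\<epsilon> > 0" and part: "vertex_partition \<epsilon> \<omega>"
    using vertex_partition_exists by blast
  have \<omega>: "\<And>v. v \<in> vertices \<Longrightarrow> smooth_on UNIV (\<omega> v)"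
      "\<And>v F x. v \<in> vertices \<Longrightarrow> F \<in> facets P - active v \<Longrightarrow> height F x \<le> \<epsilon> \<Longrightarrow> \<omega> v x = 0"
      "\<And>x. x \<in> closure P \<Longrightarrow> (\<Sum>v\<in>vertices. \<omega> v x) = 1"
    using part unfolding vertex_partition_def by auto
  define M where "M v x = (\<Sum>F\<in>active v. (2 * height F x) *\<^sub>R rank_one (dual_vector v F))" for v x
  define H where "H x = (\<Sum>v\<in>vertices. \<omega> v x *\<^sub>R M v x)" for x
  have H': "H x = (\<Sum>v\<in>vertices. \<Sum>F\<in>active v. (\<omega> v x * (2 * height F x)) *\<^sub>R rank_one (dual_vector v F))" for x
    by (simp add: H_def M_def scaleR_sum_right)
  have fa: "finite (active v)" for v using finite_facets by (simp add: active_def)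
  have "smooth_on UNIV H" unfolding H'[abs_def]
    by (intro smooth_on_sum smooth_on_scaleR_const smooth_on_mult smooth_on_const smooth_height \<omega> open_UNIV)
  moreover have "transpose (H x) = H x" for x
    unfolding H' by (intro transpose_sum transpose_scaleR_rank_one)
  moreover have "boundary_conditions_with 2 H"
    unfolding boundary_conditions_with_def
  proof (intro ballI conjI allI)
    fix F y assume F: "F \<in> facets P" and y: "y \<in> rel_interior F"
    have yF: "y \<in> F" using y rel_interior_subset by blast
    have yc: "y \<in> closure P" and hy: "height F y = 0" using yF mem_facet_iff[OF F] by auto
    have Mv: "\<nu> F \<bullet> (M v x *v w) = 2 * height F x * (dual_vector v F \<bullet> w)" if v: "v \<in> vertices" "F \<in> active v" for v x w
    proof -
      have "\<nu> F \<bullet> (M v x *v w) = (\<Sum>G\<in>active v. 2 * height G x * ((dual_vector v G \<bullet> w) * (\<nu> F \<bullet> dual_vector v G)))"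
        unfolding M_def inner_matrix_sum by (simp add: rank_one_mult)
      also have "\<dots> = (\<Sum>G\<in>active v. if G = F then 2 * height F x * (dual_vector v F \<bullet> w) else 0)"
        by (rule sum.cong) (use v dual_vector in auto)
      finally show ?thesis using v fa by simp
    qed
    have Hw: "\<nu> F \<bullet> (H x *v w) = (\<Sum>v\<in>vertices. \<omega> v x * (2 * height F x * (dual_vector v F \<bullet> w)))"
      if x: "height F x \<le> \<epsilon>" for x w
    proof -
      have "\<omega> v x * (\<nu> F \<bullet> (M v x *v w)) = \<omega> v x * (2 * height F x * (dual_vector v F \<bullet> w))" if v: "v \<in> vertices" for v
        using Mv[OF v] \<omega>(2)[OF v _ x] F by (cases "F \<in> active v") auto
      then show ?thesis unfolding H_def inner_matrix_sum by (intro sum.cong) auto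
    qed
    show "\<nu> F \<bullet> (H y *v w) = 0" for w using Hw[of y w] e by (simp add: hy)
    have Hn: "\<nu> F \<bullet> (H x *v \<nu> F) = 2 * height F x" if x: "x \<in> closure P" "height F x \<le> \<epsilon>" for x
    proof -
      have "\<omega> v x * (2 * height F x * (dual_vector v F \<bullet> \<nu> F)) = 2 * height F x * \<omega> v x" if v: "v \<in> vertices" for v
        using dual_vector(1)[OF v, of F] \<omega>(2)[OF v _ x(2)] F by (cases "F \<in> active v") (auto simp: inner_commute)
      then have "\<nu> F \<bullet> (H x *v \<nu> F) = (\<Sum>v\<in>vertices. 2 * height F x * \<omega> v x)"
        unfolding Hw[OF x(2)] by (intro sum.cong) auto
      then show ?thesis using \<omega>(3)[OF x(1)] by (simp add: sum_distrib_left[symmetric])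
    qed
    have hd: "((\<lambda>x. 2 * height F x) has_derivative (\<lambda>w. 2 * (\<nu> F \<bullet> w))) (at y within closure P)"
      unfolding height_def[abs_def] by (auto intro!: derivative_eq_intros)
    have op: "open {x. height F x < \<epsilon>}" by (intro open_Collect_less continuous_height continuous_on_const)
    have yin: "y \<in> {x. height F x < \<epsilon>}" using hy e by simp
    obtain d where d: "d > 0" "ball y d \<subseteq> {x. height F x < \<epsilon>}" by (rule openE[OF op yin])
    show "((\<lambda>x. \<nu> F \<bullet> (H x *v \<nu> F)) has_derivative (\<lambda>w. 2 * (\<nu> F \<bullet> w))) (at y within closure P)"
    proof (rule has_derivative_transform_within[OF hd d(1) yc])
      fix x assume "x \<in> closure P" "dist x y < d"
      then show "2 * height F x = \<nu> F \<bullet> (H x *v \<nu> F)"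
        using Hn[of x] d(2) by (auto simp: dist_commute subset_iff)
    qed
  qed
  ultimately show ?thesis by blast
qed

text \<open>
  The fields that may be added to a solution of the boundary conditions.
\<close>

definition flat :: "(real ^ 'n \<Rightarrow> real ^ 'n ^ 'n) \<Rightarrow> bool" where
  "flat K \<longleftrightarrow> smooth_on UNIV K \<and> (\<forall>x. transpose (K x) = K x) \<and> boundary_conditions_with 0 K"

lemma boundary_conditions_add:
  "boundary_conditions_with c G \<Longrightarrow> boundary_conditions_with d H \<Longrightarrow> boundary_conditions_with (c + d) (\<lambda>x. G x + H x)"
  unfolding boundary_conditions_with_def
  by (auto simp: matrix_vector_mult_add_rdistrib inner_add_right distrib_right intro!: has_derivative_add)

lemma boundary_conditions_scaleR:
  "boundary_conditions_with c G \<Longrightarrow> boundary_conditions_with (a * c) (\<lambda>x. a *\<^sub>R G x)"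
  unfolding boundary_conditions_with_def
  by (auto simp: scaleR_matrix_vector_assoc[symmetric] mult.assoc intro!: has_derivative_mult_right)

lemma flat_add: "flat K \<Longrightarrow> flat L \<Longrightarrow> flat (\<lambda>x. K x + L x)"
  unfolding flat_def using boundary_conditions_add[of 0 K 0 L]
  by (auto intro!: smooth_on_add simp: transpose_def vec_eq_iff)

lemma flat_0: "flat (\<lambda>x. 0)"
  by (auto simp: flat_def boundary_conditions_with_def smooth_on_const transpose_def vec_eq_iff)

lemma flat_sum: "finite I \<Longrightarrow> (\<And>i. i \<in> I \<Longrightarrow> flat (K i)) \<Longrightarrow> flat (\<lambda>x. \<Sum>i\<in>I. K i x)"
  by (induction I rule: finite_induct) (auto intro: flat_0 flat_add)

lemma boundary_conditions_local:
  assumes F: "F \<in> facets P" and y: "y \<in> rel_interior F" and W: "open W" "y \<in> W"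
    and K: "\<And>x. x \<in> W \<Longrightarrow> K x = 0"
  shows "(\<forall>w. \<nu> F \<bullet> (K y *v w) = 0) \<and>
     ((\<lambda>x. \<nu> F \<bullet> (K x *v \<nu> F)) has_derivative (\<lambda>w. 0 * (\<nu> F \<bullet> w))) (at y within closure P)"
proof
  show "\<forall>w. \<nu> F \<bullet> (K y *v w) = 0" using K[OF W(2)] by simp
  have "((\<lambda>x. 0) has_derivative (\<lambda>w. 0 * (\<nu> F \<bullet> w))) (at y)" by simp
  then have "((\<lambda>x. \<nu> F \<bullet> (K x *v \<nu> F)) has_derivative (\<lambda>w. 0 * (\<nu> F \<bullet> w))) (at y)"
    by (rule has_derivative_transform_within_open[OF _ W]) (simp add: K)
  then show "((\<lambda>x. \<nu> F \<bullet> (K x *v \<nu> F)) has_derivative (\<lambda>w. 0 * (\<nu> F \<bullet> w))) (at y within closure P)"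
    by (rule has_derivative_at_withinI)
qed

lemma flat_compact_support:
  assumes "smooth_on UNIV K" "\<And>x. transpose (K x) = K x" "compact T" "T \<subseteq> P" "\<And>x. x \<notin> T \<Longrightarrow> K x = 0"
  shows "flat K"
  unfolding flat_def boundary_conditions_with_def
proof (intro conjI allI ballI assms)
  fix F y assume F: "F \<in> facets P" and y: "y \<in> rel_interior F"
  have "y \<notin> P" using y rel_interior_subset[of F] height_facet[OF F, of y] height_pos[OF F, of y] by auto
  then have "y \<in> - T" using assms(4) by auto
  from boundary_conditions_local[OF F y _ this, of K] compact_imp_closed[OF assms(3)] assms(5)
  show "\<nu> F \<bullet> (K y *v w) = 0"
    "((\<lambda>x. \<nu> F \<bullet> (K x *v \<nu> F)) has_derivative (\<lambda>w. 0 * (\<nu> F \<bullet> w))) (at y within closure P)" for w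
    by auto
qed

text \<open>
  Near the facet \<open>F\<close> the equation is solved by integrating twice along the edge that leaves \<open>F\<close> at
  the vertex. The solution \<open>\<psi> e \<otimes> e\<close> satisfies the homogeneous conditions because the edge is
  tangent to the other facets through the vertex and \<open>\<psi>\<close> vanishes to second order on \<open>F\<close>; it is
  cut off before it comes near the facets away from the vertex.
\<close>

lemma clear_facet:
  assumes v: "v \<in> vertices" and F: "F \<in> active v" "F \<notin> T" and T: "T \<subseteq> active v"
    and f: "smooth_on UNIV f" and e1: "\<epsilon> > 0"
    and f0: "\<And>G x. G \<in> (facets P - active v) \<union> T \<Longrightarrow> \<bar>height G x\<bar> < \<epsilon> \<Longrightarrow> f x = 0"
  shows "\<exists>K. flat K \<and> (\<exists>\<delta>>0. \<forall>G\<in>(facets P - active v) \<union> insert F T. \<forall>x. \<bar>height G x\<bar> < \<delta> \<longrightarrow> f x - double_divergence K x = 0)"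
proof -
  have FP: "F \<in> facets P" using F by (simp add: active_def)
  define e where "e = dual_vector v F"
  have e: "\<nu> F \<bullet> e = 1" "\<And>G. G \<in> active v \<Longrightarrow> G \<noteq> F \<Longrightarrow> \<nu> G \<bullet> e = 0"
    unfolding e_def using dual_vector[OF v F(1)] by auto
  define b where "b = \<nu> F \<bullet> (SOME y. y \<in> F)"
  have hF: "height F x = \<nu> F \<bullet> x - b" for x by (simp add: height_def b_def)
  define g where "g = primitive (\<nu> F) b e f"
  define \<psi>0 where "\<psi>0 = primitive (\<nu> F) b e g"
  have smg: "smooth_on UNIV g" unfolding g_def by (rule smooth_primitive[OF f])
  have smp0: "smooth_on UNIV \<psi>0" unfolding \<psi>0_def by (rule smooth_primitive[OF smg])
  have dg: "dderiv e g x = f x" and dp0: "dderiv e \<psi>0 x = g x" for x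
    unfolding g_def \<psi>0_def by (rule dderiv_primitive[OF f e(1)], rule dderiv_primitive[OF smg[unfolded g_def] e(1)])
  define M where "M = 1 + (\<Sum>G\<in>facets P. \<bar>\<nu> G \<bullet> e\<bar>)"
  have M: "M \<ge> 1" "\<bar>\<nu> G \<bullet> e\<bar> \<le> M" if "G \<in> facets P" for G
  proof -
    show "M \<ge> 1" by (simp add: M_def sum_nonneg)
    show "\<bar>\<nu> G \<bullet> e\<bar> \<le> M" using member_le_sum[of G "facets P" "\<lambda>G. \<bar>\<nu> G \<bullet> e\<bar>"] that finite_facets by (simp add: M_def)
  qed
  have M1: "M \<ge> 1" by (rule M(1)[OF FP])
  define \<delta> where "\<delta> = \<epsilon> / (4 * M)"
  have d: "\<delta> > 0" "2 * \<delta> * M = \<epsilon> / 2" using e1 M1 by (auto simp: \<delta>_def)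
  define \<kappa> where "\<kappa> x = 1 - smooth_step ((1 / \<delta>\<^sup>2) * (height F x * height F x))" for x
  have sm\<kappa>: "smooth_on UNIV \<kappa>" unfolding \<kappa>_def
    by (rule smooth_on_diff[OF open_UNIV smooth_on_const], rule smooth_on_compose_real[OF open_UNIV smooth_step(1)])
      (intro smooth_on_mult smooth_on_const smooth_height open_UNIV)
  have \<kappa>1: "\<kappa> x = 1" if "\<bar>height F x\<bar> < \<delta>" for x
  proof -
    have "height F x * height F x \<le> \<delta>\<^sup>2"
      using that abs_le_square_iff[of "height F x" \<delta>] d(1) by (simp add: power2_eq_square)
    then have "(1 / \<delta>\<^sup>2) * (height F x * height F x) \<le> 1" using d(1) by simp
    then show ?thesis by (simp add: \<kappa>_def smooth_step(2))
  qed
  have \<kappa>0: "\<kappa> x = 0" if "\<bar>height F x\<bar> \<ge> 2 * \<delta>" for x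
  proof -
    have "(2 * \<delta>)\<^sup>2 \<le> (height F x)\<^sup>2"
      using that abs_le_square_iff[of "2 * \<delta>" "height F x"] d(1) by simp
    then have "4 * (\<delta> * \<delta>) \<le> height F x * height F x" by (simp add: power2_eq_square)
    then have "2 * \<delta>\<^sup>2 \<le> height F x * height F x"
      using zero_le_square[of \<delta>] unfolding power2_eq_square by linarith
    then have "(1 / \<delta>\<^sup>2) * (height F x * height F x) \<ge> 2" using d(1) by (simp add: field_simps)
    then show ?thesis by (simp add: \<kappa>_def smooth_step(3))
  qed
  define \<psi> where "\<psi> x = \<kappa> x * \<psi>0 x" for x
  have smp: "smooth_on UNIV \<psi>" unfolding \<psi>_def by (intro smooth_on_mult sm\<kappa> smp0 open_UNIV)
  have p0_eq_0: "\<psi>0 x = 0" if "\<And>s. 0 \<le> s \<Longrightarrow> s \<le> 1 \<Longrightarrow> f (x - (s * height F x) *\<^sub>R e) = 0" for x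
    unfolding \<psi>0_def
  proof (rule primitive_eq_0)
    fix t :: real assume t: "0 \<le> t" "t \<le> 1"
    define z where "z = x - (t * (\<nu> F \<bullet> x - b)) *\<^sub>R e"
    have hz: "\<nu> F \<bullet> z - b = (1 - t) * height F x"
      by (simp add: z_def hF inner_diff_right e(1) algebra_simps)
    show "g z = 0"
      unfolding g_def
    proof (rule primitive_eq_0)
      fix s :: real assume s: "0 \<le> s" "s \<le> 1"
      have "z - (s * (\<nu> F \<bullet> z - b)) *\<^sub>R e = x - ((t + s * (1 - t)) * height F x) *\<^sub>R e"
        unfolding hz by (simp add: z_def hF[symmetric] algebra_simps)
      moreover have "t + s * (1 - t) \<le> t + 1 * (1 - t)" using s t by (intro add_left_mono mult_right_mono) auto
      moreover have "0 \<le> t + s * (1 - t)" using s t by simp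
      ultimately show "f (z - (s * (\<nu> F \<bullet> z - b)) *\<^sub>R e) = 0" using that by simp
    qed
  qed
  have psi0: "\<psi> x = 0" if G: "G \<in> (facets P - active v) \<union> T" and x: "\<bar>height G x\<bar> < \<epsilon> / 2" for G x
  proof (cases "\<bar>height F x\<bar> \<ge> 2 * \<delta>")
    case True
    then show ?thesis by (simp add: \<psi>_def \<kappa>0)
  next
    case False
    have GP: "G \<in> facets P" using G T by (auto simp: active_def)
    have "f (x - (s * height F x) *\<^sub>R e) = 0" if s: "0 \<le> s" "s \<le> 1" for s
    proof (rule f0[OF G])
      have "height G (x - (s * height F x) *\<^sub>R e) = height G x - s * height F x * (\<nu> G \<bullet> e)"
        using height_add[of G x "- (s * height F x) *\<^sub>R e"] by simp
      moreover have "\<bar>s * height F x * (\<nu> G \<bullet> e)\<bar> \<le> \<epsilon> / 2"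
      proof -
        have "\<bar>s * height F x * (\<nu> G \<bullet> e)\<bar> \<le> (1 * (2 * \<delta>)) * M"
          unfolding abs_mult using s False M(2)[OF GP] M1 d(1) by (intro mult_mono) auto
        then show ?thesis using d(2) by simp
      qed
      ultimately show "\<bar>height G (x - (s * height F x) *\<^sub>R e)\<bar> < \<epsilon>" using x by linarith
    qed
    then show ?thesis by (simp add: \<psi>_def p0_eq_0)
  qed
  define K where "K x = \<psi> x *\<^sub>R rank_one e" for x
  have opG: "open {x. \<bar>height G x\<bar> < c}" for G c
    by (intro open_Collect_less continuous_on_rabs continuous_height continuous_on_const)
  have Kw: "u \<bullet> (K x *v w) = \<psi> x * ((e \<bullet> w) * (u \<bullet> e))" for u x w
    by (simp add: K_def scaleR_matrix_vector_assoc[symmetric] rank_one_mult)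
  have "flat K"
    unfolding flat_def
  proof (intro conjI allI)
    show "smooth_on UNIV K" unfolding K_def by (intro smooth_on_scaleR_const smp open_UNIV)
    show "transpose (K x) = K x" for x unfolding K_def by (rule transpose_scaleR_rank_one)
    show "boundary_conditions_with 0 K"
      unfolding boundary_conditions_with_def
    proof (intro ballI)
      fix G y assume G: "G \<in> facets P" and y: "y \<in> rel_interior G"
      have hG: "height G y = 0" using y rel_interior_subset[of G] height_facet[OF G] by auto
      show "(\<forall>w. \<nu> G \<bullet> (K y *v w) = 0) \<and>
         ((\<lambda>x. \<nu> G \<bullet> (K x *v \<nu> G)) has_derivative (\<lambda>w. 0 * (\<nu> G \<bullet> w))) (at y within closure P)"
      proof (cases "G = F")
        case True
        have hy: "\<nu> F \<bullet> y = b" using hG hF[of y] True by simp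
        have p0y: "\<psi>0 y = 0" "g y = 0" using hy by (simp_all add: \<psi>0_def g_def primitive_def)
        have "dderiv w \<psi> y = 0" for w
          unfolding \<psi>_def[abs_def] dderiv_mult[OF sm\<kappa> smp0 UNIV_I] p0y
          using dderiv_primitive_hyperplane[OF smg hy p0y(2), of w e] by (simp add: \<psi>0_def)
        then have "(\<psi> has_derivative (\<lambda>w. 0)) (at y)" using smooth_on_has_derivative[OF smp, of y] by simp
        then have "((\<lambda>x. \<psi> x * ((e \<bullet> \<nu> F) * (\<nu> F \<bullet> e))) has_derivative (\<lambda>w. 0 * (\<nu> F \<bullet> w))) (at y within closure P)"
          using has_derivative_mult_left[of \<psi> "\<lambda>w. 0"] by (auto intro: has_derivative_at_withinI)
        then show ?thesis using True p0y by (simp add: Kw \<psi>_def)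
      next
        case False
        show ?thesis
        proof (cases "G \<in> active v")
          case True
          then show ?thesis using e(2)[OF True False] by (simp add: Kw)
        next
          case nG: False
          show ?thesis
            by (rule boundary_conditions_local[OF G y opG[of G "\<epsilon> / 2"]])
              (use hG e1 psi0[of G] G nG in \<open>auto simp: K_def\<close>)
        qed
      qed
    qed
  qed
  moreover have "f x - double_divergence K x = 0" if G: "G \<in> (facets P - active v) \<union> insert F T"
    and x: "\<bar>height G x\<bar> < min \<delta> (\<epsilon> / 2)" for G x
  proof (cases "G = F")
    case True
    have "double_divergence K x = dderiv e (dderiv e \<psi>) x"
      unfolding K_def by (rule double_divergence_rank_one[OF open_UNIV smp UNIV_I])
    also have "\<dots> = dderiv e g x"
    proof (rule dderiv_cong_open[OF opG[of F \<delta>]])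
      show "x \<in> {x. \<bar>height F x\<bar> < \<delta>}" using x True by simp
      fix y assume y: "y \<in> {x. \<bar>height F x\<bar> < \<delta>}"
      have "dderiv e \<psi> y = dderiv e \<psi>0 y"
        by (rule dderiv_cong_open[OF opG[of F \<delta>] y]) (simp add: \<psi>_def \<kappa>1)
      then show "dderiv e \<psi> y = g y" by (simp add: dp0)
    qed
    finally show ?thesis by (simp add: dg)
  next
    case False
    then have G': "G \<in> (facets P - active v) \<union> T" using G by auto
    have "double_divergence K x = 0"
      by (rule double_divergence_0[OF opG[of G "\<epsilon> / 2"]]) (use x psi0[OF G'] in \<open>auto simp: K_def\<close>)
    moreover have "f x = 0" using f0[OF G'] x e1 by simp
    ultimately show ?thesis by simp
  qed
  moreover have "min \<delta> (\<epsilon> / 2) > 0" using d(1) e1 by simp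
  ultimately show ?thesis by blast
qed

text \<open>
  The facets through the vertex are treated one after the other; each step keeps the remainder zero
  near the facets that were treated before.
\<close>

lemma clear_vertex:
  assumes v: "v \<in> vertices" and f: "smooth_on UNIV f" and e: "\<epsilon> > 0"
    and f0: "\<And>G x. G \<in> facets P - active v \<Longrightarrow> \<bar>height G x\<bar> < \<epsilon> \<Longrightarrow> f x = 0"
    and T: "finite T" "T \<subseteq> active v"
  shows "\<exists>K. flat K \<and> (\<exists>\<delta>>0. \<forall>G\<in>(facets P - active v) \<union> T. \<forall>x. \<bar>height G x\<bar> < \<delta> \<longrightarrow> f x - double_divergence K x = 0)"
  using T
proof (induction T)
  case empty
  have "double_divergence (\<lambda>x. 0) x = 0" for x :: "real ^ 'n" by (rule double_divergence_0[of UNIV]) auto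
  then show ?case using flat_0 e f0 by (intro exI[of _ "\<lambda>x. 0"] conjI exI[of _ \<epsilon>]) auto
next
  case (insert F T)
  then obtain K d where K: "flat K" and d: "d > 0"
    "\<And>G x. G \<in> (facets P - active v) \<union> T \<Longrightarrow> \<bar>height G x\<bar> < d \<Longrightarrow> f x - double_divergence K x = 0"
    by auto
  have smK: "smooth_on UNIV K" using K by (simp add: flat_def)
  have sm: "smooth_on UNIV (\<lambda>x. f x - double_divergence K x)"
    by (intro smooth_on_diff f smooth_double_divergence smK open_UNIV)
  have "\<exists>L. flat L \<and> (\<exists>\<delta>>0. \<forall>G\<in>(facets P - active v) \<union> insert F T. \<forall>x. \<bar>height G x\<bar> < \<delta> \<longrightarrow>
      f x - double_divergence K x - double_divergence L x = 0)"
    by (rule clear_facet[OF v _ insert.hyps(2) _ sm d(1)]) (use insert.prems d(2) in blast)+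
  then obtain L d' where L: "flat L" and d': "d' > 0"
    "\<And>G x. G \<in> (facets P - active v) \<union> insert F T \<Longrightarrow> \<bar>height G x\<bar> < d' \<Longrightarrow> f x - double_divergence K x - double_divergence L x = 0"
    by blast
  have "smooth_on UNIV L" using L by (simp add: flat_def)
  then have "double_divergence (\<lambda>x. K x + L x) x = double_divergence K x + double_divergence L x" for x
    by (intro double_divergence_add[of UNIV] smK) auto
  then show ?case using d' flat_add[OF K L]
    by (intro exI[of _ "\<lambda>x. K x + L x"] conjI exI[of _ d']) (auto simp: algebra_simps)
qed

text \<open>
  The partition of unity splits \<open>f\<close> into pieces that vanish near the facets away from some vertex. When
  the facets through the vertex have been cleared as well, each remainder vanishes near the whole
  boundary.
\<close>

lemma clear_boundary:
  assumes f: "smooth_on UNIV f"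
  shows "\<exists>K k S. flat K \<and> smooth_on UNIV k \<and> compact S \<and> S \<subseteq> P \<and> (\<forall>x. x \<notin> S \<longrightarrow> k x = 0) \<and>
     (\<forall>x\<in>P. f x = double_divergence K x + k x)"
proof -
  obtain \<epsilon> \<omega> where e: "\<epsilon> > 0" and part: "vertex_partition \<epsilon> \<omega>"
    using vertex_partition_exists by blast
  have \<omega>: "\<And>v. v \<in> vertices \<Longrightarrow> smooth_on UNIV (\<omega> v)"
      "\<And>v F x. v \<in> vertices \<Longrightarrow> F \<in> facets P - active v \<Longrightarrow> height F x \<le> \<epsilon> \<Longrightarrow> \<omega> v x = 0"
      "\<And>x. x \<in> closure P \<Longrightarrow> (\<Sum>v\<in>vertices. \<omega> v x) = 1"
    using part unfolding vertex_partition_def by auto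
  have smf: "smooth_on UNIV (\<lambda>x. \<omega> v x * f x)" if "v \<in> vertices" for v
    by (intro smooth_on_mult \<omega> that f open_UNIV)
  have "\<forall>v\<in>vertices. \<exists>K. flat K \<and> (\<exists>\<delta>>0. \<forall>G\<in>(facets P - active v) \<union> active v. \<forall>x. \<bar>height G x\<bar> < \<delta> \<longrightarrow> \<omega> v x * f x - double_divergence K x = 0)"
  proof
    fix v assume v: "v \<in> vertices"
    show "\<exists>K. flat K \<and> (\<exists>\<delta>>0. \<forall>G\<in>(facets P - active v) \<union> active v. \<forall>x. \<bar>height G x\<bar> < \<delta> \<longrightarrow> \<omega> v x * f x - double_divergence K x = 0)"
    proof (rule clear_vertex[OF v smf[OF v] e])
      fix G x assume "G \<in> facets P - active v" "\<bar>height G x\<bar> < \<epsilon>"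
      then show "\<omega> v x * f x = 0" using \<omega>(2)[OF v, of G x] by simp
    qed (use finite_facets in \<open>auto simp: active_def\<close>)
  qed
  from bchoice[OF this] obtain K where K: "\<And>v. v \<in> vertices \<Longrightarrow> flat (K v)"
     "\<forall>v\<in>vertices. \<exists>\<delta>>0. \<forall>G\<in>(facets P - active v) \<union> active v. \<forall>x. \<bar>height G x\<bar> < \<delta> \<longrightarrow> \<omega> v x * f x - double_divergence (K v) x = 0"
    by blast
  from bchoice[OF K(2)] obtain d where d: "\<And>v. v \<in> vertices \<Longrightarrow> d v > 0"
     "\<And>v G x. v \<in> vertices \<Longrightarrow> G \<in> facets P \<Longrightarrow> \<bar>height G x\<bar> < d v \<Longrightarrow> \<omega> v x * f x - double_divergence (K v) x = 0"
    by (metis Un_Diff_cancel2 Un_iff)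
  define m where "m = Min (d ` vertices)"
  have m: "m > 0" "\<And>v. v \<in> vertices \<Longrightarrow> m \<le> d v"
    using d(1) finite_vertices vertices_ne by (auto simp: m_def)
  have smK: "smooth_on UNIV (K v)" if "v \<in> vertices" for v using K(1)[OF that] by (simp add: flat_def)
  define L where "L x = (\<Sum>v\<in>vertices. K v x)" for x
  have L: "double_divergence L x = (\<Sum>v\<in>vertices. double_divergence (K v) x)" for x
    unfolding L_def[abs_def] using double_divergence_sum[of vertices K x] finite_vertices smK by blast
  have flatL: "flat L" unfolding L_def[abs_def] by (rule flat_sum[OF finite_vertices K(1)])
  define r where "r x = (\<Sum>v\<in>vertices. \<omega> v x * f x - double_divergence (K v) x)" for x
  have smr: "smooth_on UNIV r" unfolding r_def
    by (intro smooth_on_sum smooth_on_diff smf smooth_double_divergence smK open_UNIV)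
  define S where "S = {x. \<forall>F\<in>facets P. m \<le> height F x}"
  have "closed S"
  proof -
    have "S = (\<Inter>F\<in>facets P. {x. m \<le> height F x})" by (auto simp: S_def)
    then show ?thesis by (simp add: closed_INT closed_Collect_le continuous_height)
  qed
  have SP: "S \<subseteq> P"
  proof
    fix x assume x: "x \<in> S"
    have "height F x > 0" if "F \<in> facets P" for F using x m(1) that less_le_trans[of 0 m "height F x"] by (simp add: S_def)
    then show "x \<in> P" unfolding mem_P_iff by blast
  qed
  have cS: "compact S" using \<open>closed S\<close> bounded_subset[OF P_bounded SP] by (simp add: compact_eq_bounded_closed)
  have r0: "r x = 0" if xP: "x \<in> P" and xS: "x \<notin> S" for x
  proof -
    obtain F where F: "F \<in> facets P" "height F x < m" using xS by (auto simp: S_def not_le)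
    have "\<bar>height F x\<bar> < m" using F height_pos[OF F(1) xP] by simp
    then have "\<omega> v x * f x - double_divergence (K v) x = 0" if "v \<in> vertices" for v
      using d(2)[OF that F(1)] m(2)[OF that] by simp
    then show ?thesis unfolding r_def by (intro sum.neutral) auto
  qed
  define k where "k x = (if x \<in> P then r x else 0)" for x
  have "smooth_on P k"
    by (rule smooth_on_cong_imp[OF P_open _ smooth_on_subset[OF smr subset_UNIV]]) (simp add: k_def)
  moreover have "smooth_on (- S) k"
    by (rule smooth_on_cong_imp[OF _ _ smooth_on_const[of _ 0]]) (use \<open>closed S\<close> r0 in \<open>auto simp: k_def\<close>)
  ultimately have "smooth_on (P \<union> - S) k" using P_open \<open>closed S\<close> by (intro smooth_on_Un) auto
  moreover have "P \<union> - S = UNIV" using SP by auto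
  ultimately have "smooth_on UNIV k" by simp
  moreover have "k x = 0" if "x \<notin> S" for x using that r0 by (simp add: k_def)
  moreover have "f x = double_divergence L x + k x" if x: "x \<in> P" for x
  proof -
    have "(\<Sum>v\<in>vertices. \<omega> v x) = 1" using \<omega>(3)[of x] x closure_subset[of P] by blast
    then have "r x = f x - double_divergence L x"
      by (simp add: r_def sum_subtractf L sum_distrib_right[symmetric])
    then show ?thesis using x by (simp add: k_def)
  qed
  ultimately show ?thesis using flatL cS SP by blast
qed

lemma hessian_trace_affine:
  fixes u :: "real ^ 'n"
  shows "hessian_trace G (\<lambda>x. u \<bullet> x + c) x = 0"
proof -
  have d: "dderiv v (\<lambda>x. u \<bullet> x + c) x = u \<bullet> v" for v x
    by (rule dderivI) (auto intro!: derivative_eq_intros)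
  have "dderiv v (\<lambda>x. u \<bullet> x + c) = (\<lambda>x. u \<bullet> v)" for v by (rule ext, rule d)
  then show ?thesis by (simp add: hessian_trace_def)
qed

lemma flat_affine:
  assumes "flat K"
  shows "(LINT x:P|lborel. (u \<bullet> x + c) * double_divergence K x) = 0"
proof -
  have "(LINT x:P|lborel. (u \<bullet> x + c) * double_divergence K x) = (LINT x:P|lborel. hessian_trace K (\<lambda>x. u \<bullet> x + c) x) - 0 * (\<integral>x. (u \<bullet> x + c) \<partial>\<sigma>)"
    by (rule green_boundary_conditions[of UNIV]) (use assms in \<open>auto simp: flat_def intro!: smooth_intros\<close>)
  then show ?thesis by (simp add: hessian_trace_affine set_lebesgue_integral_def)
qed

text \<open>
  By Green's formula the double divergence of a flat field is orthogonal to the affine functions. So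
  is therefore the compactly supported remainder that is left when the boundary has been cleared,
  and this remainder is the double divergence of a compactly supported field.
\<close>

lemma flat_solution:
  assumes g: "smooth_on UNIV g" and orth: "\<And>u c. (LINT x:P|lborel. (u \<bullet> x + c) * g x) = 0"
  shows "\<exists>K. flat K \<and> (\<forall>x\<in>P. g x = double_divergence K x)"
proof -
  obtain K k S where K: "flat K" and k: "smooth_on UNIV k" "compact S" "S \<subseteq> P" "\<And>x. x \<notin> S \<Longrightarrow> k x = 0"
      and eq: "\<And>x. x \<in> P \<Longrightarrow> g x = double_divergence K x + k x"
    using clear_boundary[OF g] by blast
  have smK: "smooth_on UNIV K" using K by (simp add: flat_def)
  have mom: "(\<integral>x. (u \<bullet> x + c) * k x \<partial>lborel) = 0" for u c
  proof -
    note ci = closure_integrable[OF smooth_continuous_closure[OF subset_UNIV]]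
    have a: "smooth_on UNIV (\<lambda>x. u \<bullet> x + c)" by (intro smooth_intros open_UNIV)
    have "(\<integral>x. (u \<bullet> x + c) * k x \<partial>lborel) = (LINT x:P|lborel. (u \<bullet> x + c) * k x)"
      unfolding set_lebesgue_integral_def using k(3,4)
      by (intro Bochner_Integration.integral_cong) (auto simp: indicator_def)
    also have "\<dots> = (LINT x:P|lborel. (u \<bullet> x + c) * g x - (u \<bullet> x + c) * double_divergence K x)"
      by (rule set_lebesgue_integral_cong) (use P_open eq in \<open>auto simp: algebra_simps\<close>)
    also have "\<dots> = (LINT x:P|lborel. (u \<bullet> x + c) * g x) - (LINT x:P|lborel. (u \<bullet> x + c) * double_divergence K x)"
      by (intro set_integral_diff ci smooth_on_mult a g smooth_double_divergence smK open_UNIV)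
    finally show ?thesis by (simp add: orth flat_affine[OF K])
  qed
  obtain p where p: "p \<in> P" using P_ne by blast
  have m0: "(\<integral>x. k x \<partial>lborel) = 0" using mom[of 0 1] by simp
  have m1: "(\<integral>x. x $ i * k x \<partial>lborel) = 0" for i using mom[of "axis i 1" 0] by (simp add: inner_axis' inner_real_def)
  obtain L T where L: "compact T" "T \<subseteq> P" "smooth_on UNIV L" "\<And>x. transpose (L x) = L x"
     "\<And>x. x \<notin> T \<Longrightarrow> L x = 0" "\<And>x. k x = double_divergence L x"
    using double_divergence_solvable[OF P_open P_convex p k(2,3,1,4) m0 m1] by blast
  have "flat L" by (rule flat_compact_support[OF L(3,4,1,2,5)])
  moreover have "g x = double_divergence (\<lambda>x. K x + L x) x" if "x \<in> P" for x
    using eq[OF that] L(6)[of x] double_divergence_add[OF open_UNIV smK L(3) UNIV_I, of x] by simp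
  ultimately show ?thesis using flat_add[OF K] by blast
qed

lemma affine_eq_0:
  assumes "\<And>x. x \<in> P \<Longrightarrow> u \<bullet> x + c = 0"
  shows "u = 0 \<and> c = 0"
proof -
  obtain p where p: "p \<in> P" using P_ne by blast
  obtain d where d: "d > 0" "ball p d \<subseteq> P" using p P_open open_contains_ball by blast
  have "u = 0"
  proof (rule ccontr)
    assume u: "u \<noteq> 0"
    define t where "t = d / (2 * norm u)"
    have t: "t > 0" using d u by (simp add: t_def)
    have "norm (t *\<^sub>R u) < d" using d u by (simp add: t_def)
    then have "p + t *\<^sub>R u \<in> P" using d(2) by (auto simp: dist_norm)
    from assms[OF this] have "u \<bullet> p + t * (u \<bullet> u) + c = 0" by (simp add: inner_add_right)
    then have "t * (u \<bullet> u) = 0" using assms[OF p] by linarith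
    then show False using t u by simp
  qed
  then show ?thesis using assms[OF p] by simp
qed

lemma affine_integrable: "set_integrable lborel P (\<lambda>x. (u \<bullet> x + c) * (w \<bullet> x + d))"
  by (intro closure_integrable continuous_intros)

lemma affine_orthogonal_eq_0:
  assumes "(LINT x:P|lborel. (u \<bullet> x + c) * (u \<bullet> x + c)) = 0"
  shows "u = 0 \<and> c = 0"
proof (rule affine_eq_0)
  fix x assume x: "x \<in> P"
  have "(u \<bullet> x + c) * (u \<bullet> x + c) = 0"
    by (rule integral_continuous_eq_0[OF P_open _ _ affine_integrable assms x]) (auto intro!: continuous_intros)
  then show "u \<bullet> x + c = 0" by simp
qed

text \<open>
  The orthogonal projection to the affine functions exists because their Gram matrix is injective.
\<close>

lemma affine_projection:
  assumes g: "continuous_on (closure P) g"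
  shows "\<exists>u c. \<forall>w d. (LINT x:P|lborel. (w \<bullet> x + d) * (g x - (u \<bullet> x + c))) = 0"
proof -
  have ci: "set_integrable lborel P (\<lambda>x. x $ i * h x)" "set_integrable lborel P h" if "continuous_on (closure P) h" for i h
    by (intro closure_integrable continuous_intros that)+
  define h :: "(real ^ 'n) \<times> real \<Rightarrow> real ^ 'n \<Rightarrow> real" where "h a x = fst a \<bullet> x + snd a" for a x
  define T :: "(real ^ 'n) \<times> real \<Rightarrow> (real ^ 'n) \<times> real" where
    "T a = ((\<chi> i. LINT x:P|lborel. x $ i * h a x), LINT x:P|lborel. h a x)" for a
  have split: "(LINT x:P|lborel. (w \<bullet> x + d) * h x) = w \<bullet> (\<chi> i. LINT x:P|lborel. x $ i * h x) + d * (LINT x:P|lborel. h x)"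
    if h: "continuous_on (closure P) h" for w d h
  proof -
    have i: "set_integrable lborel P (\<lambda>x. w $ i * (x $ i * h x))" for i using ci(1)[OF h] by simp
    have "(LINT x:P|lborel. (w \<bullet> x + d) * h x) = (LINT x:P|lborel. (\<Sum>i\<in>UNIV. w $ i * (x $ i * h x)) + d * h x)"
    proof -
      have "(w \<bullet> x + d) * h x = (\<Sum>i\<in>UNIV. w $ i * (x $ i * h x)) + d * h x" for x
        by (simp add: inner_vec_def sum_distrib_right distrib_right mult.assoc)
      then show ?thesis by (simp only:)
    qed
    also have "\<dots> = (LINT x:P|lborel. (\<Sum>i\<in>UNIV. w $ i * (x $ i * h x))) + (LINT x:P|lborel. d * h x)"
      using ci(2)[OF h] by (intro set_integral_add) (auto intro!: closure_integrable continuous_intros h)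
    also have "(LINT x:P|lborel. (\<Sum>i\<in>UNIV. w $ i * (x $ i * h x))) = (\<Sum>i\<in>UNIV. LINT x:P|lborel. w $ i * (x $ i * h x))"
      unfolding set_lebesgue_integral_def scaleR_sum_right using i unfolding set_integrable_def
      by (intro Bochner_Integration.integral_sum)
    finally show ?thesis by (simp add: inner_vec_def)
  qed
  have "linear T"
  proof (rule linearI)
    fix a b :: "(real ^ 'n) \<times> real" and r :: real
    have c: "continuous_on (closure P) (h a)" for a :: "(real ^ 'n) \<times> real"
      unfolding h_def[abs_def] by (intro continuous_intros)
    have e1: "h (a + b) x = h a x + h b x" for x by (simp add: h_def inner_add_left)
    have e2: "h (r *\<^sub>R a) x = r * h a x" for x by (simp add: h_def algebra_simps)
    show "T (a + b) = T a + T b"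
      unfolding T_def e1 distrib_left
      by (simp add: prod_eq_iff vec_eq_iff set_integral_add(2)[OF ci(1)[OF c] ci(1)[OF c]] set_integral_add(2)[OF ci(2)[OF c] ci(2)[OF c]])
    show "T (r *\<^sub>R a) = r *\<^sub>R T a"
      unfolding T_def e2 mult.left_commute[of _ r] by (simp add: prod_eq_iff vec_eq_iff)
  qed
  moreover have "inj T"
    unfolding linear_injective_0[OF \<open>linear T\<close>]
  proof (intro allI impI)
    fix a assume "T a = 0"
    then have z: "(\<chi> i. LINT x:P|lborel. x $ i * (fst a \<bullet> x + snd a)) = 0" "(LINT x:P|lborel. (fst a \<bullet> x + snd a)) = 0"
      by (auto simp: T_def h_def prod_eq_iff)
    have "(LINT x:P|lborel. (fst a \<bullet> x + snd a) * (fst a \<bullet> x + snd a)) = 0"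
      by (subst split) (auto intro!: continuous_intros simp: z)
    from affine_orthogonal_eq_0[OF this] show "a = 0" by (simp add: prod_eq_iff)
  qed
  ultimately have "surj T" using linear_injective_imp_surjective[of T] by simp
  from surjD[OF this, of "((\<chi> i. LINT x:P|lborel. x $ i * g x), LINT x:P|lborel. g x)"]
  obtain a where a: "((\<chi> i. LINT x:P|lborel. x $ i * g x), LINT x:P|lborel. g x) = T a" by (rule exE)
  have "(LINT x:P|lborel. (w \<bullet> x + d) * (g x - (fst a \<bullet> x + snd a))) = 0" for w d
  proof -
    have c: "continuous_on (closure P) (\<lambda>x. fst a \<bullet> x + snd a)" by (intro continuous_intros)
    have "(LINT x:P|lborel. (w \<bullet> x + d) * (g x - (fst a \<bullet> x + snd a))) =
       (LINT x:P|lborel. (w \<bullet> x + d) * g x) - (LINT x:P|lborel. (w \<bullet> x + d) * (fst a \<bullet> x + snd a))"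
      unfolding right_diff_distrib
      by (intro set_integral_diff closure_integrable continuous_on_mult g continuous_intros)
    then show ?thesis using a unfolding split[OF g] split[OF c] by (simp add: T_def h_def prod_eq_iff)
  qed
  then show ?thesis by blast
qed

text \<open>
  The boundary conditions have a solution; its double divergence is made affine by subtracting a flat
  field, which takes care of the part orthogonal to the affine functions.
\<close>

lemma formal_solution_exists:
  "\<exists>H u c. smooth_on UNIV H \<and> (\<forall>x. transpose (H x) = H x) \<and> boundary_conditions_with 2 H \<and>
     (\<forall>x\<in>P. double_divergence H x = u \<bullet> x + c)"
proof -
  obtain H where H: "smooth_on UNIV H" "\<And>x. transpose (H x) = H x" "boundary_conditions_with 2 H"
    using boundary_conditions_solvable by blast
  have smd: "smooth_on UNIV (double_divergence H)" by (intro smooth_double_divergence H open_UNIV)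
  obtain u c where uc: "\<And>w d. (LINT x:P|lborel. (w \<bullet> x + d) * (double_divergence H x - (u \<bullet> x + c))) = 0"
    using affine_projection[OF smooth_continuous_closure[OF subset_UNIV smd]] by blast
  have "\<exists>K. flat K \<and> (\<forall>x\<in>P. double_divergence H x - (u \<bullet> x + c) = double_divergence K x)"
    by (rule flat_solution[OF _ uc]) (intro smooth_on_diff smooth_on_add smooth_on_inner_left smooth_on_const smd open_UNIV)
  then obtain K where K: "flat K" "\<And>x. x \<in> P \<Longrightarrow> double_divergence H x - (u \<bullet> x + c) = double_divergence K x"
    by blast
  have smK: "smooth_on UNIV K" and bK: "boundary_conditions_with 0 K" and tK: "\<And>x. transpose (K x) = K x"
    using K(1) by (auto simp: flat_def)
  define H' where "H' x = H x + (- 1) *\<^sub>R K x" for x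
  have smK': "smooth_on UNIV (\<lambda>x. (- 1) *\<^sub>R K x)"
    by (rule smooth_on_bounded_linear[OF bounded_linear_scaleR_right open_UNIV smK])
  have "smooth_on UNIV H'" unfolding H'_def by (intro smooth_on_add open_UNIV H smK')
  moreover have "transpose (H' x) = H' x" for x
    using H(2)[of x] tK[of x] by (simp add: H'_def transpose_def vec_eq_iff)
  moreover have "boundary_conditions_with 2 H'"
    unfolding H'_def using boundary_conditions_add[OF H(3) boundary_conditions_scaleR[OF bK, of "- 1"]] by simp
  moreover have "double_divergence H' x = u \<bullet> x + c" if "x \<in> P" for x
    using K(2)[OF that] double_divergence_add[OF open_UNIV H(1) smK' UNIV_I, of x]
      double_divergence_scaleR[OF open_UNIV smK UNIV_I, of "- 1" x] by (simp add: H'_def[abs_def])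
  ultimately show ?thesis by blast
qed

end

section \<open>Infinitely many solutions\<close>

definition matrix_unit :: "'n \<Rightarrow> 'n \<Rightarrow> real ^ 'n ^ 'n" where
  "matrix_unit a b = (\<chi> k l. if k = a \<and> l = b then 1 else 0)"

lemma double_divergence_matrix_unit:
  fixes \<psi> :: "real ^ 'n \<Rightarrow> real"
  shows "double_divergence (\<lambda>x. \<psi> x *\<^sub>R matrix_unit a b) x = dderiv (axis a 1) (dderiv (axis b 1) \<psi>) x"
proof -
  have z: "dderiv v (dderiv w (\<lambda>y. 0 :: real)) x = 0" for v w :: "real ^ 'n"
  proof -
    have "dderiv w (\<lambda>y. 0 :: real) = (\<lambda>y. 0)" by (intro ext) simp
    then show ?thesis by simp
  qed
  have e: "(\<lambda>y. (\<psi> y *\<^sub>R matrix_unit a b) $ k $ l) = (if k = a \<and> l = b then \<psi> else (\<lambda>y. 0))" for k l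
    by (auto simp: matrix_unit_def)
  have "double_divergence (\<lambda>x. \<psi> x *\<^sub>R matrix_unit a b) x =
     (\<Sum>k\<in>UNIV. \<Sum>l\<in>UNIV. if l = b then (if k = a then dderiv (axis a 1) (dderiv (axis b 1) \<psi>) x else 0) else 0)"
    unfolding double_divergence_def e by (intro sum.cong refl) (auto simp: z)
  then show ?thesis by simp
qed

text \<open>
  The Hessian of a bump function in two of the coordinates, rotated by a right angle, has vanishing
  double divergence because partial derivatives commute. In dimension one there is no such field.
\<close>

lemma divergence_free_bump:
  fixes q :: "real ^ 'n"
  assumes n: "CARD('n) \<ge> 2" and r: "r > 0"
  shows "\<exists>K :: real ^ 'n \<Rightarrow> real ^ 'n ^ 'n. smooth_on UNIV K \<and> (\<forall>x. transpose (K x) = K x) \<and>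
    (\<forall>x. x \<notin> cball q r \<longrightarrow> K x = 0) \<and> (\<forall>x. double_divergence K x = 0) \<and> (\<exists>z. K z \<noteq> 0)"
proof -
  obtain i j :: 'n where ij: "i \<noteq> j"
    using n card_le_Suc0_iff_eq[of "UNIV :: 'n set"] by auto
  define \<phi> where "\<phi> x = half_bump (r\<^sup>2 - (\<Sum>k\<in>UNIV. (x $ k - q $ k) * (x $ k - q $ k)))" for x
  have sm: "smooth_on UNIV \<phi>" unfolding \<phi>_def
    by (rule smooth_on_compose_real[OF open_UNIV half_bump(1)])
      (intro smooth_on_diff smooth_on_sum smooth_on_mult smooth_on_const smooth_on_component[OF open_UNIV smooth_on_id] open_UNIV)
  have nrm: "(\<Sum>k\<in>UNIV. (x $ k - q $ k) * (x $ k - q $ k)) = (norm (x - q))\<^sup>2" for x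
    unfolding power2_norm_eq_inner by (simp add: inner_vec_def)
  have p0: "\<phi> x = 0" if "x \<notin> cball q r" for x
  proof -
    have "r \<le> norm (x - q)" using that by (simp add: dist_norm norm_minus_commute)
    then have "r\<^sup>2 \<le> (norm (x - q))\<^sup>2" using r by (intro power_mono) auto
    then show ?thesis unfolding \<phi>_def nrm by (intro half_bump(2)) simp
  qed
  have pq: "\<phi> q > 0" unfolding \<phi>_def using r by (intro half_bump(3)) simp
  define A where "A = dderiv (axis j 1) (dderiv (axis j 1) \<phi>)"
  define B where "B = dderiv (axis i 1) (dderiv (axis i 1) \<phi>)"
  define G where "G = dderiv (axis i 1) (dderiv (axis j 1) \<phi>)"
  have smA: "smooth_on UNIV A" and smB: "smooth_on UNIV B" and smG: "smooth_on UNIV G"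
    unfolding A_def B_def G_def by (intro smooth_on_dderiv sm)+
  define K1 where "K1 x = A x *\<^sub>R matrix_unit i i + B x *\<^sub>R matrix_unit j j" for x
  define K2 where "K2 x = G x *\<^sub>R matrix_unit i j + G x *\<^sub>R matrix_unit j i" for x
  define K where "K x = K1 x + (- 1) *\<^sub>R K2 x" for x
  have sm1: "smooth_on UNIV K1" and sm2: "smooth_on UNIV K2"
    unfolding K1_def K2_def by (intro smooth_on_add smooth_on_scaleR_const smA smB smG open_UNIV)+
  have sm2': "smooth_on UNIV (\<lambda>x. (- 1) *\<^sub>R K2 x)"
    by (rule smooth_on_bounded_linear[OF bounded_linear_scaleR_right open_UNIV sm2])
  have "smooth_on UNIV K"
    unfolding K_def[abs_def] by (rule smooth_on_add[OF open_UNIV sm1 sm2'])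
  moreover have "transpose (K x) = K x" for x
  proof -
    have "transpose (matrix_unit a b) = matrix_unit b a" for a b :: 'n
      by (simp add: matrix_unit_def transpose_def vec_eq_iff conj_commute)
    moreover have "transpose (X + Y) = transpose X + transpose Y" "transpose (- X) = - transpose X"
        "transpose (X - Y) = transpose X - transpose Y" "transpose (t *\<^sub>R X) = t *\<^sub>R transpose X"
      for X Y :: "real ^ 'n ^ 'n" and t
      by (simp_all add: transpose_def vec_eq_iff)
    ultimately show ?thesis by (simp add: K_def K1_def K2_def)
  qed
  moreover have "K x = 0" if x: "x \<notin> cball q r" for x
  proof -
    note o1 = dderiv_outside_support[OF closed_cball p0]
    have "A x = 0" "B x = 0" "G x = 0"
      unfolding A_def B_def G_def by (rule dderiv_outside_support[OF closed_cball o1 x]; assumption)+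
    then show ?thesis by (simp add: K_def K1_def K2_def)
  qed
  moreover have "double_divergence K x = 0" for x
  proof -
    have com: "dderiv v (dderiv w g) = dderiv w (dderiv v g)" if "smooth_on UNIV g" for v w and g :: "real ^ 'n \<Rightarrow> real"
      using dderiv_commute[OF that] by (intro ext) auto
    have "double_divergence K1 x = dderiv (axis i 1) (dderiv (axis i 1) A) x + dderiv (axis j 1) (dderiv (axis j 1) B) x"
      unfolding K1_def[abs_def] by (subst double_divergence_add[of UNIV])
        (auto intro!: smooth_on_scaleR_const smA smB simp: double_divergence_matrix_unit)
    moreover have "double_divergence K2 x = dderiv (axis i 1) (dderiv (axis j 1) G) x + dderiv (axis j 1) (dderiv (axis i 1) G) x"
      unfolding K2_def[abs_def] by (subst double_divergence_add[of UNIV])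
        (auto intro!: smooth_on_scaleR_const smG simp: double_divergence_matrix_unit)
    moreover have "dderiv (axis i 1) A = dderiv (axis j 1) G"
      unfolding A_def G_def by (rule com[OF smooth_on_dderiv[OF sm]])
    moreover have "dderiv (axis j 1) B = dderiv (axis i 1) G"
      unfolding B_def G_def com[OF sm, of "axis i 1" "axis j 1"] by (rule com[OF smooth_on_dderiv[OF sm]])
    moreover have "double_divergence K x = double_divergence K1 x + (- 1) * double_divergence K2 x"
      unfolding K_def[abs_def] double_divergence_add[OF open_UNIV sm1 sm2' UNIV_I]
        double_divergence_scaleR[OF open_UNIV sm2 UNIV_I] ..
    ultimately show ?thesis by simp
  qed
  moreover have "\<exists>z. K z \<noteq> 0"
  proof (rule ccontr)
    assume "\<nexists>z. K z \<noteq> 0"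
    then have K0: "K z = 0" for z by blast
    have A0: "A z = 0" for z
    proof -
      have "K z $ i $ i = A z" using ij by (simp add: K_def K1_def K2_def matrix_unit_def)
      then show ?thesis by (simp add: K0)
    qed
    let ?e = "axis j 1 :: real ^ 'n"
    have far: "q + (2 * r) *\<^sub>R ?e \<notin> cball q r" using r by (simp add: dist_norm)
    have g0: "dderiv ?e \<phi> (q + t *\<^sub>R ?e) = 0" for t
    proof -
      have "((\<lambda>t. dderiv ?e \<phi> (q + t *\<^sub>R ?e)) has_real_derivative 0) (at t)" for t
        using dderiv_line_real[OF smooth_on_dderiv[OF sm], of q t ?e ?e] A0 by (simp add: A_def)
      then have "dderiv ?e \<phi> (q + t *\<^sub>R ?e) = dderiv ?e \<phi> (q + (2 * r) *\<^sub>R ?e)"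
        by (intro DERIV_isconst_all[of "\<lambda>t. dderiv ?e \<phi> (q + t *\<^sub>R ?e)"]) blast
      also have "\<dots> = 0" by (rule dderiv_outside_support[OF closed_cball p0 far])
      finally show ?thesis .
    qed
    have "((\<lambda>t. \<phi> (q + t *\<^sub>R ?e)) has_real_derivative 0) (at t)" for t
      using dderiv_line_real[OF sm, of q t ?e] g0 by simp
    then have "\<phi> (q + 0 *\<^sub>R ?e) = \<phi> (q + (2 * r) *\<^sub>R ?e)"
      by (intro DERIV_isconst_all[of "\<lambda>t. \<phi> (q + t *\<^sub>R ?e)"]) blast
    then show False using pq p0[OF far] by simp
  qed
  ultimately show ?thesis by blast
qed

text \<open>
  The centres approach \<open>p\<close> and the radii are less than half of the gaps between consecutive centres.
\<close>

lemma disjoint_cballs: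
  fixes p e :: "'a::real_normed_vector"
  assumes d: "d > 0" and e: "norm e = 1"
    and q_def: "\<And>k. q k = p + (d / real (k + 2)) *\<^sub>R e" and r_def: "\<And>k. r k = d / (4 * (real (k + 3))\<^sup>2)"
  shows "r k > 0" "cball (q k) (r k) \<subseteq> ball p d" "k < j \<Longrightarrow> cball (q k) (r k) \<inter> cball (q j) (r j) = {}"
proof -
  show rp: "r k > 0" for k using d by (simp add: r_def)
  show "cball (q k) (r k) \<subseteq> ball p d"
  proof
    fix x assume "x \<in> cball (q k) (r k)"
    then have "dist p x \<le> dist p (q k) + r k" using dist_triangle[of p x "q k"] by simp
    also have "dist p (q k) = d / real (k + 2)" using d e by (simp add: q_def dist_norm)
    also have "d / real (k + 2) \<le> d / 2" using d by (intro divide_left_mono) auto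
    also have "r k \<le> d / 4"
    proof -
      have "1 \<le> (real (k + 3))\<^sup>2" by simp
      then show ?thesis unfolding r_def using d by (intro divide_left_mono) auto
    qed
    finally show "x \<in> ball p d" using d by simp
  qed
  assume kj: "k < j"
  show "cball (q k) (r k) \<inter> cball (q j) (r j) = {}"
  proof (rule ccontr)
    assume "cball (q k) (r k) \<inter> cball (q j) (r j) \<noteq> {}"
    then obtain z where z: "dist (q k) z \<le> r k" "dist (q j) z \<le> r j" by auto
    have "dist (q k) (q j) \<le> r k + r j" using dist_triangle2[of "q k" "q j" z] z by simp
    also have "r j \<le> r k" unfolding r_def using kj d by (intro divide_left_mono mult_left_mono power_mono) auto
    finally have "dist (q k) (q j) \<le> d / (2 * (real (k + 3))\<^sup>2)" by (simp add: r_def)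
    moreover have "dist (q k) (q j) \<ge> d / (real (k + 2) * real (k + 3))"
    proof -
      have "q k - q j = (d / real (k + 2) - d / real (j + 2)) *\<^sub>R e" by (simp add: q_def algebra_simps)
      then have "dist (q k) (q j) \<ge> d / real (k + 2) - d / real (j + 2)" using e by (simp add: dist_norm)
      moreover have "d / real (j + 2) \<le> d / real (k + 3)" using kj d by (intro divide_left_mono) auto
      moreover have "d / real (k + 2) - d / real (k + 3) = d / (real (k + 2) * real (k + 3))"
        by (simp add: field_simps)
      ultimately show ?thesis by linarith
    qed
    moreover have "d / (2 * (real (k + 3))\<^sup>2) < d / (real (k + 2) * real (k + 3))"
    proof -
      have "real (k + 2) * real (k + 3) < 2 * (real (k + 3))\<^sup>2"
        by (simp add: power2_eq_square algebra_simps add_nonneg_pos)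
      then show ?thesis using d by (intro divide_strict_left_mono) auto
    qed
    ultimately show False by linarith
  qed
qed

context labelled_simple_polytope
begin

lemma boundary_conditions_eq:
  assumes "label_of P \<sigma> = \<nu>"
  shows "boundary_conditions P \<sigma> H \<longleftrightarrow> boundary_conditions_with 2 H"
  by (simp add: boundary_conditions_def boundary_conditions_with_def assms Let_def)

lemma boundary_conditions_with_cong:
  assumes "\<And>x. x \<in> closure P \<Longrightarrow> G x = H x" "boundary_conditions_with c G"
  shows "boundary_conditions_with c H"
  unfolding boundary_conditions_with_def
proof (intro ballI conjI allI)
  fix F y assume F: "F \<in> facets P" and y: "y \<in> rel_interior F"
  have yc: "y \<in> closure P" using y rel_interior_subset[of F] facet_subset[OF F] by blast
  have "\<nu> F \<bullet> (G y *v w) = 0" for w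
    using assms(2) F y unfolding boundary_conditions_with_def by blast
  then show "\<nu> F \<bullet> (H y *v w) = 0" for w by (simp add: assms(1)[OF yc])
  have "((\<lambda>x. \<nu> F \<bullet> (G x *v \<nu> F)) has_derivative (\<lambda>w. c * (\<nu> F \<bullet> w))) (at y within closure P)"
    using assms(2) F y unfolding boundary_conditions_with_def by blast
  then show "((\<lambda>x. \<nu> F \<bullet> (H x *v \<nu> F)) has_derivative (\<lambda>w. c * (\<nu> F \<bullet> w))) (at y within closure P)"
    by (rule has_derivative_transform[OF yc, rotated]) (simp add: assms(1))
qed

text \<open>
  A solution together with a smooth extension \<open>G\<close> to the open set \<open>U\<close>; \<open>u\<close> and \<open>c\<close> are the coefficients of
  \<open>S(G)\<close>.
\<close>

definition extended_solution ::
  "(real ^ 'n) set \<Rightarrow> (real ^ 'n \<Rightarrow> real ^ 'n ^ 'n) \<Rightarrow> real ^ 'n \<Rightarrow> real \<Rightarrow> bool" where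
  "extended_solution U G u c \<longleftrightarrow> open U \<and> closure P \<subseteq> U \<and> smooth_on U G \<and>
     (\<forall>x\<in>U. transpose (G x) = G x) \<and> boundary_conditions_with 2 G \<and>
     (\<forall>x\<in>P. double_divergence G x = - (u \<bullet> x + c))"

lemma extended_solutionD:
  assumes "extended_solution U G u c"
  shows "open U" "closure P \<subseteq> U" "smooth_on U G" "x \<in> U \<Longrightarrow> transpose (G x) = G x"
    "boundary_conditions_with 2 G" "x \<in> P \<Longrightarrow> double_divergence G x = - (u \<bullet> x + c)"
  using assms by (simp_all add: extended_solution_def)

lemma formal_solution_extension:
  assumes "label_of P \<sigma> = \<nu>" "H \<in> formal_extremal_solutions P \<sigma>"
  shows "\<exists>U G u c. extended_solution U G u c \<and> (\<forall>x\<in>closure P. H x = G x)"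
proof -
  from assms(2) have H: "smooth_Sym2 P H" "boundary_conditions_with 2 H"
     and "\<exists>a\<in>affine_functions. \<forall>x\<in>P. S_op H x = a x"
    by (simp_all add: formal_extremal_solutions_def boundary_conditions_eq[OF assms(1)])
  then obtain u c where uc: "\<And>x. x \<in> P \<Longrightarrow> S_op H x = u \<bullet> x + c" by (auto simp: affine_functions_def)
  from H(1) obtain U G where G: "open U" "closure P \<subseteq> U" "smooth_on U G" "\<forall>x\<in>U. transpose (G x) = G x"
    "\<forall>x\<in>closure P. H x = G x"
    unfolding smooth_Sym2_def by blast
  have bcG: "boundary_conditions_with 2 G" by (rule boundary_conditions_with_cong[OF _ H(2)]) (use G(5) in auto)
  have ddG: "double_divergence G x = - (u \<bullet> x + c)" if x: "x \<in> P" for x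
  proof -
    have "double_divergence G x = double_divergence H x"
      by (rule double_divergence_cong[OF P_open x]) (use G(5) closure_subset[of P] in auto)
    then show ?thesis using uc[OF x] by (simp add: S_op_eq)
  qed
  have "extended_solution U G u c" unfolding extended_solution_def using G bcG ddG by simp
  then show ?thesis using G(5) by blast
qed

lemma formal_solutionI:
  assumes "label_of P \<sigma> = \<nu>" "open U" "closure P \<subseteq> U" "smooth_on U G" "\<And>x. x \<in> U \<Longrightarrow> transpose (G x) = G x"
    "boundary_conditions_with 2 G" "\<And>x. x \<in> P \<Longrightarrow> double_divergence G x = - (u \<bullet> x + c)"
    and H: "\<And>x. x \<in> closure P \<Longrightarrow> G x = H x"
  shows "H \<in> formal_extremal_solutions P \<sigma>"
proof -
  have "smooth_Sym2 P H" unfolding smooth_Sym2_def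
    by (intro exI[of _ U] exI[of _ G]) (use assms in auto)
  moreover have "boundary_conditions P \<sigma> H"
    unfolding boundary_conditions_eq[OF assms(1)] by (rule boundary_conditions_with_cong[OF H assms(6)])
  moreover have S: "S_op H x = u \<bullet> x + c" if x: "x \<in> P" for x
  proof -
    have "double_divergence H x = double_divergence G x"
      by (rule double_divergence_cong[OF P_open x]) (use H closure_subset[of P] in auto)
    then show ?thesis using assms(7)[OF x] by (simp add: S_op_eq)
  qed
  moreover have "\<exists>a\<in>affine_functions. \<forall>x\<in>P. S_op H x = a x"
    by (rule bexI[of _ "\<lambda>x. u \<bullet> x + c"]) (auto simp: affine_functions_def S)
  ultimately show ?thesis by (simp add: formal_extremal_solutions_def)
qed

lemma formal_solutions_affine_space:
  assumes lab: "label_of P \<sigma> = \<nu>" and G: "G \<in> formal_extremal_solutions P \<sigma>" and H: "H \<in> formal_extremal_solutions P \<sigma>"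
  shows "(\<lambda>x. (1 - a) *\<^sub>R G x + a *\<^sub>R H x) \<in> formal_extremal_solutions P \<sigma>"
proof -
  obtain U G' u c where eG: "extended_solution U G' u c" and GG: "\<forall>x\<in>closure P. G x = G' x"
    using formal_solution_extension[OF lab G] by blast
  obtain V H' w d where eH: "extended_solution V H' w d" and HH: "\<forall>x\<in>closure P. H x = H' x"
    using formal_solution_extension[OF lab H] by blast
  note G' = extended_solutionD(1-4)[OF eG] GG[rule_format] extended_solutionD(5,6)[OF eG]
  note H' = extended_solutionD(1-4)[OF eH] HH[rule_format] extended_solutionD(5,6)[OF eH]
  define W where "W = U \<inter> V"
  have W: "open W" "closure P \<subseteq> W" using G'(1,2) H'(1,2) by (auto simp: W_def)
  have sG: "smooth_on W G'" and sH: "smooth_on W H'"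
    using smooth_on_subset[OF G'(3)] smooth_on_subset[OF H'(3)] by (auto simp: W_def)
  have sa: "smooth_on W (\<lambda>x. (1 - a) *\<^sub>R G' x)" "smooth_on W (\<lambda>x. a *\<^sub>R H' x)"
    by (rule smooth_on_bounded_linear[OF bounded_linear_scaleR_right W(1)], fact)+
  show ?thesis
  proof (rule formal_solutionI[OF lab W, where G = "\<lambda>x. (1 - a) *\<^sub>R G' x + a *\<^sub>R H' x" and
        u = "(1 - a) *\<^sub>R u + a *\<^sub>R w" and c = "(1 - a) * c + a * d"])
    show "smooth_on W (\<lambda>x. (1 - a) *\<^sub>R G' x + a *\<^sub>R H' x)" by (intro smooth_on_add W sa)
    fix x
    show "transpose ((1 - a) *\<^sub>R G' x + a *\<^sub>R H' x) = (1 - a) *\<^sub>R G' x + a *\<^sub>R H' x" if "x \<in> W"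
      using G'(4)[of x] H'(4)[of x] that by (simp add: W_def transpose_def vec_eq_iff)
    show "boundary_conditions_with 2 (\<lambda>x. (1 - a) *\<^sub>R G' x + a *\<^sub>R H' x)"
      using boundary_conditions_add[OF boundary_conditions_scaleR[OF G'(6), of "1 - a"]
          boundary_conditions_scaleR[OF H'(6), of a]] by (simp add: algebra_simps)
    show "double_divergence (\<lambda>x. (1 - a) *\<^sub>R G' x + a *\<^sub>R H' x) x = - (((1 - a) *\<^sub>R u + a *\<^sub>R w) \<bullet> x + ((1 - a) * c + a * d))"
      if x: "x \<in> P"
    proof -
      have xW: "x \<in> W" using x W(2) closure_subset[of P] by blast
      show ?thesis
        unfolding double_divergence_add[OF W(1) sa xW] double_divergence_scaleR[OF W(1) sG xW]
          double_divergence_scaleR[OF W(1) sH xW] G'(7)[OF x] H'(7)[OF x]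
        by (simp add: inner_add_left algebra_simps)
    qed
    show "(1 - a) *\<^sub>R G' x + a *\<^sub>R H' x = (1 - a) *\<^sub>R G x + a *\<^sub>R H x" if "x \<in> closure P"
      using that G'(5) H'(5) by simp
  qed
qed

lemma formal_solutions_ne:
  assumes lab: "label_of P \<sigma> = \<nu>"
  shows "\<exists>H u c. smooth_on UNIV H \<and> (\<forall>x. transpose (H x) = H x) \<and> boundary_conditions_with 2 H \<and>
     (\<forall>x\<in>P. double_divergence H x = - (u \<bullet> x + c)) \<and> H \<in> formal_extremal_solutions P \<sigma>"
proof -
  obtain H u c where H: "smooth_on UNIV H" "\<And>x. transpose (H x) = H x" "boundary_conditions_with 2 H"
    "\<And>x. x \<in> P \<Longrightarrow> double_divergence H x = u \<bullet> x + c"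
    using formal_solution_exists by blast
  have dd: "double_divergence H x = - ((- u) \<bullet> x + (- c))" if "x \<in> P" for x using H(4)[OF that] by simp
  have "H \<in> formal_extremal_solutions P \<sigma>"
    by (rule formal_solutionI[OF lab open_UNIV subset_UNIV H(1,2,3) dd]) auto
  then show ?thesis using H dd by blast
qed

text \<open>
  To one solution one may add fields with vanishing double divergence and compact support in \<open>P\<close>. If the
  supports are disjoint, evaluation at a point of one of them isolates one coefficient.
\<close>

lemma formal_solutions_infinite_dimensional:
  assumes lab: "label_of P \<sigma> = \<nu>" and n: "CARD('n) \<ge> 2"
  shows "infinite_dimensional_affine_family (closure P) (formal_extremal_solutions P \<sigma>)"
proof -
  obtain H u c where H: "smooth_on UNIV H" "\<And>x. transpose (H x) = H x" "boundary_conditions_with 2 H"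
    "\<And>x. x \<in> P \<Longrightarrow> double_divergence H x = - (u \<bullet> x + c)"
    using formal_solutions_ne[OF lab] by blast
  obtain p where p: "p \<in> P" using P_ne by blast
  obtain d where d: "d > 0" "ball p d \<subseteq> P" using p P_open open_contains_ball by blast
  define e where "e = (axis (SOME i. True) 1 :: real ^ 'n)"
  have e: "norm e = 1" by (simp add: e_def)
  define q where "q k = p + (d / real (k + 2)) *\<^sub>R e" for k
  define r where "r k = d / (4 * (real (k + 3))\<^sup>2)" for k
  note balls = disjoint_cballs[OF d(1) e q_def r_def]
  have "\<forall>k. \<exists>K :: real ^ 'n \<Rightarrow> real ^ 'n ^ 'n. smooth_on UNIV K \<and> (\<forall>x. transpose (K x) = K x) \<and>
    (\<forall>x. x \<notin> cball (q k) (r k) \<longrightarrow> K x = 0) \<and> (\<forall>x. double_divergence K x = 0) \<and> (\<exists>z. K z \<noteq> 0)"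
    by (intro allI divergence_free_bump n balls(1))
  from choice[OF this] obtain K :: "nat \<Rightarrow> real ^ 'n \<Rightarrow> real ^ 'n ^ 'n" where
    "\<forall>k. smooth_on UNIV (K k) \<and> (\<forall>x. transpose (K k x) = K k x) \<and>
    (\<forall>x. x \<notin> cball (q k) (r k) \<longrightarrow> K k x = 0) \<and> (\<forall>x. double_divergence (K k) x = 0) \<and> (\<exists>z. K k z \<noteq> 0)" by (rule exE)
  then have K: "smooth_on UNIV (K k)" "transpose (K k x) = K k x" "x \<notin> cball (q k) (r k) \<Longrightarrow> K k x = 0"
    "double_divergence (K k) x = 0" "\<exists>z. K k z \<noteq> 0" for k x by simp_all
  have cP: "cball (q k) (r k) \<subseteq> P" for k using balls(2)[of k] d(2) by blast
  have sol: "(\<lambda>x. H x + K k x) \<in> formal_extremal_solutions P \<sigma>" for k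
  proof (rule formal_solutionI[OF lab open_UNIV subset_UNIV, where G = "\<lambda>x. H x + K k x" and u = u and c = c])
    show "smooth_on UNIV (\<lambda>x. H x + K k x)" by (intro smooth_on_add H K open_UNIV)
    show "transpose (H x + K k x) = H x + K k x" for x
      using H(2)[of x] K(2)[of k x] by (simp add: transpose_def vec_eq_iff)
    have "flat (K k)" by (rule flat_compact_support[OF K(1,2) compact_cball cP K(3)])
    then show "boundary_conditions_with 2 (\<lambda>x. H x + K k x)"
      using boundary_conditions_add[OF H(3), of 0 "K k"] by (simp add: flat_def)
    show "double_divergence (\<lambda>x. H x + K k x) x = - (u \<bullet> x + c)" if "x \<in> P" for x
      unfolding double_divergence_add[OF open_UNIV H(1) K(1) UNIV_I] H(4)[OF that] K(4) by simp
  qed auto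
  have indep: "\<forall>k\<le>N. a k = 0" if s0: "(\<Sum>k\<le>N. a k) = (0::real)" and z0: "\<forall>x\<in>closure P. (\<Sum>k\<le>N. a k *\<^sub>R (H x + K k x)) = 0" for N a
  proof (intro allI impI)
    fix m assume m: "m \<le> N"
    obtain z where z: "K m z \<noteq> 0" using K(5) by blast
    then have zm: "z \<in> cball (q m) (r m)" using K(3) by blast
    then have zP: "z \<in> closure P" using cP closure_subset[of P] by blast
    have other: "K k z = 0" if "k \<noteq> m" for k
    proof (rule K(3), rule notI)
      assume "z \<in> cball (q k) (r k)"
      then show False using balls(3)[of k m] balls(3)[of m k] zm that by (cases "k < m") auto
    qed
    have "0 = (\<Sum>k\<le>N. a k *\<^sub>R (H z + K k z))" using z0 zP by simp
    also have "\<dots> = (\<Sum>k\<le>N. a k) *\<^sub>R H z + (\<Sum>k\<le>N. a k *\<^sub>R K k z)"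
      by (simp add: scaleR_right_distrib sum.distrib scaleR_sum_left)
    also have "(\<Sum>k\<le>N. a k *\<^sub>R K k z) = (\<Sum>k\<le>N. if k = m then a m *\<^sub>R K m z else 0)"
      by (intro sum.cong refl) (use other in auto)
    also have "\<dots> = a m *\<^sub>R K m z" using m by simp
    finally have "a m *\<^sub>R K m z = 0" using s0 by simp
    then show "a m = 0" using z by simp
  qed
  show ?thesis
    unfolding infinite_dimensional_affine_family_def
  proof (intro conjI ballI allI exI[of _ "\<lambda>k x. H x + K k x"])
    show "(\<lambda>x. (1 - a) *\<^sub>R G x + a *\<^sub>R H' x) \<in> formal_extremal_solutions P \<sigma>"
      if "G \<in> formal_extremal_solutions P \<sigma>" "H' \<in> formal_extremal_solutions P \<sigma>" for G H' a
      by (rule formal_solutions_affine_space[OF lab that])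
    show "(\<lambda>x. H x + K k x) \<in> formal_extremal_solutions P \<sigma>" for k by (rule sol)
    show "(\<Sum>k\<le>N. a k) = (0::real) \<and> (\<forall>x\<in>closure P. (\<Sum>k\<le>N. a k *\<^sub>R (H x + K k x)) = 0) \<longrightarrow> (\<forall>k\<le>N. a k = 0)" for N a
      using indep[of a N] by (intro impI) (elim conjE)
  qed
qed

end

section \<open>Positive semidefinite matrices\<close>

text \<open>
  A positive semidefinite symmetric matrix is a sum of squares of linear forms (Cholesky), so its
  trace pairing with a form that is nonnegative on the diagonal is nonnegative. The induction
  eliminates one coordinate with nonzero diagonal entry at a time.
\<close>

lemma psd_trace_nonneg:
  fixes A :: "real ^ 'n ^ 'n" and D :: "'n \<Rightarrow> 'n \<Rightarrow> real"
  assumes "transpose A = A" "\<And>v. v \<bullet> (A *v v) \<ge> 0"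
    and D: "\<And>v :: real ^ 'n. (\<Sum>i\<in>UNIV. \<Sum>j\<in>UNIV. v $ i * v $ j * D i j) \<ge> 0"
  shows "(\<Sum>i\<in>UNIV. \<Sum>j\<in>UNIV. A $ i $ j * D i j) \<ge> 0"
  using assms(1,2)
proof (induction "card {i. A $ i $ i \<noteq> 0}" arbitrary: A rule: less_induct)
  case less
  note psd = less.prems(2)
  have sym: "A $ i $ j = A $ j $ i" for i j
    using less.prems(1) by (metis transpose_def vec_lambda_beta)
  have Ae: "axis i 1 \<bullet> (A *v axis j 1) = A $ i $ j" for i j
    by (simp add: inner_axis' matrix_vector_mult_basis column_def inner_real_def)
  have swap: "u \<bullet> (A *v w) = w \<bullet> (A *v u)" for u w
  proof -
    have "u \<bullet> (A *v w) = (transpose A *v u) \<bullet> w" by (simp add: dot_lmul_matrix[symmetric] transpose_matrix_vector)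
    then show ?thesis using less.prems(1) by (simp add: inner_commute)
  qed
  have quad: "(v + t *\<^sub>R w) \<bullet> (A *v (v + t *\<^sub>R w)) = v \<bullet> (A *v v) + 2 * t * (w \<bullet> (A *v v)) + t\<^sup>2 * (w \<bullet> (A *v w))" for v w t
  proof -
    have "A *v (v + t *\<^sub>R w) = A *v v + t *\<^sub>R (A *v w)"
      by (simp add: matrix_vector_right_distrib matrix_vector_mult_scaleR)
    then show ?thesis using swap[of v w] by (simp add: inner_add_left inner_add_right power2_eq_square algebra_simps)
  qed
  have zero_row: "A $ i $ j = 0" if i: "A $ i $ i = 0" for i j
  proof (rule ccontr)
    assume n: "A $ i $ j \<noteq> 0"
    define t where "t = - (A $ j $ j + 1) / (2 * A $ i $ j)"
    have "0 \<le> A $ j $ j + 2 * t * A $ i $ j"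
      using psd[of "axis j 1 + t *\<^sub>R axis i 1"] quad[of "axis j 1" t "axis i 1"] by (simp add: Ae i)
    also have "\<dots> = - 1" using n by (simp add: t_def field_simps)
    finally show False by simp
  qed
  show ?case
  proof (cases "\<exists>k. A $ k $ k \<noteq> 0")
    case False
    then have "A $ i $ j = 0" for i j using zero_row by blast
    then show ?thesis by simp
  next
    case True
    then obtain k where k: "A $ k $ k \<noteq> 0" by blast
    have kp: "A $ k $ k > 0" using psd[of "axis k 1"] k by (simp add: Ae less_le)
    define a where "a = A *v axis k 1"
    have ai: "a $ i = A $ i $ k" for i by (simp add: a_def matrix_vector_mult_basis column_def)
    have av: "a \<bullet> v = axis k 1 \<bullet> (A *v v)" for v using swap[of "axis k 1" v] by (simp add: a_def inner_commute)
    define A' where "A' = A - (1 / A $ k $ k) *\<^sub>R rank_one a"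
    have A'e: "A' $ i $ j = A $ i $ j - (A $ i $ k * A $ j $ k) / A $ k $ k" for i j
      by (simp add: A'_def rank_one_def ai)
    have tr: "transpose A' = A'" by (simp add: transpose_def vec_eq_iff A'e sym mult.commute)
    have psd': "v \<bullet> (A' *v v) \<ge> 0" for v
    proof -
      have "v \<bullet> (A' *v v) = v \<bullet> (A *v v) - (a \<bullet> v)\<^sup>2 / A $ k $ k"
        by (simp add: A'_def matrix_vector_mult_diff_rdistrib scaleR_matrix_vector_assoc[symmetric] rank_one_mult
            inner_diff_right power2_eq_square inner_commute)
      also have "\<dots> = (v + (- (a \<bullet> v) / A $ k $ k) *\<^sub>R axis k 1) \<bullet> (A *v (v + (- (a \<bullet> v) / A $ k $ k) *\<^sub>R axis k 1))"
        unfolding quad av[symmetric] Ae using k by (simp add: power2_eq_square field_simps)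
      finally show ?thesis using psd by simp
    qed
    have "{i. A' $ i $ i \<noteq> 0} \<subset> {i. A $ i $ i \<noteq> 0}"
    proof (rule psubsetI)
      show "{i. A' $ i $ i \<noteq> 0} \<subseteq> {i. A $ i $ i \<noteq> 0}" using zero_row by (auto simp: A'e)
      have "A' $ k $ k = 0" using k by (simp add: A'e)
      then show "{i. A' $ i $ i \<noteq> 0} \<noteq> {i. A $ i $ i \<noteq> 0}" using k by blast
    qed
    then have "card {i. A' $ i $ i \<noteq> 0} < card {i. A $ i $ i \<noteq> 0}" by (intro psubset_card_mono) auto
    from less.hyps[OF this tr psd'] have h: "(\<Sum>i\<in>UNIV. \<Sum>j\<in>UNIV. A' $ i $ j * D i j) \<ge> 0" .
    have "A $ i $ j * D i j = A' $ i $ j * D i j + (1 / A $ k $ k) * (a $ i * a $ j * D i j)" for i j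
      by (simp add: A'e ai algebra_simps)
    then have "(\<Sum>i\<in>UNIV. \<Sum>j\<in>UNIV. A $ i $ j * D i j) = (\<Sum>i\<in>UNIV. \<Sum>j\<in>UNIV. A' $ i $ j * D i j) +
       (1 / A $ k $ k) * (\<Sum>i\<in>UNIV. \<Sum>j\<in>UNIV. a $ i * a $ j * D i j)"
      by (simp only: sum.distrib sum_distrib_left)
    moreover have "(1 / A $ k $ k) * (\<Sum>i\<in>UNIV. \<Sum>j\<in>UNIV. a $ i * a $ j * D i j) \<ge> 0"
      using D[of a] kp by (intro mult_nonneg_nonneg) auto
    ultimately show ?thesis using h by simp
  qed
qed

section \<open>Convex functions\<close>

lemma convex_tangent:
  fixes f :: "'a::real_normed_vector \<Rightarrow> real"
  assumes f: "convex_on C f" "smooth_on U f" and x: "x \<in> C" "x \<in> U" and y: "y \<in> C"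
  shows "f y \<ge> f x + dderiv (y - x) f x"
proof -
  define \<phi> where "\<phi> t = f (x + t *\<^sub>R (y - x))" for t
  have "(\<phi> has_real_derivative dderiv (y - x) f x) (at 0)"
    unfolding \<phi>_def using dderiv_line_real[OF f(2), of x 0 "y - x"] x by simp
  then have "((\<lambda>h. (\<phi> (0 + h) - \<phi> 0) / h) \<longlongrightarrow> dderiv (y - x) f x) (at 0)" by (simp add: DERIV_def)
  then have "((\<lambda>h. (\<phi> (0 + h) - \<phi> 0) / h) \<longlongrightarrow> dderiv (y - x) f x) (at_right 0)"
    by (rule filterlim_mono) (auto intro: at_le)
  moreover have "\<forall>\<^sub>F h in at_right 0. (\<phi> (0 + h) - \<phi> 0) / h \<le> f y - f x"
    unfolding eventually_at_right_field
  proof (intro exI[of _ 1] conjI allI impI)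
    fix h :: real assume h: "0 < h" "h < 1"
    have "f ((1 - h) *\<^sub>R x + h *\<^sub>R y) \<le> (1 - h) * f x + h * f y"
      using convex_onD[OF f(1), of h x y] h x y by simp
    moreover have "x + h *\<^sub>R (y - x) = (1 - h) *\<^sub>R x + h *\<^sub>R y" by (simp add: algebra_simps)
    ultimately have "\<phi> h - \<phi> 0 \<le> h * (f y - f x)" by (simp add: \<phi>_def algebra_simps)
    then show "(\<phi> (0 + h) - \<phi> 0) / h \<le> f y - f x" using h by (simp add: field_simps)
  qed simp
  ultimately have "dderiv (y - x) f x \<le> f y - f x" by (rule tendsto_upperbound) simp
  then show ?thesis by simp
qed

lemma convex_second_derivative_nonneg:
  fixes f :: "'a::real_normed_vector \<Rightarrow> real"
  assumes f: "convex_on C f" "smooth_on U f" and P: "open P" "P \<subseteq> C" "P \<subseteq> U" and x: "x \<in> P"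
  shows "dderiv v (dderiv v f) x \<ge> 0"
proof -
  have xU: "x \<in> U" using x P by blast
  have "((\<lambda>t. dderiv v f (x + t *\<^sub>R v)) has_real_derivative dderiv v (dderiv v f) x) (at 0)"
    using dderiv_line_real[OF smooth_on_dderiv[OF f(2)], of x 0 v v] xU by simp
  then have "((\<lambda>h. (dderiv v f (x + (0 + h) *\<^sub>R v) - dderiv v f (x + 0 *\<^sub>R v)) / h) \<longlongrightarrow> dderiv v (dderiv v f) x) (at 0)"
    by (simp add: DERIV_def)
  then have "((\<lambda>h. (dderiv v f (x + (0 + h) *\<^sub>R v) - dderiv v f (x + 0 *\<^sub>R v)) / h) \<longlongrightarrow> dderiv v (dderiv v f) x) (at_right 0)"
    by (rule filterlim_mono) (auto intro: at_le)
  moreover have "\<forall>\<^sub>F h in at_right 0. 0 \<le> (dderiv v f (x + (0 + h) *\<^sub>R v) - dderiv v f (x + 0 *\<^sub>R v)) / h"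
  proof -
    have "continuous_on UNIV (\<lambda>t. x + t *\<^sub>R v)" by (intro continuous_intros)
    then have "open {t. x + t *\<^sub>R v \<in> P}" using open_vimage[OF P(1)] by (simp add: vimage_def)
    then have "\<forall>\<^sub>F h in nhds 0. h \<in> {t. x + t *\<^sub>R v \<in> P}" using x by (intro eventually_nhds_in_open) auto
    then have "\<forall>\<^sub>F h in at_right 0. x + h *\<^sub>R v \<in> P" unfolding eventually_at_filter by eventually_elim auto
    moreover have "\<forall>\<^sub>F h in at_right 0. (h::real) > 0" by (rule eventually_at_right_less)
    ultimately show ?thesis
    proof eventually_elim
      case (elim h)
      define y where "y = x + h *\<^sub>R v"
      have y: "y \<in> C" "y \<in> U" using elim P by (auto simp: y_def)
      have xC: "x \<in> C" using x P by blast
      have yx: "y - x = h *\<^sub>R v" "x - y = (- h) *\<^sub>R v" by (simp_all add: y_def)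
      have "dderiv (y - x) f x = h * dderiv v f x" "dderiv (x - y) f y = - h * dderiv v f y"
        unfolding yx using linear_scale[OF dderiv_linear[OF f(2) xU]] linear_scale[OF dderiv_linear[OF f(2) y(2)]]
        by (simp_all only: real_scaleR_def)
      then have "h * dderiv v f x \<le> h * dderiv v f y"
        using convex_tangent[OF f xC xU y(1)] convex_tangent[OF f y xC] by linarith
      then have "dderiv v f x \<le> dderiv v f y" using elim by simp
      then show ?case using elim by (simp add: y_def)
    qed
  qed
  ultimately show ?thesis by (rule tendsto_lowerbound) simp
qed

lemma hessian_trace_rank_one:
  fixes f :: "real ^ 'n \<Rightarrow> real"
  assumes U: "open U" "smooth_on U f" "x \<in> U"
  shows "(\<Sum>i\<in>UNIV. \<Sum>j\<in>UNIV. v $ i * v $ j * dderiv (axis j 1) (dderiv (axis i 1) f) x) = dderiv v (dderiv v f) x"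
proof -
  have "(\<Sum>i\<in>UNIV. \<Sum>j\<in>UNIV. v $ i * v $ j * dderiv (axis j 1) (dderiv (axis i 1) f) x) =
      (\<Sum>i\<in>UNIV. v $ i * dderiv v (dderiv (axis i 1) f) x)"
    by (intro sum.cong refl)
      (simp only: mult.assoc sum_distrib_left[symmetric] dderiv_axis_sum[OF smooth_on_dderiv[OF U(2)] U(3)])
  also have "\<dots> = (\<Sum>i\<in>UNIV. v $ i * dderiv (axis i 1) (dderiv v f) x)"
    by (simp add: dderiv_commute[OF U(2,1,3), of v])
  also have "\<dots> = dderiv v (dderiv v f) x" by (rule dderiv_axis_sum[OF smooth_on_dderiv[OF U(2)] U(3)])
  finally show ?thesis .
qed

lemma integral_dilation:
  fixes g :: "real ^ 'n \<Rightarrow> real"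
  assumes g: "g \<in> borel_measurable borel" and c: "c \<noteq> 0"
  shows "(\<integral>x. g x \<partial>lborel) = \<bar>c\<bar> ^ CARD('n) * (\<integral>x. g (p + c *\<^sub>R (x - p)) \<partial>lborel)"
proof -
  define t where "t = p - c *\<^sub>R p"
  have "(\<integral>x. g x \<partial>lborel) = (\<integral>x. g x \<partial>density (distr lborel borel (\<lambda>x. t + c *\<^sub>R x)) (\<lambda>_. ennreal (\<bar>c\<bar> ^ DIM(real ^ 'n))))"
    by (rule arg_cong[OF lborel_affine[OF c, of t]])
  also have "\<dots> = (\<integral>x. (\<bar>c\<bar> ^ DIM(real ^ 'n)) *\<^sub>R g x \<partial>distr lborel borel (\<lambda>x. t + c *\<^sub>R x))"
    by (rule integral_density) (use g in auto)
  also have "\<dots> = (\<integral>x. (\<bar>c\<bar> ^ DIM(real ^ 'n)) *\<^sub>R g (t + c *\<^sub>R x) \<partial>lborel)"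
    by (rule integral_distr) (use g in measurable)
  also have "\<dots> = \<bar>c\<bar> ^ CARD('n) * (\<integral>x. g (t + c *\<^sub>R x) \<partial>lborel)" by simp
  also have "(\<lambda>x. g (t + c *\<^sub>R x)) = (\<lambda>x. g (p + c *\<^sub>R (x - p)))" by (simp add: t_def algebra_simps)
  finally show ?thesis .
qed

text \<open>
  The weight \<open>u\<close> is orthogonal to the affine functions, although the integral of \<open>f\<close> against it bounds the
  one against \<open>\<eta>\<close>. Adding to \<open>\<eta>\<close> a reflected and contracted copy moves the barycentre to \<open>p\<close>; then one
  subtracts the contraction towards \<open>p\<close> by the factor 2, which has the same affine moments. Convexity
  bounds the integral of \<open>f\<close> against the contraction by half of the original one.
\<close>

lemma balanced_weight:
  fixes \<eta> :: "real ^ 'n \<Rightarrow> real"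
  assumes P: "open P" "convex P" "p \<in> P" and \<eta>: "smooth_on UNIV \<eta>" "\<And>x. \<eta> x \<ge> 0"
    and S: "compact S" "S \<subseteq> P" "\<And>x. x \<notin> S \<Longrightarrow> \<eta> x = 0"
  shows "\<exists>u T. smooth_on UNIV u \<and> compact T \<and> T \<subseteq> P \<and> (\<forall>x. x \<notin> T \<longrightarrow> u x = 0) \<and>
    (\<integral>x. u x \<partial>lborel) = 0 \<and> (\<forall>i. (\<integral>x. x $ i * u x \<partial>lborel) = 0) \<and>
    (\<forall>f. continuous_on (closure P) f \<longrightarrow> convex_on (closure P) f \<longrightarrow> f p = 0 \<longrightarrow> (\<forall>x\<in>closure P. f x \<ge> 0) \<longrightarrow>
       (LINT x:P|lborel. f x * \<eta> x) \<le> 2 * (LINT x:P|lborel. f x * u x))"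
proof -
  let ?n = "CARD('n)"
  obtain d where d: "d > 0" "ball p d \<subseteq> P" using P open_contains_ball by blast
  obtain M where M: "M > 0" "\<And>y. y \<in> S \<Longrightarrow> norm (y - p) \<le> M"
  proof -
    have "bounded ((\<lambda>y. y - p) ` S)" using compact_imp_bounded[OF S(1)] by (simp add: bounded_translation_minus)
    then show ?thesis using that by (auto simp: bounded_pos)
  qed
  \<comment> \<open>a contraction by this factor sends \<open>S\<close> into the ball around \<open>p\<close>, which lies in \<open>P\<close>\<close>
  define s where "s = 1 + M / d"
  have s: "s > 0" "M / s < d"
    using M d by (auto simp: s_def add_pos_pos field_simps)
  have smd: "smooth_on UNIV (\<lambda>x. h (p + c *\<^sub>R (x - p)))" if "smooth_on UNIV h" for h :: "real ^ 'n \<Rightarrow> real" and c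
    using smooth_on_compose_affine[OF bounded_linear_scaleR_right[of c] open_UNIV that, of "p - c *\<^sub>R p"]
    by (simp add: algebra_simps)
  define \<theta> where "\<theta> x = \<eta> x + s ^ Suc ?n * \<eta> (p + (- s) *\<^sub>R (x - p))" for x
  define u where "u x = \<theta> x - 2 ^ ?n * \<theta> (p + 2 *\<^sub>R (x - p))" for x
  have sm\<theta>: "smooth_on UNIV \<theta>" unfolding \<theta>_def by (intro smooth_on_add smooth_on_mult smooth_on_const \<eta> smd open_UNIV)
  have smu: "smooth_on UNIV u" unfolding u_def by (intro smooth_on_diff smooth_on_mult smooth_on_const sm\<theta> smd open_UNIV)
  have \<theta>0: "\<theta> x \<ge> 0" "\<theta> x \<ge> \<eta> x" for x unfolding \<theta>_def using \<eta>(2) s(1) by auto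
  have undo: "z \<in> (\<lambda>y. p + (1 / c) *\<^sub>R (y - p)) ` K" if "c \<noteq> 0" and y: "p + c *\<^sub>R (z - p) \<in> K" for c z and K :: "(real ^ 'n) set"
  proof (rule image_eqI[OF _ y])
    have "(1 / c) *\<^sub>R (p + c *\<^sub>R (z - p) - p) = z - p" using that(1) by simp
    then show "z = p + (1 / c) *\<^sub>R (p + c *\<^sub>R (z - p) - p)" by simp
  qed
  define S1 where "S1 = S \<union> (\<lambda>y. p + (1 / (- s)) *\<^sub>R (y - p)) ` S"
  define S2 where "S2 = S1 \<union> (\<lambda>y. p + (1 / 2) *\<^sub>R (y - p)) ` S1"
  have cS1: "compact S1" unfolding S1_def
    by (intro compact_Un compact_continuous_image S continuous_intros)
  have cS2: "compact S2" unfolding S2_def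
    by (intro compact_Un compact_continuous_image cS1 continuous_intros)
  have S1P: "S1 \<subseteq> P"
  proof -
    have "p + (1 / (- s)) *\<^sub>R (y - p) \<in> P" if "y \<in> S" for y
    proof -
      have "norm (y - p) / s < d" using M(2)[OF that] s by (meson divide_right_mono less_imp_le order_le_less_trans)
      then have "p + (1 / (- s)) *\<^sub>R (y - p) \<in> ball p d" using s(1) by (simp add: dist_norm)
      then show ?thesis using d(2) by blast
    qed
    then show ?thesis using S(2) by (auto simp: S1_def)
  qed
  have midP: "p + (1 / 2) *\<^sub>R (y - p) = (1 - 1 / 2) *\<^sub>R p + (1 / 2) *\<^sub>R y" for y
    by (simp add: vec_eq_iff field_simps)
  have S2P: "S2 \<subseteq> P"
  proof -
    have "p + (1 / 2) *\<^sub>R (y - p) \<in> P" if "y \<in> S1" for y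
      unfolding midP using S1P that by (intro convexD_alt[OF P(2,3)]) auto
    then show ?thesis unfolding S2_def using S1P by blast
  qed
  have \<theta>S1: "\<theta> x = 0" if x: "x \<notin> S1" for x
  proof -
    have "\<eta> x = 0" using x S(3) by (auto simp: S1_def)
    moreover have "\<eta> (p + (- s) *\<^sub>R (x - p)) = 0"
    proof (rule S(3), rule notI)
      assume y: "p + (- s) *\<^sub>R (x - p) \<in> S"
      have "x \<in> S1" unfolding S1_def by (rule UnI2, rule undo[OF _ y]) (use s(1) in simp)
      then show False using x by simp
    qed
    ultimately show ?thesis by (simp add: \<theta>_def)
  qed
  have uS2: "u x = 0" if x: "x \<notin> S2" for x
  proof -
    have "\<theta> x = 0" using x by (intro \<theta>S1) (auto simp: S2_def)
    moreover have "\<theta> (p + 2 *\<^sub>R (x - p)) = 0"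
    proof (rule \<theta>S1, rule notI)
      assume y: "p + 2 *\<^sub>R (x - p) \<in> S1"
      have "x \<in> S2" unfolding S2_def by (rule UnI2, rule undo[OF _ y]) simp
      then show False using x by simp
    qed
    ultimately show ?thesis by (simp add: u_def)
  qed
  note bm = borel_measurable_continuous_onI[OF smooth_on_continuous]
  have dil: "\<bar>c\<bar> ^ ?n * (\<integral>x. h (p + c *\<^sub>R (x - p)) \<partial>lborel) = (\<integral>x. h x \<partial>lborel)"
    if "smooth_on UNIV h" "c \<noteq> 0" for h c
    by (rule integral_dilation[OF bm[OF that(1)] that(2), symmetric])
  have sml: "smooth_on UNIV (\<lambda>x::real ^ 'n. x $ i - p $ i)" for i
    by (intro smooth_on_diff smooth_on_const open_UNIV smooth_on_component[OF open_UNIV smooth_on_id[OF open_UNIV]])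
  have int: "integrable lborel (\<lambda>x. (x $ i - p $ i) * h x)" "integrable lborel h"
    if "smooth_on UNIV h" "compact K" "\<And>x. x \<notin> K \<Longrightarrow> h x = 0" for h K i
    by (rule integrable_compact_support[OF smooth_on_continuous that(2)]; use that in \<open>auto intro!: smooth_on_mult sml\<close>)+
  have cpt: "compact ((\<lambda>y. p + (1 / c) *\<^sub>R (y - p)) ` K)" if "compact K" for c :: real and K
    by (intro compact_continuous_image that continuous_intros)
  have out: "h (p + c *\<^sub>R (x - p)) = 0"
    if "\<And>x. x \<notin> K \<Longrightarrow> h x = 0" "c \<noteq> 0" "x \<notin> (\<lambda>y. p + (1 / c) *\<^sub>R (y - p)) ` K" for h :: "real ^ 'n \<Rightarrow> real" and c K x
  proof (rule that(1), rule notI)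
    assume y: "p + c *\<^sub>R (x - p) \<in> K"
    show False using undo[OF that(2) y] that(3) by blast
  qed
  have mom: "\<bar>c\<bar> ^ ?n * (\<integral>x. (x $ i - p $ i) * h (p + c *\<^sub>R (x - p)) \<partial>lborel) = (1 / c) * (\<integral>x. (x $ i - p $ i) * h x \<partial>lborel)"
    if "smooth_on UNIV h" "c \<noteq> 0" for h c i
  proof -
    have "(x $ i - p $ i) * h (p + c *\<^sub>R (x - p)) =
       (1 / c) * (((p + c *\<^sub>R (x - p)) $ i - p $ i) * h (p + c *\<^sub>R (x - p)))" for x
      using that(2) by simp
    then have "\<bar>c\<bar> ^ ?n * (\<integral>x. (x $ i - p $ i) * h (p + c *\<^sub>R (x - p)) \<partial>lborel) =
      (1 / c) * (\<bar>c\<bar> ^ ?n * (\<integral>x. ((p + c *\<^sub>R (x - p)) $ i - p $ i) * h (p + c *\<^sub>R (x - p)) \<partial>lborel))"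
      by (simp only: integral_mult_right_zero mult_ac)
    also have "\<bar>c\<bar> ^ ?n * (\<integral>x. ((p + c *\<^sub>R (x - p)) $ i - p $ i) * h (p + c *\<^sub>R (x - p)) \<partial>lborel) = (\<integral>x. (x $ i - p $ i) * h x \<partial>lborel)"
      by (rule dil[of "\<lambda>x. (x $ i - p $ i) * h x"]) (intro smooth_on_mult sml that open_UNIV)+
    finally show ?thesis .
  qed
  have i\<theta>: "integrable lborel \<theta>" "integrable lborel (\<lambda>x. (x $ i - p $ i) * \<theta> x)" for i
    using int[OF sm\<theta> cS1 \<theta>S1] by auto
  have out\<theta>: "\<theta> (p + 2 *\<^sub>R (x - p)) = 0" if "x \<notin> (\<lambda>y. p + (1 / 2) *\<^sub>R (y - p)) ` S1" for x
    by (rule out[where h = \<theta> and K = S1 and c = 2, OF \<theta>S1 _ that]) simp_all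
  have out\<eta>: "\<eta> (p + (- s) *\<^sub>R (x - p)) = 0" if "x \<notin> (\<lambda>y. p + (1 / (- s)) *\<^sub>R (y - p)) ` S" for x
    by (rule out[where h = \<eta> and K = S and c = "- s", OF S(3) _ that]) (use s(1) in simp_all)
  have i\<theta>2: "integrable lborel (\<lambda>x. \<theta> (p + 2 *\<^sub>R (x - p)))" "integrable lborel (\<lambda>x. (x $ i - p $ i) * \<theta> (p + 2 *\<^sub>R (x - p)))" for i
    using int[OF smd[OF sm\<theta>, of 2] cpt[OF cS1, of 2] out\<theta>] by simp_all
  have u0: "(\<integral>x. u x \<partial>lborel) = 0"
    unfolding u_def using i\<theta>(1) i\<theta>2(1) dil[OF sm\<theta>, of 2] by simp
  have \<theta>m: "(\<integral>x. (x $ i - p $ i) * \<theta> x \<partial>lborel) = 0" for i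
  proof -
    have i1: "integrable lborel (\<lambda>x. (x $ i - p $ i) * \<eta> x)" by (rule int(1)[OF \<eta>(1) S(1,3)])
    have i2: "integrable lborel (\<lambda>x. (x $ i - p $ i) * \<eta> (p + (- s) *\<^sub>R (x - p)))"
      by (rule int(1)[OF smd[OF \<eta>(1)] cpt[OF S(1), of "- s"] out\<eta>])
    have "(\<integral>x. (x $ i - p $ i) * \<theta> x \<partial>lborel) = (\<integral>x. (x $ i - p $ i) * \<eta> x +
        s ^ Suc ?n * ((x $ i - p $ i) * \<eta> (p + (- s) *\<^sub>R (x - p))) \<partial>lborel)"
      by (simp add: \<theta>_def algebra_simps)
    also have "\<dots> = (\<integral>x. (x $ i - p $ i) * \<eta> x \<partial>lborel) + s * (s ^ ?n * (\<integral>x. (x $ i - p $ i) * \<eta> (p + (- s) *\<^sub>R (x - p)) \<partial>lborel))"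
      using i1 i2 by simp
    also have "s ^ ?n * (\<integral>x. (x $ i - p $ i) * \<eta> (p + (- s) *\<^sub>R (x - p)) \<partial>lborel) = (1 / (- s)) * (\<integral>x. (x $ i - p $ i) * \<eta> x \<partial>lborel)"
      using mom[OF \<eta>(1), of "- s" i] s(1) by simp
    finally show ?thesis using s(1) by simp
  qed
  have um: "(\<integral>x. x $ i * u x \<partial>lborel) = 0" for i
  proof -
    have "(\<integral>x. (x $ i - p $ i) * u x \<partial>lborel) =
      (\<integral>x. (x $ i - p $ i) * \<theta> x - 2 ^ ?n * ((x $ i - p $ i) * \<theta> (p + 2 *\<^sub>R (x - p))) \<partial>lborel)"
      by (simp add: u_def algebra_simps)
    also have "\<dots> = 0"
      using i\<theta>(2) i\<theta>2(2) mom[OF sm\<theta>, of 2 i] \<theta>m by simp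
    finally have z: "(\<integral>x. (x $ i - p $ i) * u x \<partial>lborel) = 0" .
    have "(\<integral>x. x $ i * u x \<partial>lborel) = (\<integral>x. (x $ i - p $ i) * u x + p $ i * u x \<partial>lborel)"
      by (simp add: algebra_simps)
    also have "\<dots> = 0" using int[OF smu cS2 uS2] z u0 by simp
    finally show ?thesis .
  qed
  have main: "(LINT x:P|lborel. f x * \<eta> x) \<le> 2 * (LINT x:P|lborel. f x * u x)"
    if f: "continuous_on (closure P) f" "convex_on (closure P) f" "f p = 0" "\<forall>x\<in>closure P. f x \<ge> 0" for f
  proof -
    define g where "g x = indicator (closure P) x * f x" for x
    have gm [measurable]: "g \<in> borel_measurable borel"
      unfolding g_def using borel_measurable_continuous_on_indicator[OF _ f(1)] by simp
    have g0: "g x \<ge> 0" for x using f(4) by (auto simp: g_def indicator_def)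
    have gi: "integrable lborel (\<lambda>x. g x * h x)" if h: "smooth_on UNIV h" "compact K" "K \<subseteq> P" "\<And>x. x \<notin> K \<Longrightarrow> h x = 0" for h K
    proof -
      have "integrable lborel (\<lambda>x. indicator K x *\<^sub>R (f x * h x))"
        using h closure_subset[of P] by (intro borel_integrable_compact continuous_on_mult)
          (auto intro: continuous_on_subset[OF f(1)] continuous_on_subset[OF smooth_on_continuous])
      moreover have "(\<lambda>x. indicator K x *\<^sub>R (f x * h x)) = (\<lambda>x. g x * h x)"
        using h closure_subset[of P] by (auto simp: g_def indicator_def fun_eq_iff)
      ultimately show ?thesis by simp
    qed
    have eqP: "(LINT x:P|lborel. f x * h x) = (\<integral>x. g x * h x \<partial>lborel)" if "K \<subseteq> P" "\<And>x. x \<notin> K \<Longrightarrow> h x = 0" for h K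
      unfolding set_lebesgue_integral_def using that closure_subset[of P]
      by (intro Bochner_Integration.integral_cong) (auto simp: g_def indicator_def)
    note ig\<theta> = gi[OF sm\<theta> cS1 S1P \<theta>S1] and igu = gi[OF smu cS2 S2P uS2] and ig\<eta> = gi[OF \<eta>(1) S]
    have c2: "compact ((\<lambda>y. p + (1 / 2) *\<^sub>R (y - p)) ` S1)" by (rule cpt[OF cS1])
    have igd: "integrable lborel (\<lambda>x. g x * \<theta> (p + 2 *\<^sub>R (x - p)))"
      by (rule gi[OF smd[OF sm\<theta>] c2 _ out\<theta>]) (use S2P in \<open>auto simp: S2_def\<close>)
    have "2 ^ ?n * (\<integral>x. g x * \<theta> (p + 2 *\<^sub>R (x - p)) \<partial>lborel) = (\<integral>y. g (p + (1 / 2) *\<^sub>R (y - p)) * \<theta> y \<partial>lborel)"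
    proof -
      have m1: "(\<lambda>y. g (p + (1 / 2) *\<^sub>R (y - p)) * \<theta> y) \<in> borel_measurable borel" using bm[OF sm\<theta>] by measurable
      show ?thesis using integral_dilation[OF m1, of 2 p] by simp
    qed
    also have "\<dots> \<le> (\<integral>y. (1 / 2) * (g y * \<theta> y) \<partial>lborel)"
    proof (rule integral_mono')
      show "integrable lborel (\<lambda>y. (1 / 2) * (g y * \<theta> y))" using ig\<theta> by simp
      fix y
      show "g (p + (1 / 2) *\<^sub>R (y - p)) * \<theta> y \<le> (1 / 2) * (g y * \<theta> y)"
      proof (cases "y \<in> S1")
        case True
        then have yP: "y \<in> closure P" "p + (1 / 2) *\<^sub>R (y - p) \<in> closure P"
          using S1P S2P closure_subset[of P] by (auto simp: S2_def)
        have "f (p + (1 / 2) *\<^sub>R (y - p)) \<le> (1 / 2) * f y"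
          using convex_onD[OF f(2), of "1 / 2" p y] yP P(3) closure_subset[of P] f(3) unfolding midP by auto
        then have "f (p + (1 / 2) *\<^sub>R (y - p)) * \<theta> y \<le> ((1 / 2) * f y) * \<theta> y" using \<theta>0(1) by (rule mult_right_mono)
        then show ?thesis using yP by (simp add: g_def)
      qed (simp add: \<theta>S1)
      show "0 \<le> (1 / 2) * (g y * \<theta> y)" using g0 \<theta>0 by simp
    qed
    finally have half: "2 ^ ?n * (\<integral>x. g x * \<theta> (p + 2 *\<^sub>R (x - p)) \<partial>lborel) \<le> (1 / 2) * (\<integral>y. g y * \<theta> y \<partial>lborel)" by simp
    have "(\<integral>x. g x * u x \<partial>lborel) = (\<integral>x. g x * \<theta> x - 2 ^ ?n * (g x * \<theta> (p + 2 *\<^sub>R (x - p))) \<partial>lborel)"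
      by (simp add: u_def algebra_simps)
    also have "\<dots> = (\<integral>x. g x * \<theta> x \<partial>lborel) - 2 ^ ?n * (\<integral>x. g x * \<theta> (p + 2 *\<^sub>R (x - p)) \<partial>lborel)"
      using ig\<theta> igd by simp
    finally have "(\<integral>x. g x * u x \<partial>lborel) \<ge> (1 / 2) * (\<integral>y. g y * \<theta> y \<partial>lborel)" using half by linarith
    moreover have "(\<integral>x. g x * \<eta> x \<partial>lborel) \<le> (\<integral>x. g x * \<theta> x \<partial>lborel)"
      by (rule integral_mono[OF ig\<eta> ig\<theta>]) (auto intro!: mult_left_mono g0 \<theta>0)
    ultimately show ?thesis using eqP[OF S(2,3)] eqP[OF S2P uS2] by simp
  qed
  show ?thesis using smu cS2 S2P uS2 u0 um main by blast
qed

section \<open>Positive solutions and uniform K-stability\<close>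

text \<open>
  By homogeneity it suffices to compare the forms on unit vectors, where compactness gives a positive
  lower bound of one and an upper bound of the other.
\<close>

lemma quadratic_form_domination:
  fixes K G :: "'a::topological_space \<Rightarrow> real ^ 'n ^ 'n"
  assumes T: "compact T" and K: "continuous_on T K" and G: "continuous_on T G"
    and pos: "\<And>x v. x \<in> T \<Longrightarrow> v \<noteq> 0 \<Longrightarrow> v \<bullet> (G x *v v) > 0"
  shows "\<exists>C\<ge>0. \<forall>x\<in>T. \<forall>v. v \<bullet> (K x *v v) \<le> C * (v \<bullet> (G x *v v))"
proof (cases "T = {}")
  case False
  define S where "S = T \<times> sphere (0 :: real ^ 'n) 1"
  have cS: "compact S" unfolding S_def by (intro compact_Times T) simp
  have "axis (SOME i. True) 1 \<in> sphere (0 :: real ^ 'n) 1" by simp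
  then have neS: "S \<noteq> {}" using False unfolding S_def by blast
  have cont: "continuous_on S (\<lambda>z. snd z \<bullet> (A (fst z) *v snd z))" if A: "continuous_on T A"
    for A :: "'a \<Rightarrow> real ^ 'n ^ 'n"
  proof -
    have "continuous_on S (\<lambda>z. A (fst z))"
      by (rule continuous_on_compose2[OF A]) (auto intro!: continuous_intros simp: S_def)
    then have "continuous_on S (\<lambda>z. \<Sum>i\<in>UNIV. snd z $ i * (\<Sum>j\<in>UNIV. A (fst z) $ i $ j * snd z $ j))"
      by (intro continuous_intros)
    then show ?thesis by (simp add: inner_vec_def matrix_vector_mult_def)
  qed
  obtain z0 where z0: "z0 \<in> S" "\<And>z. z \<in> S \<Longrightarrow> snd z0 \<bullet> (G (fst z0) *v snd z0) \<le> snd z \<bullet> (G (fst z) *v snd z)"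
    using continuous_attains_inf[OF cS neS cont[OF G]] by blast
  obtain z1 where z1: "z1 \<in> S" "\<And>z. z \<in> S \<Longrightarrow> snd z \<bullet> (K (fst z) *v snd z) \<le> snd z1 \<bullet> (K (fst z1) *v snd z1)"
    using continuous_attains_sup[OF cS neS cont[OF K]] by blast
  define m where "m = snd z0 \<bullet> (G (fst z0) *v snd z0)"
  define M where "M = max 0 (snd z1 \<bullet> (K (fst z1) *v snd z1))"
  have m: "m > 0" unfolding m_def using z0(1) by (intro pos) (auto simp: S_def)
  have M: "M \<ge> 0" by (simp add: M_def)
  have "v \<bullet> (K x *v v) \<le> M / m * (v \<bullet> (G x *v v))" if x: "x \<in> T" for x v
  proof (cases "v = 0")
    case False
    define w where "w = (1 / norm v) *\<^sub>R v"
    have vw: "v = norm v *\<^sub>R w" using False by (simp add: w_def)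
    have scale: "v \<bullet> (A *v v) = (norm v)\<^sup>2 * (w \<bullet> (A *v w))" for A :: "real ^ 'n ^ 'n"
    proof -
      have "v \<bullet> (A *v v) = (norm v *\<^sub>R w) \<bullet> (A *v (norm v *\<^sub>R w))" using vw by simp
      then show ?thesis by (simp only: matrix_vector_mult_scaleR) (simp add: power2_eq_square)
    qed
    have xw: "(x, w) \<in> S" using x False by (simp add: S_def w_def)
    have "w \<bullet> (K x *v w) \<le> M" using z1(2)[OF xw] by (simp add: M_def)
    also have "M \<le> M / m * (w \<bullet> (G x *v w))"
      using mult_left_mono[OF z0(2)[OF xw], of "M / m"] m M by (simp add: m_def[symmetric])
    finally have "(norm v)\<^sup>2 * (w \<bullet> (K x *v w)) \<le> (norm v)\<^sup>2 * (M / m * (w \<bullet> (G x *v w)))"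
      by (rule mult_left_mono) simp
    then show ?thesis unfolding scale by (simp only: mult.left_commute[of "(norm v)\<^sup>2"])
  qed simp
  then show ?thesis using m M by (intro exI[of _ "M / m"]) auto
qed auto

lemma linear_axis_sum:
  fixes L :: "real ^ 'n \<Rightarrow> real"
  assumes "linear L"
  shows "(\<Sum>i\<in>UNIV. v $ i * L (axis i 1)) = L v"
proof -
  have "L v = L (\<Sum>i\<in>UNIV. v $ i *\<^sub>R axis i 1)"
    using basis_expansion[of v] by (simp add: scalar_mult_eq_scaleR)
  then show ?thesis by (simp add: linear_sum[OF assms] linear_scale[OF assms])
qed

context labelled_simple_polytope
begin

lemma closure_integral_mono:
  assumes "continuous_on (closure P) f" "continuous_on (closure P) g" "\<And>x. x \<in> P \<Longrightarrow> f x \<le> (g x :: real)"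
  shows "(LINT x:P|lborel. f x) \<le> (LINT x:P|lborel. g x)"
  by (rule set_integral_mono[OF closure_integrable closure_integrable]) (use assms in auto)

lemma P_sets: "P \<in> sets lborel"
  using P_open by simp

lemma solution_pairing:
  assumes S: "extended_solution U G u c" and V: "open V" "closure P \<subseteq> V" "smooth_on V f"
  shows "2 * (\<integral>x. f x \<partial>\<sigma>) - (LINT x:P|lborel. f x * (u \<bullet> x + c)) = (LINT x:P|lborel. hessian_trace G f x)"
proof -
  note G = extended_solutionD[OF S]
  have W: "open (U \<inter> V)" "closure P \<subseteq> U \<inter> V" using G(1,2) V(1,2) by auto
  have "(LINT x:P|lborel. f x * double_divergence G x) = (LINT x:P|lborel. (- 1) * (f x * (u \<bullet> x + c)))"
    by (rule set_lebesgue_integral_cong[OF P_sets]) (auto simp: G(6) right_diff_distrib distrib_left)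
  also have "\<dots> = - (LINT x:P|lborel. f x * (u \<bullet> x + c))" unfolding set_integral_mult_right by simp
  finally have "- (LINT x:P|lborel. f x * (u \<bullet> x + c)) = (LINT x:P|lborel. hessian_trace G f x) - 2 * (\<integral>x. f x \<partial>\<sigma>)"
    using green_boundary_conditions[OF W smooth_on_subset[OF G(3)] _ smooth_on_subset[OF V(3)] G(5)] G(4) by simp
  then show ?thesis by linarith
qed

text \<open>
  Pairing a solution with affine functions, whose Hessian vanishes, gives the equations that define
  the extremal affine function; so the affine function \<open>S(H)\<close> cannot be anything else.
\<close>

lemma extremal_affine_function_solution:
  assumes S: "extended_solution U G u c"
  shows "extremal_affine_function P \<sigma> = (\<lambda>x. u \<bullet> x + c)"
  unfolding extremal_affine_function_def
proof (rule the_equality)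
  have aff: "(LINT x:P|lborel. (u \<bullet> x + c) * (w \<bullet> x + d)) = 2 * (\<integral>x. w \<bullet> x + d \<partial>\<sigma>)" for w d
  proof -
    have "smooth_on UNIV (\<lambda>x. w \<bullet> x + d)"
      by (intro smooth_on_add smooth_on_inner_left smooth_on_const open_UNIV)
    from solution_pairing[OF S open_UNIV subset_UNIV this]
    have "2 * (\<integral>x. w \<bullet> x + d \<partial>\<sigma>) - (LINT x:P|lborel. (w \<bullet> x + d) * (u \<bullet> x + c)) = 0"
      by (simp add: hessian_trace_affine set_lebesgue_integral_def)
    then show ?thesis by (simp add: mult.commute)
  qed
  show "(\<lambda>x. u \<bullet> x + c) \<in> affine_functions \<and> (\<forall>f\<in>affine_functions. (LINT x:P|lborel. (u \<bullet> x + c) * f x) = 2 * (\<integral>x. f x \<partial>\<sigma>))"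
    using aff by (auto simp: affine_functions_def)
  fix A :: "real ^ 'n \<Rightarrow> real"
  assume A: "A \<in> affine_functions \<and> (\<forall>f\<in>affine_functions. (LINT x:P|lborel. A x * f x) = 2 * (\<integral>x. f x \<partial>\<sigma>))"
  then obtain w d where wd: "A = (\<lambda>x. w \<bullet> x + d)" by (auto simp: affine_functions_def)
  have "(\<lambda>x. (w - u) \<bullet> x + (d - c)) \<in> affine_functions" by (auto simp: affine_functions_def)
  moreover have "\<forall>f\<in>affine_functions. (LINT x:P|lborel. (w \<bullet> x + d) * f x) = 2 * (\<integral>x. f x \<partial>\<sigma>)"
    using A by (simp add: wd)
  ultimately have "(LINT x:P|lborel. (w \<bullet> x + d) * ((w - u) \<bullet> x + (d - c))) = 2 * (\<integral>x. (w - u) \<bullet> x + (d - c) \<partial>\<sigma>)"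
    by (rule bspec[rotated])
  also have "\<dots> = (LINT x:P|lborel. (u \<bullet> x + c) * ((w - u) \<bullet> x + (d - c)))" by (rule aff[symmetric])
  finally have "(LINT x:P|lborel. (w \<bullet> x + d) * ((w - u) \<bullet> x + (d - c))) = (LINT x:P|lborel. (u \<bullet> x + c) * ((w - u) \<bullet> x + (d - c)))" .
  then have "(LINT x:P|lborel. (w \<bullet> x + d) * ((w - u) \<bullet> x + (d - c)) - (u \<bullet> x + c) * ((w - u) \<bullet> x + (d - c))) = 0"
    using set_integral_diff(2)[OF affine_integrable affine_integrable, of w d "w - u" "d - c" u c "w - u" "d - c"] by simp
  moreover have "(w \<bullet> x + d) * ((w - u) \<bullet> x + (d - c)) - (u \<bullet> x + c) * ((w - u) \<bullet> x + (d - c)) =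
      ((w - u) \<bullet> x + (d - c)) * ((w - u) \<bullet> x + (d - c))" for x by (simp add: inner_diff_left algebra_simps)
  ultimately have "w - u = 0 \<and> d - c = 0" using affine_orthogonal_eq_0[of "w - u" "d - c"] by simp
  then show "A = (\<lambda>x. u \<bullet> x + c)" by (simp add: wd)
qed

lemma L_functional_solution:
  assumes S: "extended_solution U G u c"
  shows "L_functional P \<sigma> f = (\<integral>x. f x \<partial>\<sigma>) - 1 / 2 * (LINT x:P|lborel. f x * (u \<bullet> x + c))"
  unfolding L_functional_def extremal_affine_function_solution[OF S] ..

definition regular_convex_function :: "real ^ 'n \<Rightarrow> (real ^ 'n) set \<Rightarrow> (real ^ 'n \<Rightarrow> real) \<Rightarrow> bool" where
  "regular_convex_function p V f \<longleftrightarrow> open V \<and> closure P \<subseteq> V \<and> smooth_on V f \<and> convex_on (closure P) f \<and>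
     f p = 0 \<and> (\<forall>x\<in>closure P. f x \<ge> 0)"

lemma regular_convex_functionD:
  assumes "regular_convex_function p V f"
  shows "open V" "closure P \<subseteq> V" "smooth_on V f" "convex_on (closure P) f" "f p = 0"
    "x \<in> closure P \<Longrightarrow> f x \<ge> 0" "continuous_on (closure P) f"
  using assms smooth_continuous_closure[of V f] by (simp_all add: regular_convex_function_def)

text \<open>
  The Hessian of \<open>f\<close> is positive semidefinite, and so is the difference \<open>C G - K\<close> at \<open>x\<close>.
\<close>

lemma hessian_trace_convex_mono:
  assumes f: "regular_convex_function p V f" and x: "x \<in> P"
    and sym: "transpose (G x) = G x" "transpose (K x) = K x"
    and dom: "\<And>v. v \<bullet> (K x *v v) \<le> C * (v \<bullet> (G x *v v))"
  shows "hessian_trace K f x \<le> C * hessian_trace G f x"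
proof -
  note f = regular_convex_functionD[OF f]
  have xV: "x \<in> V" using x f(2) closure_subset[of P] by blast
  let ?D = "\<lambda>i j. dderiv (axis j 1) (dderiv (axis i 1) f) x"
  let ?A = "C *\<^sub>R G x - K x"
  have "transpose ?A = ?A" using sym by (simp add: transpose_def vec_eq_iff)
  moreover have "v \<bullet> (?A *v v) \<ge> 0" for v
    using dom[of v] by (simp add: matrix_vector_mult_diff_rdistrib scaleR_matrix_vector_assoc[symmetric] inner_diff_right)
  moreover have "(\<Sum>i\<in>UNIV. \<Sum>j\<in>UNIV. v $ i * v $ j * ?D i j) \<ge> 0" for v
    unfolding hessian_trace_rank_one[OF f(1,3) xV]
    by (rule convex_second_derivative_nonneg[OF f(4,3) P_open _ _ x]) (use closure_subset[of P] f(2) in auto)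
  ultimately have "(\<Sum>i\<in>UNIV. \<Sum>j\<in>UNIV. ?A $ i $ j * ?D i j) \<ge> 0" by (rule psd_trace_nonneg)
  also have "(\<Sum>i\<in>UNIV. \<Sum>j\<in>UNIV. ?A $ i $ j * ?D i j) = C * hessian_trace G f x - hessian_trace K f x"
    by (simp add: hessian_trace_def sum_distrib_left sum_subtractf algebra_simps)
  finally show ?thesis by simp
qed

text \<open>
  The balanced weight is the double divergence of some compactly supported \<open>K\<close>. On its
  support the positive solution \<open>G\<close> dominates \<open>K\<close>, so integration by parts compares both sides
  through the positive semidefinite Hessian of \<open>f\<close>.
\<close>

lemma interior_estimate:
  assumes S: "extended_solution U G u c" and pos: "\<And>x. x \<in> P \<Longrightarrow> positive_definite (G x)" and p: "p \<in> P"
    and \<eta>: "smooth_on UNIV \<eta>" "\<And>x. \<eta> x \<ge> 0" and Z: "compact Z" "Z \<subseteq> P" "\<And>x. x \<notin> Z \<Longrightarrow> \<eta> x = 0"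
  shows "\<exists>C\<ge>0. \<forall>V f. regular_convex_function p V f \<longrightarrow>
     (LINT x:P|lborel. f x * \<eta> x) \<le> C * (LINT x:P|lborel. hessian_trace G f x)"
proof -
  note G = extended_solutionD[OF S]
  have "\<exists>q T0. smooth_on UNIV q \<and> compact T0 \<and> T0 \<subseteq> P \<and> (\<forall>x. x \<notin> T0 \<longrightarrow> q x = 0) \<and>
    (\<integral>x. q x \<partial>lborel) = 0 \<and> (\<forall>i. (\<integral>x. x $ i * q x \<partial>lborel) = 0) \<and>
    (\<forall>f. continuous_on (closure P) f \<longrightarrow> convex_on (closure P) f \<longrightarrow> f p = 0 \<longrightarrow> (\<forall>x\<in>closure P. f x \<ge> 0) \<longrightarrow>
       (LINT x:P|lborel. f x * \<eta> x) \<le> 2 * (LINT x:P|lborel. f x * q x))" (is "\<exists>q T0. ?Q q T0")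
    by (rule balanced_weight[OF P_open P_convex p \<eta> Z])
  then obtain q T0 where Q: "?Q q T0" by (elim exE)
  then have q: "smooth_on UNIV q" "compact T0" "T0 \<subseteq> P" "\<And>x. x \<notin> T0 \<Longrightarrow> q x = 0"
    "(\<integral>x. q x \<partial>lborel) = 0" "\<And>i. (\<integral>x. x $ i * q x \<partial>lborel) = 0"
    by simp_all
  from Q have qf: "(LINT x:P|lborel. f x * \<eta> x) \<le> 2 * (LINT x:P|lborel. f x * q x)"
    if "continuous_on (closure P) f" "convex_on (closure P) f" "f p = 0" "\<forall>x\<in>closure P. f x \<ge> 0" for f
    using that by simp
  obtain K T where K: "compact T" "T \<subseteq> P" "smooth_on UNIV K" "\<And>x. transpose (K x) = K x"
     "\<And>x. x \<notin> T \<Longrightarrow> K x = 0" "\<And>x. q x = double_divergence K x"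
    using double_divergence_solvable[OF P_open P_convex p q(2,3,1) _ q(5,6)] q(4) by auto
  have TU: "T \<subseteq> U" using K(2) G(2) closure_subset[of P] by blast
  have "\<exists>C\<ge>0. \<forall>x\<in>T. \<forall>v. v \<bullet> (K x *v v) \<le> C * (v \<bullet> (G x *v v))"
    by (rule quadratic_form_domination[OF K(1)])
      (use K(2) pos TU smooth_on_continuous[OF K(3)] smooth_on_continuous[OF G(3)] in
        \<open>auto simp: positive_definite_def intro: continuous_on_subset\<close>)
  then obtain C where C: "C \<ge> 0" "\<And>x v. x \<in> T \<Longrightarrow> v \<bullet> (K x *v v) \<le> C * (v \<bullet> (G x *v v))" by blast
  have dom: "v \<bullet> (K x *v v) \<le> C * (v \<bullet> (G x *v v))" if x: "x \<in> P" for x v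
  proof (cases "x \<in> T")
    case False
    have "v \<bullet> (G x *v v) \<ge> 0"
    proof (cases "v = 0")
      case False
      then show ?thesis using pos[OF x] unfolding positive_definite_def by (simp add: less_imp_le)
    qed simp
    then show ?thesis using K(5)[OF False] C(1) by simp
  qed (rule C(2))
  have flatK: "boundary_conditions_with 0 K" using flat_compact_support[OF K(3,4,1,2,5)] by (simp add: flat_def)
  have "(LINT x:P|lborel. f x * \<eta> x) \<le> (2 * C) * (LINT x:P|lborel. hessian_trace G f x)" if tf: "regular_convex_function p V f" for V f
  proof -
    note f = regular_convex_functionD[OF tf]
    have W: "open (U \<inter> V)" "closure P \<subseteq> U \<inter> V" using G(1,2) f(1,2) by auto
    have cG: "continuous_on (closure P) (hessian_trace G f)"
      by (rule smooth_continuous_closure[OF W(2) smooth_hessian_trace[OF W(1)]])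
        (use smooth_on_subset[OF G(3)] smooth_on_subset[OF f(3)] in auto)
    have cK: "continuous_on (closure P) (hessian_trace K f)"
      by (rule smooth_continuous_closure[OF f(2) smooth_hessian_trace[OF f(1) _ f(3)]])
        (use smooth_on_subset[OF K(3)] in auto)
    have "(LINT x:P|lborel. f x * q x) = (LINT x:P|lborel. hessian_trace K f x)"
      unfolding K(6) using green_boundary_conditions[OF f(1,2) smooth_on_subset[OF K(3)] K(4) f(3) flatK] by simp
    also have "\<dots> \<le> (LINT x:P|lborel. C * hessian_trace G f x)"
    proof (rule closure_integral_mono[OF cK continuous_on_mult_left[OF cG]])
      fix x assume x: "x \<in> P"
      then have xU: "x \<in> U" using G(2) closure_subset[of P] by blast
      show "hessian_trace K f x \<le> C * hessian_trace G f x"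
        by (rule hessian_trace_convex_mono[where G = G and K = K, OF tf x G(4)[OF xU] K(4)]) (rule dom[OF x])
    qed
    also have "\<dots> = C * (LINT x:P|lborel. hessian_trace G f x)" by (rule set_integral_mult_right)
    finally have "(LINT x:P|lborel. f x * q x) \<le> C * (LINT x:P|lborel. hessian_trace G f x)" .
    moreover have "(LINT x:P|lborel. f x * \<eta> x) \<le> 2 * (LINT x:P|lborel. f x * q x)"
      by (rule qf[OF f(7,4,5)]) (use f(6) in blast)
    ultimately show ?thesis by linarith
  qed
  then show ?thesis using C(1) by (intro exI[of _ "2 * C"]) auto
qed

text \<open>
  It equals 1 on \<open>F\<close> and 0 beyond the hyperplane through \<open>p\<close> parallel to \<open>F\<close>. The square makes the positive
  part \<open>C\<^sup>1\<close>, as the divergence theorem requires.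
\<close>

definition facet_weight :: "real ^ 'n \<Rightarrow> nat \<Rightarrow> (real ^ 'n) set \<Rightarrow> real ^ 'n \<Rightarrow> real" where
  "facet_weight p m F x = ((max 0 (1 - height F x / height F p))\<^sup>2) ^ Suc m"

lemma facet_weight_C_1: "C_k_on 1 UNIV (facet_weight p m F)"
  and facet_weight_radial: "\<exists>D. linear D \<and> (facet_weight p m F has_derivative D) (at x) \<and>
     (height F p > 0 \<longrightarrow> D (x - p) = 2 * Suc m * facet_weight p m F x)"
proof -
  define g where "g s = ((max 0 s)\<^sup>2) ^ Suc m" for s :: real
  define g' where "g' s = Suc m * ((max 0 s)\<^sup>2) ^ m * (2 * max 0 s)" for s :: real
  define b where "b y = 1 + (- (1 / height F p)) * height F y" for y
  have fw: "facet_weight p m F = (\<lambda>y. g (b y))" by (simp add: facet_weight_def g_def b_def fun_eq_iff)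
  have gd: "(g has_real_derivative g' s) (at s)" for s
    unfolding g_def g'_def using DERIV_power[OF DERIV_pos_part_square[of 0 s], of "Suc m"] by (simp add: mult_ac)
  have g1: "C_k_on 1 UNIV g"
    unfolding One_nat_def
  proof (rule C_k_on_SucI[OF open_UNIV])
    show "(g has_derivative (\<lambda>h. h * g' s)) (at s)" for s
      using gd[of s] by (simp add: has_field_derivative_def mult_commute_abs)
    show "C_k_on 0 UNIV (\<lambda>s. v * g' s)" for v
      by (auto simp: g'_def intro!: continuous_intros)
  qed
  have sb: "smooth_on UNIV b" unfolding b_def
    by (intro smooth_on_add smooth_on_mult smooth_on_const smooth_height open_UNIV)
  show "C_k_on 1 UNIV (facet_weight p m F)"
    unfolding fw by (rule C_k_on_compose_real[OF open_UNIV open_UNIV subset_UNIV smooth_on_C_1[OF sb] g1])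
  have "(height F has_derivative (\<lambda>w. \<nu> F \<bullet> w)) (at x)"
    using smooth_on_has_derivative[OF smooth_height[OF open_UNIV] UNIV_I, of F x] by (simp add: dderiv_height)
  then have hb: "(b has_derivative (\<lambda>w. - (1 / height F p) * (\<nu> F \<bullet> w))) (at x)"
    unfolding b_def
    using has_derivative_add[OF has_derivative_const[of 1] has_derivative_mult_right[of _ _ _ "- (1 / height F p)"]] by simp
  define D where "D w = g' (b x) * (- (1 / height F p) * (\<nu> F \<bullet> w))" for w
  have "(facet_weight p m F has_derivative D) (at x)"
    unfolding fw D_def by (rule has_derivative_compose[OF hb gd[of "b x", unfolded has_field_derivative_def]])
  moreover have "linear D" unfolding D_def by (rule linearI) (simp_all add: inner_add_right algebra_simps)
  moreover have "D (x - p) = 2 * Suc m * facet_weight p m F x" if h: "height F p > 0"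
  proof -
    have "\<nu> F \<bullet> (x - p) = height F x - height F p" using height_add[of F p "x - p"] by simp
    then have "- (1 / height F p) * (\<nu> F \<bullet> (x - p)) = b x" using h by (simp add: b_def field_simps)
    then have "D (x - p) = g' (b x) * b x" by (simp add: D_def)
    also have "\<dots> = 2 * Suc m * g (b x)" by (cases "b x \<ge> 0") (simp_all add: g'_def g_def power2_eq_square max_def)
    finally show ?thesis by (simp add: fw)
  qed
  ultimately show "\<exists>D. linear D \<and> (facet_weight p m F has_derivative D) (at x) \<and>
     (height F p > 0 \<longrightarrow> D (x - p) = 2 * Suc m * facet_weight p m F x)" by blast
qed

lemma facet_weight_range:
  assumes "F \<in> facets P" "p \<in> P" "x \<in> closure P"
  shows "facet_weight p m F x \<ge> 0" "facet_weight p m F x \<le> 1"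
proof -
  have "max 0 (1 - height F x / height F p) \<le> 1"
    using height_nonneg[OF assms(1,3)] height_pos[OF assms(1,2)] by simp
  then show "facet_weight p m F x \<le> 1" unfolding facet_weight_def by (intro power_le_one) auto
  show "facet_weight p m F x \<ge> 0" by (simp add: facet_weight_def)
qed

text \<open>
  The divergence theorem for the field \<open>(x - p) f(x) \<beta>(x)\<close> with \<open>\<beta>\<close> the weight of \<open>F\<close>: its radial derivative is
  \<open>2 (m + 1) \<beta>\<close>, while that of \<open>f\<close> is nonnegative because \<open>f\<close> is minimal at \<open>p\<close>. So for large \<open>m\<close> the
  integral of \<open>f\<close> near the facets is small compared to its boundary integral.
\<close>

lemma tail_estimate:
  assumes tf: "regular_convex_function p V f" and p: "p \<in> P" and F: "F \<in> facets P"
  shows "2 * Suc m * (LINT x:P|lborel. f x * facet_weight p m F x) \<le> (\<Sum>E\<in>facets P. height E p) * (\<integral>x. f x \<partial>\<sigma>)"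
proof -
  note f = regular_convex_functionD[OF tf]
  let ?\<beta> = "facet_weight p m F"
  define X where "X i x = (x $ i - p $ i) * (f x * ?\<beta> x)" for i x
  have c\<beta>: "continuous_on S ?\<beta>" for S
    using C_k_on_imp_continuous[OF facet_weight_C_1] continuous_on_subset by blast
  have hp: "height E p > 0" if "E \<in> facets P" for E by (rule height_pos[OF that p])
  have cf\<beta>: "continuous_on (closure P) (\<lambda>x. f x * ?\<beta> x)" by (intro continuous_on_mult f c\<beta>)
  have cX: "continuous_on (closure P) (\<lambda>x. \<Sum>i\<in>UNIV. \<nu> E $ i * X i x)" for E
    unfolding X_def by (intro continuous_intros f c\<beta>)
  have X1: "C_k_on 1 V (X i)" for i
  proof -
    have "smooth_on V (\<lambda>x::real ^ 'n. x $ i - p $ i)"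
      by (intro smooth_on_diff smooth_on_const f smooth_on_component[OF f(1) smooth_on_id[OF f(1)]])
    then show ?thesis unfolding X_def
      by (intro C_k_on_mult f smooth_on_C_1 C_k_on_subset[OF facet_weight_C_1]) auto
  qed
  have div: "(\<Sum>i\<in>UNIV. dderiv (axis i 1) (X i) x) \<ge> 2 * Suc m * (f x * ?\<beta> x)" if x: "x \<in> P" for x
  proof -
    have xc: "x \<in> closure P" "x \<in> V" "p \<in> closure P" using x p f(2) closure_subset[of P] by auto
    obtain D where D: "linear D" "(?\<beta> has_derivative D) (at x)" "D (x - p) = 2 * Suc m * ?\<beta> x"
      using facet_weight_radial[of p m F x] hp[OF F] by blast
    have fd: "(f has_derivative (\<lambda>v. dderiv v f x)) (at x)" by (rule smooth_on_has_derivative[OF f(3) xc(2)])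
    have lf: "linear (\<lambda>v. dderiv v f x)" by (rule dderiv_linear[OF f(3) xc(2)])
    have "dderiv (axis i 1) (X i) x = f x * ?\<beta> x + ((x - p) $ i * dderiv (axis i 1) f x) * ?\<beta> x + f x * ((x - p) $ i * D (axis i 1))" for i
    proof -
      have "((\<lambda>x. x $ i - p $ i) has_derivative (\<lambda>w. w $ i)) (at x)"
        using has_derivative_diff[OF bounded_linear_imp_has_derivative[OF bounded_linear_vec_nth[of i]] has_derivative_const[of "p $ i"]]
        by simp
      from has_derivative_mult[OF this has_derivative_mult[OF fd D(2)]]
      have "(X i has_derivative (\<lambda>w. (x $ i - p $ i) * (f x * D w + dderiv w f x * ?\<beta> x) + w $ i * (f x * ?\<beta> x))) (at x)"
        unfolding X_def .
      from dderivI[OF this, of "axis i 1"] show ?thesis by (simp add: algebra_simps)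
    qed
    then have "(\<Sum>i\<in>UNIV. dderiv (axis i 1) (X i) x) = CARD('n) * (f x * ?\<beta> x) +
       (\<Sum>i\<in>UNIV. (x - p) $ i * dderiv (axis i 1) f x) * ?\<beta> x + f x * (\<Sum>i\<in>UNIV. (x - p) $ i * D (axis i 1))"
      by (simp only: sum.distrib sum_distrib_left sum_distrib_right sum_constant of_nat_mult)
    also have "\<dots> = CARD('n) * (f x * ?\<beta> x) + dderiv (x - p) f x * ?\<beta> x + f x * (2 * Suc m * ?\<beta> x)"
      unfolding linear_axis_sum[OF lf] linear_axis_sum[OF D(1)] D(3) ..
    also have "dderiv (x - p) f x * ?\<beta> x \<ge> 0"
    proof -
      have "dderiv (p - x) f x = - dderiv (x - p) f x" using linear_neg[OF lf, of "x - p"] by simp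
      then have "dderiv (x - p) f x \<ge> f x" using convex_tangent[OF f(4,3) xc(1,2,3)] f(5) by simp
      then show ?thesis using f(6)[OF xc(1)] facet_weight_range(1)[OF F p xc(1)] by (intro mult_nonneg_nonneg) auto
    qed
    moreover have "CARD('n) * (f x * ?\<beta> x) \<ge> 0"
      using f(6)[OF xc(1)] facet_weight_range(1)[OF F p xc(1)] by simp
    ultimately show ?thesis by (simp add: mult.left_commute)
  qed
  have eqn: "- facet_int E (\<lambda>x. \<Sum>i\<in>UNIV. \<nu> E $ i * X i x) \<le> height E p * facet_int E f" if E: "E \<in> facets P" for E
  proof -
    have "facet_int E (\<lambda>x. \<Sum>i\<in>UNIV. \<nu> E $ i * X i x) = facet_int E (\<lambda>x. - height E p * (f x * ?\<beta> x))"
    proof (rule facet_int_cong[OF E cX continuous_on_mult_left[OF cf\<beta>]])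
      fix y assume "y \<in> rel_interior E"
      then have y: "y \<in> E" using rel_interior_subset[of E] by blast
      have "(\<Sum>i\<in>UNIV. \<nu> E $ i * X i y) = (\<nu> E \<bullet> (y - p)) * (f y * ?\<beta> y)"
        by (simp add: X_def inner_vec_def sum_distrib_right mult.assoc)
      also have "\<nu> E \<bullet> (y - p) = - height E p" using height_add[of E p "y - p"] height_facet[OF E y] by simp
      finally show "(\<Sum>i\<in>UNIV. \<nu> E $ i * X i y) = - height E p * (f y * ?\<beta> y)" .
    qed
    then have "- facet_int E (\<lambda>x. \<Sum>i\<in>UNIV. \<nu> E $ i * X i x) = height E p * facet_int E (\<lambda>x. f x * ?\<beta> x)"
      unfolding facet_int_cmult by simp
    moreover have "facet_int E (\<lambda>x. f x * ?\<beta> x) \<le> facet_int E f"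
      unfolding facet_int_def
    proof (rule integral_mono[OF facet_int_slab(2)[OF E cf\<beta>] facet_int_slab(2)[OF E f(7)]])
      fix x
      show "indicator E x * (f x * ?\<beta> x) \<le> indicator E x * f x"
      proof (cases "x \<in> E")
        case True
        then have xc: "x \<in> closure P" using facet_subset[OF E] by blast
        show ?thesis using mult_left_mono[OF facet_weight_range(2)[OF F p xc] f(6)[OF xc]] True by simp
      qed simp
    qed
    ultimately show ?thesis using hp[OF E] by simp
  qed
  have fi0: "facet_int E f \<ge> 0" if E: "E \<in> facets P" for E
    unfolding facet_int_def
  proof (rule integral_nonneg_AE, rule AE_I2)
    fix x show "0 \<le> indicator E x * f x" using f(6)[of x] facet_subset[OF E] by (cases "x \<in> E") auto
  qed
  have dX: "set_integrable lborel P (\<lambda>x. \<Sum>i\<in>UNIV. dderiv (axis i 1) (X i) x)"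
  proof (rule closure_integrable, intro continuous_on_sum)
    fix i
    have "C_k_on 0 V (dderiv (axis i 1) (X i))" using X1[of i] unfolding One_nat_def C_k_on_Suc by blast
    then show "continuous_on (closure P) (dderiv (axis i 1) (X i))" using continuous_on_subset[OF _ f(2)] by simp
  qed
  have "2 * Suc m * (LINT x:P|lborel. f x * ?\<beta> x) = (LINT x:P|lborel. 2 * Suc m * (f x * ?\<beta> x))"
    by (rule set_integral_mult_right[symmetric])
  also have "\<dots> \<le> (LINT x:P|lborel. \<Sum>i\<in>UNIV. dderiv (axis i 1) (X i) x)"
    by (rule set_integral_mono[OF closure_integrable[OF continuous_on_mult_left[OF cf\<beta>]] dX div])
  also have "\<dots> = (\<Sum>E\<in>facets P. - facet_int E (\<lambda>x. \<Sum>i\<in>UNIV. \<nu> E $ i * X i x))"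
    unfolding divergence_theorem_field[OF f(1,2) X1] by (simp add: sum_negf)
  also have "\<dots> \<le> (\<Sum>E\<in>facets P. height E p * facet_int E f)" by (rule sum_mono[OF eqn])
  also have "\<dots> \<le> (\<Sum>E\<in>facets P. (\<Sum>E\<in>facets P. height E p) * facet_int E f)"
  proof (intro sum_mono mult_right_mono fi0)
    fix E assume "E \<in> facets P"
    then show "height E p \<le> (\<Sum>E\<in>facets P. height E p)"
      by (rule member_le_sum[OF _ _ finite_facets]) (use hp in \<open>auto intro: less_imp_le\<close>)
  qed
  also have "\<dots> = (\<Sum>E\<in>facets P. height E p) * (\<integral>x. f x \<partial>\<sigma>)"
    unfolding boundary_integral(1)[OF f(7)] sum_distrib_left ..
  finally show ?thesis .
qed

end

context labelled_simple_polytope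
begin

text \<open>
  A cutoff that is 1 except in thin collars of the facets. In the collar of \<open>F\<close> the weight of \<open>F\<close> is
  at least one half, by Bernoulli's inequality, so that cutoff and weights together control every
  nonnegative function.
\<close>

lemma collar_cutoff:
  assumes p: "p \<in> P"
  shows "\<exists>\<eta> Z. smooth_on UNIV \<eta> \<and> (\<forall>x. \<eta> x \<ge> 0) \<and> compact Z \<and> Z \<subseteq> P \<and> (\<forall>x. x \<notin> Z \<longrightarrow> \<eta> x = 0) \<and>
    (\<forall>x\<in>P. 1 \<le> 2 * (\<Sum>F\<in>facets P. facet_weight p m F x) + \<eta> x)"
proof -
  \<comment> \<open>such that \<open>1 - 2 (m + 1) \<epsilon> = 1 / 2\<close> in Bernoulli's inequality\<close>
  define \<epsilon> where "\<epsilon> = 1 / (4 * real (Suc m))"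
  have \<epsilon>: "\<epsilon> > 0" "\<epsilon> \<le> 1" by (simp_all add: \<epsilon>_def)
  have hp: "height F p > 0" if "F \<in> facets P" for F by (rule height_pos[OF that p])
  define \<eta> where "\<eta> x = (\<Prod>F\<in>facets P. smooth_step ((2 / (\<epsilon> * height F p)) * height F x))" for x
  define Z where "Z = (\<Inter>F\<in>facets P. {x. height F x \<ge> \<epsilon> * height F p / 2}) \<inter> closure P"
  have "smooth_on UNIV \<eta>" unfolding \<eta>_def
    by (intro smooth_on_prod smooth_on_compose_real[OF open_UNIV smooth_step(1)] smooth_on_mult smooth_on_const
        smooth_height open_UNIV)
  moreover have "\<eta> x \<ge> 0" for x unfolding \<eta>_def by (intro prod_nonneg ballI smooth_step)
  moreover have "compact Z"
  proof -
    have "closed {x. height F x \<ge> \<epsilon> * height F p / 2}" for F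
      by (intro closed_Collect_le continuous_on_const continuous_height)
    then show ?thesis unfolding Z_def by (intro closed_Int_compact closed_INT ballI compact_closure_P) auto
  qed
  moreover have ZP: "Z \<subseteq> P"
  proof
    fix x assume x: "x \<in> Z"
    have "height F x > 0" if F: "F \<in> facets P" for F
    proof -
      have "height F x \<ge> \<epsilon> * height F p / 2" using x F by (auto simp: Z_def)
      moreover have "\<epsilon> * height F p / 2 > 0" using \<epsilon>(1) hp[OF F] by simp
      ultimately show ?thesis by linarith
    qed
    then show "x \<in> P" using mem_P_iff by blast
  qed
  moreover have "\<eta> x = 0" if x: "x \<notin> Z" for x
  proof -
    have "\<exists>F\<in>facets P. height F x < \<epsilon> * height F p / 2"
    proof (rule ccontr)
      assume "\<not> ?thesis"
      then have big: "height F x \<ge> \<epsilon> * height F p / 2" if "F \<in> facets P" for F using that by force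
      have "height F x \<ge> 0" if F: "F \<in> facets P" for F
      proof -
        have "\<epsilon> * height F p / 2 > 0" using \<epsilon>(1) hp[OF F] by simp
        then show ?thesis using big[OF F] by linarith
      qed
      then have "x \<in> closure P" using mem_closure_iff by blast
      then show False using x big by (auto simp: Z_def)
    qed
    then obtain F where F: "F \<in> facets P" "height F x < \<epsilon> * height F p / 2" by blast
    have "(2 / (\<epsilon> * height F p)) * height F x \<le> 1"
      using F(2) \<epsilon>(1) hp[OF F(1)] by (simp add: field_simps)
    then have "smooth_step ((2 / (\<epsilon> * height F p)) * height F x) = 0" by (rule smooth_step(2))
    then show ?thesis unfolding \<eta>_def by (intro prod_zero finite_facets bexI[OF _ F(1)])
  qed
  moreover have "1 \<le> 2 * (\<Sum>F\<in>facets P. facet_weight p m F x) + \<eta> x" if x: "x \<in> P" for x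
  proof -
    have xc: "x \<in> closure P" using x closure_subset[of P] by blast
    have fw0: "facet_weight p m F x \<ge> 0" if "F \<in> facets P" for F by (rule facet_weight_range(1)[OF that p xc])
    have \<eta>0: "\<eta> x \<ge> 0" unfolding \<eta>_def by (intro prod_nonneg ballI smooth_step)
    show ?thesis
    proof (cases "\<forall>F\<in>facets P. height F x \<ge> \<epsilon> * height F p")
      case True
      have "smooth_step ((2 / (\<epsilon> * height F p)) * height F x) = 1" if F: "F \<in> facets P" for F
        by (rule smooth_step(3)) (use True F \<epsilon>(1) hp[OF F] in \<open>simp add: field_simps\<close>)
      then have "\<eta> x = 1" unfolding \<eta>_def by (intro prod.neutral) auto
      then show ?thesis using sum_nonneg[of "facets P" "\<lambda>F. facet_weight p m F x"] fw0 by simp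
    next
      case False
      then obtain F where F: "F \<in> facets P" "height F x < \<epsilon> * height F p" by force
      have b: "1 - height F x / height F p \<ge> 1 - \<epsilon>" using F hp[OF F(1)] by (simp add: field_simps)
      have "1 / 2 = 1 + real (2 * Suc m) * (- \<epsilon>)" unfolding of_nat_mult \<epsilon>_def by (simp add: field_simps del: of_nat_Suc)
      also have "\<dots> \<le> (1 + - \<epsilon>) ^ (2 * Suc m)" by (rule Bernoulli_inequality) (use \<epsilon>(2) in simp)
      also have "\<dots> = (1 - \<epsilon>) ^ (2 * Suc m)" by (simp only: add_uminus_conv_diff)
      also have "\<dots> \<le> (max 0 (1 - height F x / height F p)) ^ (2 * Suc m)"
        using b \<epsilon>(2) by (intro power_mono) auto
      also have "\<dots> = facet_weight p m F x" unfolding facet_weight_def power_mult ..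
      also have "\<dots> \<le> (\<Sum>F\<in>facets P. facet_weight p m F x)"
        by (rule member_le_sum[OF F(1) _ finite_facets]) (use fw0 in auto)
      finally show ?thesis using \<eta>0 by simp
    qed
  qed
  ultimately show ?thesis by blast
qed

text \<open>
  The weight exponent is chosen so large that the collars contribute less than the boundary integral
  to \<open>\<integral> f A\<close>; the rest of \<open>\<integral> f\<close> is bounded by the functional itself through the interior estimate.
\<close>

lemma regular_stability:
  assumes S: "extended_solution U G u c" and pos: "\<And>x. x \<in> P \<Longrightarrow> positive_definite (G x)" and p: "p \<in> P"
  shows "\<exists>l>0. \<forall>V f. regular_convex_function p V f \<longrightarrow> L_functional P \<sigma> f \<ge> l * (\<integral>x. f x \<partial>\<sigma>)"
proof -
  define a where "a x = u \<bullet> x + c" for x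
  have ca: "continuous_on (closure P) a" unfolding a_def by (intro continuous_intros)
  obtain MA where MA: "MA \<ge> 0" "\<And>x. x \<in> closure P \<Longrightarrow> \<bar>a x\<bar> \<le> MA"
    using continuous_bounded_on_closure[OF ca] by blast
  define M where "M = (\<Sum>E\<in>facets P. height E p)"
  define N where "N = card (facets P)"
  obtain m where m: "MA * (real N * M) \<le> real m" using real_arch_simple by blast
  obtain \<eta> Z where \<eta>: "smooth_on UNIV \<eta>" "\<And>x. \<eta> x \<ge> 0" "compact Z" "Z \<subseteq> P" "\<And>x. x \<notin> Z \<Longrightarrow> \<eta> x = 0"
    "\<And>x. x \<in> P \<Longrightarrow> 1 \<le> 2 * (\<Sum>F\<in>facets P. facet_weight p m F x) + \<eta> x"
    using collar_cutoff[OF p, of m] by blast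
  have "\<exists>C\<ge>0. \<forall>V f. regular_convex_function p V f \<longrightarrow>
     (LINT x:P|lborel. f x * \<eta> x) \<le> C * (LINT x:P|lborel. hessian_trace G f x)"
    by (rule interior_estimate[OF S pos p \<eta>(1-5)])
  then obtain C where C: "C \<ge> 0" "\<And>V f. regular_convex_function p V f \<Longrightarrow>
     (LINT x:P|lborel. f x * \<eta> x) \<le> C * (LINT x:P|lborel. hessian_trace G f x)" by blast
  have MC: "1 + MA * C > 0" using MA(1) C(1) by (simp add: add_pos_nonneg)
  have "L_functional P \<sigma> f \<ge> (1 / (2 * (1 + MA * C))) * (\<integral>x. f x \<partial>\<sigma>)" if tf: "regular_convex_function p V f" for V f
  proof -
    note f = regular_convex_functionD[OF tf]
    define B where "B = (\<integral>x. f x \<partial>\<sigma>)"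
    define Q where "Q = (LINT x:P|lborel. hessian_trace G f x)"
    define I where "I = (LINT x:P|lborel. f x)"
    have B0: "B \<ge> 0" unfolding B_def
    proof (rule integral_nonneg_AE, rule AE_I2)
      fix x assume "x \<in> space \<sigma>"
      then show "0 \<le> f x" using f(6) by (simp add: space_\<sigma> frontier_def)
    qed
    \<comment> \<open>the functional is half of \<open>Q\<close>; bounding \<open>I\<close> by a small multiple of \<open>B\<close> plus a multiple of \<open>Q\<close>
      bounds \<open>B\<close> by a multiple of \<open>Q\<close>\<close>
    have pair: "2 * B - (LINT x:P|lborel. f x * a x) = Q"
      unfolding B_def Q_def a_def by (rule solution_pairing[OF S f(1,2,3)])
    have L: "L_functional P \<sigma> f = Q / 2"
      using pair unfolding L_functional_solution[OF S] a_def B_def[symmetric] by linarith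
    have c\<beta>: "continuous_on (closure P) (facet_weight p m F)" for F
      by (rule continuous_on_subset[OF C_k_on_imp_continuous[OF facet_weight_C_1]]) simp
    have c\<eta>: "continuous_on (closure P) \<eta>"
      by (rule continuous_on_subset[OF smooth_on_continuous[OF \<eta>(1)]]) simp
    have cf\<beta>: "continuous_on (closure P) (\<lambda>x. f x * facet_weight p m F x)" for F by (intro continuous_on_mult f c\<beta>)
    have cf\<eta>: "continuous_on (closure P) (\<lambda>x. f x * \<eta> x)" by (intro continuous_on_mult f c\<eta>)
    have "I \<le> (LINT x:P|lborel. 2 * (\<Sum>F\<in>facets P. f x * facet_weight p m F x) + f x * \<eta> x)"
      unfolding I_def
    proof (rule closure_integral_mono[OF f(7)])
      show "continuous_on (closure P) (\<lambda>x. 2 * (\<Sum>F\<in>facets P. f x * facet_weight p m F x) + f x * \<eta> x)"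
        by (intro continuous_on_add continuous_on_mult_left continuous_on_sum cf\<beta> cf\<eta>)
      fix x assume x: "x \<in> P"
      then have "f x \<ge> 0" using f(6) closure_subset[of P] by blast
      from mult_left_mono[OF \<eta>(6)[OF x] this]
      show "f x \<le> 2 * (\<Sum>F\<in>facets P. f x * facet_weight p m F x) + f x * \<eta> x"
        by (simp add: distrib_left sum_distrib_left mult.left_commute)
    qed
    also have "\<dots> = (LINT x:P|lborel. 2 * (\<Sum>F\<in>facets P. f x * facet_weight p m F x)) + (LINT x:P|lborel. f x * \<eta> x)"
      by (intro set_integral_add closure_integrable continuous_on_mult_left continuous_on_sum cf\<beta> cf\<eta>)
    also have "(LINT x:P|lborel. 2 * (\<Sum>F\<in>facets P. f x * facet_weight p m F x)) =
        (\<Sum>F\<in>facets P. 2 * (LINT x:P|lborel. f x * facet_weight p m F x))"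
    proof -
      have "(LINT x:P|lborel. (\<Sum>F\<in>facets P. f x * facet_weight p m F x)) = (\<Sum>F\<in>facets P. (LINT x:P|lborel. f x * facet_weight p m F x))"
        unfolding set_lebesgue_integral_def scaleR_sum_right
        by (rule Bochner_Integration.integral_sum) (use closure_integrable[OF cf\<beta>] in \<open>simp add: set_integrable_def\<close>)
      then show ?thesis by (simp only: set_integral_mult_right sum_distrib_left[symmetric])
    qed
    also have "\<dots> \<le> (\<Sum>F\<in>facets P. M * B / Suc m)"
    proof (rule sum_mono)
      fix F assume F: "F \<in> facets P"
      show "2 * (LINT x:P|lborel. f x * facet_weight p m F x) \<le> M * B / Suc m"
        using tail_estimate[OF tf p F, of m] unfolding M_def[symmetric] B_def[symmetric] of_nat_mult
        by (simp add: field_simps del: of_nat_Suc)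
    qed
    also have "\<dots> = real N * M * B / Suc m" by (simp add: N_def)
    finally have I: "I \<le> real N * M * B / Suc m + (LINT x:P|lborel. f x * \<eta> x)" by simp
    then have "I \<le> real N * M * B / Suc m + C * Q" using C(2)[OF tf] unfolding Q_def[symmetric] by linarith
    then have "MA * I \<le> MA * (real N * M * B / Suc m + C * Q)" using MA(1) by (rule mult_left_mono)
    also have "\<dots> = (MA * (real N * M) / Suc m) * B + MA * C * Q" by (simp add: algebra_simps)
    also have "(MA * (real N * M) / Suc m) * B \<le> 1 * B"
      by (rule mult_right_mono[OF _ B0]) (use m in simp)
    finally have MAI: "MA * I \<le> B + MA * C * Q" by simp
    have "(LINT x:P|lborel. f x * a x) \<le> (LINT x:P|lborel. MA * f x)"
    proof (rule closure_integral_mono)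
      show "continuous_on (closure P) (\<lambda>x. f x * a x)" "continuous_on (closure P) (\<lambda>x. MA * f x)"
        by (intro continuous_intros f ca)+
      fix x assume "x \<in> P"
      then have "x \<in> closure P" using closure_subset[of P] by blast
      then show "f x * a x \<le> MA * f x" using mult_left_mono[of "a x" MA "f x"] f(6)[of x] MA(2)[of x]
        by (simp add: mult.commute)
    qed
    also have "\<dots> = MA * I" unfolding I_def by (rule set_integral_mult_right)
    finally have "B \<le> (1 + MA * C) * Q" using MAI pair by (simp add: algebra_simps)
    then have "B / (1 + MA * C) \<le> Q" using MC by (simp add: field_simps)
    then have "B / (1 + MA * C) / 2 \<le> Q / 2" by (rule divide_right_mono) simp
    also have "B / (1 + MA * C) / 2 = 1 / (2 * (1 + MA * C)) * B" by simp
    finally show ?thesis unfolding L B_def[symmetric] .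
  qed
  then show ?thesis using MC by (intro exI[of _ "1 / (2 * (1 + MA * C))"]) auto
qed

text \<open>
  A convex function that is smooth only inside \<open>P\<close> is the limit of its contractions towards \<open>p\<close>,
  which are smooth near the closure.
\<close>

lemma contraction_regular_convex_function:
  assumes f: "f \<in> normalized_convex_functions P p" and p: "p \<in> P" and t: "0 \<le> t" "t < 1"
  shows "x \<in> closure P \<Longrightarrow> t *\<^sub>R x + (p - t *\<^sub>R p) \<in> P"
    and "regular_convex_function p {x. t *\<^sub>R x + (p - t *\<^sub>R p) \<in> P} (\<lambda>x. f (t *\<^sub>R x + (p - t *\<^sub>R p)))"
proof -
  have f: "convex_on (closure P) f" "smooth_on P f" "f p = 0" "\<And>x. x \<in> P \<Longrightarrow> f x \<ge> 0"
    using f by (auto simp: normalized_convex_functions_def)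
  have inP: "t *\<^sub>R x + (p - t *\<^sub>R p) \<in> P" if x: "x \<in> closure P" for x
    unfolding mem_P_iff
  proof
    fix F assume F: "F \<in> facets P"
    have "height F (p + t *\<^sub>R (x - p)) = (1 - t) * height F p + t * height F (p + (x - p))"
      unfolding height_add by (simp add: algebra_simps)
    also have "\<dots> > 0" using height_pos[OF F p] height_nonneg[OF F x] t by (simp add: add_pos_nonneg)
    finally show "0 < height F (t *\<^sub>R x + (p - t *\<^sub>R p))" by (simp add: algebra_simps)
  qed
  then show "x \<in> closure P \<Longrightarrow> t *\<^sub>R x + (p - t *\<^sub>R p) \<in> P" .
  show "regular_convex_function p {x. t *\<^sub>R x + (p - t *\<^sub>R p) \<in> P} (\<lambda>x. f (t *\<^sub>R x + (p - t *\<^sub>R p)))"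
    unfolding regular_convex_function_def
  proof (intro conjI ballI)
    have "open ((\<lambda>x. t *\<^sub>R x + (p - t *\<^sub>R p)) -` P)"
      by (rule open_vimage[OF P_open]) (intro continuous_intros)
    then show "open {x. t *\<^sub>R x + (p - t *\<^sub>R p) \<in> P}" by (simp add: vimage_def)
    show "closure P \<subseteq> {x. t *\<^sub>R x + (p - t *\<^sub>R p) \<in> P}" using inP by blast
    show "smooth_on {x. t *\<^sub>R x + (p - t *\<^sub>R p) \<in> P} (\<lambda>x. f (t *\<^sub>R x + (p - t *\<^sub>R p)))"
      by (rule smooth_on_compose_affine[OF bounded_linear_scaleR_right P_open f(2)])
    show "convex_on (closure P) (\<lambda>x. f (t *\<^sub>R x + (p - t *\<^sub>R p)))"
    proof (rule convex_onI[OF _ convex_closure_P])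
      fix r :: real and x y assume r: "0 < r" "r < 1" and xy: "x \<in> closure P" "y \<in> closure P"
      have "t *\<^sub>R ((1 - r) *\<^sub>R x + r *\<^sub>R y) + (p - t *\<^sub>R p) =
          (1 - r) *\<^sub>R (t *\<^sub>R x + (p - t *\<^sub>R p)) + r *\<^sub>R (t *\<^sub>R y + (p - t *\<^sub>R p))" by (simp add: algebra_simps)
      then show "f (t *\<^sub>R ((1 - r) *\<^sub>R x + r *\<^sub>R y) + (p - t *\<^sub>R p)) \<le>
          (1 - r) * f (t *\<^sub>R x + (p - t *\<^sub>R p)) + r * f (t *\<^sub>R y + (p - t *\<^sub>R p))"
        using convex_onD[OF f(1), of r "t *\<^sub>R x + (p - t *\<^sub>R p)" "t *\<^sub>R y + (p - t *\<^sub>R p)"] r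
          inP[OF xy(1)] inP[OF xy(2)] closure_subset[of P] by auto
    qed
    show "f (t *\<^sub>R p + (p - t *\<^sub>R p)) = 0" by (simp add: f(3))
    show "0 \<le> f (t *\<^sub>R x + (p - t *\<^sub>R p))" if "x \<in> closure P" for x by (rule f(4)[OF inP[OF that]])
  qed
qed

lemma positive_solution_stable:
  assumes S: "extended_solution U G u c" and pos: "\<And>x. x \<in> P \<Longrightarrow> positive_definite (G x)" and p: "p \<in> P"
  shows "uniformly_K_stable P \<sigma> p"
proof -
  obtain l where l: "l > 0" "\<And>V f. regular_convex_function p V f \<Longrightarrow> L_functional P \<sigma> f \<ge> l * (\<integral>x. f x \<partial>\<sigma>)"
    using regular_stability[OF S pos p] by blast
  have "L_functional P \<sigma> f \<ge> l * (\<integral>x. f x \<partial>\<sigma>)" if f: "f \<in> normalized_convex_functions P p" for f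
  proof -
    have cf: "continuous_on (closure P) f" using f by (simp add: normalized_convex_functions_def)
    obtain M where M: "M \<ge> 0" "\<And>x. x \<in> closure P \<Longrightarrow> \<bar>f x\<bar> \<le> M" using continuous_bounded_on_closure[OF cf] by blast
    define a where "a x = u \<bullet> x + c" for x
    have ca: "continuous_on (closure P) a" unfolding a_def by (intro continuous_intros)
    obtain MA where MA: "MA \<ge> 0" "\<And>x. x \<in> closure P \<Longrightarrow> \<bar>a x\<bar> \<le> MA"
      using continuous_bounded_on_closure[OF ca] by blast
    define t where "t k = 1 - 1 / (real k + 2)" for k
    have t: "0 \<le> t k" "t k < 1" for k by (simp_all add: t_def field_simps)
    define T where "T k x = t k *\<^sub>R x + (p - t k *\<^sub>R p)" for k x
    note T = contraction_regular_convex_function[OF f p t, folded T_def]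
    have TP: "T k x \<in> closure P" if "x \<in> closure P" for k x using T(1)[OF that] closure_subset[of P] by blast
    have tlim: "t \<longlonglongrightarrow> 1"
    proof -
      have "(\<lambda>k. 1 / real k) \<longlonglongrightarrow> 0" by (rule lim_1_over_n)
      from LIMSEQ_ignore_initial_segment[OF this, of 2]
      have "(\<lambda>k. 1 / (real k + 2)) \<longlonglongrightarrow> 0" by (simp add: add.commute)
      from tendsto_diff[OF tendsto_const this, of 1] show ?thesis by (simp add: t_def[abs_def])
    qed
    have conv: "(\<lambda>k. f (T k x)) \<longlonglongrightarrow> f x" if x: "x \<in> closure P" for x
    proof (rule continuous_on_tendsto_compose[OF cf _ x])
      have "(\<lambda>k. T k x) \<longlonglongrightarrow> 1 *\<^sub>R x + (p - 1 *\<^sub>R p)" unfolding T_def by (intro tendsto_intros tlim)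
      then show "(\<lambda>k. T k x) \<longlonglongrightarrow> x" by simp
      show "\<forall>\<^sub>F k in sequentially. T k x \<in> closure P" using TP[OF x] by simp
    qed
    have cfT: "continuous_on (closure P) (\<lambda>x. f (T k x))" for k by (rule regular_convex_functionD(7)[OF T(2)])
    have sub: "x \<in> closure P" if "x \<in> space \<sigma>" for x using that by (simp add: space_\<sigma> frontier_def)
    have lim\<sigma>: "(\<lambda>k. \<integral>x. f (T k x) \<partial>\<sigma>) \<longlonglongrightarrow> (\<integral>x. f x \<partial>\<sigma>)"
    proof (rule integral_dominated_convergence[where w = "\<lambda>_. M"])
      show "f \<in> borel_measurable \<sigma>" using boundary_integral(2)[OF cf] by auto
      show "(\<lambda>x. f (T k x)) \<in> borel_measurable \<sigma>" for k using boundary_integral(2)[OF cfT] by auto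
      show "integrable \<sigma> (\<lambda>_. M)" by (rule boundary_integral(2)) (rule continuous_on_const)
      show "AE x in \<sigma>. (\<lambda>k. f (T k x)) \<longlonglongrightarrow> f x" by (rule AE_I2) (rule conv[OF sub])
      show "AE x in \<sigma>. norm (f (T k x)) \<le> M" for k by (rule AE_I2) (use M(2) TP sub in auto)
    qed
    have limP: "(\<lambda>k. LINT x:P|lborel. f (T k x) * a x) \<longlonglongrightarrow> (LINT x:P|lborel. f x * a x)"
      unfolding set_lebesgue_integral_def
    proof (rule integral_dominated_convergence[where w = "\<lambda>x. indicator P x *\<^sub>R (M * MA)"])
      have i: "set_integrable lborel P (\<lambda>x. f x * a x)" "set_integrable lborel P (\<lambda>x. f (T k x) * a x)"
        "set_integrable lborel P (\<lambda>x. M * MA)" for k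
        by (intro closure_integrable continuous_on_mult cf ca cfT continuous_on_const)+
      show "(\<lambda>x. indicator P x *\<^sub>R (f x * a x)) \<in> borel_measurable lborel"
        using i(1) unfolding set_integrable_def by (rule borel_measurable_integrable)
      show "(\<lambda>x. indicator P x *\<^sub>R (f (T k x) * a x)) \<in> borel_measurable lborel" for k
        using i(2) unfolding set_integrable_def by (rule borel_measurable_integrable)
      show "integrable lborel (\<lambda>x. indicator P x *\<^sub>R (M * MA))" using i(3) unfolding set_integrable_def .
      show "AE x in lborel. (\<lambda>k. indicator P x *\<^sub>R (f (T k x) * a x)) \<longlonglongrightarrow> indicator P x *\<^sub>R (f x * a x)"
      proof (rule AE_I2)
        fix x :: "real ^ 'n"
        show "(\<lambda>k. indicator P x *\<^sub>R (f (T k x) * a x)) \<longlonglongrightarrow> indicator P x *\<^sub>R (f x * a x)"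
        proof (cases "x \<in> P")
          case True
          then have "x \<in> closure P" using closure_subset[of P] by blast
          then show ?thesis by (intro tendsto_intros conv)
        qed simp
      qed
      show "AE x in lborel. norm (indicator P x *\<^sub>R (f (T k x) * a x)) \<le> indicator P x *\<^sub>R (M * MA)" for k
      proof (rule AE_I2)
        fix x :: "real ^ 'n"
        show "norm (indicator P x *\<^sub>R (f (T k x) * a x)) \<le> indicator P x *\<^sub>R (M * MA)"
        proof (cases "x \<in> P")
          case True
          then have x: "x \<in> closure P" using closure_subset[of P] by blast
          have "\<bar>f (T k x)\<bar> * \<bar>a x\<bar> \<le> M * MA" by (intro mult_mono M(2) MA(2) TP x M(1)) auto
          then show ?thesis using True by (simp add: abs_mult)
        qed simp
      qed
    qed
    have limL: "(\<lambda>k. L_functional P \<sigma> (\<lambda>x. f (T k x))) \<longlonglongrightarrow> L_functional P \<sigma> f"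
      unfolding L_functional_solution[OF S] a_def[symmetric] by (intro tendsto_intros lim\<sigma> limP)
    have liml: "(\<lambda>k. l * (\<integral>x. f (T k x) \<partial>\<sigma>)) \<longlonglongrightarrow> l * (\<integral>x. f x \<partial>\<sigma>)" by (intro tendsto_intros lim\<sigma>)
    show ?thesis by (rule LIMSEQ_le[OF liml limL]) (use l(2)[OF T(2)] in blast)
  qed
  then show ?thesis unfolding uniformly_K_stable_def using l(1) by blast
qed

end

theorem proposition1p7:
  fixes P :: "(real ^ 'n) set" and \<sigma> :: "(real ^ 'n) measure" and p\<^sub>o :: "real ^ 'n"
  assumes "labelled_polytope P \<sigma>"
    and "p\<^sub>o \<in> P"
  shows "formal_extremal_solutions P \<sigma> \<noteq> {} \<and>
    (CARD('n) \<ge> 2 \<longrightarrow>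
       infinite_dimensional_affine_family (closure P) (formal_extremal_solutions P \<sigma>)) \<and>
    (\<forall>H\<in>formal_extremal_solutions P \<sigma>.
       (\<forall>x\<in>P. positive_definite (H x)) \<longrightarrow> uniformly_K_stable P \<sigma> p\<^sub>o)"
proof -
  have "\<exists>\<nu>. labels P \<sigma> \<nu>" using assms(1) by (simp add: labelled_polytope_def boundary_measures_def)
  then have "labels P \<sigma> (label_of P \<sigma>)" unfolding label_of_def by (rule someI_ex)
  then interpret labelled_simple_polytope P \<sigma> "label_of P \<sigma>"
    using assms(1) by unfold_locales (simp_all add: labelled_polytope_def boundary_measures_def)
  have "uniformly_K_stable P \<sigma> p\<^sub>o"
    if H: "H \<in> formal_extremal_solutions P \<sigma>" and pos: "\<forall>x\<in>P. positive_definite (H x)" for H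
  proof -
    obtain U G u c where S: "extended_solution U G u c" and HG: "\<forall>x\<in>closure P. H x = G x"
      using formal_solution_extension[OF refl H] by blast
    have "positive_definite (G x)" if "x \<in> P" for x
    proof -
      have "H x = G x" using HG that closure_subset[of P] by blast
      then show ?thesis using pos that by metis
    qed
    then show ?thesis by (rule positive_solution_stable[OF S _ assms(2)])
  qed
  then show ?thesis
    using formal_solutions_ne[OF refl] formal_solutions_infinite_dimensional[OF refl] by blast
qed

end
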